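(* (i) The dual variety $\sigma_9(v_6(\mathbb{P}^2))^{\vee}$ contains the plane sextics which are double cubics, and it has codimension $18$. (ii) The dual variety $\sigma_8(v_4(\mathbb{P}^3))^{\vee}$ contains the quartic surfaces which are reducible into a pair of quadrics, and it has codimension $16$. (iii) The dual variety $\sigma_9(v_3(\mathbb{P}^5))^{\vee}$ contains the cubic $4$-folds which can be written as the determinant of a $3\times 3$ matrix with linear entries, and it has codimension $18$.
   Context: $v_d(\mathbb{P}^n)\subset\mathbb{P}(S^d\mathbb{C}^{n+1})$ is the degree-$d$ Veronese variety (classes of $d$-th powers of linear forms), and $\sigma_k(X)$ is the $k$-th secant variety of $X$: the Zariski closure of the union of linear spans of $k$ points of $X$. For a projective variety $Y\subset\mathbb{P}^N$, $Y^\vee$ is its projective dual variety in the dual space $(\mathbb{P}^N)^*$ (the closure of the set of hyperplanes tangent to $Y$ at a smooth point); here the dual space of $\mathbb{P}(S^d\mathbb{C}^{n+1})$ is identified with the space of degree-$d$ hypersurfaces in $\mathbb{P}^n$. Codimension is taken in this dual projective space. *)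

theory Defs
  imports "HOL-Analysis.Analysis"
begin

definition aff :: "'i set \<Rightarrow> ('i \<Rightarrow> complex) set" where
  "aff I = {x. \<forall>i. i \<notin> I \<longrightarrow> x i = 0}"

inductive_set poly_fun :: "'i set \<Rightarrow> (('i \<Rightarrow> complex) \<Rightarrow> complex) set" for I where
  pf_const: "(\<lambda>x. c) \<in> poly_fun I"
| pf_coord: "i \<in> I \<Longrightarrow> (\<lambda>x. x i) \<in> poly_fun I"
| pf_add: "f \<in> poly_fun I \<Longrightarrow> g \<in> poly_fun I \<Longrightarrow> (\<lambda>x. f x + g x) \<in> poly_fun I"
| pf_mult: "f \<in> poly_fun I \<Longrightarrow> g \<in> poly_fun I \<Longrightarrow> (\<lambda>x. f x * g x) \<in> poly_fun I"

definition zero_set :: "'i set \<Rightarrow> (('i \<Rightarrow> complex) \<Rightarrow> complex) set \<Rightarrow> ('i \<Rightarrow> complex) set" where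
  "zero_set I F = {x \<in> aff I. \<forall>f\<in>F. f x = 0}"

definition zclosed :: "'i set \<Rightarrow> ('i \<Rightarrow> complex) set \<Rightarrow> bool" where
  "zclosed I Z \<longleftrightarrow> (\<exists>F \<subseteq> poly_fun I. Z = zero_set I F)"

definition vanishing :: "'i set \<Rightarrow> ('i \<Rightarrow> complex) set \<Rightarrow> (('i \<Rightarrow> complex) \<Rightarrow> complex) set" where
  "vanishing I S = {f \<in> poly_fun I. \<forall>x\<in>S. f x = 0}"

definition zclosure :: "'i set \<Rightarrow> ('i \<Rightarrow> complex) set \<Rightarrow> ('i \<Rightarrow> complex) set" where
  "zclosure I S = zero_set I (vanishing I S)"

definition zirred :: "'i set \<Rightarrow> ('i \<Rightarrow> complex) set \<Rightarrow> bool" where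
  "zirred I Z \<longleftrightarrow> zclosed I Z \<and> Z \<noteq> {} \<and>
     (\<forall>Z1 Z2. zclosed I Z1 \<and> zclosed I Z2 \<and> Z = Z1 \<union> Z2 \<longrightarrow> Z1 = Z \<or> Z2 = Z)"

definition zdim :: "'i set \<Rightarrow> ('i \<Rightarrow> complex) set \<Rightarrow> nat" where
  "zdim I Y = Sup {k. \<exists>C :: nat \<Rightarrow> ('i \<Rightarrow> complex) set.
      (\<forall>j\<le>k. zirred I (C j) \<and> C j \<subseteq> Y) \<and> (\<forall>j<k. C j \<subset> C (Suc j))}"

definition ztangent :: "'i set \<Rightarrow> ('i \<Rightarrow> complex) set \<Rightarrow> ('i \<Rightarrow> complex) \<Rightarrow> ('i \<Rightarrow> complex) set" where
  "ztangent I Y x = {v \<in> aff I. \<forall>f \<in> vanishing I Y.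
       deriv (\<lambda>t::complex. f (\<lambda>i. x i + t * v i)) 0 = 0}"

definition zsmooth :: "'i set \<Rightarrow> ('i \<Rightarrow> complex) set \<Rightarrow> ('i \<Rightarrow> complex) \<Rightarrow> bool" where
  "zsmooth I Y x \<longleftrightarrow> x \<in> Y \<and> zdim I (ztangent I Y x) = zdim I Y"

text \<open>Affine cone over the projective dual variety of the projectivisation of a cone Y,
  using the pairing <F,v> = sum_{i in I} F i * v i.\<close>
definition zdual :: "'i set \<Rightarrow> ('i \<Rightarrow> complex) set \<Rightarrow> ('i \<Rightarrow> complex) set" where
  "zdual I Y = zclosure I {F \<in> aff I. \<exists>x. x \<noteq> (\<lambda>_. 0) \<and> zsmooth I Y x \<and>
       (\<forall>v \<in> ztangent I Y x. (\<Sum>i\<in>I. F i * v i) = 0)}"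

definition Mon :: "nat \<Rightarrow> nat \<Rightarrow> (nat \<Rightarrow> nat) set" where
  "Mon n d = {\<alpha>. (\<forall>i>n. \<alpha> i = 0) \<and> (\<Sum>i\<le>n. \<alpha> i) = d}"

definition form_eval :: "nat \<Rightarrow> nat \<Rightarrow> ((nat \<Rightarrow> nat) \<Rightarrow> complex) \<Rightarrow> (nat \<Rightarrow> complex) \<Rightarrow> complex" where
  "form_eval n d F l = (\<Sum>\<alpha>\<in>Mon n d. F \<alpha> * (\<Prod>i\<le>n. l i ^ \<alpha> i))"

text \<open>Veronese map (coordinates of l^d, up to the diagonal multinomial rescaling that
  makes <F, ver l> = F(l)).\<close>
definition ver :: "nat \<Rightarrow> nat \<Rightarrow> (nat \<Rightarrow> complex) \<Rightarrow> ((nat \<Rightarrow> nat) \<Rightarrow> complex)" where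
  "ver n d l = (\<lambda>\<alpha>. if \<alpha> \<in> Mon n d then (\<Prod>i\<le>n. l i ^ \<alpha> i) else 0)"

definition sec_cone :: "nat \<Rightarrow> nat \<Rightarrow> nat \<Rightarrow> ((nat \<Rightarrow> nat) \<Rightarrow> complex) set" where
  "sec_cone n d k = zclosure (Mon n d)
     {(\<lambda>\<alpha>. \<Sum>j<k. ver n d (l j) \<alpha>) | l :: nat \<Rightarrow> nat \<Rightarrow> complex. True}"

definition forms :: "nat \<Rightarrow> nat \<Rightarrow> ((nat \<Rightarrow> nat) \<Rightarrow> complex) set" where
  "forms n d = aff (Mon n d) - {\<lambda>_. 0}"

definition double_cubics :: "((nat \<Rightarrow> nat) \<Rightarrow> complex) set" where
  "double_cubics = {F \<in> forms 2 6. \<exists>G \<in> aff (Mon 2 3).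
      \<forall>l. form_eval 2 6 F l = (form_eval 2 3 G l)^2}"

definition quadric_pairs :: "((nat \<Rightarrow> nat) \<Rightarrow> complex) set" where
  "quadric_pairs = {F \<in> forms 3 4. \<exists>Q1 \<in> aff (Mon 3 2). \<exists>Q2 \<in> aff (Mon 3 2).
      \<forall>l. form_eval 3 4 F l = form_eval 3 2 Q1 l * form_eval 3 2 Q2 l}"

definition determinantal_cubics :: "((nat \<Rightarrow> nat) \<Rightarrow> complex) set" where
  "determinantal_cubics = {F \<in> forms 5 3. \<exists>A :: 3 \<Rightarrow> 3 \<Rightarrow> nat \<Rightarrow> complex.
      \<forall>l. form_eval 5 3 F l = det (\<chi> r s. \<Sum>i\<le>5. A r s i * l i)}"

end

theory Submission
  imports Defs
begin

text \<open>Parametrise the secant cone by k points of the affine space. By Terracini's lemma the covectors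
  annihilating its tangent space at a general point are the forms singular at the k points, and the
  dual is the closure of the union of these spaces. In each case a special configuration shows that
  the tangent space has the expected dimension, so that these spaces have dimension 1, 3 and 2.

  For nine points in the plane the space is spanned by the square of the cubic through the points;
  for eight points in space it consists of the products of two members of the pencil of quadrics
  through the points. So the duals are the closures of families with 10 and 19 parameters, and the
  dimensions are read off from the differentials at the witnesses.

  For nine points l_j in projective 5-space let w_j be the Gale dual plane configuration and v_j a
  Gale dual of its second Veronese image. There is a matrix L of linear forms with L(l_j) equal to
  the product of w_j and v_j, and the space is spanned by F_1 = det L and F_2 = tr Y_1 [Y_2, Y_3], where
  Y_k = T_k^T L for a basis T_k of the matrices orthogonal to the values of L. All derivatives of
  s F_1 + t F_2 with respect to the points, s and t lie in the degree 3 part of the ideal of 2 by 2 minors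
  of L, which bounds the dimension of the dual by 38; determinants reach this bound.

  Conversely, join the special form with known singular points to an arbitrary double cubic, product
  of quadrics or determinant by a line in the space of the data. The singular points persist for
  small parameters, so the whole line lies in the dual.\<close>

section \<open>Polynomial functions\<close>

text \<open>\<open>zdim\<close> is a supremum over chains of irreducible closed sets, so every
  dimension needs two separate arguments. For the upper bound, a chain of length k yields k
  algebraically independent functions, while more functions than parameters satisfy a relation. For
  the lower bound, the parameters of an immersion are frozen one after another. Genericity is always
  expressed by a polynomial that is non-zero at one explicit configuration, so a single witness
  suffices in each case. The witnesses lie on a cycle of coordinate lines: a triangle, a
  quadrilateral, a hexagon. There the forms singular at the points are spanned by monomials: (x0 x1
  x2)^2; the products of x0 x2 and x1 x3; x0 x2 x4 and x1 x3 x5. In the third case a general L has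
  rank one along an elliptic normal sextic through the points; F_1 and F_2 are singular along that
  curve and contain its secant variety. The family s F_1 + t F_2 has 54 + 2 parameters but dimension
  at most 38, so counting parameters is not enough and the rank of the differential has to be
  bounded.\<close>

lemma pf_cmult: "f \<in> poly_fun I \<Longrightarrow> (\<lambda>x. c * f x) \<in> poly_fun I"
  by (rule pf_mult[OF pf_const])

lemma pf_uminus: "f \<in> poly_fun I \<Longrightarrow> (\<lambda>x. - f x) \<in> poly_fun I"
  using pf_cmult[of f I "-1"] by simp

lemma pf_diff: "f \<in> poly_fun I \<Longrightarrow> g \<in> poly_fun I \<Longrightarrow> (\<lambda>x. f x - g x) \<in> poly_fun I"
  using pf_add[OF _ pf_uminus, of f I g] by simp

lemma pf_sum: "(\<And>a. a \<in> A \<Longrightarrow> f a \<in> poly_fun I) \<Longrightarrow> (\<lambda>x. \<Sum>a\<in>A. f a x) \<in> poly_fun I"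
  by (induction A rule: infinite_finite_induct) (auto intro: poly_fun.intros)

lemma pf_prod: "(\<And>a. a \<in> A \<Longrightarrow> f a \<in> poly_fun I) \<Longrightarrow> (\<lambda>x. \<Prod>a\<in>A. f a x) \<in> poly_fun I"
  by (induction A rule: infinite_finite_induct) (auto intro: poly_fun.intros)

lemma pf_power: "f \<in> poly_fun I \<Longrightarrow> (\<lambda>x. f x ^ k) \<in> poly_fun I"
  by (induction k) (auto intro: poly_fun.intros)

lemma pf_if: "(P \<Longrightarrow> f \<in> poly_fun I) \<Longrightarrow> (\<not> P \<Longrightarrow> g \<in> poly_fun I) \<Longrightarrow> (\<lambda>x. if P then f x else g x) \<in> poly_fun I"
  by (cases P) simp_all

lemma pf_comp:
  assumes "f \<in> poly_fun I" "\<And>i. i \<in> I \<Longrightarrow> (\<lambda>p. g p i) \<in> poly_fun J"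
  shows "(\<lambda>p. f (g p)) \<in> poly_fun J"
  using assms(1) by induction (auto intro: poly_fun.intros assms(2))

lemma pf_mono: "f \<in> poly_fun I \<Longrightarrow> I \<subseteq> J \<Longrightarrow> f \<in> poly_fun J"
  by (induction rule: poly_fun.induct) (auto intro: poly_fun.intros)

lemma pf_cong:
  assumes "f \<in> poly_fun I" "\<And>i. i \<in> I \<Longrightarrow> x i = y i"
  shows "f x = f y"
  using assms(1) by induction (auto simp: assms(2))

text \<open>Restriction to a line reduces questions about polynomial functions, which carry no
  canonical coefficients, to univariate polynomials.\<close>

lemma pf_line:
  assumes "f \<in> poly_fun I"
  shows "\<exists>p. \<forall>t. f (\<lambda>i. x i + t * v i) = poly p t"
  using assms
proof induction
  case (pf_const c)
  then show ?case by (intro exI[of _ "[:c:]"]) simp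
next
  case (pf_coord i)
  then show ?case by (intro exI[of _ "[:x i, v i:]"]) simp
next
  case (pf_add f g)
  then show ?case by (metis poly_add)
next
  case (pf_mult f g)
  then show ?case by (metis poly_mult)
qed

text \<open>The functions form an integral domain: on the line through a point with f non-zero and a
  point with g non-zero, both restrictions are non-zero univariate polynomials, and so is their
  product.\<close>

lemma pf_mult_eq_zero:
  assumes "f \<in> poly_fun I" "g \<in> poly_fun I" "\<And>x. f x * g x = 0"
  shows "(\<forall>x. f x = 0) \<or> (\<forall>x. g x = 0)"
proof (rule ccontr)
  assume "\<not> ?thesis"
  then obtain a b where ab: "f a \<noteq> 0" "g b \<noteq> 0" by blast
  obtain p where p: "\<And>t. f (\<lambda>i. a i + t * (b i - a i)) = poly p t"
    using pf_line[OF assms(1), of a "\<lambda>i. b i - a i"] by blast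
  obtain q where q: "\<And>t. g (\<lambda>i. a i + t * (b i - a i)) = poly q t"
    using pf_line[OF assms(2), of a "\<lambda>i. b i - a i"] by blast
  have "poly (p * q) t = 0" for t using assms(3) by (simp add: p[symmetric] q[symmetric])
  then have "p * q = 0" using poly_all_0_iff_0 by blast
  then have "p = 0 \<or> q = 0" by simp
  moreover have "poly p 0 \<noteq> 0" using ab p[of 0] by simp
  moreover have "poly q 1 \<noteq> 0" using ab q[of 1] by simp
  ultimately show False by auto
qed

text \<open>The density principle behind all statements about general points: an equation checked
  where h does not vanish holds everywhere.\<close>

lemma pf_dense:
  assumes "f \<in> poly_fun I" "h \<in> poly_fun I" "h x0 \<noteq> 0" "\<And>x. h x \<noteq> 0 \<Longrightarrow> f x = 0"
  shows "f x = 0"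
  using pf_mult_eq_zero[OF assms(1,2)] assms(3,4) by (metis mult_eq_0_iff)

lemma pf_mult_nonzero:
  assumes "f \<in> poly_fun I" "g \<in> poly_fun I" "f a \<noteq> 0" "g b \<noteq> 0"
  shows "\<exists>x. f x * g x \<noteq> 0"
  using pf_mult_eq_zero[OF assms(1,2)] assms(3,4) by blast

lemma pf_prod_nonzero:
  assumes "finite A" "\<And>a. a \<in> A \<Longrightarrow> f a \<in> poly_fun I" "\<And>a. a \<in> A \<Longrightarrow> \<exists>x. f a x \<noteq> 0"
  shows "\<exists>x. (\<Prod>a\<in>A. f a x) \<noteq> 0"
  using assms
proof (induction A rule: finite_induct)
  case (insert a A)
  obtain x where x: "f a x \<noteq> 0" using insert.prems(2) by blast
  have "\<exists>y. (\<Prod>a\<in>A. f a y) \<noteq> 0" by (rule insert.IH) (use insert.prems in auto)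
  then obtain y where y: "(\<Prod>a\<in>A. f a y) \<noteq> 0" ..
  have "\<exists>x. f a x * (\<Prod>a\<in>A. f a x) \<noteq> 0"
  proof (rule pf_mult_nonzero[of "f a" I "\<lambda>x. \<Prod>a\<in>A. f a x", OF _ _ x y])
    show "f a \<in> poly_fun I" by (rule insert.prems) simp
    show "(\<lambda>x. \<Prod>a\<in>A. f a x) \<in> poly_fun I" by (intro pf_prod insert.prems) simp
  qed
  then show ?case using insert.hyps by simp
qed auto

text \<open>A non-zero univariate polynomial has finitely many roots, whereas a disc is uncountable.
  This carries analytic information about small parameters to the whole line.\<close>

lemma pf_small_line:
  assumes "f \<in> poly_fun I" "\<delta> > 0"
    and "\<And>t. norm t < \<delta> \<Longrightarrow> f (\<lambda>i. x i + t * v i) = 0"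
  shows "f (\<lambda>i. x i + t * v i) = 0"
proof -
  obtain p where p: "\<And>t. f (\<lambda>i. x i + t * v i) = poly p t"
    using pf_line[OF assms(1), of x v] by blast
  have "p = 0"
  proof (rule ccontr)
    assume "p \<noteq> 0"
    then have "finite {t. poly p t = 0}" by (rule poly_roots_finite)
    moreover have "ball 0 \<delta> \<subseteq> {t. poly p t = 0}" using assms(3) p by auto
    ultimately have "countable (ball (0::complex) \<delta>)" using finite_subset countable_finite by blast
    then show False using assms(2) uncountable_ball by blast
  qed
  then show ?thesis using p by simp
qed

section \<open>Degree bounds for polynomial functions\<close>

inductive pdeg :: "'i set \<Rightarrow> nat \<Rightarrow> (('i \<Rightarrow> complex) \<Rightarrow> complex) \<Rightarrow> bool" for I where
  pd_const: "pdeg I D (\<lambda>x. c)"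
| pd_coord: "i \<in> I \<Longrightarrow> pdeg I (Suc D) (\<lambda>x. x i)"
| pd_add: "pdeg I D f \<Longrightarrow> pdeg I D g \<Longrightarrow> pdeg I D (\<lambda>x. f x + g x)"
| pd_mult: "pdeg I D f \<Longrightarrow> pdeg I E g \<Longrightarrow> pdeg I (D + E) (\<lambda>x. f x * g x)"

lemma pdeg_mono: "pdeg I D f \<Longrightarrow> D \<le> D' \<Longrightarrow> pdeg I D' f"
proof (induction arbitrary: D' rule: pdeg.induct)
  case (pd_coord i D)
  then show ?case by (cases D') (auto intro: pdeg.intros)
next
  case (pd_mult D f E g)
  from pd_mult.prems pd_mult.IH(2)[of "D' - D"] have "pdeg I (D' - D) g" by simp
  from pdeg.pd_mult[OF pd_mult.hyps(1) this] show ?case using pd_mult.prems by simp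
qed (auto intro: pdeg.intros)

lemma pdeg_imp_pf: "pdeg I D f \<Longrightarrow> f \<in> poly_fun I"
  by (induction rule: pdeg.induct) (auto intro: poly_fun.intros)

lemma pf_imp_pdeg: "f \<in> poly_fun I \<Longrightarrow> \<exists>D. pdeg I D f"
proof (induction rule: poly_fun.induct)
  case (pf_add f g)
  then obtain D E where "pdeg I D f" "pdeg I E g" by blast
  then have "pdeg I (max D E) f" "pdeg I (max D E) g" by (auto intro: pdeg_mono)
  then show ?case by (blast intro: pdeg.intros)
qed (blast intro: pdeg.intros)+

lemma pdeg_sum: "(\<And>a. a \<in> A \<Longrightarrow> pdeg I D (f a)) \<Longrightarrow> pdeg I D (\<lambda>x. \<Sum>a\<in>A. f a x)"
  by (induction A rule: infinite_finite_induct) (auto intro: pdeg.intros)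

lemma pdeg_cmult: "pdeg I D f \<Longrightarrow> pdeg I D (\<lambda>x. c * f x)"
  using pd_mult[OF pd_const[of I 0 c]] by simp

lemma pdeg_prod: "finite A \<Longrightarrow> (\<And>a. a \<in> A \<Longrightarrow> pdeg I D (f a)) \<Longrightarrow> pdeg I (card A * D) (\<lambda>x. \<Prod>a\<in>A. f a x)"
  by (induction A rule: finite_induct) (auto intro: pdeg.intros)

lemma pdeg_comp:
  assumes "pdeg K D Q" "\<And>k. k \<in> K \<Longrightarrow> pdeg J d (\<lambda>p. g p k)"
  shows "pdeg J (D * d) (\<lambda>p. Q (g p))"
  using assms(1)
proof induction
  case (pd_coord k D)
  then show ?case by (intro pdeg_mono[OF assms(2)]) auto
next
  case (pd_mult D f E g)
  then show ?case using pdeg.pd_mult[of J "D*d" _ "E*d"] by (simp add: algebra_simps)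
qed (auto intro: pdeg.intros)

lemma pdeg_line:
  assumes "pdeg I D f"
  shows "\<exists>p. degree p \<le> D \<and> (\<forall>t. f (\<lambda>i. x i + t * v i) = poly p t)"
  using assms
proof induction
  case (pd_const D c)
  then show ?case by (intro exI[of _ "[:c:]"]) simp
next
  case (pd_coord i)
  then show ?case by (intro exI[of _ "[:x i, v i:]"]) simp
next
  case (pd_add D f g)
  then show ?case by (metis poly_add degree_add_le)
next
  case (pd_mult D f E g)
  then obtain p q where "degree p \<le> D" "\<forall>t. f (\<lambda>i. x i + t * v i) = poly p t"
    "degree q \<le> E" "\<forall>t. g (\<lambda>i. x i + t * v i) = poly q t" by blast
  then show ?case by (intro exI[of _ "p * q"]) (auto intro: order_trans[OF degree_mult_le])
qed

lemma pdeg_zero_coord: "pdeg I D f \<Longrightarrow> pdeg I D (\<lambda>x. f (x(k := 0)))"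
proof (induction rule: pdeg.induct)
  case (pd_coord i D)
  then show ?case by (cases "i = k") (auto intro: pdeg.intros)
qed (auto intro: pdeg.intros)

text \<open>Division by variable k with remainder. For D = 0 the bound \<open>D - 1\<close> does not
  drop, so the vanishing of the quotient is recorded separately; a descent on D relies on
  it.\<close>

lemma pdeg_divide_coord:
  assumes "pdeg I D f"
  shows "\<exists>q. pdeg I (D - 1) q \<and> (D = 0 \<longrightarrow> q = (\<lambda>x. 0)) \<and> (\<forall>x. f x = f (x(k := 0)) + x k * q x)"
  using assms
proof induction
  case (pd_const D c)
  then show ?case by (intro exI[of _ "\<lambda>x. 0"]) (auto intro: pdeg.intros)
next
  case (pd_coord i)
  then show ?case by (intro exI[of _ "\<lambda>x. if i = k then 1 else 0"]) (auto intro: pdeg.intros)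
next
  case (pd_add D f g)
  then obtain q r where h: "pdeg I (D - 1) q" "D = 0 \<longrightarrow> q = (\<lambda>x. 0)" "\<And>x. f x = f (x(k := 0)) + x k * q x"
    "pdeg I (D - 1) r" "D = 0 \<longrightarrow> r = (\<lambda>x. 0)" "\<And>x. g x = g (x(k := 0)) + x k * r x" by blast
  have e: "f x + g x = f (x(k := 0)) + g (x(k := 0)) + x k * (q x + r x)" for x
  proof -
    have "f x + g x = (f (x(k := 0)) + x k * q x) + (g (x(k := 0)) + x k * r x)"
      by (rule arg_cong2[OF h(3) h(6)])
    also have "\<dots> = f (x(k := 0)) + g (x(k := 0)) + x k * (q x + r x)" by (simp add: algebra_simps)
    finally show ?thesis .
  qed
  show ?case by (rule exI[of _ "\<lambda>x. q x + r x"], intro conjI allI pdeg.pd_add h(1,4) e) (use h(2,5) in auto)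
next
  case (pd_mult D f E g)
  then obtain q r where h: "pdeg I (D - 1) q" "D = 0 \<longrightarrow> q = (\<lambda>x. 0)" "\<And>x. f x = f (x(k := 0)) + x k * q x"
    "pdeg I (E - 1) r" "E = 0 \<longrightarrow> r = (\<lambda>x. 0)" "\<And>x. g x = g (x(k := 0)) + x k * r x" by blast
  have f0: "pdeg I D (\<lambda>x. f (x(k := 0)))"
    using pdeg_zero_coord[OF pd_mult.hyps(1)] .
  have 1: "pdeg I (D + E - 1) (\<lambda>x. q x * g x)"
  proof (cases "D = 0")
    case True
    then show ?thesis using h(2,5) by (auto intro: pdeg.intros)
  next
    case False
    then show ?thesis using pdeg.pd_mult[OF h(1) pd_mult.hyps(2)] by simp
  qed
  have 2: "pdeg I (D + E - 1) (\<lambda>x. f (x(k := 0)) * r x)"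
  proof (cases "E = 0")
    case True
    then show ?thesis using h(2,5) by (auto intro: pdeg.intros)
  next
    case False
    then show ?thesis using pdeg.pd_mult[OF f0 h(4)] by simp
  qed
  have e: "f x * g x = f (x(k := 0)) * g (x(k := 0)) + x k * (q x * g x + f (x(k := 0)) * r x)" for x
  proof -
    have "f x * g x = (f (x(k := 0)) + x k * q x) * g x" by (rule arg_cong[OF h(3)])
    also have "\<dots> = f (x(k := 0)) * g x + x k * q x * g x" by (simp add: algebra_simps)
    also have "f (x(k := 0)) * g x = f (x(k := 0)) * (g (x(k := 0)) + x k * r x)" by (rule arg_cong[OF h(6)])
    finally show ?thesis by (simp add: algebra_simps)
  qed
  show ?case
    by (rule exI[of _ "\<lambda>x. q x * g x + f (x(k := 0)) * r x"], intro conjI allI pdeg.pd_add 1 2 e) (use h(2,5) in auto)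
qed

section \<open>Derivatives\<close>

definition dd :: "(('i \<Rightarrow> complex) \<Rightarrow> complex) \<Rightarrow> ('i \<Rightarrow> complex) \<Rightarrow> ('i \<Rightarrow> complex) \<Rightarrow> complex" where
  "dd f x v = deriv (\<lambda>t::complex. f (\<lambda>i. x i + t * v i)) 0"

definition ax :: "'i \<Rightarrow> 'i \<Rightarrow> complex" where
  "ax i = (\<lambda>k. if k = i then 1 else 0)"

definition pd :: "(('i \<Rightarrow> complex) \<Rightarrow> complex) \<Rightarrow> 'i \<Rightarrow> ('i \<Rightarrow> complex) \<Rightarrow> complex" where
  "pd f i x = dd f x (ax i)"

lemma dd_has:
  assumes "f \<in> poly_fun I"
  shows "((\<lambda>t. f (\<lambda>i. x i + t * v i)) has_field_derivative dd f x v) (at 0)"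
proof -
  obtain p where p: "\<And>t. f (\<lambda>i. x i + t * v i) = poly p t"
    using pf_line[OF assms, of x v] by blast
  have "(\<lambda>t. f (\<lambda>i. x i + t * v i)) = poly p" using p by auto
  then show ?thesis unfolding dd_def
    by (metis DERIV_imp_deriv poly_DERIV)
qed

lemma dd_const [simp]: "dd (\<lambda>x. c) x v = 0"
  by (simp add: dd_def)

lemma dd_coord [simp]: "dd (\<lambda>x. x i) x v = v i"
  unfolding dd_def by (rule DERIV_imp_deriv) (auto intro!: derivative_eq_intros)

lemma dd_add:
  assumes "f \<in> poly_fun I" "g \<in> poly_fun I"
  shows "dd (\<lambda>x. f x + g x) x v = dd f x v + dd g x v"
  unfolding dd_def[of "\<lambda>x. f x + g x"]
  by (rule DERIV_imp_deriv) (intro DERIV_add dd_has[OF assms(1)] dd_has[OF assms(2)])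

lemma dd_mult:
  assumes "f \<in> poly_fun I" "g \<in> poly_fun I"
  shows "dd (\<lambda>x. f x * g x) x v = dd f x v * g x + f x * dd g x v"
proof -
  have "((\<lambda>t. f (\<lambda>i. x i + t * v i) * g (\<lambda>i. x i + t * v i)) has_field_derivative
      (dd f x v * g (\<lambda>i. x i + 0 * v i) + dd g x v * f (\<lambda>i. x i + 0 * v i))) (at 0)"
    by (rule DERIV_mult[OF dd_has[OF assms(1)] dd_has[OF assms(2)]])
  then show ?thesis
    unfolding dd_def[of "\<lambda>x. f x * g x"] by (simp add: DERIV_imp_deriv mult.commute)
qed

lemma dd_cmult:
  assumes "f \<in> poly_fun I"
  shows "dd (\<lambda>x. c * f x) x v = c * dd f x v"
  using dd_mult[OF pf_const assms] by simp

lemma dd_diff: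
  assumes "f \<in> poly_fun I" "g \<in> poly_fun I"
  shows "dd (\<lambda>x. f x - g x) x v = dd f x v - dd g x v"
  using dd_add[OF assms(1) pf_cmult[OF assms(2), of "-1"]] dd_cmult[OF assms(2), of "-1"] by simp

lemma dd_sum:
  assumes "\<And>a. a \<in> A \<Longrightarrow> f a \<in> poly_fun I"
  shows "dd (\<lambda>x. \<Sum>a\<in>A. f a x) x v = (\<Sum>a\<in>A. dd (f a) x v)"
  using assms
proof (induction A rule: infinite_finite_induct)
  case (insert a A)
  have "dd (\<lambda>x. f a x + (\<Sum>a\<in>A. f a x)) x v = dd (f a) x v + dd (\<lambda>x. \<Sum>a\<in>A. f a x) x v"
    by (rule dd_add[OF _ pf_sum]) (use insert.prems in auto)
  then show ?case using insert by simp
qed auto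

lemma pd_add_eq: "f \<in> poly_fun I \<Longrightarrow> g \<in> poly_fun I \<Longrightarrow> pd (\<lambda>x. f x + g x) i = (\<lambda>x. pd f i x + pd g i x)"
  by (auto simp: pd_def dd_add)

lemma pd_mult_eq: "f \<in> poly_fun I \<Longrightarrow> g \<in> poly_fun I \<Longrightarrow> pd (\<lambda>x. f x * g x) i = (\<lambda>x. pd f i x * g x + f x * pd g i x)"
  by (auto simp: pd_def dd_mult)

lemma pd_const_eq [simp]: "pd (\<lambda>x. c) i = (\<lambda>x. 0)"
  by (auto simp: pd_def)

lemma pd_coord_eq [simp]: "pd (\<lambda>x. x i) j = (\<lambda>x. if i = j then 1 else 0)"
  by (auto simp: pd_def ax_def)

lemma pf_pd: "f \<in> poly_fun I \<Longrightarrow> pd f i \<in> poly_fun I"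
  by (induction rule: poly_fun.induct) (auto simp: pd_add_eq pd_mult_eq intro!: poly_fun.intros)

text \<open>As for division by a variable, bound 0 is treated apart because \<open>D - 1\<close>
  does not decrease there.\<close>

lemma pdeg_pd_aux:
  assumes "pdeg I D f"
  shows "pdeg I (D - 1) (pd f i) \<and> (D = 0 \<longrightarrow> pd f i = (\<lambda>x. 0))"
  using assms
proof induction
  case (pd_mult D f E g)
  note pfs = pdeg_imp_pf[OF pd_mult.hyps(1)] pdeg_imp_pf[OF pd_mult.hyps(2)]
  have 1: "pdeg I (D + E - 1) (\<lambda>x. pd f i x * g x)"
  proof (cases "D = 0")
    case True
    then show ?thesis using pd_mult.IH by (auto intro: pdeg.intros)
  next
    case False
    then show ?thesis using pdeg.pd_mult[OF conjunct1[OF pd_mult.IH(1)] pd_mult.hyps(2)] by simp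
  qed
  have 2: "pdeg I (D + E - 1) (\<lambda>x. f x * pd g i x)"
  proof (cases "E = 0")
    case True
    then show ?thesis using pd_mult.IH by (auto intro: pdeg.intros)
  next
    case False
    then show ?thesis using pdeg.pd_mult[OF pd_mult.hyps(1) conjunct1[OF pd_mult.IH(2)]] by simp
  qed
  show ?case using pdeg.pd_add[OF 1 2] pd_mult.IH by (auto simp: pd_mult_eq[OF pfs])
next
  case (pd_add D f g)
  note pfs = pdeg_imp_pf[OF pd_add.hyps(1)] pdeg_imp_pf[OF pd_add.hyps(2)]
  from pd_add show ?case by (auto simp: pd_add_eq[OF pfs] intro: pdeg.intros)
qed (auto intro: pdeg.intros)

lemma pdeg_pd: "pdeg I D f \<Longrightarrow> pdeg I (D - 1) (pd f i)"
  by (rule pdeg_pd_aux[THEN conjunct1])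

lemma dd_linear:
  assumes "f \<in> poly_fun I" "finite I"
  shows "dd f x v = (\<Sum>i\<in>I. pd f i x * v i)"
  using assms(1)
proof induction
  case (pf_coord i)
  then show ?case using assms(2) by (simp add: if_distrib[of "\<lambda>c. c * _"] cong: if_cong)
next
  case (pf_add f g)
  then show ?case by (simp add: dd_add pd_add_eq algebra_simps sum.distrib)
next
  case (pf_mult f g)
  then show ?case by (simp add: dd_mult pd_mult_eq algebra_simps sum.distrib sum_distrib_left)
qed simp

lemma dd_comp:
  assumes "Q \<in> poly_fun K" "finite K" "\<And>k. k \<in> K \<Longrightarrow> (\<lambda>p. g p k) \<in> poly_fun J"
  shows "dd (\<lambda>p. Q (g p)) p v = (\<Sum>k\<in>K. pd Q k (g p) * dd (\<lambda>p. g p k) p v)"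
  using assms(1)
proof induction
  case (pf_coord k)
  then show ?case using assms(2) by (simp add: if_distrib[of "\<lambda>c. c * _"] cong: if_cong)
next
  case (pf_add f h)
  then have "(\<lambda>p. f (g p)) \<in> poly_fun J" "(\<lambda>p. h (g p)) \<in> poly_fun J" using pf_comp assms(3) by blast+
  then show ?case using pf_add by (simp add: dd_add pd_add_eq algebra_simps sum.distrib)
next
  case (pf_mult f h)
  then have "(\<lambda>p. f (g p)) \<in> poly_fun J" "(\<lambda>p. h (g p)) \<in> poly_fun J" using pf_comp assms(3) by blast+
  then show ?case using pf_mult by (simp add: dd_mult pd_mult_eq algebra_simps sum.distrib sum_distrib_left)
qed simp

text \<open>On the line through x and y the derivative is a combination of partial derivatives from
  S, hence zero, and in characteristic zero the univariate restriction is constant. This serves to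
  drop variables from a relation.\<close>

lemma pf_const_along:
  assumes "f \<in> poly_fun I" "finite I" "\<And>i y. i \<in> S \<Longrightarrow> pd f i y = 0" "\<And>i. i \<in> I - S \<Longrightarrow> x i = y i"
  shows "f x = f y"
proof -
  define v where "v = (\<lambda>i. y i - x i)"
  obtain p where p: "\<And>t. f (\<lambda>i. x i + t * v i) = poly p t"
    using pf_line[OF assms(1), of x v] by blast
  have "poly (pderiv p) t = 0" for t
  proof -
    have "(\<lambda>s. f (\<lambda>i. (x i + t * v i) + s * v i)) = (\<lambda>s. poly p (t + s))"
      using p by (simp add: p[symmetric] algebra_simps)
    moreover have "((\<lambda>s. f (\<lambda>i. (x i + t * v i) + s * v i)) has_field_derivative dd f (\<lambda>i. x i + t * v i) v) (at 0)"
      by (rule dd_has[OF assms(1)])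
    moreover have "((\<lambda>s. poly p (t + s)) has_field_derivative poly (pderiv p) t) (at 0)"
      using DERIV_shift[of "poly p" "poly (pderiv p) t" 0 t] poly_DERIV[of p t] by (simp add: add.commute)
    ultimately have "poly (pderiv p) t = dd f (\<lambda>i. x i + t * v i) v"
      using DERIV_unique by metis
    also have "\<dots> = (\<Sum>i\<in>I. pd f i (\<lambda>i. x i + t * v i) * v i)" using assms dd_linear by blast
    also have "\<dots> = 0"
    proof (intro sum.neutral ballI)
      fix i assume i: "i \<in> I"
      show "pd f i (\<lambda>i. x i + t * v i) * v i = 0"
        using assms(3)[of i "\<lambda>i. x i + t * v i"] assms(4)[of i] i by (cases "i \<in> S") (auto simp: v_def)
    qed
    finally show ?thesis .
  qed
  then have "pderiv p = 0" using poly_all_0_iff_0 by blast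
  then obtain c where "p = [:c:]" using pderiv_eq_0_iff degree_eq_zeroE by blast
  then have "poly p 0 = poly p 1" by simp
  then show ?thesis using p[of 0] p[of 1] by (simp add: v_def)
qed

lemma pf_const_pd0:
  assumes "f \<in> poly_fun I" "finite I" "\<And>i y. i \<in> I \<Longrightarrow> pd f i y = 0"
  shows "f x = f y"
  by (rule pf_const_along[OF assms]) auto

text \<open>Only the finitely many coordinates in I enter, so closeness is measured coordinatewise
  and not by a norm on the function space.\<close>

lemma pf_continuous:
  assumes "f \<in> poly_fun I" "finite I" "e > 0"
  shows "\<exists>d>0. \<forall>x. (\<forall>i\<in>I. norm (x i - x0 i) < d) \<longrightarrow> norm (f x - f x0) < e"
  using assms(1,3)
proof (induction arbitrary: e)
  case (pf_const c)
  then show ?case by (auto intro: exI[of _ 1])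
next
  case (pf_coord i)
  then show ?case by blast
next
  case (pf_add f g)
  obtain d1 where d1: "d1 > 0" "\<And>x. (\<forall>i\<in>I. norm (x i - x0 i) < d1) \<Longrightarrow> norm (f x - f x0) < e/2"
    using pf_add.IH(1)[of "e/2"] pf_add.prems by auto
  obtain d2 where d2: "d2 > 0" "\<And>x. (\<forall>i\<in>I. norm (x i - x0 i) < d2) \<Longrightarrow> norm (g x - g x0) < e/2"
    using pf_add.IH(2)[of "e/2"] pf_add.prems by auto
  show ?case
  proof (intro exI[of _ "min d1 d2"] conjI allI impI)
    fix x assume "\<forall>i\<in>I. norm (x i - x0 i) < min d1 d2"
    then have "norm (f x - f x0) < e/2" "norm (g x - g x0) < e/2" using d1 d2 by auto
    then show "norm (f x + g x - (f x0 + g x0)) < e"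
      using norm_triangle_ineq[of "f x - f x0" "g x - g x0"] by (simp add: algebra_simps)
  qed (use d1 d2 in auto)
next
  case (pf_mult f g)
  define M where "M = norm (f x0) + norm (g x0) + 1"
  define e' where "e' = min 1 (e / (2 * M))"
  have M: "M > 0" "M \<ge> 1" by (auto simp: M_def add_nonneg_pos)
  have e': "e' > 0" "e' \<le> 1" "e' * (2 * M) \<le> e" using M pf_mult.prems
    by (auto simp: e'_def min_def field_simps)
  obtain d1 where d1: "d1 > 0" "\<And>x. (\<forall>i\<in>I. norm (x i - x0 i) < d1) \<Longrightarrow> norm (f x - f x0) < e'"
    using pf_mult.IH(1)[OF e'(1)] by auto
  obtain d2 where d2: "d2 > 0" "\<And>x. (\<forall>i\<in>I. norm (x i - x0 i) < d2) \<Longrightarrow> norm (g x - g x0) < e'"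
    using pf_mult.IH(2)[OF e'(1)] by auto
  show ?case
  proof (intro exI[of _ "min d1 d2"] conjI allI impI)
    fix x assume "\<forall>i\<in>I. norm (x i - x0 i) < min d1 d2"
    then have fg: "norm (f x - f x0) < e'" "norm (g x - g x0) < e'" using d1 d2 by auto
    have gx: "norm (g x) < norm (g x0) + 1"
      using fg(2) e'(2) norm_triangle_ineq2[of "g x" "g x0"] by linarith
    have "f x * g x - f x0 * g x0 = (f x - f x0) * g x + f x0 * (g x - g x0)"
      by (simp add: algebra_simps)
    then have "norm (f x * g x - f x0 * g x0) \<le> norm (f x - f x0) * norm (g x) + norm (f x0) * norm (g x - g x0)"
      by (metis norm_mult norm_triangle_ineq)
    also have "\<dots> \<le> e' * (norm (g x0) + 1) + norm (f x0) * e'"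
      using fg gx e'(1) by (intro add_mono mult_mono) auto
    also have "\<dots> = e' * M" by (simp add: M_def algebra_simps)
    also have "\<dots> < e' * (2 * M)" using e' M by simp
    finally show "norm (f x * g x - f x0 * g x0) < e" using e'(3) by simp
  qed (use d1 d2 in auto)
qed

lemma pf_nonzero_near:
  assumes "f \<in> poly_fun I" "finite I" "f x0 \<noteq> 0"
  shows "\<exists>d>0. \<forall>x. (\<forall>i\<in>I. norm (x i - x0 i) < d) \<longrightarrow> f x \<noteq> 0"
proof -
  obtain d where "d > 0" "\<And>x. (\<forall>i\<in>I. norm (x i - x0 i) < d) \<Longrightarrow> norm (f x - f x0) < norm (f x0)"
    using pf_continuous[OF assms(1,2), of "norm (f x0)" x0] assms(3) by auto
  then show ?thesis by (intro exI[of _ d]) (auto simp: norm_minus_commute, force)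
qed

text \<open>Passes from formal partial derivatives to Frechet derivatives: the persistence of
  singular points is an analytic argument whose unknowns live in a normed space and reach the
  coordinates through c.\<close>

lemma pf_has_derivative:
  fixes c :: "'y::real_normed_vector \<Rightarrow> 'i \<Rightarrow> complex"
  assumes "f \<in> poly_fun I" "finite I" "\<And>i. i \<in> I \<Longrightarrow> ((\<lambda>y. c y i) has_derivative c' i) (at y0)"
  shows "((\<lambda>y. f (c y)) has_derivative (\<lambda>h. \<Sum>i\<in>I. pd f i (c y0) * c' i h)) (at y0)"
  using assms(1)
proof induction
  case (pf_coord i)
  then have "(\<lambda>h. \<Sum>ia\<in>I. pd (\<lambda>x. x i) ia (c y0) * c' ia h) = c' i"
    using assms(2) by (auto simp: if_distrib[of "\<lambda>c. c * _"] cong: if_cong)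
  then show ?case using assms(3)[OF pf_coord] by simp
next
  case (pf_add f g)
  show ?case
    by (rule has_derivative_eq_rhs[OF has_derivative_add[OF pf_add.IH]])
      (auto simp: pd_add_eq[OF pf_add.hyps] algebra_simps sum.distrib)
next
  case (pf_mult f g)
  show ?case
    by (rule has_derivative_eq_rhs[OF has_derivative_mult[OF pf_mult.IH]])
      (auto simp: pd_mult_eq[OF pf_mult.hyps] algebra_simps sum.distrib sum_distrib_left)
qed simp

section \<open>Linear algebra with polynomial coefficients\<close>

text \<open>Gaussian elimination, one equation at a time: \<open>c'\<close> is the system left after
  eliminating the unknown \<open>a0\<close>, and \<open>r\<close> restores the value of that
  unknown.\<close>

lemma homogeneous_system:
  fixes c :: "'a \<Rightarrow> 'b \<Rightarrow> complex"
  assumes "finite B" "finite A" "card B < card A"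
  shows "\<exists>q. (\<exists>a\<in>A. q a \<noteq> 0) \<and> (\<forall>b\<in>B. (\<Sum>a\<in>A. q a * c a b) = 0)"
  using assms
proof (induction B arbitrary: A c rule: finite_induct)
  case empty
  then show ?case by (intro exI[of _ "\<lambda>_. 1"]) (auto simp: card_gt_0_iff)
next
  case (insert b B)
  show ?case
  proof (cases "\<forall>a\<in>A. c a b = 0")
    case True
    have "card B < card A" using insert by simp
    from insert.IH[OF insert.prems(1) this, of c] obtain q
      where "\<exists>a\<in>A. q a \<noteq> 0" "\<forall>b\<in>B. (\<Sum>a\<in>A. q a * c a b) = 0" by blast
    with True show ?thesis by (intro exI[of _ q]) simp
  next
    case False
    then obtain a0 where a0: "a0 \<in> A" "c a0 b \<noteq> 0" by blast
    define c' where "c' = (\<lambda>a b'. c a b' - c a b / c a0 b * c a0 b')"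
    have fin: "finite (A - {a0})" using insert.prems by simp
    have "card B < card (A - {a0})" using insert a0 by simp
    from insert.IH[OF fin this, of c'] obtain q
      where q: "\<exists>a\<in>A - {a0}. q a \<noteq> 0" "\<forall>b'\<in>B. (\<Sum>a\<in>A - {a0}. q a * c' a b') = 0" by blast
    define r where "r = (\<lambda>a. if a = a0 then - (\<Sum>a\<in>A - {a0}. q a * c a b) / c a0 b else q a)"
    have split: "(\<Sum>a\<in>A. r a * c a b') = (\<Sum>a\<in>A - {a0}. q a * c' a b')" for b'
    proof -
      have "(\<Sum>a\<in>A. r a * c a b') = r a0 * c a0 b' + (\<Sum>a\<in>A - {a0}. r a * c a b')"
        using a0 insert.prems by (simp add: sum.remove)
      also have "(\<Sum>a\<in>A - {a0}. r a * c a b') = (\<Sum>a\<in>A - {a0}. q a * c a b')"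
        by (rule sum.cong) (auto simp: r_def)
      also have "r a0 * c a0 b' = (\<Sum>a\<in>A - {a0}. - (q a * (c a b / c a0 b * c a0 b')))"
        by (simp add: r_def sum_negf sum_distrib_left sum_distrib_right sum_divide_distrib mult_ac)
      finally show ?thesis by (simp add: c'_def algebra_simps sum_subtractf sum_negf)
    qed
    have "(\<Sum>a\<in>A. r a * c a b) = 0" unfolding split using a0 by (simp add: c'_def)
    moreover have "\<exists>a\<in>A. r a \<noteq> 0" using q(1) by (auto simp: r_def)
    ultimately show ?thesis using q(2) split by (intro exI[of _ r]) auto
  qed
qed

definition lin_indep :: "'r set \<Rightarrow> 'i set \<Rightarrow> ('r \<Rightarrow> 'i \<Rightarrow> complex) \<Rightarrow> bool" where
  "lin_indep R I m \<longleftrightarrow> (\<forall>q. (\<forall>i\<in>I. (\<Sum>r\<in>R. q r * m r i) = 0) \<longrightarrow> (\<forall>r\<in>R. q r = 0))"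

lemma lin_indepD: "lin_indep R I m \<Longrightarrow> (\<And>i. i \<in> I \<Longrightarrow> (\<Sum>r\<in>R. q r * m r i) = 0) \<Longrightarrow> r \<in> R \<Longrightarrow> q r = 0"
  unfolding lin_indep_def by blast

lemma lin_indep_card:
  assumes "lin_indep R I m" "finite R" "finite I"
  shows "card R \<le> card I"
  using homogeneous_system[of I R m] assms unfolding lin_indep_def by force

lemma lin_indep_subset:
  assumes "lin_indep R I m" "finite R" "S \<subseteq> R"
  shows "lin_indep S I m"
  unfolding lin_indep_def
proof (intro allI impI ballI)
  fix q r assume q: "\<forall>i\<in>I. (\<Sum>r\<in>S. q r * m r i) = 0" and r: "r \<in> S"
  have "(\<Sum>r\<in>R. (if r \<in> S then q r else 0) * m r i) = (\<Sum>r\<in>S. q r * m r i)" for i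
    using assms by (intro sum.mono_neutral_cong_right) auto
  then have "(if r \<in> S then q r else 0) = 0"
    using q r assms(3) by (intro lin_indepD[OF assms(1), of "\<lambda>r. if r \<in> S then q r else 0"]) auto
  then show "q r = 0" using r by simp
qed

lemma dual_basis_imp_lin_indep:
  assumes "finite R" "D \<noteq> 0"
    and "\<And>r s. r \<in> R \<Longrightarrow> s \<in> R \<Longrightarrow> (\<Sum>i\<in>I. b r i * m s i) = (if r = s then D else 0)"
  shows "lin_indep R I m"
  unfolding lin_indep_def
proof (intro allI impI ballI)
  fix q r assume q: "\<forall>i\<in>I. (\<Sum>s\<in>R. q s * m s i) = 0" and r: "r \<in> R"
  have "0 = (\<Sum>i\<in>I. b r i * (\<Sum>s\<in>R. q s * m s i))" using q by simp
  also have "\<dots> = (\<Sum>s\<in>R. q s * (\<Sum>i\<in>I. b r i * m s i))"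
    unfolding sum_distrib_left by (subst sum.swap) (simp add: mult_ac)
  also have "\<dots> = (\<Sum>s\<in>R. q s * (if r = s then D else 0))"
    using assms(3) r by (intro sum.cong) auto
  also have "\<dots> = q r * D" using assms(1) r by (simp add: if_distrib[of "\<lambda>c. _ * c"] cong: if_cong)
  finally show "q r = 0" using assms(2) by simp
qed

text \<open>Fraction-free Gram-Schmidt: a dual basis depending polynomially on p, with common
  denominator D. The identities hold at every p, so a non-zero \<open>D p\<close> certifies
  independence at p.\<close>

lemma poly_dual_basis:
  fixes m :: "'r \<Rightarrow> ('p \<Rightarrow> complex) \<Rightarrow> 'i \<Rightarrow> complex"
  assumes "finite R" "finite I" "\<And>r i. r \<in> R \<Longrightarrow> i \<in> I \<Longrightarrow> (\<lambda>p. m r p i) \<in> poly_fun J"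
    and "lin_indep R I (\<lambda>r. m r p0)"
  shows "\<exists>b D. D \<in> poly_fun J \<and> D p0 \<noteq> 0 \<and> (\<forall>r\<in>R. \<forall>i. (\<lambda>p. b r p i) \<in> poly_fun J) \<and>
    (\<forall>p. \<forall>r\<in>R. \<forall>s\<in>R. (\<Sum>i\<in>I. b r p i * m s p i) = (if r = s then D p else 0))"
  using assms(1,3,4)
proof (induction R rule: finite_induct)
  case empty
  show ?case by (rule exI, rule exI[of _ "\<lambda>_. 1"]) (auto intro: pf_const)
next
  case (insert a R)
  have ind: "lin_indep R I (\<lambda>r. m r p0)"
    by (rule lin_indep_subset[OF insert.prems(2)]) (use insert.hyps in auto)
  have pfR: "\<And>r i. r \<in> R \<Longrightarrow> i \<in> I \<Longrightarrow> (\<lambda>p. m r p i) \<in> poly_fun J" using insert.prems(1) by simp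
  obtain b D where D: "D \<in> poly_fun J" "D p0 \<noteq> 0"
    and b0: "\<forall>r\<in>R. \<forall>i. (\<lambda>p. b r p i) \<in> poly_fun J"
    and bm0: "\<forall>p. \<forall>r\<in>R. \<forall>s\<in>R. (\<Sum>i\<in>I. b r p i * m s p i) = (if r = s then D p else 0)"
    using insert.IH[OF pfR ind] by blast
  have b: "\<And>r i. r \<in> R \<Longrightarrow> (\<lambda>p. b r p i) \<in> poly_fun J" using b0 by simp
  have bm: "\<And>p r s. r \<in> R \<Longrightarrow> s \<in> R \<Longrightarrow> (\<Sum>i\<in>I. b r p i * m s p i) = (if r = s then D p else 0)"
    using bm0 by simp
  have mpf: "\<And>r i. r \<in> insert a R \<Longrightarrow> i \<in> I \<Longrightarrow> (\<lambda>p. m r p i) \<in> poly_fun J" using insert.prems by blast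
  define e where "e = (\<lambda>r p. \<Sum>i\<in>I. b r p i * m a p i)"
  have epf: "r \<in> R \<Longrightarrow> e r \<in> poly_fun J" for r
    unfolding e_def using b mpf by (intro pf_sum pf_mult) auto
  \<comment> \<open>D times the residual of the new row modulo the old rows. Independence at p0
    forces a coordinate c where it is non-zero.\<close>
  define m' where "m' = (\<lambda>p i. D p * m a p i - (\<Sum>r\<in>R. e r p * m r p i))"
  have m'pf: "i \<in> I \<Longrightarrow> (\<lambda>p. m' p i) \<in> poly_fun J" for i
    unfolding m'_def using D epf mpf by (intro pf_diff pf_sum pf_mult) auto
  have "\<exists>c\<in>I. m' p0 c \<noteq> 0"
  proof (rule ccontr)
    assume "\<not> ?thesis"
    then have z: "\<And>i. i \<in> I \<Longrightarrow> m' p0 i = 0" by blast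
    define q where "q = (\<lambda>r. if r = a then D p0 else - e r p0)"
    have "(\<Sum>r\<in>insert a R. q r * m r p0 i) = 0" if "i \<in> I" for i
    proof -
      have "(\<Sum>r\<in>R. q r * m r p0 i) = - (\<Sum>r\<in>R. e r p0 * m r p0 i)"
        unfolding sum_negf[symmetric] using insert.hyps by (intro sum.cong) (auto simp: q_def)
      then show ?thesis using insert.hyps z[OF that] by (simp add: q_def m'_def)
    qed
    then have "q a = 0" by (intro lin_indepD[OF insert.prems(2), of q]) simp_all
    then show False using D by (simp add: q_def)
  qed
  then obtain c where c: "c \<in> I" "m' p0 c \<noteq> 0" by blast
  \<comment> \<open>The functional sending a vector to D times the c-th coordinate of its residual:
    it kills the old rows and takes the pivot value \<open>m' p c\<close> on row a.\<close>
  define ba where "ba = (\<lambda>p i. (if i = c then D p else 0) - (\<Sum>r\<in>R. m r p c * b r p i))"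
  have bapf: "(\<lambda>p. ba p i) \<in> poly_fun J" for i
    unfolding ba_def using D b mpf c by (intro pf_diff pf_sum pf_mult pf_if pf_const) auto
  have ba_ip: "(\<Sum>i\<in>I. ba p i * x i) = D p * x c - (\<Sum>r\<in>R. m r p c * (\<Sum>i\<in>I. b r p i * x i))" for p x
  proof -
    have "(\<Sum>i\<in>I. (if i = c then D p else 0) * x i) = D p * x c"
      using assms(2) c by (simp add: if_distrib[of "\<lambda>c. c * _"] cong: if_cong)
    moreover have "(\<Sum>i\<in>I. (\<Sum>r\<in>R. m r p c * b r p i) * x i) = (\<Sum>r\<in>R. m r p c * (\<Sum>i\<in>I. b r p i * x i))"
      unfolding sum_distrib_left sum_distrib_right by (subst sum.swap) (simp add: mult_ac)
    ultimately show ?thesis by (simp add: ba_def left_diff_distrib sum_subtractf)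
  qed
  have ba_m: "(\<Sum>i\<in>I. ba p i * m s p i) = 0" if "s \<in> R" for p s
  proof -
    have "(\<Sum>r\<in>R. m r p c * (\<Sum>i\<in>I. b r p i * m s p i)) = (\<Sum>r\<in>R. m r p c * (if r = s then D p else 0))"
      by (intro sum.cong refl arg_cong[where f = "times _"] bm that)
    then show ?thesis unfolding ba_ip using that insert.hyps
      by (simp add: if_distrib[of "\<lambda>c. _ * c"] cong: if_cong)
  qed
  have ba_a: "(\<Sum>i\<in>I. ba p i * m a p i) = m' p c" for p
    unfolding ba_ip by (simp add: m'_def e_def mult_ac)
  define b' where "b' = (\<lambda>r p i. if r = a then D p * ba p i else m' p c * b r p i - e r p * ba p i)"
  show ?case
  proof (rule exI[of _ b'], rule exI[of _ "\<lambda>p. D p * m' p c"], intro conjI ballI allI)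
    show "(\<lambda>p. D p * m' p c) \<in> poly_fun J" using D m'pf c by (intro pf_mult) auto
    show "D p0 * m' p0 c \<noteq> 0" using D c by simp
    fix r i assume "r \<in> insert a R"
    then show "(\<lambda>p. b' r p i) \<in> poly_fun J"
      unfolding b'_def using D bapf m'pf c b epf by (intro pf_if pf_mult pf_diff) auto
  next
    fix p r s assume rs: "r \<in> insert a R" "s \<in> insert a R"
    have 1: "(\<Sum>i\<in>I. b' r p i * m s p i) = D p * (\<Sum>i\<in>I. ba p i * m s p i)" if "r = a"
      using that by (simp add: b'_def sum_distrib_left mult_ac)
    have 2: "(\<Sum>i\<in>I. b' r p i * m s p i) = m' p c * (\<Sum>i\<in>I. b r p i * m s p i) - e r p * (\<Sum>i\<in>I. ba p i * m s p i)"
      if "r \<noteq> a"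
      using that by (simp add: b'_def sum_distrib_left sum_subtractf algebra_simps)
    show "(\<Sum>i\<in>I. b' r p i * m s p i) = (if r = s then D p * m' p c else 0)"
    proof (cases "r = a")
      case True
      then show ?thesis using 1 rs ba_m ba_a insert.hyps by (cases "s = a") auto
    next
      case False
      then have r: "r \<in> R" using rs by auto
      show ?thesis
      proof (cases "s = a")
        case True
        then show ?thesis using 2[OF False] ba_a False by (simp add: e_def)
      next
        case sa: False
        then have "s \<in> R" using rs by auto
        then show ?thesis using 2[OF False] r bm ba_m by auto
      qed
    qed
  qed
qed

lemma dual_basis:
  fixes m :: "'r \<Rightarrow> 'i \<Rightarrow> complex"
  assumes "finite R" "finite I" "lin_indep R I m"
  shows "\<exists>b. \<forall>r\<in>R. \<forall>s\<in>R. (\<Sum>i\<in>I. b r i * m s i) = (if r = s then 1 else 0)"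
proof -
  obtain b and D :: "(unit \<Rightarrow> complex) \<Rightarrow> complex" where "D undefined \<noteq> 0"
    "\<forall>p. \<forall>r\<in>R. \<forall>s\<in>R. (\<Sum>i\<in>I. b r p i * m s i) = (if r = s then D p else 0)"
    using poly_dual_basis[of R I "\<lambda>r (p::unit \<Rightarrow> complex). m r" UNIV undefined, OF assms(1,2) pf_const assms(3)] by blast
  then show ?thesis
    by (intro exI[of _ "\<lambda>r i. b r undefined i / D undefined"])
      (auto simp: sum_divide_distrib[symmetric])
qed

lemma lin_indep_open:
  fixes m :: "'r \<Rightarrow> ('p \<Rightarrow> complex) \<Rightarrow> 'i \<Rightarrow> complex"
  assumes "finite R" "finite I" "\<And>r i. r \<in> R \<Longrightarrow> i \<in> I \<Longrightarrow> (\<lambda>p. m r p i) \<in> poly_fun J"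
    and "lin_indep R I (\<lambda>r. m r p0)"
  shows "\<exists>D\<in>poly_fun J. D p0 \<noteq> 0 \<and> (\<forall>p. D p \<noteq> 0 \<longrightarrow> lin_indep R I (\<lambda>r. m r p))"
proof -
  obtain b D where D: "D \<in> poly_fun J" "D p0 \<noteq> 0"
    and bm: "\<And>p r s. r \<in> R \<Longrightarrow> s \<in> R \<Longrightarrow> (\<Sum>i\<in>I. b r p i * m s p i) = (if r = s then D p else 0)"
    using poly_dual_basis[of R I m J p0, OF assms] by blast
  then show ?thesis
    by (intro bexI[of _ D] conjI allI impI dual_basis_imp_lin_indep[OF assms(1) _ bm]) auto
qed

lemma section_orthogonal:
  fixes m b :: "'r \<Rightarrow> 'i \<Rightarrow> complex"
  assumes "finite R" "s \<in> R" "\<And>r. r \<in> R \<Longrightarrow> (\<Sum>i\<in>I. b r i * m s i) = (if r = s then D else 0)"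
  shows "(\<Sum>i\<in>I. (D * F i - (\<Sum>r\<in>R. (\<Sum>i\<in>I. F i * m r i) * b r i)) * m s i) = 0"
proof -
  have "(\<Sum>i\<in>I. (\<Sum>r\<in>R. (\<Sum>i\<in>I. F i * m r i) * b r i) * m s i)
      = (\<Sum>r\<in>R. (\<Sum>i\<in>I. F i * m r i) * (\<Sum>i\<in>I. b r i * m s i))"
    unfolding sum_distrib_left[of _ _ I] sum_distrib_right by (subst sum.swap) (simp add: mult_ac sum_distrib_left)
  also have "\<dots> = (\<Sum>r\<in>R. (\<Sum>i\<in>I. F i * m r i) * (if r = s then D else 0))"
    using assms(3) by (intro sum.cong) auto
  also have "\<dots> = D * (\<Sum>i\<in>I. F i * m s i)"
    using assms(1,2) by (simp add: if_distrib[of "\<lambda>c. _ * c"] cong: if_cong)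
  finally have e: "(\<Sum>i\<in>I. (\<Sum>r\<in>R. (\<Sum>i\<in>I. F i * m r i) * b r i) * m s i) = D * (\<Sum>i\<in>I. F i * m s i)" .
  have "(\<Sum>i\<in>I. (D * F i - (\<Sum>r\<in>R. (\<Sum>i\<in>I. F i * m r i) * b r i)) * m s i)
      = D * (\<Sum>i\<in>I. F i * m s i) - (\<Sum>i\<in>I. (\<Sum>r\<in>R. (\<Sum>i\<in>I. F i * m r i) * b r i) * m s i)"
    unfolding left_diff_distrib sum_subtractf by (simp add: sum_distrib_left mult_ac)
  then show ?thesis using e by simp
qed

text \<open>Deforms a solution of linear equations with polynomial coefficients: subtracting from
  \<open>D p * F\<close> its components along the rows gives a solution at every p, and a multiple
  of F at p0 if F solves the system there.\<close>

lemma poly_section: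
  fixes m :: "'r \<Rightarrow> ('p \<Rightarrow> complex) \<Rightarrow> 'i \<Rightarrow> complex"
  assumes "finite R" "finite I" "\<And>r i. r \<in> R \<Longrightarrow> i \<in> I \<Longrightarrow> (\<lambda>p. m r p i) \<in> poly_fun J"
    and "lin_indep R I (\<lambda>r. m r p0)"
  shows "\<exists>D S. D \<in> poly_fun J \<and> D p0 \<noteq> 0 \<and> (\<forall>F. \<forall>i. (\<lambda>p. S F p i) \<in> poly_fun J) \<and>
    (\<forall>F p. \<forall>r\<in>R. (\<Sum>i\<in>I. S F p i * m r p i) = 0) \<and>
    (\<forall>F. (\<forall>r\<in>R. (\<Sum>i\<in>I. F i * m r p0 i) = 0) \<longrightarrow> (\<forall>i. S F p0 i = D p0 * F i))"
proof -
  obtain b D where D: "D \<in> poly_fun J" "D p0 \<noteq> 0"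
    and b: "\<And>r i. r \<in> R \<Longrightarrow> (\<lambda>p. b r p i) \<in> poly_fun J"
    and bm: "\<And>p r s. r \<in> R \<Longrightarrow> s \<in> R \<Longrightarrow> (\<Sum>i\<in>I. b r p i * m s p i) = (if r = s then D p else 0)"
    using poly_dual_basis[of R I m J p0, OF assms] by blast
  define S where "S = (\<lambda>F p i. D p * F i - (\<Sum>r\<in>R. (\<Sum>i\<in>I. F i * m r p i) * b r p i))"
  have 1: "(\<lambda>p. S F p i) \<in> poly_fun J" for F i
    unfolding S_def by (intro pf_diff pf_sum pf_mult pf_const D b assms(3))
  have 2: "(\<Sum>i\<in>I. S F p i * m s p i) = 0" if s: "s \<in> R" for F p s
    unfolding S_def by (rule section_orthogonal[OF assms(1) s]) (use bm s in auto)
  have 3: "S F p0 i = D p0 * F i" if "\<forall>r\<in>R. (\<Sum>i\<in>I. F i * m r p0 i) = 0" for F i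
    using that by (simp add: S_def)
  from 1 2 3 D show ?thesis by (intro exI[of _ D] exI[of _ S]) auto
qed

text \<open>If the vectors F a were independent, a family f dual to them together with the rows of m
  would exceed the dimension. Pairing the resulting dependence with F b removes the coefficient of f
  b, which leaves a dependence between the rows of m.\<close>

lemma annihilator_dim:
  assumes "finite R" "finite I" "finite A" "lin_indep R I m" "card I < card R + card A"
    and "\<And>a r. a \<in> A \<Longrightarrow> r \<in> R \<Longrightarrow> (\<Sum>i\<in>I. F a i * m r i) = 0"
  shows "\<exists>q. (\<exists>a\<in>A. q a \<noteq> 0) \<and> (\<forall>i\<in>I. (\<Sum>a\<in>A. q a * F a i) = 0)"
proof (rule ccontr)
  assume "\<not> ?thesis"
  then have "lin_indep A I F" unfolding lin_indep_def by blast
  then obtain f where f: "\<And>a b. a \<in> A \<Longrightarrow> b \<in> A \<Longrightarrow> (\<Sum>i\<in>I. f a i * F b i) = (if a = b then 1 else 0)"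
    using dual_basis[of A I F] assms by blast
  define M where "M = case_sum m f"
  have card: "card I < card (R <+> A)" using assms by (simp add: card_Plus)
  obtain q where q: "\<exists>x\<in>R <+> A. q x \<noteq> 0" "\<And>i. i \<in> I \<Longrightarrow> (\<Sum>x\<in>R <+> A. q x * M x i) = 0"
    using homogeneous_system[of I "R <+> A" M] assms card by auto
  have q': "(\<Sum>r\<in>R. q (Inl r) * m r i) + (\<Sum>a\<in>A. q (Inr a) * f a i) = 0" if "i \<in> I" for i
    using q(2)[OF that] assms by (simp add: sum.Plus M_def)
  have inr: "q (Inr b) = 0" if b: "b \<in> A" for b
  proof -
    have "0 = (\<Sum>i\<in>I. F b i * ((\<Sum>r\<in>R. q (Inl r) * m r i) + (\<Sum>a\<in>A. q (Inr a) * f a i)))"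
      using q' by simp
    also have "\<dots> = (\<Sum>r\<in>R. q (Inl r) * (\<Sum>i\<in>I. F b i * m r i)) + (\<Sum>a\<in>A. q (Inr a) * (\<Sum>i\<in>I. f a i * F b i))"
      unfolding distrib_left sum.distrib sum_distrib_left
      by (subst (1 2) sum.swap) (simp add: mult_ac)
    also have "\<dots> = (\<Sum>a\<in>A. q (Inr a) * (if a = b then 1 else 0))"
      using assms(6) b f by simp
    also have "\<dots> = q (Inr b)" using b assms by (simp add: if_distrib[of "\<lambda>c. _ * c"] cong: if_cong)
    finally show ?thesis by simp
  qed
  have "q (Inl r) = 0" if "r \<in> R" for r
    using q' inr that by (intro lin_indepD[OF assms(4), of "\<lambda>r. q (Inl r)"]) auto
  then show False using q(1) inr by auto
qed

lemma orthogonal_to_basis: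
  fixes Y :: "'i \<Rightarrow> complex"
  assumes "lin_indep R I m" "finite R" "finite I" "card R = card I"
    and "\<And>r. r \<in> R \<Longrightarrow> (\<Sum>i\<in>I. Y i * m r i) = 0" "i \<in> I"
  shows "Y i = 0"
proof -
  have "\<exists>q. (\<exists>a\<in>{()}. q a \<noteq> 0) \<and> (\<forall>i\<in>I. (\<Sum>a\<in>{()}. q a * Y i) = 0)"
    by (rule annihilator_dim[OF assms(2,3) _ assms(1)]) (use assms(4,5) in auto)
  then show ?thesis using assms(6) by auto
qed

text \<open>Reduces the independence of many rows to uniqueness of a solution: if row r0 depended on
  the others, the other rows and the coordinates \<open>e b\<close> would impose fewer than
  \<open>card I\<close> conditions, and a common solution would annihilate row r0 as well.\<close>

lemma lin_indep_of_annihilator: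
  assumes "finite R" "finite I" "finite B" "card I = card R + card B" "inj_on e B" "e ` B \<subseteq> I"
    and "\<And>F. (\<And>r. r \<in> R \<Longrightarrow> (\<Sum>i\<in>I. F i * m r i) = 0) \<Longrightarrow> (\<And>b. b \<in> B \<Longrightarrow> F (e b) = 0) \<Longrightarrow> (\<And>i. i \<in> I \<Longrightarrow> F i = 0)"
  shows "lin_indep R I m"
  unfolding lin_indep_def
proof (intro allI impI ballI)
  fix q r0 assume q: "\<forall>i\<in>I. (\<Sum>r\<in>R. q r * m r i) = 0" and r0: "r0 \<in> R"
  show "q r0 = 0"
  proof (rule ccontr)
    assume nz: "q r0 \<noteq> 0"
    define M where "M = (\<lambda>i. case_sum (\<lambda>r. m r i) (\<lambda>b. if i = e b then 1 else (0::complex)))"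
    have "card ((R - {r0}) <+> B) < card I"
      using assms r0 card_gt_0_iff[of R] by (auto simp: card_Plus card_Diff_singleton)
    moreover have "finite ((R - {r0}) <+> B)" using assms(1,3) by simp
    ultimately obtain F where F: "\<exists>i\<in>I. F i \<noteq> 0" "\<And>x. x \<in> (R - {r0}) <+> B \<Longrightarrow> (\<Sum>i\<in>I. F i * M i x) = 0"
      using homogeneous_system[of "(R - {r0}) <+> B" I M] assms(2) by blast
    have m: "(\<Sum>i\<in>I. F i * m r i) = 0" if "r \<in> R" "r \<noteq> r0" for r
      using F(2)[OF InlI[of r]] that by (simp add: M_def)
    have b: "F (e b) = 0" if "b \<in> B" for b
      using F(2)[OF InrI[of b]] that assms(2,6)
      by (auto simp: M_def if_distrib[of "\<lambda>c. _ * c"] cong: if_cong)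
    have "0 = (\<Sum>i\<in>I. F i * (\<Sum>r\<in>R. q r * m r i))" using q by simp
    also have "\<dots> = (\<Sum>r\<in>R. q r * (\<Sum>i\<in>I. F i * m r i))"
      unfolding sum_distrib_left by (subst sum.swap) (simp add: mult_ac)
    also have "\<dots> = q r0 * (\<Sum>i\<in>I. F i * m r0 i)"
      using m r0 assms(1) by (subst sum.remove[of _ r0]) auto
    finally have "(\<Sum>i\<in>I. F i * m r0 i) = 0" using nz by simp
    then have "\<And>r. r \<in> R \<Longrightarrow> (\<Sum>i\<in>I. F i * m r i) = 0" using m by blast
    then have "\<And>i. i \<in> I \<Longrightarrow> F i = 0" using assms(7) b by presburger
    then show False using F(1) by auto
  qed
qed

text \<open>A maximal linearly independent subset of a subspace G spans it; a vector outside is then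
  detected by a coordinate of its residual modulo that span.\<close>

lemma double_annihilator:
  fixes G :: "('i \<Rightarrow> complex) set"
  assumes "finite I" "\<And>a b g h. g \<in> G \<Longrightarrow> h \<in> G \<Longrightarrow> (\<lambda>i. a * g i + b * h i) \<in> G" "G \<noteq> {}"
    and "\<And>v. (\<And>g. g \<in> G \<Longrightarrow> (\<Sum>i\<in>I. g i * v i) = 0) \<Longrightarrow> (\<Sum>i\<in>I. F i * v i) = 0"
  shows "\<exists>g\<in>G. \<forall>i\<in>I. F i = g i"
proof -
  define N where "N = {n. \<exists>m :: nat \<Rightarrow> 'i \<Rightarrow> complex. (\<forall>r<n. m r \<in> G) \<and> lin_indep {..<n} I m}"
  have bd: "n \<in> N \<Longrightarrow> n \<le> card I" for n
    using lin_indep_card[of "{..<n}" I] assms(1) by (auto simp: N_def)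
  have "0 \<in> N" by (auto simp: N_def lin_indep_def)
  then have "\<exists>n. n \<in> N \<and> (\<forall>k. k \<in> N \<longrightarrow> k \<le> n)"
    using bd by (intro Nat.ex_has_greatest_nat) auto
  then obtain n where n: "n \<in> N" and nmax: "\<forall>k. k \<in> N \<longrightarrow> k \<le> n" by blast
  have max: "Suc n \<notin> N" using nmax by auto
  from n obtain m where "\<forall>r<n. m r \<in> G" and m2: "lin_indep {..<n} I m" unfolding N_def by blast
  then have m: "\<And>r. r < n \<Longrightarrow> m r \<in> G" "lin_indep {..<n} I m" by auto
  obtain b where b: "\<And>r s. r < n \<Longrightarrow> s < n \<Longrightarrow> (\<Sum>i\<in>I. b r i * m s i) = (if r = s then 1 else 0)"
    using dual_basis[of "{..<n}" I m] assms(1) m(2) by auto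
  have sum_in: "(\<lambda>i. \<Sum>r<k. c r * m r i) \<in> G" if "k \<le> n" for k c
    using that
  proof (induction k)
    case 0
    obtain g where "g \<in> G" using assms(3) by blast
    then show ?case using assms(2)[of g g 0 0] by simp
  next
    case (Suc k)
    then show ?case using assms(2)[of "\<lambda>i. \<Sum>r<k. c r * m r i" "m k" 1 "c k"] m by simp
  qed
  have span: "\<forall>i\<in>I. g i = (\<Sum>r<n. (\<Sum>i\<in>I. b r i * g i) * m r i)" if g: "g \<in> G" for g
  proof (rule ccontr)
    assume neg: "\<not> ?thesis"
    have "lin_indep {..<Suc n} I (m(n := g))"
      unfolding lin_indep_def
    proof (intro allI impI)
      fix q assume q: "\<forall>i\<in>I. (\<Sum>r<Suc n. q r * (m(n := g)) r i) = 0"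
      have q1: "(\<Sum>r<n. q r * m r i) + q n * g i = 0" if "i \<in> I" for i
        using q that by simp
      have qn: "q n = 0"
      proof (rule ccontr)
        assume nz: "q n \<noteq> 0"
        have gi: "g i = (\<Sum>r<n. (- q r / q n) * m r i)" if "i \<in> I" for i
        proof -
          have "g i * q n = - (\<Sum>r<n. q r * m r i)" using q1[OF that]
              by (simp add: eq_neg_iff_add_eq_0 add.commute mult.commute)
          then have "g i = - (\<Sum>r<n. q r * m r i) / q n" using nz nonzero_eq_divide_eq by blast
          then show ?thesis by (simp add: sum_divide_distrib sum_negf)
        qed
        have "(\<Sum>i\<in>I. b s i * g i) = - q s / q n" if "s < n" for s
        proof -
          have "(\<Sum>i\<in>I. b s i * g i) = (\<Sum>i\<in>I. b s i * (\<Sum>r<n. (- q r / q n) * m r i))"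
            using gi by (intro sum.cong) auto
          also have "\<dots> = (\<Sum>r<n. (- q r / q n) * (\<Sum>i\<in>I. b s i * m r i))"
            unfolding sum_distrib_left by (subst sum.swap) (simp add: mult_ac)
          also have "\<dots> = (\<Sum>r<n. (- q r / q n) * (if s = r then 1 else 0))"
            using b that by (intro sum.cong) auto
          also have "\<dots> = - q s / q n" using that by (simp add: if_distrib[of "\<lambda>c. _ * c"] cong: if_cong)
          finally show ?thesis .
        qed
        then have "\<forall>i\<in>I. g i = (\<Sum>r<n. (\<Sum>i\<in>I. b r i * g i) * m r i)" using gi by simp
        then show False using neg by blast
      qed
      have "q r = 0" if "r < n" for r
        using lin_indepD[OF m(2), of q r] q1 qn that by simp
      then show "\<forall>r\<in>{..<Suc n}. q r = 0" using qn by (auto simp: less_Suc_eq)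
    qed
    then have "Suc n \<in> N" using m g unfolding N_def by (intro CollectI exI[of _ "m(n := g)"]) (auto simp: less_Suc_eq)
    then show False using max by blast
  qed
  define g0 where "g0 = (\<lambda>i. \<Sum>r<n. (\<Sum>i\<in>I. b r i * F i) * m r i)"
  have "F c = g0 c" if c: "c \<in> I" for c
  proof -
    define v where "v = (\<lambda>i. (if i = c then 1 else 0) - (\<Sum>r<n. m r c * b r i))"
    have ip: "(\<Sum>i\<in>I. g i * v i) = g c - (\<Sum>r<n. (\<Sum>i\<in>I. b r i * g i) * m r c)" for g
    proof -
      have "(\<Sum>i\<in>I. g i * (if i = c then 1 else 0)) = g c"
        using assms(1) c by (simp add: if_distrib[of "\<lambda>c. _ * c"] cong: if_cong)
      moreover have "(\<Sum>i\<in>I. g i * (\<Sum>r<n. m r c * b r i)) = (\<Sum>r<n. (\<Sum>i\<in>I. b r i * g i) * m r c)"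
        unfolding sum_distrib_left sum_distrib_right by (subst sum.swap) (simp add: mult_ac)
      ultimately show ?thesis by (simp add: v_def right_diff_distrib sum_subtractf)
    qed
    have "(\<Sum>i\<in>I. F i * v i) = 0"
      using span c by (intro assms(4)) (simp add: ip)
    then show ?thesis by (simp add: ip g0_def)
  qed
  moreover have "g0 \<in> G" unfolding g0_def by (rule sum_in) simp
  ultimately show ?thesis by blast
qed

section \<open>Algebraic dependence\<close>

text \<open>The coordinates are released from the grid one at a time: in each new direction the
  restriction has degree at most E and E + 1 roots.\<close>

lemma pdeg_grid_zero:
  fixes f :: "('j \<Rightarrow> complex) \<Rightarrow> complex"
  assumes "finite J" "pdeg J E f" "\<And>x. (\<forall>j\<in>J. \<exists>k\<le>E. x j = of_nat k) \<Longrightarrow> f x = 0"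
  shows "f x = 0"
proof -
  have "\<forall>x. (\<forall>j\<in>J - S. \<exists>k\<le>E. x j = of_nat k) \<longrightarrow> f x = 0" if "finite S" for S
    using that
  proof (induction S rule: finite_induct)
    case empty
    then show ?case using assms(3) by simp
  next
    case (insert s S)
    show ?case
    proof (intro allI impI)
      fix x :: "'j \<Rightarrow> complex" assume x: "\<forall>j\<in>J - insert s S. \<exists>k\<le>E. x j = of_nat k"
      obtain p where p: "degree p \<le> E" "\<And>t. f (\<lambda>i. x i + t * ax s i) = poly p t"
        using pdeg_line[OF assms(2), of x "ax s"] by blast
      have root: "poly p (of_nat k - x s) = 0" if "k \<le> E" for k
      proof -
        have "f (\<lambda>i. x i + (of_nat k - x s) * ax s i) = 0"
          using x that by (intro insert.IH[rule_format]) (auto simp: ax_def)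
        then show ?thesis using p by simp
      qed
      have "p = 0"
      proof (rule ccontr)
        assume p0: "p \<noteq> 0"
        have "inj_on (\<lambda>k. of_nat k - x s) {..E}" by (auto simp: inj_on_def)
        then have "card ((\<lambda>k. of_nat k - x s) ` {..E}) = Suc E" by (simp add: card_image)
        moreover have "card ((\<lambda>k. of_nat k - x s) ` {..E}) \<le> card {z. poly p z = 0}"
          using root by (intro card_mono poly_roots_finite p0) auto
        ultimately show False using card_poly_roots_bound[OF p0] p(1) by linarith
      qed
      then show "f x = 0" using p(2)[of 0] by simp
    qed
  qed
  from this[OF assms(1)] show ?thesis by simp
qed

text \<open>The Lagrange products at the grid points of [0,D]^K form a space of dimension (D+1)^(card K);
  composing with g gives polynomials in J variables of degree O(D), which are determined by
  O(D^(card J)) values.\<close>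

lemma algebraic_dependence:
  fixes g :: "'k \<Rightarrow> ('j \<Rightarrow> complex) \<Rightarrow> complex"
  assumes J: "finite J" and K: "finite K" and lt: "card J < card K"
    and g: "\<And>k. k \<in> K \<Longrightarrow> g k \<in> poly_fun J"
  shows "\<exists>Q\<in>poly_fun K. (\<exists>y. Q y \<noteq> 0) \<and> (\<forall>p. Q (\<lambda>k. g k p) = 0)"
proof -
  have "\<forall>k\<in>K. \<exists>e. pdeg J e (g k)" using pf_imp_pdeg g by blast
  then obtain e where e: "\<And>k. k \<in> K \<Longrightarrow> pdeg J (e k) (g k)" by metis
  define d where "d = Suc (\<Sum>k\<in>K. e k)"
  have gd: "pdeg J d (g k)" if "k \<in> K" for k
    using K that member_le_sum[of k K e] by (intro pdeg_mono[OF e[OF that]]) (auto simp: d_def)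
  define n where "n = card K * d"
  \<comment> \<open>With this D the constant \<open>n ^ card J\<close> in the bound for
    \<open>Suc E ^ card J\<close> is smaller than one further factor \<open>Suc D\<close>, which is
    available because J has fewer elements than K.\<close>
  define D where "D = n ^ card J"
  define E where "E = card K * D * d"
  have n: "n \<ge> 1" using lt by (auto simp: n_def d_def)
  have "Suc E ^ card J \<le> (n * Suc D) ^ card J"
    using n by (intro power_mono) (auto simp: E_def n_def)
  also have "\<dots> = D * Suc D ^ card J" by (simp only: power_mult_distrib D_def)
  also have "\<dots> < Suc D ^ Suc (card J)" by simp
  also have "\<dots> \<le> Suc D ^ card K" using lt by (intro power_increasing) auto
  finally have cardlt: "Suc E ^ card J < Suc D ^ card K" .
  define A where "A = PiE K (\<lambda>_. {..D})"
  define B where "B = PiE J (\<lambda>_. {..E})"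
  have fin: "finite A" "finite B" using J K by (auto simp: A_def B_def intro: finite_PiE)
  have "card B < card A" using cardlt J K by (simp add: A_def B_def card_PiE)
  define L where "L = (\<lambda>a y. \<Prod>k\<in>K. \<Prod>m\<in>{..D} - {a k}. y k - complex_of_nat m)"
  obtain q where q: "\<exists>a\<in>A. q a \<noteq> 0"
    "\<And>b. b \<in> B \<Longrightarrow> (\<Sum>a\<in>A. q a * L a (\<lambda>k. g k (\<lambda>j. of_nat (b j)))) = 0"
    using homogeneous_system[OF fin(2,1) \<open>card B < card A\<close>, of "\<lambda>a b. L a (\<lambda>k. g k (\<lambda>j. of_nat (b j)))"]
    by blast
  define Q where "Q = (\<lambda>y. \<Sum>a\<in>A. q a * L a y)"
  have lin: "pdeg K 1 (\<lambda>y. y k - complex_of_nat m)" if "k \<in> K" for k m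
    using pd_add[OF pd_coord[OF that, of 0] pd_const[of K "Suc 0" "- complex_of_nat m"]] by simp
  have Ldeg: "pdeg K (card K * D) (L a)" if "a \<in> A" for a
    unfolding L_def
  proof (rule pdeg_prod[OF K])
    fix k assume k: "k \<in> K"
    have "a k \<in> {..D}" using that k unfolding A_def by (rule PiE_mem)
    then have "card ({..D} - {a k}) = D" by (simp add: card_Diff_singleton)
    then show "pdeg K D (\<lambda>y. \<Prod>m\<in>{..D} - {a k}. y k - complex_of_nat m)"
      using pdeg_prod[of "{..D} - {a k}" K 1 "\<lambda>m y. y k - complex_of_nat m"] lin[OF k] by simp
  qed
  have Qdeg: "pdeg K (card K * D) Q" unfolding Q_def by (intro pdeg_sum pdeg_cmult Ldeg)
  have "Q (\<lambda>k. g k p) = 0" for p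
  proof (rule pdeg_grid_zero[OF J, where f = "\<lambda>p. Q (\<lambda>k. g k p)"])
    show "pdeg J E (\<lambda>p. Q (\<lambda>k. g k p))" unfolding E_def by (rule pdeg_comp[OF Qdeg gd])
    fix x assume "\<forall>j\<in>J. \<exists>k\<le>E. x j = complex_of_nat k"
    then obtain b where b: "\<And>j. j \<in> J \<Longrightarrow> b j \<le> E \<and> x j = of_nat (b j)" by metis
    have "restrict b J \<in> B" using b by (auto simp: B_def)
    moreover have "g k x = g k (\<lambda>j. of_nat (restrict b J j))" if "k \<in> K" for k
      using b by (intro pf_cong[OF g[OF that]]) auto
    then have "L a (\<lambda>k. g k x) = L a (\<lambda>k. g k (\<lambda>j. of_nat (restrict b J j)))" for a
      unfolding L_def by (intro prod.cong) auto
    ultimately show "Q (\<lambda>k. g k x) = 0" using q(2)[of "restrict b J"] by (simp only: Q_def)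
  qed
  moreover have "\<exists>y. Q y \<noteq> 0"
  proof -
    obtain a where a: "a \<in> A" "q a \<noteq> 0" using q(1) by blast
    have "L a' (\<lambda>k. of_nat (a k)) = 0" if a': "a' \<in> A" "a' \<noteq> a" for a'
    proof -
      obtain k where k: "k \<in> K" "a' k \<noteq> a k" using PiE_ext[of a' K "\<lambda>_. {..D}" a] a a' unfolding A_def by blast
      have "a k \<in> {..D} - {a' k}" using a k by (auto simp: A_def)
      then have "(\<Prod>m\<in>{..D} - {a' k}. complex_of_nat (a k) - of_nat m) = 0" by (intro prod_zero) auto
      then show ?thesis unfolding L_def using K k by (intro prod_zero) auto
    qed
    then have "Q (\<lambda>k. of_nat (a k)) = q a * L a (\<lambda>k. of_nat (a k))"
      unfolding Q_def using fin a by (subst sum.remove[OF _ a(1)]) auto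
    moreover have "L a (\<lambda>k. of_nat (a k)) \<noteq> 0" unfolding L_def using K by auto
    ultimately show ?thesis using a by (intro exI[of _ "\<lambda>k. of_nat (a k)"]) simp
  qed
  ultimately show ?thesis using pdeg_imp_pf[OF Qdeg] by blast
qed

text \<open>Induction on the degree of Q: differentiating the relation and using independent
  differentials shows that the partial derivatives of Q vanish on g where h is non-zero, hence
  everywhere. By induction they are zero, so Q is constant and equal to its value 0 on the
  image.\<close>

lemma jacobian_criterion:
  assumes K: "finite K" and J: "finite J" and g: "\<And>k. k \<in> K \<Longrightarrow> g k \<in> poly_fun J"
    and ind: "lin_indep K J (\<lambda>k j. pd (g k) j p0)"
    and Q: "Q \<in> poly_fun K" "\<And>p. Q (\<lambda>k. g k p) = 0"
  shows "Q y = 0"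
proof -
  obtain h where h: "h \<in> poly_fun J" "h p0 \<noteq> 0"
    and hind: "\<And>p. h p \<noteq> 0 \<Longrightarrow> lin_indep K J (\<lambda>k j. pd (g k) j p)"
    using lin_indep_open[where m = "\<lambda>k p j. pd (g k) j p" and ?p0.0 = p0, OF K J pf_pd[OF g] ind] by blast
  have "\<forall>Q. pdeg K D Q \<longrightarrow> (\<forall>p. Q (\<lambda>k. g k p) = 0) \<longrightarrow> (\<forall>y. Q y = 0)" for D
  proof (induction D rule: less_induct)
    case (less D)
    show ?case
    proof (intro allI impI)
      fix Q y assume Q: "pdeg K D Q" "\<forall>p. Q (\<lambda>k. g k p) = 0"
      have Qpf: "Q \<in> poly_fun K" by (rule pdeg_imp_pf[OF Q(1)])
      have "pd Q k (\<lambda>k. g k p) = 0" if k: "k \<in> K" and hp: "h p \<noteq> 0" for k p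
      proof (rule lin_indepD[OF hind[OF hp] _ k])
        fix j
        have "dd (\<lambda>p. Q (\<lambda>k. g k p)) p (ax j) = (\<Sum>k\<in>K. pd Q k (\<lambda>k. g k p) * dd (g k) p (ax j))"
          using dd_comp[of Q K "\<lambda>p k. g k p" J p "ax j", OF Qpf K g] by simp
        moreover have "dd (\<lambda>p. Q (\<lambda>k. g k p)) p (ax j) = 0" using Q(2) by simp
        ultimately show "(\<Sum>k\<in>K. pd Q k (\<lambda>k. g k p) * pd (g k) j p) = 0" by (simp add: pd_def)
      qed
      then have pd0: "pd Q k (\<lambda>k. g k p) = 0" if "k \<in> K" for k p
        using pf_dense[of "\<lambda>p. pd Q k (\<lambda>k. g k p)" J h p0 p,
          OF pf_comp[of "pd Q k" K "\<lambda>p k. g k p" J, OF pf_pd[OF Qpf] g] h] that by simp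
      have "pd Q k y = 0" if k: "k \<in> K" for k y
      proof (cases "D = 0")
        case True
        then show ?thesis using pdeg_pd_aux[OF Q(1)] by simp
      next
        case False
        then have "D - 1 < D" by simp
        from less.IH[OF this] pdeg_pd[OF Q(1)] pd0[OF k] show ?thesis by simp
      qed
      then have "Q y = Q (\<lambda>k. g k p0)" by (rule pf_const_pd0[OF Qpf K])
      then show "Q y = 0" using Q(2) by simp
    qed
  qed
  moreover obtain D where "pdeg K D Q" using pf_imp_pdeg[OF Q(1)] by blast
  ultimately show ?thesis using Q(2) by simp
qed

section \<open>Zariski closed sets and dimension\<close>

lemma zclosed_zclosure: "zclosed I (zclosure I S)"
  unfolding zclosed_def zclosure_def vanishing_def by (rule exI[of _ "{f \<in> poly_fun I. \<forall>x\<in>S. f x = 0}"]) simp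

lemma subset_zclosure: "S \<subseteq> aff I \<Longrightarrow> S \<subseteq> zclosure I S"
  unfolding zclosure_def zero_set_def vanishing_def by auto

lemma zclosure_subset_aff: "zclosure I S \<subseteq> aff I"
  unfolding zclosure_def zero_set_def by auto

lemma zclosure_vanish: "f \<in> poly_fun I \<Longrightarrow> (\<And>x. x \<in> S \<Longrightarrow> f x = 0) \<Longrightarrow> x \<in> zclosure I S \<Longrightarrow> f x = 0"
  unfolding zclosure_def zero_set_def vanishing_def by auto

lemma zclosureI: "x \<in> aff I \<Longrightarrow> (\<And>f. f \<in> poly_fun I \<Longrightarrow> (\<And>y. y \<in> S \<Longrightarrow> f y = 0) \<Longrightarrow> f x = 0) \<Longrightarrow> x \<in> zclosure I S"
  unfolding zclosure_def zero_set_def vanishing_def by auto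

lemma zclosed_subset_aff: "zclosed I Z \<Longrightarrow> Z \<subseteq> aff I"
  unfolding zclosed_def zero_set_def by auto

lemma zclosed_sep:
  assumes "zclosed I Z" "x \<in> aff I" "x \<notin> Z"
  shows "\<exists>f\<in>poly_fun I. f x \<noteq> 0 \<and> (\<forall>z\<in>Z. f z = 0)"
  using assms unfolding zclosed_def zero_set_def by auto

lemma zclosure_minimal:
  assumes "zclosed I Z" "S \<subseteq> Z"
  shows "zclosure I S \<subseteq> Z"
proof
  fix x assume x: "x \<in> zclosure I S"
  show "x \<in> Z"
  proof (rule ccontr)
    assume "x \<notin> Z"
    then obtain f where "f \<in> poly_fun I" "f x \<noteq> 0" "\<forall>z\<in>Z. f z = 0"
      using zclosed_sep[OF assms(1)] x zclosure_subset_aff by blast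
    then show False using zclosure_vanish[of f I S x] x assms(2) by blast
  qed
qed

lemma zclosure_mono: "S \<subseteq> T \<Longrightarrow> zclosure I S \<subseteq> zclosure I T"
  unfolding zclosure_def zero_set_def vanishing_def by auto

lemma zclosed_Int_hypersurface:
  assumes "zclosed I Z" "f \<in> poly_fun I"
  shows "zclosed I {x\<in>Z. f x = 0}"
proof -
  obtain F where "F \<subseteq> poly_fun I" "Z = zero_set I F" using assms(1) unfolding zclosed_def by blast
  then show ?thesis unfolding zclosed_def
    using assms(2) by (intro exI[of _ "insert f F"]) (auto simp: zero_set_def)
qed

lemma zirred_prime:
  assumes "zirred I C" "f \<in> poly_fun I" "g \<in> poly_fun I" "\<And>x. x \<in> C \<Longrightarrow> f x * g x = 0"
  shows "(\<forall>x\<in>C. f x = 0) \<or> (\<forall>x\<in>C. g x = 0)"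
proof -
  have C: "zclosed I C" using assms(1) unfolding zirred_def by blast
  have "C = {x\<in>C. f x = 0} \<union> {x\<in>C. g x = 0}" using assms(4) by auto
  moreover have "zclosed I {x\<in>C. f x = 0}" "zclosed I {x\<in>C. g x = 0}"
    using zclosed_Int_hypersurface[OF C] assms by auto
  ultimately have "{x\<in>C. f x = 0} = C \<or> {x\<in>C. g x = 0} = C"
    using assms(1) unfolding zirred_def by blast
  then show ?thesis by blast
qed

text \<open>Functions pulled back along \<phi> lie in an integral domain, so functions separating
  two proper closed pieces cannot have a vanishing product on the image.\<close>

lemma zirred_zclosure_range:
  assumes "\<And>i. i \<in> I \<Longrightarrow> (\<lambda>p. \<phi> p i) \<in> poly_fun J" "range \<phi> \<subseteq> aff I"
  shows "zirred I (zclosure I (range \<phi>))"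
  unfolding zirred_def
proof (intro conjI allI impI)
  show "zclosed I (zclosure I (range \<phi>))" by (rule zclosed_zclosure)
  show "zclosure I (range \<phi>) \<noteq> {}" using subset_zclosure[OF assms(2)] by auto
  fix Z1 Z2 assume Z: "zclosed I Z1 \<and> zclosed I Z2 \<and> zclosure I (range \<phi>) = Z1 \<union> Z2"
  show "Z1 = zclosure I (range \<phi>) \<or> Z2 = zclosure I (range \<phi>)"
  proof (rule ccontr)
    assume neg: "\<not> ?thesis"
    then obtain x1 x2 where x: "x1 \<in> zclosure I (range \<phi>)" "x1 \<notin> Z1" "x2 \<in> zclosure I (range \<phi>)" "x2 \<notin> Z2"
      using Z by blast
    obtain f1 where f1: "f1 \<in> poly_fun I" "f1 x1 \<noteq> 0" "\<forall>z\<in>Z1. f1 z = 0"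
      using zclosed_sep[of I Z1 x1] Z x zclosure_subset_aff by blast
    obtain f2 where f2: "f2 \<in> poly_fun I" "f2 x2 \<noteq> 0" "\<forall>z\<in>Z2. f2 z = 0"
      using zclosed_sep[of I Z2 x2] Z x zclosure_subset_aff by blast
    have "f1 (\<phi> p) * f2 (\<phi> p) = 0" for p
      using Z subset_zclosure[OF assms(2)] f1(3) f2(3) by (metis UnE mult_eq_0_iff rangeI subsetD)
    then have "(\<forall>p. f1 (\<phi> p) = 0) \<or> (\<forall>p. f2 (\<phi> p) = 0)"
      by (intro pf_mult_eq_zero[of _ J] pf_comp[OF f1(1)] pf_comp[OF f2(1)] assms(1))
    then show False
      using zclosure_vanish[of f1 I "range \<phi>" x1] zclosure_vanish[of f2 I "range \<phi>" x2] f1 f2 x by blast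
  qed
qed

text \<open>Each link of a strict chain contributes a new independent function. Setting the last
  variable of a relation to 0 gives a relation on C n, trivial by induction; so the last variable
  divides the relation, and since f n does not vanish on the irreducible C (Suc n) it can be
  cancelled.\<close>

lemma chain_independence:
  fixes C :: "nat \<Rightarrow> ('i \<Rightarrow> complex) set"
  assumes irr: "\<And>j. j \<le> k \<Longrightarrow> zirred I (C j)"
    and sub: "\<And>j. j < k \<Longrightarrow> C j \<subset> C (Suc j)"
    and f: "\<And>j. j < k \<Longrightarrow> f j \<in> poly_fun I"
    and f0: "\<And>j x. j < k \<Longrightarrow> x \<in> C j \<Longrightarrow> f j x = 0"
    and f1: "\<And>j. j < k \<Longrightarrow> \<exists>x\<in>C (Suc j). f j x \<noteq> 0"
  shows "n \<le> k \<Longrightarrow> Q \<in> poly_fun {..<n} \<Longrightarrow> (\<And>x. x \<in> C n \<Longrightarrow> Q (\<lambda>i. f i x) = 0) \<Longrightarrow> Q y = 0"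
proof (induction n arbitrary: Q y)
  case 0
  then obtain x where "x \<in> C 0" using irr[of 0] unfolding zirred_def by blast
  moreover have "Q y = Q (\<lambda>i. f i x)" by (rule pf_cong[OF 0(2)]) auto
  ultimately show ?case using 0 by simp
next
  case (Suc n)
  have nk: "n < k" using Suc.prems by simp
  have "\<forall>Q. pdeg {..<Suc n} D Q \<longrightarrow> (\<forall>x\<in>C (Suc n). Q (\<lambda>i. f i x) = 0) \<longrightarrow> (\<forall>y. Q y = 0)" for D
  proof (induction D rule: less_induct)
    case (less D)
    show ?case
    proof (intro allI impI)
      fix Q y assume Q: "pdeg {..<Suc n} D Q" "\<forall>x\<in>C (Suc n). Q (\<lambda>i. f i x) = 0"
      have Qpf: "Q \<in> poly_fun {..<Suc n}" by (rule pdeg_imp_pf[OF Q(1)])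
      have "(\<lambda>y. Q (y(n := 0))) \<in> poly_fun {..<n}"
        by (rule pf_comp[OF Qpf]) (auto simp: less_Suc_eq intro: poly_fun.intros)
      moreover have "Q ((\<lambda>i. f i x)(n := 0)) = 0" if x: "x \<in> C n" for x
      proof -
        have "x \<in> C (Suc n)" using x sub[OF nk] by blast
        moreover have "(\<lambda>i. f i x)(n := 0) = (\<lambda>i. f i x)" using f0[OF nk x] by auto
        ultimately show ?thesis using Q(2) by simp
      qed
      ultimately have Q0: "Q (y(n := 0)) = 0" for y using nk by (intro Suc.IH[of "\<lambda>y. Q (y(n := 0))" y]) simp_all
      obtain q where q: "pdeg {..<Suc n} (D - 1) q" "D = 0 \<longrightarrow> q = (\<lambda>x. 0)"
        "\<And>y. Q y = Q (y(n := 0)) + y n * q y" using pdeg_divide_coord[OF Q(1), of n] by blast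
      have Qq: "Q y = y n * q y" for y by (rule trans[OF q(3)]) (simp add: Q0)
      show "Q y = 0"
      proof (cases "D = 0")
        case True
        then show ?thesis using q(2) Qq by simp
      next
        case False
        have "(\<forall>x\<in>C (Suc n). f n x = 0) \<or> (\<forall>x\<in>C (Suc n). q (\<lambda>i. f i x) = 0)"
        proof (rule zirred_prime[OF irr])
          show "Suc n \<le> k" using nk by simp
          show "f n \<in> poly_fun I" by (rule f[OF nk])
          show "(\<lambda>x. q (\<lambda>i. f i x)) \<in> poly_fun I"
            using nk f by (intro pf_comp[OF pdeg_imp_pf[OF q(1)]]) auto
          show "f n x * q (\<lambda>i. f i x) = 0" if "x \<in> C (Suc n)" for x
            using Q(2) that Qq by simp
        qed
        then have "\<forall>x\<in>C (Suc n). q (\<lambda>i. f i x) = 0" using f1[OF nk] by blast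
        moreover have "D - 1 < D" using False by simp
        ultimately have "q y = 0" using less.IH[of "D - 1"] q(1) by simp
        then show ?thesis using Qq by simp
      qed
    qed
  qed
  moreover obtain D where "pdeg {..<Suc n} D Q" using pf_imp_pdeg[OF Suc.prems(2)] by blast
  ultimately show ?case using Suc.prems(3) by simp
qed

text \<open>Transcendence degree at most r in elementary terms. The indices 0, ..., r stand for r +
  1 functions.\<close>

definition dep_bound :: "'i set \<Rightarrow> ('i \<Rightarrow> complex) set \<Rightarrow> nat \<Rightarrow> bool" where
  "dep_bound I S r \<longleftrightarrow> (\<forall>f. (\<forall>i\<le>r. f i \<in> poly_fun I) \<longrightarrow>
     (\<exists>Q\<in>poly_fun {..r}. (\<exists>y. Q y \<noteq> 0) \<and> (\<forall>x\<in>S. Q (\<lambda>i. f i x) = 0)))"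

definition zchain :: "'i set \<Rightarrow> ('i \<Rightarrow> complex) set \<Rightarrow> nat \<Rightarrow> bool" where
  "zchain I Y k \<longleftrightarrow> (\<exists>C :: nat \<Rightarrow> ('i \<Rightarrow> complex) set.
      (\<forall>j\<le>k. zirred I (C j) \<and> C j \<subseteq> Y) \<and> (\<forall>j<k. C j \<subset> C (Suc j)))"

text \<open>A longer chain would provide r + 1 functions independent on one of its members, whereas
  the relation between them on S passes to the closure, which contains that member.\<close>

lemma zchain_le:
  assumes "dep_bound I S r" "Y \<subseteq> zclosure I S" "zchain I Y k"
  shows "k \<le> r"
proof (rule ccontr)
  assume "\<not> k \<le> r"
  then have rk: "Suc r \<le> k" by simp
  obtain C where C: "\<And>j. j \<le> k \<Longrightarrow> zirred I (C j)" "\<And>j. j \<le> k \<Longrightarrow> C j \<subseteq> Y"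
    "\<And>j. j < k \<Longrightarrow> C j \<subset> C (Suc j)" using assms(3) unfolding zchain_def by blast
  have "\<exists>f. f \<in> poly_fun I \<and> (\<forall>x\<in>C j. f x = 0) \<and> (\<exists>x\<in>C (Suc j). f x \<noteq> 0)" if j: "j < k" for j
  proof -
    have cl: "zclosed I (C j)" "zclosed I (C (Suc j))" using C(1)[of j] C(1)[of "Suc j"] j by (auto simp: zirred_def)
    obtain x where x: "x \<in> C (Suc j)" "x \<notin> C j" using C(3)[OF j] by blast
    then show ?thesis using zclosed_sep[OF cl(1)] zclosed_subset_aff[OF cl(2)] by blast
  qed
  then have "\<forall>j\<in>{..<k}. \<exists>f. f \<in> poly_fun I \<and> (\<forall>x\<in>C j. f x = 0) \<and> (\<exists>x\<in>C (Suc j). f x \<noteq> 0)" by blast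
  then obtain f where f: "\<forall>j\<in>{..<k}. f j \<in> poly_fun I \<and> (\<forall>x\<in>C j. f j x = 0) \<and> (\<exists>x\<in>C (Suc j). f j x \<noteq> 0)"
    by (rule bchoice[THEN exE])
  obtain Q where Q: "Q \<in> poly_fun {..r}" "\<exists>y. Q y \<noteq> 0" "\<forall>x\<in>S. Q (\<lambda>i. f i x) = 0"
  proof -
    have "\<forall>i\<le>r. f i \<in> poly_fun I" using f rk by simp
    then have "\<exists>Q\<in>poly_fun {..r}. (\<exists>y. Q y \<noteq> 0) \<and> (\<forall>x\<in>S. Q (\<lambda>i. f i x) = 0)"
      using assms(1) unfolding dep_bound_def by simp
    then show ?thesis using that by blast
  qed
  have Qf: "(\<lambda>x. Q (\<lambda>i. f i x)) \<in> poly_fun I" using f rk by (intro pf_comp[OF Q(1)]) auto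
  have "Q (\<lambda>i. f i x) = 0" if "x \<in> C (Suc r)" for x
    using zclosure_vanish[OF Qf, of S x] Q(3) that C(2)[OF rk] assms(2) by blast
  then have "Q y = 0" for y
    using f Q(1) rk by (intro chain_independence[of k I C f "Suc r" Q y] C) (auto simp: lessThan_Suc_atMost)
  then show False using Q(2) by blast
qed

text \<open>The supremum is taken in the naturals, so the set of chain lengths is shown to have r as
  its largest element.\<close>

lemma zdim_eqI:
  assumes "dep_bound I S r" "Y \<subseteq> zclosure I S" "zchain I Y r"
  shows "zdim I Y = r"
proof -
  have "zdim I Y = Sup {k. zchain I Y k}" unfolding zdim_def zchain_def ..
  also have "\<dots> = r" by (rule cSup_eq_maximum) (use assms zchain_le in auto)
  finally show ?thesis .
qed

lemma zchain_mono: "zchain I Y k \<Longrightarrow> Y \<subseteq> Z \<Longrightarrow> zchain I Z k"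
  unfolding zchain_def by (meson subset_trans)

lemma dep_bound_range:
  assumes "finite J" "\<And>i. i \<in> I \<Longrightarrow> (\<lambda>p. \<phi> p i) \<in> poly_fun J" "card J \<le> r"
  shows "dep_bound I (range \<phi>) r"
  unfolding dep_bound_def
proof (intro allI impI)
  fix f assume f: "\<forall>i\<le>r. f i \<in> poly_fun I"
  have "\<And>i. i \<in> {..r} \<Longrightarrow> (\<lambda>p. f i (\<phi> p)) \<in> poly_fun J" using f by (intro pf_comp[OF _ assms(2)]) auto
  then have "\<exists>Q\<in>poly_fun {..r}. (\<exists>y. Q y \<noteq> 0) \<and> (\<forall>p. Q (\<lambda>i. f i (\<phi> p)) = 0)"
    using assms(1,3) by (intro algebraic_dependence[of J "{..r}" "\<lambda>i p. f i (\<phi> p)"]) auto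
  then show "\<exists>Q\<in>poly_fun {..r}. (\<exists>y. Q y \<noteq> 0) \<and> (\<forall>x\<in>range \<phi>. Q (\<lambda>i. f i x) = 0)" by auto
qed

lemma pd_restrict_params:
  assumes "f \<in> poly_fun J" "s \<in> T"
  shows "pd (\<lambda>p. f (\<lambda>j. if j \<in> T then p j else p0 j)) s p0 = pd f s p0"
proof -
  have "(\<lambda>i. if i \<in> T then p0 i + t * ax s i else p0 i) = (\<lambda>i. p0 i + t * ax s i)" for t
    using assms(2) by (auto simp: ax_def)
  then show ?thesis unfolding pd_def dd_def by presburger
qed

text \<open>Letting n parameters vary and freezing the others at p0 gives the n-th member of the
  chain. The inclusions are strict: n + 1 linear forms dual to the derivatives at p0 satisfy a
  relation on member n, which has fewer parameters, but by the Jacobian criterion none on member n +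
  1.\<close>

lemma zchain_immersion:
  fixes \<phi> :: "('j \<Rightarrow> complex) \<Rightarrow> 'i \<Rightarrow> complex"
  assumes I: "finite I" and J: "finite J" and \<phi>: "\<And>i. i \<in> I \<Longrightarrow> (\<lambda>p. \<phi> p i) \<in> poly_fun J"
    and aff: "range \<phi> \<subseteq> aff I"
    and ind: "lin_indep J I (\<lambda>j i. pd (\<lambda>p. \<phi> p i) j p0)"
  shows "zchain I (zclosure I (range \<phi>)) (card J)"
proof -
  obtain e where "bij_betw e {0..<card J} J" using ex_bij_betw_nat_finite[OF J] by blast
  then have e: "inj_on e {..<card J}" "e ` {..<card J} = J" by (auto simp: bij_betw_def atLeast0LessThan)
  obtain \<beta> where \<beta>: "\<And>r s. r \<in> J \<Longrightarrow> s \<in> J \<Longrightarrow> (\<Sum>i\<in>I. \<beta> r i * pd (\<lambda>p. \<phi> p i) s p0) = (if r = s then 1 else 0)"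
    using dual_basis[OF J I ind] by blast
  define T where "T = (\<lambda>n. e ` {..<n})"
  define \<phi>' where "\<phi>' = (\<lambda>n p. \<phi> (\<lambda>j. if j \<in> T n then p j else p0 j))"
  define C where "C = (\<lambda>n. zclosure I (range (\<phi>' n)))"
  have Tcard: "finite (T n)" "card (T n) \<le> n" for n
    unfolding T_def using card_image_le[of "{..<n}" e] by auto
  have TJ: "T n \<subseteq> J" if "n \<le> card J" for n using that e(2) by (auto simp: T_def)
  have pf: "(\<lambda>p. \<phi>' n p i) \<in> poly_fun (T n)" if "i \<in> I" for n i
    unfolding \<phi>'_def by (rule pf_comp[OF \<phi>[OF that]]) (auto intro: poly_fun.intros pf_if)
  have aff': "range (\<phi>' n) \<subseteq> aff I" for n using aff by (auto simp: \<phi>'_def)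
  have sub: "range (\<phi>' n) \<subseteq> range (\<phi>' (Suc n))" for n
  proof
    fix x assume "x \<in> range (\<phi>' n)"
    then obtain p where p: "x = \<phi>' n p" by blast
    have "x = \<phi>' (Suc n) (\<lambda>j. if j \<in> T n then p j else p0 j)"
      unfolding p \<phi>'_def by (rule arg_cong[of _ _ \<phi>]) (auto simp: T_def fun_eq_iff less_Suc_eq)
    then show "x \<in> range (\<phi>' (Suc n))" by blast
  qed
  have strict: "C n \<noteq> C (Suc n)" if n: "n < card J" for n
  proof
    assume eq: "C n = C (Suc n)"
    define f where "f = (\<lambda>s x. \<Sum>i\<in>I. \<beta> s i * x i)"
    have fpf: "f s \<in> poly_fun I" for s unfolding f_def by (intro pf_sum pf_cmult poly_fun.intros)
    have cardT: "card (T n) < card (T (Suc n))"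
    proof -
      have "card (T (Suc n)) = Suc n" unfolding T_def using n inj_on_subset[OF e(1)] by (subst card_image) auto
      then show ?thesis using Tcard(2)[of n] by simp
    qed
    have "\<And>s. s \<in> T (Suc n) \<Longrightarrow> (\<lambda>p. f s (\<phi>' n p)) \<in> poly_fun (T n)" by (rule pf_comp[OF fpf pf])
    with algebraic_dependence[OF Tcard(1) Tcard(1) cardT, of "\<lambda>s p. f s (\<phi>' n p)"]
    obtain Q where Q: "Q \<in> poly_fun (T (Suc n))" "\<exists>y. Q y \<noteq> 0" "\<And>p. Q (\<lambda>s. f s (\<phi>' n p)) = 0" by blast
    have Qf: "(\<lambda>x. Q (\<lambda>s. f s x)) \<in> poly_fun I" by (rule pf_comp[OF Q(1) fpf])
    have Q': "Q (\<lambda>s. f s (\<phi>' (Suc n) p)) = 0" for p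
    proof -
      have "\<phi>' (Suc n) p \<in> C n" using subset_zclosure[OF aff', of "Suc n"] eq unfolding C_def by blast
      then show ?thesis using zclosure_vanish[OF Qf, of "range (\<phi>' n)"] Q(3) unfolding C_def by blast
    qed
    have ind': "lin_indep (T (Suc n)) (T (Suc n)) (\<lambda>s j. pd (\<lambda>p. f s (\<phi>' (Suc n) p)) j p0)"
      unfolding lin_indep_def
    proof (intro allI impI ballI)
      fix q t assume q: "\<forall>j\<in>T (Suc n). (\<Sum>s\<in>T (Suc n). q s * pd (\<lambda>p. f s (\<phi>' (Suc n) p)) j p0) = 0"
        and t: "t \<in> T (Suc n)"
      have pdf: "pd (\<lambda>p. f s (\<phi>' (Suc n) p)) t p0 = (if s = t then 1 else 0)" if s: "s \<in> T (Suc n)" for s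
      proof -
        have "pd (\<lambda>p. f s (\<phi>' (Suc n) p)) t p0 = (\<Sum>i\<in>I. \<beta> s i * pd (\<lambda>p. \<phi>' (Suc n) p i) t p0)"
          unfolding pd_def f_def
          by (subst dd_sum[where I = "T (Suc n)"])
            (auto intro!: pf_cmult pf sum.cong dd_cmult[OF pf])
        also have "\<dots> = (\<Sum>i\<in>I. \<beta> s i * pd (\<lambda>p. \<phi> p i) t p0)"
          unfolding \<phi>'_def using t by (intro sum.cong refl arg_cong[where f = "times _"] pd_restrict_params[OF \<phi>]) auto
        also have "\<dots> = (if s = t then 1 else 0)" using TJ[of "Suc n"] n s t by (intro \<beta>) auto
        finally show ?thesis .
      qed
      have "0 = (\<Sum>s\<in>T (Suc n). q s * pd (\<lambda>p. f s (\<phi>' (Suc n) p)) t p0)" using q t by simp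
      also have "\<dots> = (\<Sum>s\<in>T (Suc n). q s * (if s = t then 1 else 0))"
        by (intro sum.cong refl arg_cong[where f = "times _"] pdf)
      also have "\<dots> = q t" using t Tcard by (simp add: if_distrib[of "\<lambda>c. _ * c"] cong: if_cong)
      finally show "q t = 0" by simp
    qed
    have "Q y = 0" for y
      by (rule jacobian_criterion[where g = "\<lambda>s p. f s (\<phi>' (Suc n) p)", OF Tcard(1) Tcard(1) _ ind' Q(1) Q'])
        (rule pf_comp[OF fpf pf])
    then show False using Q(2) by blast
  qed
  show ?thesis unfolding zchain_def
  proof (intro exI[of _ C] conjI allI impI)
    fix j
    show "zirred I (C j)" unfolding C_def by (rule zirred_zclosure_range[OF pf aff'])
    show "C j \<subseteq> zclosure I (range \<phi>)" unfolding C_def by (rule zclosure_mono) (auto simp: \<phi>'_def)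
  next
    fix j assume "j < card J"
    then show "C j \<subset> C (Suc j)" using strict zclosure_mono[OF sub, of I j] unfolding C_def by blast
  qed
qed

lemma dd_linear_form: "dd (\<lambda>w. \<Sum>k\<in>J. w k * c k) w0 v = (\<Sum>k\<in>J. v k * c k)"
proof -
  have "dd (\<lambda>w. w k * c k) w0 v = v k * c k" if "k \<in> J" for k
    using dd_mult[OF pf_coord[OF that] pf_const[of "c k" J]] by simp
  then show ?thesis by (subst dd_sum[where I = J]) (auto intro: poly_fun.intros)
qed

text \<open>Cramer's rule without denominators: the coefficient of row j in D times the dependent
  row w is the pairing of row w with b j.\<close>

lemma dual_span:
  assumes "finite S" "finite K" "w \<notin> S" "D \<noteq> 0"
    and b: "\<And>r s. r \<in> S \<Longrightarrow> s \<in> S \<Longrightarrow> (\<Sum>k\<in>K. b r k * m s k) = (if r = s then D else 0)"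
    and dep: "\<not> lin_indep (insert w S) K m" and k: "k \<in> K"
  shows "D * m w k = (\<Sum>j\<in>S. (\<Sum>k\<in>K. b j k * m w k) * m j k)"
proof -
  obtain q where q: "\<And>k. k \<in> K \<Longrightarrow> (\<Sum>j\<in>insert w S. q j * m j k) = 0" and nz: "\<exists>j\<in>insert w S. q j \<noteq> 0"
    using dep unfolding lin_indep_def by blast
  have ind: "lin_indep S K m" by (rule dual_basis_imp_lin_indep[OF assms(1,4) b])
  have q': "q w * m w k = - (\<Sum>j\<in>S. q j * m j k)" if "k \<in> K" for k
    using q[OF that] assms(1,3) by (simp add: eq_neg_iff_add_eq_0)
  have qw: "q w \<noteq> 0"
  proof
    assume "q w = 0"
    then have "(\<Sum>j\<in>S. q j * m j k) = 0" if "k \<in> K" for k using q'[OF that] by simp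
    then have "q j = 0" if "j \<in> S" for j using that by (rule lin_indepD[OF ind, of q])
    then show False using nz \<open>q w = 0\<close> by auto
  qed
  have c: "q w * (\<Sum>k\<in>K. b i k * m w k) = - q i * D" if i: "i \<in> S" for i
  proof -
    have "q w * (\<Sum>k\<in>K. b i k * m w k) = (\<Sum>k\<in>K. b i k * (q w * m w k))"
      by (simp add: sum_distrib_left mult_ac)
    also have "\<dots> = (\<Sum>k\<in>K. b i k * (- (\<Sum>j\<in>S. q j * m j k)))" using q' by (intro sum.cong) auto
    also have "\<dots> = - (\<Sum>j\<in>S. q j * (\<Sum>k\<in>K. b i k * m j k))"
      unfolding sum_distrib_left mult_minus_right sum_negf by (subst sum.swap) (simp add: mult_ac)
    also have "(\<Sum>j\<in>S. q j * (\<Sum>k\<in>K. b i k * m j k)) = (\<Sum>j\<in>S. q j * (if i = j then D else 0))"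
      by (intro sum.cong refl arg_cong[where f = "times _"] b i)
    also have "\<dots> = q i * D" using i assms(1) by (simp add: if_distrib[of "\<lambda>c. _ * c"] cong: if_cong)
    finally show ?thesis by simp
  qed
  have "q w * (\<Sum>j\<in>S. (\<Sum>k\<in>K. b j k * m w k) * m j k) = (\<Sum>j\<in>S. (q w * (\<Sum>k\<in>K. b j k * m w k)) * m j k)"
    by (simp add: sum_distrib_left mult_ac)
  also have "\<dots> = (\<Sum>j\<in>S. (- q j * D) * m j k)" using c by (intro sum.cong) auto
  also have "\<dots> = D * (- (\<Sum>j\<in>S. q j * m j k))" by (simp add: sum_distrib_left sum_negf mult_ac)
  also have "\<dots> = q w * (D * m w k)" using q'[OF k] by (metis mult.left_commute)
  finally show ?thesis using qw by simp
qed

text \<open>Take a relation with the least degree bound. A partial derivative has a smaller bound,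
  so if it vanishes on the image of G it must vanish identically.\<close>

lemma minimal_relation:
  assumes ex: "\<exists>Q\<in>poly_fun K. (\<exists>y. Q y \<noteq> 0) \<and> (\<forall>p. Q (G p) = 0)"
  shows "\<exists>Q\<in>poly_fun K. (\<exists>y. Q y \<noteq> 0) \<and> (\<forall>p. Q (G p) = 0) \<and>
    (\<forall>k. (\<forall>p. pd Q k (G p) = 0) \<longrightarrow> (\<forall>y. pd Q k y = 0))"
proof -
  define P where "P = (\<lambda>D. \<exists>Q. pdeg K D Q \<and> (\<exists>y. Q y \<noteq> 0) \<and> (\<forall>p. Q (G p) = 0))"
  obtain D0 where "P D0" using ex pf_imp_pdeg unfolding P_def by blast
  define D where "D = (LEAST D. P D)"
  have "P D" unfolding D_def by (rule LeastI[where P = P, OF \<open>P D0\<close>])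
  then obtain Q where Q: "pdeg K D Q" "\<exists>y. Q y \<noteq> 0" "\<forall>p. Q (G p) = 0" unfolding P_def by blast
  have "\<forall>y. pd Q k y = 0" if pk: "\<forall>p. pd Q k (G p) = 0" for k
  proof (cases "D = 0")
    case True
    then show ?thesis using pdeg_pd_aux[OF Q(1)] by simp
  next
    case False
    then have "\<not> P (D - 1)" unfolding D_def using not_less_Least[of "D - 1" P] by (simp add: D_def)
    then show ?thesis using pdeg_pd[OF Q(1), of k] pk unfolding P_def by blast
  qed
  then show ?thesis using Q pdeg_imp_pf[OF Q(1)] by blast
qed

text \<open>If the rank of the differential is at most r, each direction w outside a maximal independent
  set S of parameter directions can be corrected to a polynomial vector field along which all the
  functions under consideration are constant. Applied to a relation of minimal degree between these
  functions and the parameters outside S, the vector fields show that the latter do not occur.\<close>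

lemma dep_bound_rank:
  fixes \<phi> :: "('j \<Rightarrow> complex) \<Rightarrow> 'i \<Rightarrow> complex"
  assumes I: "finite I" and J: "finite J" and \<phi>: "\<And>i. i \<in> I \<Longrightarrow> (\<lambda>p. \<phi> p i) \<in> poly_fun J"
    and h: "h \<in> poly_fun J" "h p1 \<noteq> 0"
    and rank: "\<And>p S. h p \<noteq> 0 \<Longrightarrow> S \<subseteq> J \<Longrightarrow> card S = Suc r \<Longrightarrow> \<not> lin_indep S I (\<lambda>j i. pd (\<lambda>p. \<phi> p i) j p)"
  shows "dep_bound I (range \<phi>) r"
  unfolding dep_bound_def
proof (intro allI impI)
  fix f assume f: "\<forall>i\<le>r. f i \<in> poly_fun I"
  define g where "g = (\<lambda>k p. f k (\<phi> p))"
  have g: "g k \<in> poly_fun J" if "k \<le> r" for k unfolding g_def using that f by (intro pf_comp[OF _ \<phi>]) auto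
  define m where "m = (\<lambda>j p k. pd (g k) j p)"
  have mpf: "(\<lambda>p. m j p k) \<in> poly_fun J" if "k \<le> r" for j k unfolding m_def by (rule pf_pd[OF g[OF that]])
  \<comment> \<open>The rank is maximised over all points with h non-zero, so that every further
    direction depends on S not only at p0 but wherever h and the later denominator D are
    non-zero.\<close>
  define N where "N = {n. \<exists>p S. h p \<noteq> 0 \<and> S \<subseteq> J \<and> card S = n \<and> lin_indep S {..r} (\<lambda>j. m j p)}"
  have bd: "n \<le> r" if "n \<in> N" for n
  proof (rule ccontr)
    assume n: "\<not> n \<le> r"
    from \<open>n \<in> N\<close> obtain p S where S: "h p \<noteq> 0" "S \<subseteq> J" "card S = n" "lin_indep S {..r} (\<lambda>j. m j p)"
      unfolding N_def by blast
    have fS: "finite S" using S(2) J finite_subset by blast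
    have "Suc r \<le> card S" using n S(3) by simp
    then obtain T where T: "T \<subseteq> S" "card T = Suc r" by (rule obtain_subset_with_card_n)
    have fT: "finite T" using T fS finite_subset by blast
    have ind: "lin_indep T {..r} (\<lambda>j. m j p)" by (rule lin_indep_subset[OF S(4) fS T(1)])
    have "lin_indep T I (\<lambda>j i. pd (\<lambda>p. \<phi> p i) j p)"
      unfolding lin_indep_def
    proof (intro allI impI ballI)
      fix q t assume q: "\<forall>i\<in>I. (\<Sum>j\<in>T. q j * pd (\<lambda>p. \<phi> p i) j p) = 0" and t: "t \<in> T"
      show "q t = 0"
      proof (rule lin_indepD[OF ind, of q, OF _ t])
        fix k assume k: "k \<in> {..r}"
        have "m j p k = (\<Sum>i\<in>I. pd (f k) i (\<phi> p) * pd (\<lambda>p. \<phi> p i) j p)" for j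
          unfolding m_def g_def pd_def[of _ j] using f k by (intro dd_comp[OF _ I \<phi>]) auto
        then have "(\<Sum>j\<in>T. q j * m j p k) = (\<Sum>i\<in>I. pd (f k) i (\<phi> p) * (\<Sum>j\<in>T. q j * pd (\<lambda>p. \<phi> p i) j p))"
          unfolding sum_distrib_left by (subst sum.swap) (simp add: sum_distrib_left mult_ac)
        then show "(\<Sum>j\<in>T. q j * m j p k) = 0" using q by simp
      qed
    qed
    then show False using rank[OF S(1) _ T(2)] T(1) S(2) by blast
  qed
  have "0 \<in> N" unfolding N_def using h by (auto simp: lin_indep_def intro!: exI[of _ "{}"])
  then have "\<exists>n. n \<in> N \<and> (\<forall>k. k \<in> N \<longrightarrow> k \<le> n)"
    using bd by (intro Nat.ex_has_greatest_nat) auto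
  then obtain n where n: "n \<in> N" and nmax: "\<forall>k. k \<in> N \<longrightarrow> k \<le> n" by blast
  then obtain p0 S where S: "h p0 \<noteq> 0" "S \<subseteq> J" "card S = n" "lin_indep S {..r} (\<lambda>j. m j p0)" unfolding N_def by blast
  have fS: "finite S" using S(2) J finite_subset by blast
  obtain b D where D: "D \<in> poly_fun J" "D p0 \<noteq> 0"
    and b0: "\<forall>j\<in>S. \<forall>k. (\<lambda>p. b j p k) \<in> poly_fun J"
    and bm0: "\<forall>p. \<forall>i\<in>S. \<forall>j\<in>S. (\<Sum>k\<in>{..r}. b i p k * m j p k) = (if i = j then D p else 0)"
    using poly_dual_basis[where m = m and R = S and I = "{..r}" and J = J and ?p0.0 = p0, OF fS _ _ S(4)] mpf by auto
  have b: "(\<lambda>p. b j p k) \<in> poly_fun J" if "j \<in> S" for j k using b0 that by simp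
  have bm: "(\<Sum>k\<in>{..r}. b i p k * m j p k) = (if i = j then D p else 0)" if "i \<in> S" "j \<in> S" for i j p
    using bm0 that by simp
  define c where "c = (\<lambda>w p j. \<Sum>k\<in>{..r}. b j p k * m w p k)"
  have cpf: "(\<lambda>p. c w p j) \<in> poly_fun J" if "j \<in> S" for w j
    unfolding c_def using that by (intro pf_sum pf_mult b mpf) auto
  have field: "D p * m w p k - (\<Sum>j\<in>S. c w p j * m j p k) = 0" if w: "w \<in> J" "w \<notin> S" and k: "k \<le> r" for w p k
  proof (rule pf_dense[of "\<lambda>p. D p * m w p k - (\<Sum>j\<in>S. c w p j * m j p k)" J "\<lambda>p. h p * D p" p0])
    show "(\<lambda>p. D p * m w p k - (\<Sum>j\<in>S. c w p j * m j p k)) \<in> poly_fun J"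
      using k by (intro pf_diff pf_mult pf_sum D mpf cpf) auto
    show "(\<lambda>p. h p * D p) \<in> poly_fun J" by (intro pf_mult h D)
    show "h p0 * D p0 \<noteq> 0" using S(1) D(2) by simp
    fix p assume hD: "h p * D p \<noteq> 0"
    have "\<not> lin_indep (insert w S) {..r} (\<lambda>j. m j p)"
    proof
      assume "lin_indep (insert w S) {..r} (\<lambda>j. m j p)"
      then have "Suc n \<in> N" unfolding N_def using hD w S(2,3) fS
          by (intro CollectI exI[of _ p] exI[of _ "insert w S"]) auto
      then show False using nmax by auto
    qed
    from dual_span[OF fS _ w(2) _ bm this, of k] hD k
    show "D p * m w p k - (\<Sum>j\<in>S. c w p j * m j p k) = 0" by (simp add: c_def)
  qed
  \<comment> \<open>Since n is at most r, the r + 1 functions and the parameters outside S together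
    outnumber all parameters, which forces a relation.\<close>
  define K where "K = {..r} <+> (J - S)"
  have fK: "finite K" using J by (simp add: K_def)
  have "card S \<le> card J" "n \<le> r" using S(2) J bd n by (auto intro: card_mono)
  then have cK: "card J < card K" using S fS J by (simp add: K_def card_Plus card_Diff_subset)
  define G where "G = (\<lambda>p. case_sum (\<lambda>k. g k p) (\<lambda>j. p j))"
  have Gpf: "(\<lambda>p. G p x) \<in> poly_fun J" if "x \<in> K" for x
    using that g by (auto simp: K_def G_def intro: poly_fun.intros)
  obtain Q where Q: "Q \<in> poly_fun K" "\<exists>y. Q y \<noteq> 0" "\<forall>p. Q (G p) = 0"
    and min: "\<forall>k. (\<forall>p. pd Q k (G p) = 0) \<longrightarrow> (\<forall>y. pd Q k y = 0)"
    using minimal_relation[where G = G, OF algebraic_dependence[where g = "\<lambda>k p. G p k", OF J fK cK Gpf]] by blast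
  have pd0: "pd Q (Inr w) y = 0" if w: "w \<in> J - S" for w y
  proof -
    have "pd Q (Inr w) (G p) = 0" for p
    proof (rule pf_dense[of "\<lambda>p. pd Q (Inr w) (G p)" J D p0])
      show "(\<lambda>p. pd Q (Inr w) (G p)) \<in> poly_fun J" by (rule pf_comp[OF pf_pd[OF Q(1)] Gpf])
      fix p assume Dp: "D p \<noteq> 0"
      define v where "v = (\<lambda>j. if j = w then D p else if j \<in> S then - c w p j else 0)"
      have "0 = dd (\<lambda>p. Q (G p)) p v" using Q(3) by simp
      also have "\<dots> = (\<Sum>x\<in>K. pd Q x (G p) * dd (\<lambda>p. G p x) p v)" by (rule dd_comp[OF Q(1) fK Gpf])
      also have "\<dots> = (\<Sum>k\<in>{..r}. pd Q (Inl k) (G p) * dd (g k) p v) + (\<Sum>j\<in>J - S. pd Q (Inr j) (G p) * v j)"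
        unfolding K_def using J by (subst sum.Plus) (auto simp: G_def)
      also have "(\<Sum>k\<in>{..r}. pd Q (Inl k) (G p) * dd (g k) p v) = 0"
      proof (intro sum.neutral ballI)
        fix k assume k: "k \<in> {..r}"
        have "dd (g k) p v = (\<Sum>j\<in>J. m j p k * v j)" unfolding m_def using k by (intro dd_linear g J) auto
        also have "\<dots> = (\<Sum>j\<in>insert w S. m j p k * v j)"
          using w S(2) J by (intro sum.mono_neutral_right) (auto simp: v_def)
        also have "\<dots> = D p * m w p k + (\<Sum>j\<in>S. m j p k * v j)" using w fS by (simp add: v_def)
        also have "(\<Sum>j\<in>S. m j p k * v j) = - (\<Sum>j\<in>S. c w p j * m j p k)"
          unfolding sum_negf[symmetric] using w by (intro sum.cong) (auto simp: v_def)
        finally have "dd (g k) p v = 0" using field[of w k p] w k by simp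
        then show "pd Q (Inl k) (G p) * dd (g k) p v = 0" by simp
      qed
      also have "(\<Sum>j\<in>J - S. pd Q (Inr j) (G p) * v j) = (\<Sum>j\<in>J - S. if j = w then pd Q (Inr w) (G p) * D p else 0)"
        by (intro sum.cong) (auto simp: v_def)
      also have "\<dots> = pd Q (Inr w) (G p) * D p" using w J by simp
      finally show "pd Q (Inr w) (G p) = 0" using Dp by simp
    qed (use D in auto)
    then show ?thesis using min by blast
  qed
  define Q' where "Q' = (\<lambda>y. Q (case_sum y (\<lambda>_. 0)))"
  have QQ: "Q y = Q' (\<lambda>k. y (Inl k))" for y
    unfolding Q'_def by (rule pf_const_along[OF Q(1) fK, of "Inr ` (J - S)"]) (auto simp: K_def pd0)
  have "Q' \<in> poly_fun {..r}" unfolding Q'_def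
    by (rule pf_comp[OF Q(1)]) (auto simp: K_def intro: poly_fun.intros)
  moreover have "\<exists>y. Q' y \<noteq> 0" using Q(2) QQ by auto
  moreover have "Q' (\<lambda>i. f i x) = 0" if "x \<in> range \<phi>" for x
  proof -
    from that obtain p where "x = \<phi> p" by (rule rangeE)
    then have "Q' (\<lambda>i. f i x) = Q (G p)" unfolding QQ by (simp add: G_def g_def)
    then show ?thesis using Q(3) by simp
  qed
  ultimately show "\<exists>Q\<in>poly_fun {..r}. (\<exists>y. Q y \<noteq> 0) \<and> (\<forall>x\<in>range \<phi>. Q (\<lambda>i. f i x) = 0)" by blast
qed

section \<open>The dual of a parametrised variety\<close>

text \<open>Annihilator of the image of the differential. Unlike the annihilator of the Zariski
  tangent space it is given by equations polynomial in p; at general points the two agree.\<close>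

definition ann :: "'i set \<Rightarrow> 'j set \<Rightarrow> (('j \<Rightarrow> complex) \<Rightarrow> 'i \<Rightarrow> complex) \<Rightarrow> ('j \<Rightarrow> complex) \<Rightarrow> ('i \<Rightarrow> complex) set" where
  "ann I J \<phi> p = {F \<in> aff I. \<forall>j\<in>J. (\<Sum>i\<in>I. F i * pd (\<lambda>p. \<phi> p i) j p) = 0}"

context
  fixes I :: "'i set" and J :: "'j set" and \<phi> :: "('j \<Rightarrow> complex) \<Rightarrow> 'i \<Rightarrow> complex" and Y
  assumes I: "finite I" and J: "finite J" and \<phi>: "\<And>i. i \<in> I \<Longrightarrow> (\<lambda>p. \<phi> p i) \<in> poly_fun J"
    and aff: "range \<phi> \<subseteq> aff I"
  defines "Y \<equiv> zclosure I (range \<phi>)"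
begin

lemma ztangent_dd: "v \<in> ztangent I Y x \<longleftrightarrow> v \<in> aff I \<and> (\<forall>f\<in>vanishing I Y. dd f x v = 0)"
  unfolding ztangent_def dd_def by blast

text \<open>The easy inclusion, by the chain rule and valid at every p; equality is obtained at
  general points in \<open>generic_smooth\<close>.\<close>

lemma image_in_ztangent:
  assumes "v \<in> aff I" "\<And>i. i \<in> I \<Longrightarrow> v i = (\<Sum>j\<in>J. w j * pd (\<lambda>p. \<phi> p i) j p)"
  shows "v \<in> ztangent I Y (\<phi> p)"
  unfolding ztangent_dd
proof (intro conjI ballI assms(1))
  fix f assume f: "f \<in> vanishing I Y"
  then have fpf: "f \<in> poly_fun I" by (simp add: vanishing_def)
  have "\<phi> p \<in> Y" for p using subset_zclosure[OF aff] unfolding Y_def by blast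
  then have "f (\<phi> p) = 0" for p using f by (simp add: vanishing_def)
  then have "0 = dd (\<lambda>p. f (\<phi> p)) p w" by simp
  also have "\<dots> = (\<Sum>i\<in>I. pd f i (\<phi> p) * dd (\<lambda>p. \<phi> p i) p w)" by (rule dd_comp[OF fpf I \<phi>])
  also have "\<dots> = (\<Sum>i\<in>I. pd f i (\<phi> p) * v i)"
    using assms(2) by (intro sum.cong) (auto simp: dd_linear[OF \<phi> J] mult.commute)
  also have "\<dots> = dd f (\<phi> p) v" by (rule dd_linear[OF fpf I, symmetric])
  finally show "dd f (\<phi> p) v = 0" by simp
qed

lemma zclosed_ztangent: "zclosed I (ztangent I Y x)"
  unfolding zclosed_def
proof (intro exI conjI)
  show "(\<lambda>f v. dd f x v) ` vanishing I Y \<subseteq> poly_fun I"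
  proof
    fix g assume "g \<in> (\<lambda>f v. dd f x v) ` vanishing I Y"
    then obtain f where f: "f \<in> poly_fun I" "g = (\<lambda>v. dd f x v)" by (auto simp: vanishing_def)
    then have "g = (\<lambda>v. \<Sum>i\<in>I. pd f i x * v i)" using dd_linear[OF f(1) I] by auto
    then show "g \<in> poly_fun I" by (simp only:) (intro pf_sum pf_cmult poly_fun.pf_coord)
  qed
  show "ztangent I Y x = zero_set I ((\<lambda>f v. dd f x v) ` vanishing I Y)"
    by (auto simp: ztangent_dd zero_set_def)
qed

context
  fixes p0
  assumes ind: "lin_indep J I (\<lambda>j i. pd (\<lambda>p. \<phi> p i) j p0)" and ne: "J \<noteq> {}"
begin

lemma zdim_immersed: "zdim I Y = card J"
  by (rule zdim_eqI[OF dep_bound_range[OF J \<phi> order_refl]])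
    (auto simp: Y_def intro: zchain_immersion[OF I J \<phi> aff ind])

text \<open>The linear forms B dual to the derivatives at p0 are algebraically independent on the
  image, and coordinate i is algebraic over them. Differentiating a least relation along a tangent
  vector v determines v i by the values of B on v wherever the partial derivative h in that
  coordinate is non-zero.\<close>

lemma tangent_equation:
  assumes \<beta>: "\<And>r s. r \<in> J \<Longrightarrow> s \<in> J \<Longrightarrow> (\<Sum>i\<in>I. \<beta> r i * pd (\<lambda>p. \<phi> p i) s p0) = (if r = s then 1 else 0)"
    and i: "i \<in> I"
  shows "\<exists>h\<in>poly_fun J. (\<exists>p. h p \<noteq> 0) \<and> (\<forall>p. h p \<noteq> 0 \<longrightarrow>
    (\<forall>v\<in>ztangent I Y (\<phi> p). (\<forall>s\<in>J. (\<Sum>i\<in>I. \<beta> s i * v i) = 0) \<longrightarrow> v i = 0))"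
proof -
  define B where "B = (\<lambda>s x. \<Sum>i\<in>I. \<beta> s i * x i)"
  have Bpf: "B s \<in> poly_fun I" for s unfolding B_def by (intro pf_sum pf_cmult poly_fun.intros)
  define K where "K = J <+> {()}"
  have fK: "finite K" and cK: "card J < card K" using J by (auto simp: K_def card_Plus)
  define E where "E = (\<lambda>x. case_sum (\<lambda>s. B s x) (\<lambda>_::unit. x i))"
  have Epf: "(\<lambda>x. E x k) \<in> poly_fun I" for k
    using Bpf i by (cases k) (auto simp: E_def intro: poly_fun.intros)
  have Gpf: "(\<lambda>p. E (\<phi> p) k) \<in> poly_fun J" for k by (rule pf_comp[OF Epf \<phi>])
  obtain Q where Q: "Q \<in> poly_fun K" "\<exists>y. Q y \<noteq> 0" "\<forall>p. Q (E (\<phi> p)) = 0"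
    and min: "\<forall>k. (\<forall>p. pd Q k (E (\<phi> p)) = 0) \<longrightarrow> (\<forall>y. pd Q k y = 0)"
    using minimal_relation[where G = "\<lambda>p. E (\<phi> p)",
        OF algebraic_dependence[where g = "\<lambda>k p. E (\<phi> p) k", OF J fK cK Gpf]] by blast
  define h where "h = (\<lambda>p. pd Q (Inr ()) (E (\<phi> p)))"
  have hpf: "h \<in> poly_fun J" unfolding h_def by (rule pf_comp[OF pf_pd[OF Q(1)] Gpf])
  \<comment> \<open>Otherwise the relation would not involve coordinate i and would relate the forms
    B alone, against the Jacobian criterion.\<close>
  have hnz: "\<exists>p. h p \<noteq> 0"
  proof (rule ccontr)
    assume "\<not> ?thesis"
    then have pd0: "pd Q (Inr ()) y = 0" for y using min unfolding h_def by blast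
    define Q' where "Q' = (\<lambda>y. Q (case_sum y (\<lambda>_. 0)))"
    have QQ: "Q y = Q' (\<lambda>k. y (Inl k))" for y
      unfolding Q'_def by (rule pf_const_along[OF Q(1) fK, of "{Inr ()}"]) (auto simp: K_def pd0)
    have Q'pf: "Q' \<in> poly_fun J" unfolding Q'_def
      by (rule pf_comp[OF Q(1)]) (auto simp: K_def intro: poly_fun.intros)
    have Q'0: "Q' (\<lambda>s. B s (\<phi> p)) = 0" for p using Q(3)[rule_format, of p] unfolding QQ by (simp add: E_def)
    have pdB: "pd (\<lambda>p. B s (\<phi> p)) t p0 = (if s = t then 1 else 0)" if "s \<in> J" "t \<in> J" for s t
    proof -
      have "pd (\<lambda>p. B s (\<phi> p)) t p0 = (\<Sum>i\<in>I. \<beta> s i * pd (\<lambda>p. \<phi> p i) t p0)"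
        unfolding pd_def B_def
        by (subst dd_sum[where I = J]) (auto intro!: pf_cmult \<phi> sum.cong dd_cmult[OF \<phi>])
      then show ?thesis using \<beta>[OF that] by simp
    qed
    have "lin_indep J J (\<lambda>s j. pd (\<lambda>p. B s (\<phi> p)) j p0)"
      unfolding lin_indep_def
    proof (intro allI impI ballI)
      fix q t assume q: "\<forall>j\<in>J. (\<Sum>s\<in>J. q s * pd (\<lambda>p. B s (\<phi> p)) j p0) = 0" and t: "t \<in> J"
      have "0 = (\<Sum>s\<in>J. q s * pd (\<lambda>p. B s (\<phi> p)) t p0)" using q t by simp
      also have "\<dots> = (\<Sum>s\<in>J. q s * (if s = t then 1 else 0))" using pdB t by (intro sum.cong) auto
      also have "\<dots> = q t" using t J by (simp add: if_distrib[of "\<lambda>c. _ * c"] cong: if_cong)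
      finally show "q t = 0" by simp
    qed
    then have "Q' y = 0" for y
      by (intro jacobian_criterion[where g = "\<lambda>s p. B s (\<phi> p)", OF J J _ _ Q'pf Q'0]) (auto intro: pf_comp[OF Bpf \<phi>])
    then show False using Q(2) QQ by simp
  qed
  have "v i = 0" if hp: "h p \<noteq> 0" and v: "v \<in> ztangent I Y (\<phi> p)" and B0: "\<forall>s\<in>J. (\<Sum>i\<in>I. \<beta> s i * v i) = 0" for p v
  proof -
    have QE: "(\<lambda>x. Q (E x)) \<in> poly_fun I" by (rule pf_comp[OF Q(1) Epf])
    have "(\<lambda>x. Q (E x)) \<in> vanishing I Y"
      unfolding vanishing_def Y_def using QE Q(3) zclosure_vanish[OF QE, of "range \<phi>"] by auto
    then have "0 = dd (\<lambda>x. Q (E x)) (\<phi> p) v" using v unfolding ztangent_dd by simp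
    also have "\<dots> = (\<Sum>k\<in>K. pd Q k (E (\<phi> p)) * dd (\<lambda>x. E x k) (\<phi> p) v)" by (rule dd_comp[OF Q(1) fK Epf])
    also have "\<dots> = (\<Sum>s\<in>J. pd Q (Inl s) (E (\<phi> p)) * dd (B s) (\<phi> p) v) + h p * v i"
      unfolding K_def using J by (subst sum.Plus) (auto simp: E_def h_def)
    also have "(\<Sum>s\<in>J. pd Q (Inl s) (E (\<phi> p)) * dd (B s) (\<phi> p) v) = 0"
    proof (intro sum.neutral ballI)
      fix s assume s: "s \<in> J"
      have "dd (B s) (\<phi> p) v = (\<Sum>i\<in>I. \<beta> s i * v i)" unfolding B_def
        by (subst dd_sum[where I = I]) (auto intro!: pf_cmult poly_fun.intros simp: dd_cmult[OF poly_fun.pf_coord])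
      then show "pd Q (Inl s) (E (\<phi> p)) * dd (B s) (\<phi> p) v = 0" using B0 s by simp
    qed
    finally show ?thesis using hp by simp
  qed
  then show ?thesis using hpf hnz by blast
qed

text \<open>At a general point the \<open>card J\<close> forms \<beta> are injective on the tangent
  space, which contains the image of an injective differential; hence the two coincide and the
  dimension is that of Y.\<close>

lemma generic_smooth:
  "\<exists>h\<in>poly_fun J. (\<exists>p. h p \<noteq> 0) \<and> (\<forall>p. h p \<noteq> 0 \<longrightarrow> \<phi> p \<noteq> (\<lambda>_. 0) \<and> zsmooth I Y (\<phi> p) \<and>
    (\<forall>v\<in>ztangent I Y (\<phi> p). \<exists>w. \<forall>i\<in>I. v i = (\<Sum>j\<in>J. w j * pd (\<lambda>p. \<phi> p i) j p)))"
proof -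
  obtain \<beta> where \<beta>: "\<And>r s. r \<in> J \<Longrightarrow> s \<in> J \<Longrightarrow> (\<Sum>i\<in>I. \<beta> r i * pd (\<lambda>p. \<phi> p i) s p0) = (if r = s then 1 else 0)"
    using dual_basis[OF J I ind] by blast
  have "\<forall>i\<in>I. \<exists>h. h \<in> poly_fun J \<and> (\<exists>p. h p \<noteq> 0) \<and> (\<forall>p. h p \<noteq> 0 \<longrightarrow>
    (\<forall>v\<in>ztangent I Y (\<phi> p). (\<forall>s\<in>J. (\<Sum>i\<in>I. \<beta> s i * v i) = 0) \<longrightarrow> v i = 0))"
    using tangent_equation[OF \<beta>] by blast
  then obtain h where h: "\<forall>i\<in>I. h i \<in> poly_fun J \<and> (\<exists>p. h i p \<noteq> 0) \<and> (\<forall>p. h i p \<noteq> 0 \<longrightarrow>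
    (\<forall>v\<in>ztangent I Y (\<phi> p). (\<forall>s\<in>J. (\<Sum>i\<in>I. \<beta> s i * v i) = 0) \<longrightarrow> v i = 0))"
    by (rule bchoice[THEN exE])
  obtain D where D: "D \<in> poly_fun J" "D p0 \<noteq> 0"
    and Dind: "\<And>p. D p \<noteq> 0 \<Longrightarrow> lin_indep J I (\<lambda>j i. pd (\<lambda>p. \<phi> p i) j p)"
    using lin_indep_open[where m = "\<lambda>j p i. pd (\<lambda>p. \<phi> p i) j p" and ?p0.0 = p0, OF J I pf_pd[OF \<phi>] ind] by blast
  have "\<exists>i\<in>I. \<exists>p. \<phi> p i \<noteq> 0"
  proof (rule ccontr)
    assume "\<not> ?thesis"
    then have neg: "\<phi> p i = 0" if "i \<in> I" for i p using that by blast
    obtain j where j: "j \<in> J" using ne by blast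
    have "(1::complex) = 0"
      by (rule lin_indepD[OF ind, of "\<lambda>_. 1", OF _ j]) (simp add: neg)
    then show False by simp
  qed
  then obtain i0 p1 where i0: "i0 \<in> I" "\<phi> p1 i0 \<noteq> 0" by blast
  define H where "H = (\<lambda>p. (D p * \<phi> p i0) * (\<Prod>i\<in>I. h i p))"
  have Hpf: "H \<in> poly_fun J" unfolding H_def using h by (intro pf_mult pf_prod D \<phi> i0) auto
  have "\<exists>p. D p * \<phi> p i0 \<noteq> 0" using D i0 by (intro pf_mult_nonzero[of D J "\<lambda>p. \<phi> p i0" p0 p1] \<phi>) auto
  moreover have "\<exists>p. (\<Prod>i\<in>I. h i p) \<noteq> 0" using h by (intro pf_prod_nonzero[of I h J] I) auto
  ultimately obtain p2 p3 where "D p2 * \<phi> p2 i0 \<noteq> 0" "(\<Prod>i\<in>I. h i p3) \<noteq> 0" by blast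
  then have Hnz: "\<exists>p. H p \<noteq> 0" unfolding H_def
    using h by (intro pf_mult_nonzero[of "\<lambda>p. D p * \<phi> p i0" J "\<lambda>p. \<Prod>i\<in>I. h i p" p2 p3] pf_mult pf_prod D \<phi> i0) auto
  show ?thesis
  proof (intro bexI[OF _ Hpf] conjI Hnz allI impI)
    fix p assume Hp: "H p \<noteq> 0"
    then have Dp: "D p \<noteq> 0" and ip: "\<phi> p i0 \<noteq> 0" and hp: "\<And>i. i \<in> I \<Longrightarrow> h i p \<noteq> 0" using I by (auto simp: H_def)
    show "\<phi> p \<noteq> (\<lambda>_. 0)" using ip by auto
    let ?T = "ztangent I Y (\<phi> p)"
    have inj: "v i = 0" if "v \<in> ?T" "\<forall>s\<in>J. (\<Sum>i\<in>I. \<beta> s i * v i) = 0" "i \<in> I" for v i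
      using h hp that by blast
    define L where "L = (\<lambda>w i. if i \<in> I then \<Sum>j\<in>J. w j * pd (\<lambda>p. \<phi> p i) j p else 0)"
    have LT: "L w \<in> ?T" for w
      by (rule image_in_ztangent[where w = w]) (auto simp: L_def aff_def)
    show img: "\<forall>v\<in>?T. \<exists>w. \<forall>i\<in>I. v i = (\<Sum>j\<in>J. w j * pd (\<lambda>p. \<phi> p i) j p)"
    proof
      fix v assume v: "v \<in> ?T"
      \<comment> \<open>There are \<open>card J\<close> equations for \<open>card J + 1\<close>
        coefficients, so some combination of v and the columns of the differential is killed by all
        \<beta>. Being tangent, it is zero, and its coefficient of v cannot vanish.\<close>
      define M where "M = (\<lambda>x s. \<Sum>i\<in>I. \<beta> s i * case_sum (\<lambda>j. pd (\<lambda>p. \<phi> p i) j p) (\<lambda>_::unit. v i) x)"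
      have fJ: "finite (J <+> {()})" using J by simp
      have cJ: "card J < card (J <+> {()})" using J by (simp add: card_Plus)
      obtain q where q: "\<exists>a\<in>J <+> {()}. q a \<noteq> 0" "\<forall>s\<in>J. (\<Sum>a\<in>J <+> {()}. q a * M a s) = 0"
        using homogeneous_system[OF J fJ cJ] by blast
      define u where "u = (\<lambda>i. L (\<lambda>j. q (Inl j)) i + q (Inr ()) * v i)"
      have "u \<in> ?T"
        using v LT[of "\<lambda>j. q (Inl j)"] unfolding ztangent_dd u_def
        by (auto simp: aff_def vanishing_def dd_linear[OF _ I] distrib_left sum.distrib mult.left_commute
            simp flip: sum_distrib_left)
      moreover have "(\<Sum>i\<in>I. \<beta> s i * u i) = 0" if "s \<in> J" for s
      proof -
        have "(\<Sum>i\<in>I. \<beta> s i * u i) = (\<Sum>j\<in>J. q (Inl j) * M (Inl j) s) + q (Inr ()) * M (Inr ()) s"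
        proof -
          have "(\<Sum>i\<in>I. \<beta> s i * L (\<lambda>j. q (Inl j)) i) = (\<Sum>i\<in>I. \<Sum>j\<in>J. q (Inl j) * (\<beta> s i * pd (\<lambda>p. \<phi> p i) j p))"
            by (intro sum.cong) (auto simp: L_def sum_distrib_left mult_ac)
          also have "\<dots> = (\<Sum>j\<in>J. q (Inl j) * M (Inl j) s)"
            by (subst sum.swap) (simp add: M_def sum_distrib_left)
          finally show ?thesis
            by (simp add: u_def M_def distrib_left sum.distrib sum_distrib_left mult_ac)
        qed
        then show ?thesis using q(2) that J by (simp add: sum.Plus)
      qed
      ultimately have u0: "u i = 0" if "i \<in> I" for i using inj that by blast
      have qn: "q (Inr ()) \<noteq> 0"
      proof
        assume z: "q (Inr ()) = 0"
        have "q (Inl j) = 0" if "j \<in> J" for j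
          by (rule lin_indepD[OF Dind[OF Dp], of "\<lambda>j. q (Inl j)", OF _ that]) (use u0 z in \<open>auto simp: u_def L_def\<close>)
        then show False using q(1) z by auto
      qed
      have "v i = (\<Sum>j\<in>J. (- q (Inl j) / q (Inr ())) * pd (\<lambda>p. \<phi> p i) j p)" if "i \<in> I" for i
      proof -
        have "v i * q (Inr ()) = - (\<Sum>j\<in>J. q (Inl j) * pd (\<lambda>p. \<phi> p i) j p)"
          using u0[OF that] that by (simp add: u_def L_def eq_neg_iff_add_eq_0 add.commute mult.commute)
        then have "v i = - (\<Sum>j\<in>J. q (Inl j) * pd (\<lambda>p. \<phi> p i) j p) / q (Inr ())" using qn nonzero_eq_divide_eq by blast
        then show ?thesis by (simp add: sum_divide_distrib sum_negf)
      qed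
      then show "\<exists>w. \<forall>i\<in>I. v i = (\<Sum>j\<in>J. w j * pd (\<lambda>p. \<phi> p i) j p)"
        by (intro exI[of _ "\<lambda>j. - q (Inl j) / q (Inr ())"]) simp
    qed
    have Lpf: "(\<lambda>w. L w i) \<in> poly_fun J" if "i \<in> I" for i
      using that by (auto simp: L_def intro!: pf_sum pf_mult poly_fun.intros)
    have Laff: "range L \<subseteq> aff I" by (auto simp: L_def aff_def)
    have pdL: "pd (\<lambda>w. L w i) j w0 = pd (\<lambda>p. \<phi> p i) j p" if "i \<in> I" "j \<in> J" for i j w0
    proof -
      have "pd (\<lambda>w. L w i) j w0 = (\<Sum>k\<in>J. ax j k * pd (\<lambda>p. \<phi> p i) k p)"
        using that(1) unfolding pd_def[of _ j w0] L_def by (simp add: dd_linear_form)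
      then show ?thesis using that J by (simp add: ax_def if_distrib[of "\<lambda>c. c * _"] cong: if_cong)
    qed
    have Lind: "lin_indep J I (\<lambda>j i. pd (\<lambda>w. L w i) j (\<lambda>_. 0))"
      using Dind[OF Dp] pdL unfolding lin_indep_def by simp
    have TL: "?T \<subseteq> range L"
    proof
      fix v assume v: "v \<in> ?T"
      then obtain w where "\<forall>i\<in>I. v i = (\<Sum>j\<in>J. w j * pd (\<lambda>p. \<phi> p i) j p)" using img by blast
      then have "v = L w" using v by (auto simp: L_def ztangent_dd aff_def)
      then show "v \<in> range L" by blast
    qed
    \<comment> \<open>The tangent space is measured by the same two criteria, with the linear map L
      as its parametrisation.\<close>
    have "zdim I ?T = card J"
    proof (rule zdim_eqI[OF dep_bound_range[OF J Lpf order_refl]])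
      show "?T \<subseteq> zclosure I (range L)" using TL subset_zclosure[OF Laff] by blast
      have "zclosure I (range L) \<subseteq> ?T" using LT by (intro zclosure_minimal[OF zclosed_ztangent]) auto
      then show "zchain I ?T (card J)" using zchain_mono[OF zchain_immersion[OF I J Lpf Laff Lind]] by simp
    qed
    then show "zsmooth I Y (\<phi> p)"
      unfolding zsmooth_def zdim_immersed using subset_zclosure[OF aff] unfolding Y_def by auto
  qed
qed

text \<open>The image of p0 may be a singular point. The covector is therefore spread out to a
  polynomial family G of annihilators; for general p these are conormal at smooth points, and the
  closure reaches p0.\<close>

lemma ann_subset_zdual: "ann I J \<phi> p0 \<subseteq> zdual I Y"
proof
  fix F assume F: "F \<in> ann I J \<phi> p0"
  obtain h where h: "h \<in> poly_fun J" "\<exists>p. h p \<noteq> 0"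
    and sm: "\<And>p. h p \<noteq> 0 \<Longrightarrow> \<phi> p \<noteq> (\<lambda>_. 0) \<and> zsmooth I Y (\<phi> p) \<and>
      (\<forall>v\<in>ztangent I Y (\<phi> p). \<exists>w. \<forall>i\<in>I. v i = (\<Sum>j\<in>J. w j * pd (\<lambda>p. \<phi> p i) j p))"
    using generic_smooth by blast
  obtain D S where D: "D p0 \<noteq> 0" and S: "\<forall>F. \<forall>i. (\<lambda>p. S F p i) \<in> poly_fun J"
    "\<forall>F p. \<forall>r\<in>J. (\<Sum>i\<in>I. S F p i * pd (\<lambda>p. \<phi> p i) r p) = 0"
    "\<forall>F. (\<forall>r\<in>J. (\<Sum>i\<in>I. F i * pd (\<lambda>p. \<phi> p i) r p0) = 0) \<longrightarrow> (\<forall>i. S F p0 i = D p0 * F i)"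
    using poly_section[where m = "\<lambda>j p i. pd (\<lambda>p. \<phi> p i) j p" and ?p0.0 = p0, OF J I pf_pd[OF \<phi>] ind] by blast
  \<comment> \<open>Division by \<open>D p0\<close> compensates for the factor with which
    \<open>poly_section\<close> returns its input at p0.\<close>
  define F0 where "F0 = (\<lambda>i. F i / D p0)"
  have F0: "\<forall>r\<in>J. (\<Sum>i\<in>I. F0 i * pd (\<lambda>p. \<phi> p i) r p0) = 0"
    using F by (simp add: F0_def ann_def sum_divide_distrib[symmetric])
  define G where "G = (\<lambda>p i. if i \<in> I then S F0 p i else 0)"
  have Gp0: "G p0 = F" using S(3)[rule_format, OF F0[rule_format]] D F by (auto simp: G_def F0_def ann_def aff_def)
  have Gaff: "G p \<in> aff I" for p by (auto simp: G_def aff_def)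
  have Gann: "(\<Sum>i\<in>I. G p i * pd (\<lambda>p. \<phi> p i) j p) = 0" if "j \<in> J" for p j
    using S(2) that by (simp add: G_def)
  show "F \<in> zdual I Y" unfolding zdual_def
  proof (rule zclosureI)
    show "F \<in> aff I" using F by (simp add: ann_def)
    fix P assume P: "P \<in> poly_fun I"
      "\<And>y. y \<in> {F \<in> aff I. \<exists>x. x \<noteq> (\<lambda>_. 0) \<and> zsmooth I Y x \<and> (\<forall>v\<in>ztangent I Y x. (\<Sum>i\<in>I. F i * v i) = 0)} \<Longrightarrow> P y = 0"
    have "P (G p) = 0" if hp: "h p \<noteq> 0" for p
    proof (rule P(2), intro CollectI conjI exI[of _ "\<phi> p"] ballI Gaff)
      show "\<phi> p \<noteq> (\<lambda>_. 0)" "zsmooth I Y (\<phi> p)" using sm[OF hp] by auto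
      fix v assume "v \<in> ztangent I Y (\<phi> p)"
      then obtain w where w: "\<forall>i\<in>I. v i = (\<Sum>j\<in>J. w j * pd (\<lambda>p. \<phi> p i) j p)" using sm[OF hp] by blast
      have "(\<Sum>i\<in>I. G p i * v i) = (\<Sum>j\<in>J. w j * (\<Sum>i\<in>I. G p i * pd (\<lambda>p. \<phi> p i) j p))"
        using w unfolding sum_distrib_left by (subst sum.swap) (simp add: sum_distrib_left mult_ac)
      then show "(\<Sum>i\<in>I. G p i * v i) = 0" using Gann by simp
    qed
    moreover have "(\<lambda>p. P (G p)) \<in> poly_fun J" using S(1) by (intro pf_comp[OF P(1)]) (simp add: G_def)
    ultimately have "P (G p0) = 0" using h pf_dense[of "\<lambda>p. P (G p)" J h _ p0] by blast
    then show "P F = 0" using Gp0 by simp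
  qed
qed

end

text \<open>A covector annihilating the Zariski tangent space at any point x of Y is the differential
  at x of a single f vanishing on Y, so it specialises the polynomial family y \<mapsto> df(y).\<close>

lemma zdual_subset_ann:
  assumes dense: "\<And>f p. f \<in> poly_fun J \<Longrightarrow> (\<And>q. q \<in> S \<Longrightarrow> f q = 0) \<Longrightarrow> f p = 0"
  shows "zdual I Y \<subseteq> zclosure I (\<Union>p\<in>S. ann I J \<phi> p)"
  unfolding zdual_def
proof (rule zclosure_minimal[OF zclosed_zclosure], intro subsetI)
  fix F assume "F \<in> {F \<in> aff I. \<exists>x. x \<noteq> (\<lambda>_. 0) \<and> zsmooth I Y x \<and> (\<forall>v\<in>ztangent I Y x. (\<Sum>i\<in>I. F i * v i) = 0)}"
  then obtain x where F: "F \<in> aff I" "x \<in> Y" "\<And>v. v \<in> ztangent I Y x \<Longrightarrow> (\<Sum>i\<in>I. F i * v i) = 0"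
    unfolding zsmooth_def by blast
  define G where "G = (\<lambda>f i. pd f i x) ` vanishing I Y"
  have "\<exists>g\<in>G. \<forall>i\<in>I. F i = g i"
  proof (rule double_annihilator[OF I])
    fix a b g h assume "g \<in> G" "h \<in> G"
    then obtain f1 f2 where f: "f1 \<in> vanishing I Y" "g = (\<lambda>i. pd f1 i x)" "f2 \<in> vanishing I Y" "h = (\<lambda>i. pd f2 i x)"
      unfolding G_def by blast
    have pf: "f1 \<in> poly_fun I" "f2 \<in> poly_fun I" using f by (auto simp: vanishing_def)
    have "(\<lambda>x. a * f1 x + b * f2 x) \<in> vanishing I Y"
      using f by (auto simp: vanishing_def intro!: pf_add pf_cmult)
    moreover have "(\<lambda>i. a * g i + b * h i) = (\<lambda>i. pd (\<lambda>x. a * f1 x + b * f2 x) i x)"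
      unfolding f(2,4) pd_def using pf by (simp add: dd_add[OF pf_cmult pf_cmult] dd_cmult)
    ultimately show "(\<lambda>i. a * g i + b * h i) \<in> G" unfolding G_def by blast
  next
    have "(\<lambda>x. 0) \<in> vanishing I Y" by (auto simp: vanishing_def intro: poly_fun.intros)
    then show "G \<noteq> {}" unfolding G_def by blast
  next
    fix v assume v: "\<And>g. g \<in> G \<Longrightarrow> (\<Sum>i\<in>I. g i * v i) = 0"
    define v' where "v' = (\<lambda>i. if i \<in> I then v i else 0)"
    have "v' \<in> ztangent I Y x" unfolding ztangent_dd
    proof (intro conjI ballI)
      show "v' \<in> aff I" by (auto simp: v'_def aff_def)
      fix f assume f: "f \<in> vanishing I Y"
      have "dd f x v' = (\<Sum>i\<in>I. pd f i x * v i)"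
        using f by (subst dd_linear[OF _ I]) (auto simp: vanishing_def v'_def)
      then show "dd f x v' = 0" using v[of "\<lambda>i. pd f i x"] f unfolding G_def by simp
    qed
    from F(3)[OF this] show "(\<Sum>i\<in>I. F i * v i) = 0" by (simp add: v'_def)
  qed
  then obtain f where f: "f \<in> vanishing I Y" "\<And>i. i \<in> I \<Longrightarrow> F i = pd f i x" unfolding G_def by blast
  have fpf: "f \<in> poly_fun I" using f by (simp add: vanishing_def)
  define A where "A = (\<lambda>y i. if i \<in> I then pd f i y else 0)"
  have AF: "A x = F" using f(2) F(1) by (auto simp: A_def aff_def)
  have Aann: "A (\<phi> p) \<in> ann I J \<phi> p" for p
    unfolding ann_def
  proof (intro CollectI conjI ballI)
    show "A (\<phi> p) \<in> aff I" by (auto simp: A_def aff_def)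
    fix j assume "j \<in> J"
    have "\<phi> p \<in> Y" for p using subset_zclosure[OF aff] unfolding Y_def by blast
    then have "f (\<phi> p) = 0" for p using f by (simp add: vanishing_def)
    then have "0 = dd (\<lambda>p. f (\<phi> p)) p (ax j)" by simp
    also have "\<dots> = (\<Sum>i\<in>I. pd f i (\<phi> p) * dd (\<lambda>p. \<phi> p i) p (ax j))" by (rule dd_comp[OF fpf I \<phi>])
    finally show "(\<Sum>i\<in>I. A (\<phi> p) i * pd (\<lambda>p. \<phi> p i) j p) = 0" by (simp add: A_def pd_def)
  qed
  show "F \<in> zclosure I (\<Union>p\<in>S. ann I J \<phi> p)"
  proof (rule zclosureI[OF F(1)])
    fix P assume P: "P \<in> poly_fun I" "\<And>y. y \<in> (\<Union>p\<in>S. ann I J \<phi> p) \<Longrightarrow> P y = 0"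
    have PA: "(\<lambda>y. P (A y)) \<in> poly_fun I"
      by (rule pf_comp[OF P(1)]) (auto simp: A_def intro: pf_pd[OF fpf])
    have "P (A (\<phi> p)) = 0" for p
      by (rule dense[OF pf_comp[OF PA \<phi>]]) (use P(2) Aann in auto)
    then have "P (A x) = 0" using zclosure_vanish[OF PA, of "range \<phi>" x] F(2) unfolding Y_def by blast
    then show "P F = 0" using AF by simp
  qed
qed

end

section \<open>Forms and their coefficients\<close>

lemma Mon_0: "Mon 0 d = {\<lambda>i. if i = 0 then d else 0}"
  by (auto simp: Mon_def fun_eq_iff)

lemma Mon_Suc: "Mon (Suc n) d = (\<Union>k\<in>{..d}. (\<lambda>\<alpha>. \<alpha>(Suc n := k)) ` Mon n (d - k))"
proof (intro set_eqI iffI)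
  fix \<alpha> assume a: "\<alpha> \<in> Mon (Suc n) d"
  have "(\<Sum>i\<le>n. (\<alpha>(Suc n := 0)) i) = (\<Sum>i\<le>n. \<alpha> i)" by (intro sum.cong) auto
  then have "\<alpha>(Suc n := 0) \<in> Mon n (d - \<alpha> (Suc n))" "\<alpha> (Suc n) \<le> d"
    using a by (auto simp: Mon_def)
  moreover have "\<alpha> = (\<alpha>(Suc n := 0))(Suc n := \<alpha> (Suc n))" by auto
  ultimately show "\<alpha> \<in> (\<Union>k\<in>{..d}. (\<lambda>\<alpha>. \<alpha>(Suc n := k)) ` Mon n (d - k))" by blast
next
  fix \<alpha> assume "\<alpha> \<in> (\<Union>k\<in>{..d}. (\<lambda>\<alpha>. \<alpha>(Suc n := k)) ` Mon n (d - k))"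
  then obtain k \<beta> where k: "k \<le> d" "\<beta> \<in> Mon n (d - k)" "\<alpha> = \<beta>(Suc n := k)" by auto
  have "(\<Sum>i\<le>n. (\<beta>(Suc n := k)) i) = (\<Sum>i\<le>n. \<beta> i)" by (intro sum.cong) auto
  then show "\<alpha> \<in> Mon (Suc n) d" using k by (auto simp: Mon_def)
qed

lemma finite_Mon [simp]: "finite (Mon n d)"
  by (induction n arbitrary: d) (auto simp: Mon_0 Mon_Suc)

lemma card_Mon: "card (Mon n d) = (n + d) choose n"
proof (induction n arbitrary: d)
  case 0
  then show ?case by (simp add: Mon_0)
next
  case (Suc n)
  have inj: "inj_on (\<lambda>\<alpha>. \<alpha>(Suc n := k)) (Mon n e)" for k e
  proof (rule inj_onI)
    fix \<alpha> \<beta> assume h: "\<alpha> \<in> Mon n e" "\<beta> \<in> Mon n e" "\<alpha>(Suc n := k) = \<beta>(Suc n := k)"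
    show "\<alpha> = \<beta>"
    proof
      fix i show "\<alpha> i = \<beta> i" using fun_cong[OF h(3), of i] h(1,2) by (cases "i = Suc n") (auto simp: Mon_def)
    qed
  qed
  have "card (Mon (Suc n) d) = (\<Sum>k\<le>d. card ((\<lambda>\<alpha>. \<alpha>(Suc n := k)) ` Mon n (d - k)))"
    unfolding Mon_Suc by (rule card_UN_disjoint) (auto simp: fun_eq_iff, metis fun_upd_same)
  also have "\<dots> = (\<Sum>k\<le>d. (n + (d - k)) choose n)" using inj by (simp add: card_image Suc.IH)
  also have "\<dots> = (\<Sum>k\<le>d. (n + k) choose n)"
    by (rule sum.reindex_bij_witness[of _ "\<lambda>k. d - k" "\<lambda>k. d - k"]) auto
  also have "\<dots> = (n + d + 1) choose (n + 1)" by (rule choose_rising_sum(1))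
  finally show ?case by simp
qed

lemma digits_unique:
  fixes B :: nat
  assumes "\<And>i. i \<le> n \<Longrightarrow> \<alpha> i < B" "\<And>i. i \<le> n \<Longrightarrow> \<beta> i < B"
    and "(\<Sum>i\<le>n. \<alpha> i * B ^ i) = (\<Sum>i\<le>n. \<beta> i * B ^ i)" "i \<le> n"
  shows "\<alpha> i = \<beta> i"
  using assms
proof (induction n arbitrary: \<alpha> \<beta> i)
  case 0
  then show ?case by simp
next
  case (Suc n)
  have shift: "(\<Sum>i\<le>Suc n. \<gamma> i * B ^ i) = \<gamma> 0 + B * (\<Sum>i\<le>n. \<gamma> (Suc i) * B ^ i)" for \<gamma> :: "nat \<Rightarrow> nat"
    by (subst sum.atMost_Suc_shift) (simp add: sum_distrib_left mult_ac)
  have eq: "\<alpha> 0 + B * (\<Sum>i\<le>n. \<alpha> (Suc i) * B ^ i) = \<beta> 0 + B * (\<Sum>i\<le>n. \<beta> (Suc i) * B ^ i)"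
    using Suc.prems(3) unfolding shift .
  have lt: "\<alpha> 0 < B" "\<beta> 0 < B" using Suc.prems(1,2) by auto
  have 0: "\<alpha> 0 = \<beta> 0" using arg_cong[OF eq, of "\<lambda>x. x mod B"] lt by simp
  then have "(\<Sum>i\<le>n. \<alpha> (Suc i) * B ^ i) = (\<Sum>i\<le>n. \<beta> (Suc i) * B ^ i)" using eq lt by simp
  then have "\<alpha> (Suc j) = \<beta> (Suc j)" if "j \<le> n" for j
    using Suc.IH[of "\<lambda>i. \<alpha> (Suc i)" "\<lambda>i. \<beta> (Suc i)" j] Suc.prems(1,2) that by simp
  then show ?case using 0 Suc.prems(4) by (cases i) auto
qed

lemma Mon_le: "\<alpha> \<in> Mon n d \<Longrightarrow> \<alpha> i \<le> d"
  using member_le_sum[of i "{..n}" \<alpha>] by (cases "i \<le> n") (auto simp: Mon_def)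

text \<open>Kronecker substitution: putting \<open>t ^ (Suc d ^ i)\<close> for variable i sends
  distinct monomials to distinct powers of t, by uniqueness of digits in base d + 1.\<close>

lemma form_eval_zero_iff:
  assumes "\<And>x. form_eval n d F x = 0" "\<alpha> \<in> Mon n d"
  shows "F \<alpha> = 0"
proof -
  define e where "e = (\<lambda>\<alpha>::nat\<Rightarrow>nat. \<Sum>i\<le>n. \<alpha> i * Suc d ^ i)"
  define p where "p = (\<Sum>\<alpha>\<in>Mon n d. monom (F \<alpha>) (e \<alpha>))"
  have einj: "e \<beta> = e \<alpha> \<longleftrightarrow> \<beta> = \<alpha>" if "\<beta> \<in> Mon n d" for \<beta>
  proof
    assume eq: "e \<beta> = e \<alpha>"
    have "\<beta> i = \<alpha> i" if "i \<le> n" for i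
      by (rule digits_unique[of n \<beta> "Suc d" \<alpha>]) (use that assms(2) \<open>\<beta> \<in> Mon n d\<close> Mon_le eq in \<open>auto
          simp: e_def less_Suc_eq_le\<close>)
    moreover have "\<beta> i = \<alpha> i" if "\<not> i \<le> n" for i using that assms(2) \<open>\<beta> \<in> Mon n d\<close> by (auto simp: Mon_def)
    ultimately show "\<beta> = \<alpha>" by blast
  qed simp
  have "poly p t = form_eval n d F (\<lambda>i. t ^ (Suc d ^ i))" for t
    by (simp add: p_def poly_sum poly_monom form_eval_def e_def power_sum power_mult[symmetric] mult.commute)
  then have "poly p t = 0" for t using assms(1) by simp
  then have "p = 0" using poly_all_0_iff_0 by blast
  then have "0 = coeff p (e \<alpha>)" by simp
  also have "\<dots> = (\<Sum>\<beta>\<in>Mon n d. if \<beta> = \<alpha> then F \<alpha> else 0)"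
    unfolding p_def coeff_sum by (intro sum.cong refl) (simp add: einj)
  also have "\<dots> = F \<alpha>" using assms(2) by simp
  finally show ?thesis by simp
qed

lemma form_eval_lincomb: "form_eval n d (\<lambda>\<alpha>. \<Sum>a\<in>A. q a * F a \<alpha>) x = (\<Sum>a\<in>A. q a * form_eval n d (F a) x)"
  unfolding form_eval_def sum_distrib_left sum_distrib_right by (subst sum.swap) (simp add: mult_ac)

lemma form_eval_cmult: "form_eval n d (\<lambda>\<alpha>. c * F \<alpha>) x = c * form_eval n d F x"
  by (simp add: form_eval_def sum_distrib_left mult_ac)

lemma form_eval_add: "form_eval n d (\<lambda>\<alpha>. F \<alpha> + G \<alpha>) x = form_eval n d F x + form_eval n d G x"
  by (simp add: form_eval_def sum.distrib distrib_right)

lemma form_eval_diff: "form_eval n d (\<lambda>\<alpha>. F \<alpha> - G \<alpha>) x = form_eval n d F x - form_eval n d G x"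
  by (simp add: form_eval_def sum_subtractf left_diff_distrib)

lemma form_eval_cong: "(\<And>\<alpha>. \<alpha> \<in> Mon n d \<Longrightarrow> F \<alpha> = G \<alpha>) \<Longrightarrow> form_eval n d F x = form_eval n d G x"
  by (simp add: form_eval_def)

lemma form_eval_inject:
  assumes "F \<in> aff (Mon n d)" "G \<in> aff (Mon n d)" "\<And>x. form_eval n d F x = form_eval n d G x"
  shows "F = G"
proof
  fix \<alpha>
  show "F \<alpha> = G \<alpha>"
  proof (cases "\<alpha> \<in> Mon n d")
    case True
    have "F \<alpha> - G \<alpha> = 0"
      by (rule form_eval_zero_iff[where F = "\<lambda>\<alpha>. F \<alpha> - G \<alpha>", OF _ True]) (simp add: form_eval_diff assms(3))
    then show ?thesis by simp
  next
    case False
    then show ?thesis using assms(1,2) by (simp add: aff_def)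
  qed
qed

lemma pf_monomial: "(\<lambda>x. \<Prod>i\<le>n. x i ^ \<alpha> i) \<in> poly_fun {..n}"
  by (intro pf_prod pf_power poly_fun.pf_coord)

lemma pf_form_eval: "form_eval n d F \<in> poly_fun {..n}"
  unfolding form_eval_def by (intro pf_sum pf_cmult pf_monomial)

lemma pf_form_eval_coeffs:
  "(\<And>\<alpha>. \<alpha> \<in> Mon n d \<Longrightarrow> (\<lambda>p. C p \<alpha>) \<in> poly_fun J) \<Longrightarrow> (\<lambda>p. form_eval n d (C p) x) \<in> poly_fun J"
  unfolding form_eval_def by (intro pf_sum pf_mult pf_const) auto

lemma form_eval_dd:
  assumes "\<And>\<alpha>. \<alpha> \<in> Mon n d \<Longrightarrow> (\<lambda>p. C p \<alpha>) \<in> poly_fun J"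
  shows "form_eval n d (\<lambda>\<alpha>. dd (\<lambda>p. C p \<alpha>) p v) x = dd (\<lambda>p. form_eval n d (C p) x) p v"
proof -
  have "dd (\<lambda>p. C p \<alpha> * c) p v = dd (\<lambda>p. C p \<alpha>) p v * c" if "\<alpha> \<in> Mon n d" for \<alpha> c
    using dd_mult[OF assms[OF that] pf_const] by simp
  then show ?thesis unfolding form_eval_def
    by (subst dd_sum[where I = J]) (auto intro!: pf_mult pf_const assms)
qed

text \<open>Families of forms are given by formulas for their values \<Phi>, while the dimension
  criteria need coefficient vectors C that depend polynomially on the parameters; the predicate ties
  the two together.\<close>

definition pform :: "'j set \<Rightarrow> nat \<Rightarrow> nat \<Rightarrow> (('j \<Rightarrow> complex) \<Rightarrow> (nat \<Rightarrow> complex) \<Rightarrow> complex) \<Rightarrow>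
    (('j \<Rightarrow> complex) \<Rightarrow> (nat \<Rightarrow> nat) \<Rightarrow> complex) \<Rightarrow> bool" where
  "pform J n d \<Phi> C \<longleftrightarrow> (\<forall>\<alpha>. (\<lambda>p. C p \<alpha>) \<in> poly_fun J) \<and> range C \<subseteq> aff (Mon n d) \<and>
     (\<forall>p x. form_eval n d (C p) x = \<Phi> p x)"

lemma pformD:
  assumes "pform J n d \<Phi> C"
  shows "(\<lambda>p. C p \<alpha>) \<in> poly_fun J" "range C \<subseteq> aff (Mon n d)" "C p \<in> aff (Mon n d)" "form_eval n d (C p) x = \<Phi> p x"
  using assms unfolding pform_def by auto

lemma pform_add:
  assumes "pform J n d \<Phi> C" "pform J n d \<Psi> D"
  shows "pform J n d (\<lambda>p x. \<Phi> p x + \<Psi> p x) (\<lambda>p \<alpha>. C p \<alpha> + D p \<alpha>)"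
  using assms unfolding pform_def by (auto simp: form_eval_add aff_def image_subset_iff intro: poly_fun.intros)

lemma pform_cmult:
  assumes "pform J n d \<Phi> C" "c \<in> poly_fun J"
  shows "pform J n d (\<lambda>p x. c p * \<Phi> p x) (\<lambda>p \<alpha>. c p * C p \<alpha>)"
  using assms unfolding pform_def by (auto simp: form_eval_cmult aff_def image_subset_iff intro: poly_fun.intros)

lemma pform_sum:
  assumes "finite A" "\<And>a. a \<in> A \<Longrightarrow> pform J n d (\<Phi> a) (C a)"
  shows "pform J n d (\<lambda>p x. \<Sum>a\<in>A. \<Phi> a p x) (\<lambda>p \<alpha>. \<Sum>a\<in>A. C a p \<alpha>)"
  using assms
proof (induction A rule: finite_induct)
  case empty
  then show ?case by (auto simp: pform_def form_eval_def aff_def intro: poly_fun.intros)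
next
  case (insert a A)
  then show ?case using pform_add[of J n d "\<Phi> a" "C a"] by simp
qed

lemma pform_coeffs:
  assumes "\<And>\<alpha>. \<alpha> \<in> Mon n d \<Longrightarrow> c \<alpha> \<in> poly_fun J"
  shows "pform J n d (\<lambda>p. form_eval n d (\<lambda>\<alpha>. c \<alpha> p)) (\<lambda>p \<alpha>. if \<alpha> \<in> Mon n d then c \<alpha> p else 0)"
  unfolding pform_def
  by (auto simp: aff_def intro!: pf_if assms poly_fun.intros form_eval_cong)

lemma pform_mult:
  assumes "pform J n d \<Phi> C" "pform J n e \<Psi> D"
  shows "\<exists>E. pform J n (d + e) (\<lambda>p x. \<Phi> p x * \<Psi> p x) E"
proof -
  define E where "E = (\<lambda>p \<gamma>. \<Sum>\<alpha>\<in>Mon n d. \<Sum>\<beta>\<in>Mon n e. if (\<lambda>i. \<alpha> i + \<beta> i) = \<gamma> then C p \<alpha> * D p \<beta> else 0)"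
  have in_Mon: "(\<lambda>i. \<alpha> i + \<beta> i) \<in> Mon n (d + e)" if "\<alpha> \<in> Mon n d" "\<beta> \<in> Mon n e" for \<alpha> \<beta>
    using that by (auto simp: Mon_def sum.distrib)
  have "form_eval n (d + e) (E p) x = \<Phi> p x * \<Psi> p x" for p x
  proof -
    have "form_eval n (d + e) (E p) x = (\<Sum>\<gamma>\<in>Mon n (d + e). \<Sum>\<alpha>\<in>Mon n d. \<Sum>\<beta>\<in>Mon n e.
        if (\<lambda>i. \<alpha> i + \<beta> i) = \<gamma> then C p \<alpha> * D p \<beta> * (\<Prod>i\<le>n. x i ^ \<gamma> i) else 0)"
      unfolding form_eval_def E_def sum_distrib_right by (intro sum.cong refl) auto
    also have "\<dots> = (\<Sum>\<alpha>\<in>Mon n d. \<Sum>\<beta>\<in>Mon n e. \<Sum>\<gamma>\<in>Mon n (d + e).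
        if (\<lambda>i. \<alpha> i + \<beta> i) = \<gamma> then C p \<alpha> * D p \<beta> * (\<Prod>i\<le>n. x i ^ \<gamma> i) else 0)"
      by (subst sum.swap, subst sum.swap[of _ "Mon n e"]) simp
    also have "\<dots> = (\<Sum>\<alpha>\<in>Mon n d. \<Sum>\<beta>\<in>Mon n e. C p \<alpha> * D p \<beta> * (\<Prod>i\<le>n. x i ^ (\<alpha> i + \<beta> i)))"
      using in_Mon by (intro sum.cong refl) simp
    also have "\<dots> = form_eval n d (C p) x * form_eval n e (D p) x"
      unfolding form_eval_def sum_product by (intro sum.cong refl) (simp add: power_add prod.distrib mult_ac)
    finally show ?thesis using assms by (simp add: pform_def)
  qed
  moreover have "E p \<in> aff (Mon n (d + e))" for p
    unfolding aff_def E_def by (auto intro!: sum.neutral dest: in_Mon)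
  moreover have "(\<lambda>p. E p \<gamma>) \<in> poly_fun J" for \<gamma>
    unfolding E_def by (intro pf_sum pf_if pf_mult pformD(1)[OF assms(1)] pformD(1)[OF assms(2)] pf_const)
  ultimately show ?thesis unfolding pform_def by (intro exI[of _ E]) auto
qed

lemma Mon_unit: "i \<le> n \<Longrightarrow> (\<lambda>k. if k = i then 1 else 0) \<in> Mon n 1"
  by (auto simp: Mon_def)

lemma form_eval_single:
  assumes "\<alpha> \<in> Mon n d"
  shows "form_eval n d (\<lambda>\<beta>. if \<beta> = \<alpha> then c else 0) x = c * (\<Prod>i\<le>n. x i ^ \<alpha> i)"
  using assms by (simp add: form_eval_def if_distrib[of "\<lambda>c. c * _"] cong: if_cong)

lemma pform_coord:
  assumes "i \<le> n"
  shows "\<exists>C. pform J n 1 (\<lambda>p x. x i) C"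
proof -
  have "(\<Prod>k\<le>n. x k ^ (if k = i then 1 else 0)) = x i" for x :: "nat \<Rightarrow> complex"
    using assms by (simp add: if_distrib[of "\<lambda>e. _ ^ e"] cong: if_cong)
  then have "pform J n 1 (\<lambda>p x. x i) (\<lambda>p \<beta>. if \<beta> = (\<lambda>k. if k = i then 1 else 0) then 1 else 0)"
    unfolding pform_def using assms Mon_unit[OF assms]
    by (auto simp: form_eval_single aff_def intro!: pf_if pf_const)
  then show ?thesis by blast
qed

lemma pform_linear:
  assumes "\<And>i. i \<le> n \<Longrightarrow> c i \<in> poly_fun J"
  shows "\<exists>C. pform J n 1 (\<lambda>p x. \<Sum>i\<le>n. c i p * x i) C"
proof -
  have "\<forall>i\<in>{..n}. \<exists>C. pform J n 1 (\<lambda>p x. x i) C" using pform_coord by blast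
  then obtain C where C: "\<forall>i\<in>{..n}. pform J n 1 (\<lambda>p x. x i) (C i)" by (rule bchoice[THEN exE])
  have "pform J n 1 (\<lambda>p x. \<Sum>i\<in>{..n}. c i p * x i) (\<lambda>p \<alpha>. \<Sum>i\<in>{..n}. c i p * C i p \<alpha>)"
    by (rule pform_sum) (use C assms in \<open>auto intro: pform_cmult\<close>)
  then show ?thesis by blast
qed

text \<open>A form is determined by its values, so a dependence between derivatives of coefficient
  vectors can be tested on derivatives of values.\<close>

lemma lin_indep_form_derivatives:
  assumes "pform J n d \<Phi> C" "S \<subseteq> J"
    and "\<And>q. (\<And>x. (\<Sum>j\<in>S. q j * pd (\<lambda>p. \<Phi> p x) j p0) = 0) \<Longrightarrow> (\<And>j. j \<in> S \<Longrightarrow> q j = 0)"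
  shows "lin_indep S (Mon n d) (\<lambda>j \<alpha>. pd (\<lambda>p. C p \<alpha>) j p0)"
  unfolding lin_indep_def
proof (intro allI impI ballI)
  fix q j assume q: "\<forall>\<alpha>\<in>Mon n d. (\<Sum>j\<in>S. q j * pd (\<lambda>p. C p \<alpha>) j p0) = 0" and j: "j \<in> S"
  have "(\<Sum>j\<in>S. q j * pd (\<lambda>p. \<Phi> p x) j p0) = 0" for x
  proof -
    have "(\<Sum>j\<in>S. q j * pd (\<lambda>p. \<Phi> p x) j p0) = (\<Sum>j\<in>S. q j * form_eval n d (\<lambda>\<alpha>. pd (\<lambda>p. C p \<alpha>) j p0) x)"
      unfolding pd_def using assms(1) by (subst form_eval_dd[where J = J]) (auto simp: pform_def)
    also have "\<dots> = form_eval n d (\<lambda>\<alpha>. \<Sum>j\<in>S. q j * pd (\<lambda>p. C p \<alpha>) j p0) x" by (rule form_eval_lincomb[symmetric])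
    also have "\<dots> = 0" using q by (simp add: form_eval_def)
    finally show ?thesis .
  qed
  then show "q j = 0" using assms(3) j by blast
qed

section \<open>Secant cones of Veronese varieties\<close>

definition pt :: "(nat \<times> nat \<Rightarrow> complex) \<Rightarrow> nat \<Rightarrow> nat \<Rightarrow> complex" where
  "pt p j = (\<lambda>i. p (j, i))"

definition vsum :: "nat \<Rightarrow> nat \<Rightarrow> nat \<Rightarrow> (nat \<times> nat \<Rightarrow> complex) \<Rightarrow> (nat \<Rightarrow> nat) \<Rightarrow> complex" where
  "vsum n d k p \<alpha> = (\<Sum>j<k. ver n d (pt p j) \<alpha>)"

abbreviation prm :: "nat \<Rightarrow> nat \<Rightarrow> (nat \<times> nat) set" where
  "prm k n \<equiv> {..<k} \<times> {..n}"

lemma vsum_poly: "(\<lambda>p. vsum n d k p \<alpha>) \<in> poly_fun (prm k n)"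
  unfolding vsum_def ver_def pt_def
  by (intro pf_sum pf_if pf_prod pf_power poly_fun.pf_coord pf_const) auto

lemma vsum_aff: "range (vsum n d k) \<subseteq> aff (Mon n d)"
  by (auto simp: vsum_def aff_def ver_def)

lemma sec_cone_eq: "sec_cone n d k = zclosure (Mon n d) (range (vsum n d k))"
proof -
  have "{(\<lambda>\<alpha>. \<Sum>j<k. ver n d (l j) \<alpha>) | l :: nat \<Rightarrow> nat \<Rightarrow> complex. True} = range (vsum n d k)"
  proof (intro set_eqI iffI)
    fix x assume "x \<in> {(\<lambda>\<alpha>. \<Sum>j<k. ver n d (l j) \<alpha>) | l :: nat \<Rightarrow> nat \<Rightarrow> complex. True}"
    then obtain l :: "nat \<Rightarrow> nat \<Rightarrow> complex" where "x = (\<lambda>\<alpha>. \<Sum>j<k. ver n d (l j) \<alpha>)" by blast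
    then have "x = vsum n d k (\<lambda>(j, i). l j i)" by (auto simp: vsum_def pt_def fun_eq_iff)
    then show "x \<in> range (vsum n d k)" by simp
  next
    fix x assume "x \<in> range (vsum n d k)"
    then obtain p where "x = vsum n d k p" by (rule rangeE)
    then have "x = (\<lambda>\<alpha>. \<Sum>j<k. ver n d (pt p j) \<alpha>)" by (auto simp: vsum_def)
    then show "x \<in> {(\<lambda>\<alpha>. \<Sum>j<k. ver n d (l j) \<alpha>) | l :: nat \<Rightarrow> nat \<Rightarrow> complex. True}" by blast
  qed
  then show ?thesis unfolding sec_cone_def by simp
qed

definition sing :: "nat \<Rightarrow> nat \<Rightarrow> ((nat \<Rightarrow> nat) \<Rightarrow> complex) \<Rightarrow> (nat \<Rightarrow> complex) \<Rightarrow> bool" where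
  "sing n d F x \<longleftrightarrow> (\<forall>i\<le>n. pd (form_eval n d F) i x = 0)"

text \<open>Terracini: a form annihilates the tangent space of the secant cone at the sum of the powers of
  the points iff it is singular at these points.\<close>

lemma pairing_vsum_derivative:
  assumes "j < k" "i \<le> n"
  shows "(\<Sum>\<alpha>\<in>Mon n d. F \<alpha> * pd (\<lambda>p. vsum n d k p \<alpha>) (j, i) p) = pd (form_eval n d F) i (pt p j)"
proof -
  have pfj: "(\<lambda>p. form_eval n d F (pt p j)) \<in> poly_fun (prm k n)" if "j < k" for j
    unfolding pt_def using that by (intro pf_comp[OF pf_form_eval]) (auto intro: poly_fun.intros)
  have "(\<Sum>\<alpha>\<in>Mon n d. F \<alpha> * pd (\<lambda>p. vsum n d k p \<alpha>) (j, i) p)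
      = dd (\<lambda>p. \<Sum>\<alpha>\<in>Mon n d. F \<alpha> * vsum n d k p \<alpha>) p (ax (j, i))"
    by (subst dd_sum[where I = "prm k n"]) (auto intro!: pf_cmult vsum_poly sum.cong
        simp: pd_def dd_cmult[OF vsum_poly])
  also have "(\<lambda>p. \<Sum>\<alpha>\<in>Mon n d. F \<alpha> * vsum n d k p \<alpha>) = (\<lambda>p. \<Sum>j<k. form_eval n d F (pt p j))"
    unfolding vsum_def form_eval_def sum_distrib_left
    by (subst sum.swap) (auto simp: ver_def intro!: sum.cong)
  also have "dd \<dots> p (ax (j, i)) = (\<Sum>j'<k. dd (\<lambda>p. form_eval n d F (pt p j')) p (ax (j, i)))"
    by (rule dd_sum[OF pfj]) auto
  also have "\<dots> = (\<Sum>j'<k. if j' = j then pd (form_eval n d F) i (pt p j) else 0)"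
  proof (intro sum.cong refl)
    fix j' 
    have "pt (\<lambda>x. p x + t * ax (j, i) x) j' = (\<lambda>x. pt p j' x + t * (if j' = j then ax i x else 0))" for t
      by (auto simp: pt_def ax_def)
    then have "dd (\<lambda>p. form_eval n d F (pt p j')) p (ax (j, i))
        = dd (form_eval n d F) (pt p j') (if j' = j then ax i else (\<lambda>_. 0))"
      unfolding dd_def by (auto intro!: arg_cong[where f = "\<lambda>f. deriv f 0"])
    then show "dd (\<lambda>p. form_eval n d F (pt p j')) p (ax (j, i))
        = (if j' = j then pd (form_eval n d F) i (pt p j) else 0)"
      by (auto simp: pd_def dd_def)
  qed
  also have "\<dots> = pd (form_eval n d F) i (pt p j)" using assms by simp
  finally show ?thesis .
qed

lemma ann_vsum: "F \<in> ann (Mon n d) (prm k n) (vsum n d k) p \<longleftrightarrow> F \<in> aff (Mon n d) \<and> (\<forall>j<k. sing n d F (pt p j))"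
  by (auto simp: ann_def sing_def pairing_vsum_derivative)

text \<open>The parametrisation of the secant cone is an immersion at p. Dually, the
  \<open>k * Suc n\<close> conditions on a form to be singular at the k points are
  independent.\<close>

definition nondeg :: "nat \<Rightarrow> nat \<Rightarrow> nat \<Rightarrow> (nat \<times> nat \<Rightarrow> complex) \<Rightarrow> bool" where
  "nondeg n d k p \<longleftrightarrow> lin_indep (prm k n) (Mon n d) (\<lambda>j \<alpha>. pd (\<lambda>p. vsum n d k p \<alpha>) j p)"

lemma singular_in_zdual:
  assumes "nondeg n d k p" "k > 0" "F \<in> aff (Mon n d)" "\<And>j. j < k \<Longrightarrow> sing n d F (pt p j)"
  shows "F \<in> zdual (Mon n d) (sec_cone n d k)"
proof -
  have "ann (Mon n d) (prm k n) (vsum n d k) p \<subseteq> zdual (Mon n d) (sec_cone n d k)"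
    unfolding sec_cone_eq using assms(1,2)
    by (intro ann_subset_zdual vsum_poly vsum_aff) (auto simp: nondeg_def)
  then show ?thesis using assms(3,4) ann_vsum by blast
qed

text \<open>S may be any Zariski dense set of configurations, which lets each case add its own open
  conditions to \<open>nondeg\<close>.\<close>

lemma zdual_subset_singular:
  assumes "\<And>f p. f \<in> poly_fun (prm k n) \<Longrightarrow> (\<And>q. q \<in> S \<Longrightarrow> f q = 0) \<Longrightarrow> f p = 0"
    and "\<And>p F. p \<in> S \<Longrightarrow> F \<in> aff (Mon n d) \<Longrightarrow> (\<And>j. j < k \<Longrightarrow> sing n d F (pt p j)) \<Longrightarrow> F \<in> W"
  shows "zdual (Mon n d) (sec_cone n d k) \<subseteq> zclosure (Mon n d) W"
proof -
  have "zdual (Mon n d) (sec_cone n d k) \<subseteq> zclosure (Mon n d) (\<Union>p\<in>S. ann (Mon n d) (prm k n) (vsum n d k) p)"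
    unfolding sec_cone_eq
  proof (rule zdual_subset_ann[where J = "prm k n"])
    show "f p = 0" if "f \<in> poly_fun (prm k n)" "\<And>q. q \<in> S \<Longrightarrow> f q = 0" for f p using that by (rule assms(1))
  qed (auto intro: vsum_poly vsum_aff[THEN subsetD])
  also have "\<dots> \<subseteq> zclosure (Mon n d) W"
    by (rule zclosure_mono) (use assms(2) ann_vsum in blast)
  finally show ?thesis .
qed

lemma nondeg_open:
  assumes "nondeg n d k p0"
  shows "\<exists>D\<in>poly_fun (prm k n). D p0 \<noteq> 0 \<and> (\<forall>p. D p \<noteq> 0 \<longrightarrow> nondeg n d k p)"
  using lin_indep_open[where m = "\<lambda>j p \<alpha>. pd (\<lambda>p. vsum n d k p \<alpha>) j p" and R = "prm k n" and I = "Mon n d"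
      and J = "prm k n" and ?p0.0 = p0]
    assms pf_pd[OF vsum_poly] unfolding nondeg_def by auto

lemma nondeg_near:
  assumes "nondeg n d k p0"
  shows "\<exists>e>0. \<forall>p. (\<forall>j<k. \<forall>i\<le>n. norm (pt p j i - pt p0 j i) < e) \<longrightarrow> nondeg n d k p"
proof -
  obtain D where D: "D \<in> poly_fun (prm k n)" "D p0 \<noteq> 0" "\<forall>p. D p \<noteq> 0 \<longrightarrow> nondeg n d k p"
    using nondeg_open[OF assms] by blast
  obtain e where e: "e > 0" "\<forall>x. (\<forall>i\<in>prm k n. norm (x i - p0 i) < e) \<longrightarrow> D x \<noteq> 0"
    using pf_nonzero_near[OF D(1) _ D(2)] by auto
  show ?thesis
  proof (intro exI[of _ e] conjI allI impI e(1))
    fix p assume "\<forall>j<k. \<forall>i\<le>n. norm (pt p j i - pt p0 j i) < e"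
    then have "\<forall>i\<in>prm k n. norm (p i - p0 i) < e" by (auto simp: pt_def)
    then show "nondeg n d k p" using e(2) D(3) by blast
  qed
qed

lemma nondeg_dense:
  assumes "nondeg n d k p0" "f \<in> poly_fun (prm k n)" "\<And>q. nondeg n d k q \<Longrightarrow> f q = 0"
  shows "f p = 0"
proof -
  obtain D where D: "D \<in> poly_fun (prm k n)" "D p0 \<noteq> 0" "\<forall>p. D p \<noteq> 0 \<longrightarrow> nondeg n d k p"
    using nondeg_open[OF assms(1)] by blast
  then show ?thesis using pf_dense[OF assms(2) D(1,2)] assms(3) by blast
qed

text \<open>Independent conditions leave a space of dimension
  \<open>card (Mon n d) - k * Suc n\<close>. Applied to an unknown singular form and enough known
  ones, the dependence expresses the unknown form by the others.\<close>

lemma nondeg_singular_dim: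
  assumes "nondeg n d k p" "finite A" "card (Mon n d) < k * Suc n + card A"
    and "\<And>a. a \<in> A \<Longrightarrow> F a \<in> aff (Mon n d)" "\<And>a j. a \<in> A \<Longrightarrow> j < k \<Longrightarrow> sing n d (F a) (pt p j)"
  shows "\<exists>q. (\<exists>a\<in>A. q a \<noteq> 0) \<and> (\<forall>x. (\<Sum>a\<in>A. q a * form_eval n d (F a) x) = 0)"
proof -
  have "\<exists>q. (\<exists>a\<in>A. q a \<noteq> 0) \<and> (\<forall>i\<in>Mon n d. (\<Sum>a\<in>A. q a * F a i) = 0)"
  proof (rule annihilator_dim[OF _ _ assms(2)])
    show "lin_indep (prm k n) (Mon n d) (\<lambda>j \<alpha>. pd (\<lambda>p. vsum n d k p \<alpha>) j p)" using assms(1) by (simp add: nondeg_def)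
    show "card (Mon n d) < card (prm k n) + card A" using assms(3) by (simp add: card_cartesian_product)
    fix a r assume "a \<in> A" "r \<in> prm k n"
    then show "(\<Sum>i\<in>Mon n d. F a i * pd (\<lambda>p. vsum n d k p i) r p) = 0"
      using assms(4,5) ann_vsum[of "F a" n d k p] unfolding ann_def by blast
  qed auto
  then obtain q where q: "\<exists>a\<in>A. q a \<noteq> 0" "\<forall>i\<in>Mon n d. (\<Sum>a\<in>A. q a * F a i) = 0" by blast
  have "(\<Sum>a\<in>A. q a * form_eval n d (F a) x) = 0" for x
    unfolding form_eval_lincomb[symmetric] using q(2) by (simp add: form_eval_def)
  then show ?thesis using q(1) by blast
qed

text \<open>B contains as many monomials as the expected dimension of the space of singular forms;
  when the singular forms without these monomials are all zero, no dimension is in excess.\<close>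

lemma nondeg_witness:
  assumes "finite B" "card (Mon n d) = k * Suc n + card B" "B \<subseteq> Mon n d"
    and "\<And>F. F \<in> aff (Mon n d) \<Longrightarrow> (\<And>j. j < k \<Longrightarrow> sing n d F (pt p j)) \<Longrightarrow> (\<And>\<alpha>. \<alpha> \<in> B \<Longrightarrow> F \<alpha> = 0)
        \<Longrightarrow> (\<And>\<alpha>. \<alpha> \<in> Mon n d \<Longrightarrow> F \<alpha> = 0)"
  shows "nondeg n d k p"
  unfolding nondeg_def
proof (rule lin_indep_of_annihilator[of _ _ B id])
  show "card (Mon n d) = card (prm k n) + card B" using assms(2) by (simp add: card_cartesian_product)
  fix F \<alpha> assume F: "\<And>r. r \<in> prm k n \<Longrightarrow> (\<Sum>i\<in>Mon n d. F i * pd (\<lambda>p. vsum n d k p i) r p) = 0"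
    "\<And>b. b \<in> B \<Longrightarrow> F (id b) = 0" "\<alpha> \<in> Mon n d"
  define F' where "F' = (\<lambda>\<alpha>. if \<alpha> \<in> Mon n d then F \<alpha> else 0)"
  have "F' \<in> ann (Mon n d) (prm k n) (vsum n d k) p" using F(1) by (auto simp: ann_def F'_def aff_def)
  then have "F' \<alpha> = 0"
    using ann_vsum assms(4)[of F'] F(2,3) by (auto simp: F'_def)
  then show "F \<alpha> = 0" using F(3) by (simp add: F'_def)
qed (use assms(1,3) in auto)

lemma sing_mult:
  assumes "\<And>x. form_eval n d F x = g x * h x" "g \<in> poly_fun {..n}" "h \<in> poly_fun {..n}" "g x = 0" "h x = 0"
  shows "sing n d F x"
proof -
  have "form_eval n d F = (\<lambda>x. g x * h x)" using assms(1) by auto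
  then show ?thesis using assms by (auto simp: sing_def pd_mult_eq)
qed

section \<open>Persistence of solutions\<close>

text \<open>The map f sending (t, z) to (t, \<Phi> (t, z)) has a derivative with right inverse
  \<open>g'\<close>. By an open mapping theorem that asks only for such a right inverse, its image
  of a small ball contains all (t, 0) with t small, and each preimage is a solution.\<close>

lemma persist:
  fixes \<Phi> :: "complex \<times> 'a::euclidean_space \<Rightarrow> 'b::euclidean_space"
  assumes cont: "continuous_on UNIV \<Phi>" and der: "(\<Phi> has_derivative D) (at (0, 0))"
    and zero: "\<Phi> (0, 0) = 0" and surj: "surj (\<lambda>z. D (0, z))" and e: "e > 0"
  shows "\<exists>\<delta>>0. \<forall>t. norm t < \<delta> \<longrightarrow> (\<exists>z. norm z < e \<and> \<Phi> (t, z) = 0)"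
proof -
  have bl: "bounded_linear D" using der by (rule has_derivative_bounded_linear)
  then interpret D: bounded_linear D .
  have "bounded_linear (\<lambda>z. D (0, z))"
    by (intro bounded_linear_compose[OF bl] bounded_linear_Pair bounded_linear_zero bounded_linear_ident)
  then have lin: "linear (\<lambda>z. D (0, z))" by (rule bounded_linear.linear)
  obtain g where g: "linear g" "(\<lambda>z. D (0, z)) \<circ> g = id"
    using linear_surjective_right_inverse[OF lin surj] by blast
  have Dg: "D (0, g w) = w" for w using fun_cong[OF g(2), of w] by simp
  have blg: "bounded_linear g" using g(1) linear_conv_bounded_linear by blast
  define f where "f = (\<lambda>y. (fst y, \<Phi> y))"
  define f' where "f' = (\<lambda>y. (fst y, D y))"
  define g' where "g' = (\<lambda>y. (fst y, g (snd y - D (fst y, 0))))"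
  have "f (0, 0) \<in> interior (f ` ball (0, 0) e)"
  proof (rule sussmann_open_mapping[of UNIV f "(0,0)" f' g'])
    show "continuous_on UNIV f" unfolding f_def by (intro continuous_intros cont)
    show "(f has_derivative f') (at (0, 0))" unfolding f_def f'_def
      by (intro derivative_intros has_derivative_Pair der)
    show "bounded_linear g'" unfolding g'_def
      by (intro bounded_linear_Pair bounded_linear_fst bounded_linear_compose[OF blg] bounded_linear_sub
          bounded_linear_snd bounded_linear_compose[OF bl] bounded_linear_zero)
    show "f' \<circ> g' = id"
    proof
      fix y :: "complex \<times> 'b"
      have "D (fst y, g (snd y - D (fst y, 0))) = D (fst y, 0) + D (0, g (snd y - D (fst y, 0)))"
        unfolding D.add[symmetric] by simp
      then show "(f' \<circ> g') y = id y" unfolding f'_def g'_def by (simp add: Dg)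
    qed
    show "(0, 0) \<in> interior (ball (0, 0) e :: (complex \<times> 'a) set)" using e by simp
  qed auto
  then obtain \<delta> where \<delta>: "\<delta> > 0" "ball (f (0, 0)) \<delta> \<subseteq> f ` ball (0, 0) e" by (auto simp: mem_interior)
  show ?thesis
  proof (intro exI[of _ \<delta>] conjI allI impI \<delta>(1))
    fix t :: complex assume t: "norm t < \<delta>"
    have "(t, 0) \<in> ball (f (0, 0)) \<delta>" using t zero by (simp add: f_def dist_norm norm_Pair)
    then have "(t, 0) \<in> f ` ball (0, 0) e" using \<delta>(2) by blast
    then obtain y where y: "y \<in> ball (0, 0) e" "(t, 0) = f y" by blast
    then have "y = (t, snd y)" "\<Phi> y = 0" by (auto simp: f_def prod_eq_iff)
    moreover have "norm (snd y) \<le> norm y" by (metis norm_snd_le prod.collapse)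
    ultimately show "\<exists>z. norm z < e \<and> \<Phi> (t, z) = 0"
      using y(1) by (intro exI[of _ "snd y"]) (auto simp: dist_norm norm_minus_commute,
          metis prod.collapse zero_prod_def diff_zero le_less_trans)
  qed
qed

section \<open>Monomials as lists of exponents\<close>

definition expo :: "nat list \<Rightarrow> nat \<Rightarrow> nat" where
  "expo xs = (\<lambda>k. if k < length xs then xs ! k else 0)"

fun monl :: "nat \<Rightarrow> nat \<Rightarrow> nat list list" where
  "monl 0 d = [[d]]"
| "monl (Suc n) d = concat (map (\<lambda>k. map (\<lambda>xs. xs @ [k]) (monl n (d - k))) [0..<Suc d])"

lemma monl_length: "xs \<in> set (monl n d) \<Longrightarrow> length xs = Suc n"
  by (induction n arbitrary: d xs) auto

lemma expo_snoc: "length xs = Suc n \<Longrightarrow> expo (xs @ [k]) = (expo xs)(Suc n := k)"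
  by (auto simp: expo_def fun_eq_iff nth_append)

lemma Mon_monl: "Mon n d = expo ` set (monl n d)"
proof (induction n arbitrary: d)
  case 0
  then show ?case by (auto simp: Mon_0 expo_def fun_eq_iff)
next
  case (Suc n)
  have "Mon (Suc n) d = (\<Union>k\<in>{..d}. (\<lambda>xs. (expo xs)(Suc n := k)) ` set (monl n (d - k)))"
    unfolding Mon_Suc Suc.IH by (simp add: image_image)
  also have "\<dots> = (\<Union>k\<in>{..d}. (\<lambda>xs. expo (xs @ [k])) ` set (monl n (d - k)))"
    using expo_snoc monl_length by (intro SUP_cong refl image_cong) metis
  also have "\<dots> = expo ` set (monl (Suc n) d)" by (simp del: upt_Suc add: image_UN image_image atLeast0LessThan
      lessThan_Suc_atMost)
  finally show ?case .
qed

lemma expo_inj: "length xs = length ys \<Longrightarrow> expo xs = expo ys \<Longrightarrow> xs = ys"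
  by (rule nth_equalityI) (auto simp: expo_def fun_eq_iff, metis)

lemma distinct_monl: "distinct (monl n d)"
proof (induction n arbitrary: d)
  case (Suc n)
  have "distinct (concat (map (\<lambda>k. map (\<lambda>xs. xs @ [k]) (monl n (d - k))) ks))" if "distinct ks" for ks
    using that by (induction ks) (auto simp: distinct_map Suc.IH inj_on_def)
  then show ?case by (simp del: upt_Suc)
qed simp

lemma sum_Mon: "(\<Sum>\<alpha>\<in>Mon n d. g \<alpha>) = (\<Sum>xs\<leftarrow>monl n d. g (expo xs))"
proof -
  have "inj_on expo (set (monl n d))" using expo_inj monl_length by (intro inj_onI) metis
  then have "(\<Sum>\<alpha>\<in>Mon n d. g \<alpha>) = (\<Sum>xs\<in>set (monl n d). g (expo xs))"
    unfolding Mon_monl by (simp add: sum.reindex)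
  then show ?thesis by (simp add: sum_list_distinct_conv_sum_set distinct_monl)
qed

lemma pd_power: "f \<in> poly_fun I \<Longrightarrow> pd (\<lambda>x. f x ^ m) i = (\<lambda>x. of_nat m * f x ^ (m - 1) * pd f i x)"
proof (induction m)
  case (Suc m)
  then have "pd (\<lambda>x. f x * f x ^ m) i = (\<lambda>x. pd f i x * f x ^ m + f x * (of_nat m * f x ^ (m - 1) * pd f i x))"
    by (simp add: pd_mult_eq[OF Suc.prems pf_power[OF Suc.prems]])
  also have "\<dots> = (\<lambda>x. of_nat (Suc m) * f x ^ m * pd f i x)"
    by (cases m) (auto simp: fun_eq_iff algebra_simps)
  finally show ?case by simp
qed simp

lemma pd_monomial:
  fixes n :: nat
  shows
  "pd (\<lambda>x. \<Prod>k\<le>n. x k ^ \<alpha> k) i x =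
    (if i \<le> n then \<Prod>k\<le>n. if k = i then of_nat (\<alpha> k) * x k ^ (\<alpha> k - 1) else x k ^ \<alpha> k else 0)"
proof (induction n)
  case 0
  then show ?case using pd_power[OF pf_coord[of 0 UNIV], of "\<alpha> 0" i] by (auto simp: fun_eq_iff)
next
  case (Suc n)
  have "pd (\<lambda>x. (\<Prod>k\<le>n. x k ^ \<alpha> k) * x (Suc n) ^ \<alpha> (Suc n)) i x
      = pd (\<lambda>x. \<Prod>k\<le>n. x k ^ \<alpha> k) i x * x (Suc n) ^ \<alpha> (Suc n)
        + (\<Prod>k\<le>n. x k ^ \<alpha> k) * (of_nat (\<alpha> (Suc n)) * x (Suc n) ^ (\<alpha> (Suc n) - 1) * pd (\<lambda>x. x (Suc n)) i x)"
    using pd_mult_eq[of "\<lambda>x. \<Prod>k\<le>n. x k ^ \<alpha> k" UNIV "\<lambda>x. x (Suc n) ^ \<alpha> (Suc n)" i]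
    by (simp add: pf_prod pf_power poly_fun.pf_coord pd_power[OF pf_coord[of "Suc n" UNIV]])
  moreover have "(\<Prod>k\<le>n. if k = Suc n then of_nat (\<alpha> k) * x k ^ (\<alpha> k - 1) else x k ^ \<alpha> k) = (\<Prod>k\<le>n. x k ^ \<alpha> k)"
    by (intro prod.cong) auto
  ultimately show ?case using Suc by auto
qed

text \<open>The derivative becomes a sum over an explicit list, which rewriting can expand and
  simplify at points with few non-zero coordinates.\<close>

lemma pd_form_eval:
  assumes "i \<le> n"
  shows "pd (form_eval n d F) i x = (\<Sum>xs\<leftarrow>monl n d. F (expo xs) *
    (\<Prod>k\<leftarrow>[0..<Suc n]. if k = i then of_nat (xs ! k) * x k ^ (xs ! k - 1) else x k ^ (xs ! k)))"
proof -
  have "pd (form_eval n d F) i x = (\<Sum>\<alpha>\<in>Mon n d. F \<alpha> * pd (\<lambda>x. \<Prod>k\<le>n. x k ^ \<alpha> k) i x)"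
    unfolding form_eval_def pd_def
    by (subst dd_sum[where I = "{..n}"]) (auto intro!: pf_cmult pf_monomial sum.cong dd_cmult[OF pf_monomial])
  also have "\<dots> = (\<Sum>xs\<leftarrow>monl n d. F (expo xs) * (\<Prod>k\<le>n. if k
      = i then of_nat (expo xs k) * x k ^ (expo xs k - 1) else x k ^ expo xs k))"
    unfolding sum_Mon pd_monomial using assms by simp
  also have "\<dots> = (\<Sum>xs\<leftarrow>monl n d. F (expo xs) *
    (\<Prod>k\<leftarrow>[0..<Suc n]. if k = i then of_nat (xs ! k) * x k ^ (xs ! k - 1) else x k ^ (xs ! k)))"
  proof (intro arg_cong[where f = sum_list] map_cong refl arg_cong[where f = "times _"])
    fix xs assume "xs \<in> set (monl n d)"
    then have l: "length xs = Suc n" by (rule monl_length)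
    have "(\<Prod>k\<leftarrow>[0..<Suc n]. if k = i then of_nat (xs ! k) * x k ^ (xs ! k - 1) else x k ^ (xs ! k))
      = (\<Prod>k\<in>set [0..<Suc n]. if k = i then of_nat (xs ! k) * x k ^ (xs ! k - 1) else x k ^ (xs ! k))"
      by (rule prod.distinct_set_conv_list[symmetric]) simp
    also have "\<dots> = (\<Prod>k\<le>n. if k = i then of_nat (expo xs k) * x k ^ (expo xs k - 1) else x k ^ expo xs k)"
      using l by (intro prod.cong) (auto simp: expo_def)
    finally show "(\<Prod>k\<le>n. if k = i then of_nat (expo xs k) * x k ^ (expo xs k - 1) else x k ^ expo xs k)
      = (\<Prod>k\<leftarrow>[0..<Suc n]. if k = i then of_nat (xs ! k) * x k ^ (xs ! k - 1) else x k ^ (xs ! k))" ..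
  qed
  finally show ?thesis .
qed

text \<open>All witnesses consist of points on the lines joining cyclically consecutive coordinate points,
  where the conditions for a form to be singular involve few coefficients each.\<close>

definition edge :: "nat \<Rightarrow> nat \<Rightarrow> complex \<Rightarrow> nat \<Rightarrow> complex" where
  "edge a b s = (\<lambda>k. if k = a then 1 else if k = b then s else 0)"

lemma all_le2: "(\<forall>i\<le>2::nat. P i) \<longleftrightarrow> P 0 \<and> P 1 \<and> P 2"
  by (simp add: numeral_nat le_Suc_eq all_conj_distrib)

lemma all_le3: "(\<forall>i\<le>3::nat. P i) \<longleftrightarrow> P 0 \<and> P 1 \<and> P 2 \<and> P 3"
  by (simp add: numeral_nat le_Suc_eq all_conj_distrib)

lemma all_le5: "(\<forall>i\<le>5::nat. P i) \<longleftrightarrow> P 0 \<and> P 1 \<and> P 2 \<and> P 3 \<and> P 4 \<and> P 5"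
  by (simp add: numeral_nat le_Suc_eq all_conj_distrib)

lemma upt_3: "[0..<3] = [0, 1, 2::nat]" by code_simp

lemma upt_4: "[0..<4] = [0, 1, 2, 3::nat]" by code_simp

lemma upt_6: "[0..<6] = [0, 1, 2, 3, 4, 5::nat]" by code_simp

lemma monl_2_6: "monl 2 6 =
   [[6, 0, 0], [5, 1, 0], [4, 2, 0], [3, 3, 0], [2, 4, 0], [1, 5, 0], [0, 6, 0], [5, 0, 1],
    [4, 1, 1], [3, 2, 1], [2, 3, 1], [1, 4, 1], [0, 5, 1], [4, 0, 2], [3, 1, 2], [2, 2, 2],
    [1, 3, 2], [0, 4, 2], [3, 0, 3], [2, 1, 3], [1, 2, 3], [0, 3, 3], [2, 0, 4], [1, 1, 4],
    [0, 2, 4], [1, 0, 5], [0, 1, 5], [0, 0, 6]]"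
  by code_simp

lemma monl_3_4: "monl 3 4 =
   [[4, 0, 0, 0], [3, 1, 0, 0], [2, 2, 0, 0], [1, 3, 0, 0], [0, 4, 0, 0], [3, 0, 1, 0],
    [2, 1, 1, 0], [1, 2, 1, 0], [0, 3, 1, 0], [2, 0, 2, 0], [1, 1, 2, 0], [0, 2, 2, 0],
    [1, 0, 3, 0], [0, 1, 3, 0], [0, 0, 4, 0], [3, 0, 0, 1], [2, 1, 0, 1], [1, 2, 0, 1],
    [0, 3, 0, 1], [2, 0, 1, 1], [1, 1, 1, 1], [0, 2, 1, 1], [1, 0, 2, 1], [0, 1, 2, 1],
    [0, 0, 3, 1], [2, 0, 0, 2], [1, 1, 0, 2], [0, 2, 0, 2], [1, 0, 1, 2], [0, 1, 1, 2],
    [0, 0, 2, 2], [1, 0, 0, 3], [0, 1, 0, 3], [0, 0, 1, 3], [0, 0, 0, 4]]"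
  by code_simp

lemma monl_5_3: "monl 5 3 =
   [[3, 0, 0, 0, 0, 0], [2, 1, 0, 0, 0, 0], [1, 2, 0, 0, 0, 0], [0, 3, 0, 0, 0, 0],
    [2, 0, 1, 0, 0, 0], [1, 1, 1, 0, 0, 0], [0, 2, 1, 0, 0, 0], [1, 0, 2, 0, 0, 0],
    [0, 1, 2, 0, 0, 0], [0, 0, 3, 0, 0, 0], [2, 0, 0, 1, 0, 0], [1, 1, 0, 1, 0, 0],
    [0, 2, 0, 1, 0, 0], [1, 0, 1, 1, 0, 0], [0, 1, 1, 1, 0, 0], [0, 0, 2, 1, 0, 0],
    [1, 0, 0, 2, 0, 0], [0, 1, 0, 2, 0, 0], [0, 0, 1, 2, 0, 0], [0, 0, 0, 3, 0, 0],
    [2, 0, 0, 0, 1, 0], [1, 1, 0, 0, 1, 0], [0, 2, 0, 0, 1, 0], [1, 0, 1, 0, 1, 0],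
    [0, 1, 1, 0, 1, 0], [0, 0, 2, 0, 1, 0], [1, 0, 0, 1, 1, 0], [0, 1, 0, 1, 1, 0],
    [0, 0, 1, 1, 1, 0], [0, 0, 0, 2, 1, 0], [1, 0, 0, 0, 2, 0], [0, 1, 0, 0, 2, 0],
    [0, 0, 1, 0, 2, 0], [0, 0, 0, 1, 2, 0], [0, 0, 0, 0, 3, 0], [2, 0, 0, 0, 0, 1],
    [1, 1, 0, 0, 0, 1], [0, 2, 0, 0, 0, 1], [1, 0, 1, 0, 0, 1], [0, 1, 1, 0, 0, 1],
    [0, 0, 2, 0, 0, 1], [1, 0, 0, 1, 0, 1], [0, 1, 0, 1, 0, 1], [0, 0, 1, 1, 0, 1],
    [0, 0, 0, 2, 0, 1], [1, 0, 0, 0, 1, 1], [0, 1, 0, 0, 1, 1], [0, 0, 1, 0, 1, 1],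
    [0, 0, 0, 1, 1, 1], [0, 0, 0, 0, 2, 1], [1, 0, 0, 0, 0, 2], [0, 1, 0, 0, 0, 2],
    [0, 0, 1, 0, 0, 2], [0, 0, 0, 1, 0, 2], [0, 0, 0, 0, 1, 2], [0, 0, 0, 0, 0, 3]]"
  by code_simp

text \<open>On the line x2 = 0 the derivatives along the line see only monomials in x0 and x1, and
  the transverse derivative only monomials of degree one in x2. Conditions at different sides thus
  overlap in few coefficients.\<close>

lemma sextic_edge_01:
  assumes "sing 2 6 F (edge 0 1 s)"
  shows "6 * F (expo [6, 0, 0]) + 5 * F (expo [5, 1, 0]) * s + 4 * F (expo [4, 2, 0]) * s ^ 2
      + 3 * F (expo [3, 3, 0]) * s ^ 3 + 2 * F (expo [2, 4, 0]) * s ^ 4 + F (expo [1, 5, 0]) * s ^ 5 = 0"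
    "F (expo [5, 1, 0]) + 2 * F (expo [4, 2, 0]) * s + 3 * F (expo [3, 3, 0]) * s ^ 2
        + 4 * F (expo [2, 4, 0]) * s ^ 3 + 5 * F (expo [1, 5, 0]) * s ^ 4 + 6 * F (expo [0, 6, 0]) * s ^ 5 = 0"
    "F (expo [5, 0, 1]) + F (expo [4, 1, 1]) * s + F (expo [3, 2, 1]) * s ^ 2 + F (expo [2, 3, 1]) * s ^ 3
        + F (expo [1, 4, 1]) * s ^ 4 + F (expo [0, 5, 1]) * s ^ 5 = 0"
  using assms unfolding sing_def all_le2
  by (simp_all add: pd_form_eval monl_2_6 upt_3 edge_def mult_ac add_ac del: upt_Suc One_nat_def)

lemma sextic_edge_12:
  assumes "sing 2 6 F (edge 1 2 s)"
  shows "6 * F (expo [0, 6, 0]) + 5 * F (expo [0, 5, 1]) * s + 4 * F (expo [0, 4, 2]) * s ^ 2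
      + 3 * F (expo [0, 3, 3]) * s ^ 3 + 2 * F (expo [0, 2, 4]) * s ^ 4 + F (expo [0, 1, 5]) * s ^ 5 = 0"
    "F (expo [0, 5, 1]) + 2 * F (expo [0, 4, 2]) * s + 3 * F (expo [0, 3, 3]) * s ^ 2
        + 4 * F (expo [0, 2, 4]) * s ^ 3 + 5 * F (expo [0, 1, 5]) * s ^ 4 + 6 * F (expo [0, 0, 6]) * s ^ 5 = 0"
    "F (expo [1, 5, 0]) + F (expo [1, 4, 1]) * s + F (expo [1, 3, 2]) * s ^ 2 + F (expo [1, 2, 3]) * s ^ 3
        + F (expo [1, 1, 4]) * s ^ 4 + F (expo [1, 0, 5]) * s ^ 5 = 0"
  using assms unfolding sing_def all_le2
  by (simp_all add: pd_form_eval monl_2_6 upt_3 edge_def mult_ac add_ac del: upt_Suc One_nat_def)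

lemma sextic_edge_20:
  assumes "sing 2 6 F (edge 2 0 s)"
  shows "6 * F (expo [0, 0, 6]) + 5 * F (expo [1, 0, 5]) * s + 4 * F (expo [2, 0, 4]) * s ^ 2
      + 3 * F (expo [3, 0, 3]) * s ^ 3 + 2 * F (expo [4, 0, 2]) * s ^ 4 + F (expo [5, 0, 1]) * s ^ 5 = 0"
    "F (expo [1, 0, 5]) + 2 * F (expo [2, 0, 4]) * s + 3 * F (expo [3, 0, 3]) * s ^ 2
        + 4 * F (expo [4, 0, 2]) * s ^ 3 + 5 * F (expo [5, 0, 1]) * s ^ 4 + 6 * F (expo [6, 0, 0]) * s ^ 5 = 0"
    "F (expo [0, 1, 5]) + F (expo [1, 1, 4]) * s + F (expo [2, 1, 3]) * s ^ 2 + F (expo [3, 1, 2]) * s ^ 3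
        + F (expo [4, 1, 1]) * s ^ 4 + F (expo [5, 1, 0]) * s ^ 5 = 0"
  using assms unfolding sing_def all_le2
  by (simp_all add: pd_form_eval monl_2_6 upt_3 edge_def mult_ac add_ac del: upt_Suc One_nat_def)

lemma quartic_edge_01:
  assumes "sing 3 4 F (edge 0 1 s)"
  shows "4 * F (expo [4, 0, 0, 0]) + 3 * F (expo [3, 1, 0, 0]) * s + 2 * F (expo [2, 2, 0, 0]) * s ^ 2
      + F (expo [1, 3, 0, 0]) * s ^ 3 = 0"
    "F (expo [3, 1, 0, 0]) + 2 * F (expo [2, 2, 0, 0]) * s + 3 * F (expo [1, 3, 0, 0]) * s ^ 2
        + 4 * F (expo [0, 4, 0, 0]) * s ^ 3 = 0"
    "F (expo [3, 0, 1, 0]) + F (expo [2, 1, 1, 0]) * s + F (expo [1, 2, 1, 0]) * s ^ 2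
        + F (expo [0, 3, 1, 0]) * s ^ 3 = 0"
    "F (expo [3, 0, 0, 1]) + F (expo [2, 1, 0, 1]) * s + F (expo [1, 2, 0, 1]) * s ^ 2
        + F (expo [0, 3, 0, 1]) * s ^ 3 = 0"
  using assms unfolding sing_def all_le3
  by (simp_all add: pd_form_eval monl_3_4 upt_4 edge_def mult_ac add_ac del: upt_Suc One_nat_def)

lemma quartic_edge_12:
  assumes "sing 3 4 F (edge 1 2 s)"
  shows "4 * F (expo [0, 4, 0, 0]) + 3 * F (expo [0, 3, 1, 0]) * s + 2 * F (expo [0, 2, 2, 0]) * s ^ 2
      + F (expo [0, 1, 3, 0]) * s ^ 3 = 0"
    "F (expo [0, 3, 1, 0]) + 2 * F (expo [0, 2, 2, 0]) * s + 3 * F (expo [0, 1, 3, 0]) * s ^ 2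
        + 4 * F (expo [0, 0, 4, 0]) * s ^ 3 = 0"
    "F (expo [1, 3, 0, 0]) + F (expo [1, 2, 1, 0]) * s + F (expo [1, 1, 2, 0]) * s ^ 2
        + F (expo [1, 0, 3, 0]) * s ^ 3 = 0"
    "F (expo [0, 3, 0, 1]) + F (expo [0, 2, 1, 1]) * s + F (expo [0, 1, 2, 1]) * s ^ 2
        + F (expo [0, 0, 3, 1]) * s ^ 3 = 0"
  using assms unfolding sing_def all_le3
  by (simp_all add: pd_form_eval monl_3_4 upt_4 edge_def mult_ac add_ac del: upt_Suc One_nat_def)

lemma quartic_edge_23:
  assumes "sing 3 4 F (edge 2 3 s)"
  shows "4 * F (expo [0, 0, 4, 0]) + 3 * F (expo [0, 0, 3, 1]) * s + 2 * F (expo [0, 0, 2, 2]) * s ^ 2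
      + F (expo [0, 0, 1, 3]) * s ^ 3 = 0"
    "F (expo [0, 0, 3, 1]) + 2 * F (expo [0, 0, 2, 2]) * s + 3 * F (expo [0, 0, 1, 3]) * s ^ 2
        + 4 * F (expo [0, 0, 0, 4]) * s ^ 3 = 0"
    "F (expo [1, 0, 3, 0]) + F (expo [1, 0, 2, 1]) * s + F (expo [1, 0, 1, 2]) * s ^ 2
        + F (expo [1, 0, 0, 3]) * s ^ 3 = 0"
    "F (expo [0, 1, 3, 0]) + F (expo [0, 1, 2, 1]) * s + F (expo [0, 1, 1, 2]) * s ^ 2
        + F (expo [0, 1, 0, 3]) * s ^ 3 = 0"
  using assms unfolding sing_def all_le3
  by (simp_all add: pd_form_eval monl_3_4 upt_4 edge_def mult_ac add_ac del: upt_Suc One_nat_def)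

lemma quartic_edge_30:
  assumes "sing 3 4 F (edge 3 0 s)"
  shows "4 * F (expo [0, 0, 0, 4]) + 3 * F (expo [1, 0, 0, 3]) * s + 2 * F (expo [2, 0, 0, 2]) * s ^ 2
      + F (expo [3, 0, 0, 1]) * s ^ 3 = 0"
    "F (expo [1, 0, 0, 3]) + 2 * F (expo [2, 0, 0, 2]) * s + 3 * F (expo [3, 0, 0, 1]) * s ^ 2
        + 4 * F (expo [4, 0, 0, 0]) * s ^ 3 = 0"
    "F (expo [0, 1, 0, 3]) + F (expo [1, 1, 0, 2]) * s + F (expo [2, 1, 0, 1]) * s ^ 2
        + F (expo [3, 1, 0, 0]) * s ^ 3 = 0"
    "F (expo [0, 0, 1, 3]) + F (expo [1, 0, 1, 2]) * s + F (expo [2, 0, 1, 1]) * s ^ 2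
        + F (expo [3, 0, 1, 0]) * s ^ 3 = 0"
  using assms unfolding sing_def all_le3
  by (simp_all add: pd_form_eval monl_3_4 upt_4 edge_def mult_ac add_ac del: upt_Suc One_nat_def)

lemma cubic_edge_01:
  assumes "sing 5 3 F (edge 0 1 s)"
  shows "3 * F (expo [3, 0, 0, 0, 0, 0]) + 2 * F (expo [2, 1, 0, 0, 0, 0]) * s
      + F (expo [1, 2, 0, 0, 0, 0]) * s ^ 2 = 0"
    "F (expo [2, 1, 0, 0, 0, 0]) + 2 * F (expo [1, 2, 0, 0, 0, 0]) * s + 3 * F (expo [0, 3, 0, 0, 0, 0]) * s ^ 2 = 0"
    "F (expo [2, 0, 1, 0, 0, 0]) + F (expo [1, 1, 1, 0, 0, 0]) * s + F (expo [0, 2, 1, 0, 0, 0]) * s ^ 2 = 0"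
    "F (expo [2, 0, 0, 1, 0, 0]) + F (expo [1, 1, 0, 1, 0, 0]) * s + F (expo [0, 2, 0, 1, 0, 0]) * s ^ 2 = 0"
    "F (expo [2, 0, 0, 0, 1, 0]) + F (expo [1, 1, 0, 0, 1, 0]) * s + F (expo [0, 2, 0, 0, 1, 0]) * s ^ 2 = 0"
    "F (expo [2, 0, 0, 0, 0, 1]) + F (expo [1, 1, 0, 0, 0, 1]) * s + F (expo [0, 2, 0, 0, 0, 1]) * s ^ 2 = 0"
  using assms unfolding sing_def all_le5
  by (simp_all add: pd_form_eval monl_5_3 upt_6 edge_def mult_ac add_ac del: upt_Suc One_nat_def)

lemma cubic_edge_12:
  assumes "sing 5 3 F (edge 1 2 s)"
  shows "3 * F (expo [0, 3, 0, 0, 0, 0]) + 2 * F (expo [0, 2, 1, 0, 0, 0]) * s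
      + F (expo [0, 1, 2, 0, 0, 0]) * s ^ 2 = 0"
    "F (expo [0, 2, 1, 0, 0, 0]) + 2 * F (expo [0, 1, 2, 0, 0, 0]) * s + 3 * F (expo [0, 0, 3, 0, 0, 0]) * s ^ 2 = 0"
    "F (expo [1, 2, 0, 0, 0, 0]) + F (expo [1, 1, 1, 0, 0, 0]) * s + F (expo [1, 0, 2, 0, 0, 0]) * s ^ 2 = 0"
    "F (expo [0, 2, 0, 1, 0, 0]) + F (expo [0, 1, 1, 1, 0, 0]) * s + F (expo [0, 0, 2, 1, 0, 0]) * s ^ 2 = 0"
    "F (expo [0, 2, 0, 0, 1, 0]) + F (expo [0, 1, 1, 0, 1, 0]) * s + F (expo [0, 0, 2, 0, 1, 0]) * s ^ 2 = 0"
    "F (expo [0, 2, 0, 0, 0, 1]) + F (expo [0, 1, 1, 0, 0, 1]) * s + F (expo [0, 0, 2, 0, 0, 1]) * s ^ 2 = 0"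
  using assms unfolding sing_def all_le5
  by (simp_all add: pd_form_eval monl_5_3 upt_6 edge_def mult_ac add_ac del: upt_Suc One_nat_def)

lemma cubic_edge_23:
  assumes "sing 5 3 F (edge 2 3 s)"
  shows "3 * F (expo [0, 0, 3, 0, 0, 0]) + 2 * F (expo [0, 0, 2, 1, 0, 0]) * s
      + F (expo [0, 0, 1, 2, 0, 0]) * s ^ 2 = 0"
    "F (expo [0, 0, 2, 1, 0, 0]) + 2 * F (expo [0, 0, 1, 2, 0, 0]) * s + 3 * F (expo [0, 0, 0, 3, 0, 0]) * s ^ 2 = 0"
    "F (expo [1, 0, 2, 0, 0, 0]) + F (expo [1, 0, 1, 1, 0, 0]) * s + F (expo [1, 0, 0, 2, 0, 0]) * s ^ 2 = 0"
    "F (expo [0, 1, 2, 0, 0, 0]) + F (expo [0, 1, 1, 1, 0, 0]) * s + F (expo [0, 1, 0, 2, 0, 0]) * s ^ 2 = 0"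
    "F (expo [0, 0, 2, 0, 1, 0]) + F (expo [0, 0, 1, 1, 1, 0]) * s + F (expo [0, 0, 0, 2, 1, 0]) * s ^ 2 = 0"
    "F (expo [0, 0, 2, 0, 0, 1]) + F (expo [0, 0, 1, 1, 0, 1]) * s + F (expo [0, 0, 0, 2, 0, 1]) * s ^ 2 = 0"
  using assms unfolding sing_def all_le5
  by (simp_all add: pd_form_eval monl_5_3 upt_6 edge_def mult_ac add_ac del: upt_Suc One_nat_def)

lemma cubic_edge_34:
  assumes "sing 5 3 F (edge 3 4 s)"
  shows "3 * F (expo [0, 0, 0, 3, 0, 0]) + 2 * F (expo [0, 0, 0, 2, 1, 0]) * s
      + F (expo [0, 0, 0, 1, 2, 0]) * s ^ 2 = 0"
    "F (expo [0, 0, 0, 2, 1, 0]) + 2 * F (expo [0, 0, 0, 1, 2, 0]) * s + 3 * F (expo [0, 0, 0, 0, 3, 0]) * s ^ 2 = 0"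
    "F (expo [1, 0, 0, 2, 0, 0]) + F (expo [1, 0, 0, 1, 1, 0]) * s + F (expo [1, 0, 0, 0, 2, 0]) * s ^ 2 = 0"
    "F (expo [0, 1, 0, 2, 0, 0]) + F (expo [0, 1, 0, 1, 1, 0]) * s + F (expo [0, 1, 0, 0, 2, 0]) * s ^ 2 = 0"
    "F (expo [0, 0, 1, 2, 0, 0]) + F (expo [0, 0, 1, 1, 1, 0]) * s + F (expo [0, 0, 1, 0, 2, 0]) * s ^ 2 = 0"
    "F (expo [0, 0, 0, 2, 0, 1]) + F (expo [0, 0, 0, 1, 1, 1]) * s + F (expo [0, 0, 0, 0, 2, 1]) * s ^ 2 = 0"
  using assms unfolding sing_def all_le5
  by (simp_all add: pd_form_eval monl_5_3 upt_6 edge_def mult_ac add_ac del: upt_Suc One_nat_def)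

lemma cubic_edge_45:
  assumes "sing 5 3 F (edge 4 5 s)"
  shows "3 * F (expo [0, 0, 0, 0, 3, 0]) + 2 * F (expo [0, 0, 0, 0, 2, 1]) * s
      + F (expo [0, 0, 0, 0, 1, 2]) * s ^ 2 = 0"
    "F (expo [0, 0, 0, 0, 2, 1]) + 2 * F (expo [0, 0, 0, 0, 1, 2]) * s + 3 * F (expo [0, 0, 0, 0, 0, 3]) * s ^ 2 = 0"
    "F (expo [1, 0, 0, 0, 2, 0]) + F (expo [1, 0, 0, 0, 1, 1]) * s + F (expo [1, 0, 0, 0, 0, 2]) * s ^ 2 = 0"
    "F (expo [0, 1, 0, 0, 2, 0]) + F (expo [0, 1, 0, 0, 1, 1]) * s + F (expo [0, 1, 0, 0, 0, 2]) * s ^ 2 = 0"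
    "F (expo [0, 0, 1, 0, 2, 0]) + F (expo [0, 0, 1, 0, 1, 1]) * s + F (expo [0, 0, 1, 0, 0, 2]) * s ^ 2 = 0"
    "F (expo [0, 0, 0, 1, 2, 0]) + F (expo [0, 0, 0, 1, 1, 1]) * s + F (expo [0, 0, 0, 1, 0, 2]) * s ^ 2 = 0"
  using assms unfolding sing_def all_le5
  by (simp_all add: pd_form_eval monl_5_3 upt_6 edge_def mult_ac add_ac del: upt_Suc One_nat_def)

lemma cubic_edge_50:
  assumes "sing 5 3 F (edge 5 0 s)"
  shows "3 * F (expo [0, 0, 0, 0, 0, 3]) + 2 * F (expo [1, 0, 0, 0, 0, 2]) * s
      + F (expo [2, 0, 0, 0, 0, 1]) * s ^ 2 = 0"
    "F (expo [1, 0, 0, 0, 0, 2]) + 2 * F (expo [2, 0, 0, 0, 0, 1]) * s + 3 * F (expo [3, 0, 0, 0, 0, 0]) * s ^ 2 = 0"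
    "F (expo [0, 1, 0, 0, 0, 2]) + F (expo [1, 1, 0, 0, 0, 1]) * s + F (expo [2, 1, 0, 0, 0, 0]) * s ^ 2 = 0"
    "F (expo [0, 0, 1, 0, 0, 2]) + F (expo [1, 0, 1, 0, 0, 1]) * s + F (expo [2, 0, 1, 0, 0, 0]) * s ^ 2 = 0"
    "F (expo [0, 0, 0, 1, 0, 2]) + F (expo [1, 0, 0, 1, 0, 1]) * s + F (expo [2, 0, 0, 1, 0, 0]) * s ^ 2 = 0"
    "F (expo [0, 0, 0, 0, 1, 2]) + F (expo [1, 0, 0, 0, 1, 1]) * s + F (expo [2, 0, 0, 0, 1, 0]) * s ^ 2 = 0"
  using assms unfolding sing_def all_le5
  by (simp_all add: pd_form_eval monl_5_3 upt_6 edge_def mult_ac add_ac del: upt_Suc One_nat_def)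

section \<open>Deformation of singular forms\<close>

text \<open>The unknown z lives in an abstract Euclidean space and c gives the displacement of each
  coordinate of the point; the common operator bound M transfers smallness from z to the
  coordinates.\<close>

lemma persist_points:
  fixes \<Phi> :: "complex \<times> 'a::euclidean_space \<Rightarrow> 'b::euclidean_space" and c :: "'a \<Rightarrow> nat \<Rightarrow> complex"
  assumes "continuous_on UNIV \<Phi>" "(\<Phi> has_derivative D) (at (0, 0))" "\<Phi> (0, 0) = 0" "surj (\<lambda>z. D (0, z))"
    and c: "\<And>i. i \<le> n \<Longrightarrow> bounded_linear (\<lambda>z. c z i)" and e: "e > 0"
  shows "\<exists>\<delta>>0. \<forall>t. norm t < \<delta> \<longrightarrow> (\<exists>z. (\<forall>i\<le>n. norm (c z i) < e) \<and> \<Phi> (t, z) = 0)"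
proof -
  have "\<forall>i\<in>{..n}. \<exists>K>0. \<forall>z. norm (c z i) \<le> norm z * K" using bounded_linear.pos_bounded[OF c] by auto
  then obtain K where K: "\<forall>i\<in>{..n}. K i > 0 \<and> (\<forall>z. norm (c z i) \<le> norm z * K i)" by (rule bchoice[THEN exE])
  define M where "M = (\<Sum>i\<le>n. K i)"
  have KM: "K i \<le> M" if "i \<le> n" for i unfolding M_def using K that by (intro member_le_sum) (auto intro: less_imp_le)
  have M: "M > 0" using KM[of 0] K by (auto intro: less_le_trans)
  obtain \<delta> where \<delta>: "\<delta> > 0" "\<forall>t. norm t < \<delta> \<longrightarrow> (\<exists>z. norm z < e / M \<and> \<Phi> (t, z) = 0)"
    using persist[OF assms(1-4), of "e / M"] e M by auto
  show ?thesis
  proof (intro exI[of _ \<delta>] conjI \<delta>(1) allI impI)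
    fix t :: complex assume "norm t < \<delta>"
    then obtain z where z: "norm z < e / M" "\<Phi> (t, z) = 0" using \<delta>(2) by blast
    have "norm (c z i) < e" if i: "i \<le> n" for i
    proof -
      have "norm (c z i) \<le> norm z * K i" using K i by auto
      also have "\<dots> \<le> norm z * M" using KM[OF i] by (intro mult_left_mono) auto
      also have "\<dots> < e" using z(1) M by (simp add: pos_less_divide_eq)
      finally show ?thesis .
    qed
    then show "\<exists>z. (\<forall>i\<le>n. norm (c z i) < e) \<and> \<Phi> (t, z) = 0" using z(2) by blast
  qed
qed

lemma pf_continuous_on:
  assumes "f \<in> poly_fun I" "\<And>i. i \<in> I \<Longrightarrow> continuous_on S (\<lambda>y. c y i)"
  shows "continuous_on S (\<lambda>y. f (c y))"
  using assms(1) by induction (auto intro!: continuous_intros assms(2))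

lemma zclosed_line:
  assumes "zclosed I Z" "pform {()} n d \<Phi> C" "I = Mon n d" "\<delta> > 0"
    and "\<And>t. norm t < \<delta> \<Longrightarrow> C (\<lambda>_. t) \<in> Z"
  shows "C (\<lambda>_. 1) \<in> Z"
proof (rule ccontr)
  assume "C (\<lambda>_. 1) \<notin> Z"
  then obtain f where f: "f \<in> poly_fun I" "f (C (\<lambda>_. 1)) \<noteq> 0" "\<forall>z\<in>Z. f z = 0"
    using zclosed_sep[OF assms(1)] pformD(3)[OF assms(2)] assms(3) by blast
  have pf: "(\<lambda>p. f (C p)) \<in> poly_fun {()}" by (rule pf_comp[OF f(1) pformD(1)[OF assms(2)]])
  have "f (C (\<lambda>i. 0 + t * 1)) = 0" if "norm t < \<delta>" for t
    using f(3) assms(5)[OF that] by simp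
  then have "f (C (\<lambda>i. 0 + 1 * 1)) = 0"
    using pf_small_line[OF pf assms(4), of "\<lambda>_. 0" "\<lambda>_. 1" 1] by simp
  then show False using f(2) by simp
qed

lemma zclosed_zdual: "zclosed I (zdual I Y)"
  unfolding zdual_def by (rule zclosed_zclosure)

text \<open>The singular points of the witness persist along the line C for small parameters, and a Zariski
  closed set containing the points of a line with small parameter contains the whole line.\<close>

lemma zdual_deform:
  assumes p0: "nondeg n d k p0" "k > 0" and C: "pform {()} n d \<Phi> C"
    and near: "\<And>j e. j < k \<Longrightarrow> e > 0 \<Longrightarrow> \<exists>\<delta>>0. \<forall>t. norm t < \<delta> \<longrightarrow>
      (\<exists>x. (\<forall>i\<le>n. norm (x i - pt p0 j i) < e) \<and> sing n d (C (\<lambda>_. t)) x)"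
  shows "C (\<lambda>_. 1) \<in> zdual (Mon n d) (sec_cone n d k)"
proof -
  obtain e where e: "e > 0" "\<And>p. (\<forall>j<k. \<forall>i\<le>n. norm (pt p j i - pt p0 j i) < e) \<Longrightarrow> nondeg n d k p"
    using nondeg_near[OF p0(1)] by blast
  have "\<forall>j\<in>{..<k}. \<exists>\<delta>. \<delta> > 0 \<and> (\<forall>t. norm t < \<delta> \<longrightarrow>
      (\<exists>x. (\<forall>i\<le>n. norm (x i - pt p0 j i) < e) \<and> sing n d (C (\<lambda>_. t)) x))" using near[OF _ e(1)] by auto
  then obtain \<delta> where \<delta>: "\<forall>j\<in>{..<k}. \<delta> j > 0 \<and> (\<forall>t. norm t < \<delta> j \<longrightarrow>
      (\<exists>x. (\<forall>i\<le>n. norm (x i - pt p0 j i) < e) \<and> sing n d (C (\<lambda>_. t)) x))" by (rule bchoice[THEN exE])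
  define \<delta>0 where "\<delta>0 = Min (\<delta> ` {..<k})"
  have \<delta>0: "\<delta>0 > 0" unfolding \<delta>0_def using \<delta> p0(2) by (subst Min_gr_iff) auto
  show ?thesis
  proof (rule zclosed_line[OF zclosed_zdual C refl \<delta>0])
    fix t :: complex assume t: "norm t < \<delta>0"
    have "norm t < \<delta> j" if "j < k" for j
    proof -
      have "\<delta>0 \<le> \<delta> j" unfolding \<delta>0_def using that by (intro Min_le) auto
      then show ?thesis using t by simp
    qed
    then have "\<forall>j\<in>{..<k}. \<exists>x. (\<forall>i\<le>n. norm (x i - pt p0 j i) < e) \<and> sing n d (C (\<lambda>_. t)) x" using \<delta> by simp
    then obtain x where x: "\<forall>j\<in>{..<k}. (\<forall>i\<le>n. norm (x j i - pt p0 j i) < e) \<and> sing n d (C (\<lambda>_. t)) (x j)"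
      by (rule bchoice[THEN exE])
    define p where "p = (\<lambda>(j, i). x j i)"
    have ptp: "pt p j = x j" for j by (simp add: pt_def p_def)
    show "C (\<lambda>_. t) \<in> zdual (Mon n d) (sec_cone n d k)"
      by (rule singular_in_zdual[of n d k p]) (use x p0(2) e(2)[of p] pformD(3)[OF C] in \<open>auto simp: ptp\<close>)
  qed
qed

lemma pform_line:
  assumes "F \<in> aff (Mon n d)" "G \<in> aff (Mon n d)"
  shows "\<exists>C. pform {()} n d (\<lambda>p x. form_eval n d F x + p () * (form_eval n d G x - form_eval n d F x)) C"
proof -
  have "pform {()} n d (\<lambda>p. form_eval n d (\<lambda>\<alpha>. F \<alpha> + p () * (G \<alpha> - F \<alpha>)))
      (\<lambda>p \<alpha>. if \<alpha> \<in> Mon n d then F \<alpha> + p () * (G \<alpha> - F \<alpha>) else 0)"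
    by (rule pform_coeffs) (intro pf_add pf_mult pf_const poly_fun.pf_coord, simp)
  moreover have "(\<lambda>p. form_eval n d (\<lambda>\<alpha>. F \<alpha> + p () * (G \<alpha> - F \<alpha>)))
      = (\<lambda>p x. form_eval n d F x + p () * (form_eval n d G x - form_eval n d F x))"
    by (simp add: fun_eq_iff form_eval_add form_eval_cmult form_eval_diff)
  ultimately show ?thesis by auto
qed

section \<open>Single monomials and lists of points\<close>

definition mform :: "nat \<Rightarrow> nat \<Rightarrow> nat list \<Rightarrow> (nat \<Rightarrow> nat) \<Rightarrow> complex" where
  "mform n d xs = (\<lambda>\<beta>. if \<beta> = expo xs then 1 else 0)"

lemma mform:
  assumes "xs \<in> set (monl n d)"
  shows "mform n d xs \<in> aff (Mon n d)" "form_eval n d (mform n d xs) x = (\<Prod>k\<leftarrow>[0..<Suc n]. x k ^ (xs ! k))"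
proof -
  have M: "expo xs \<in> Mon n d" using assms unfolding Mon_monl by blast
  then show "mform n d xs \<in> aff (Mon n d)" by (auto simp: mform_def aff_def)
  have "(\<Prod>k\<leftarrow>[0..<Suc n]. x k ^ (xs ! k)) = (\<Prod>k\<in>set [0..<Suc n]. x k ^ (xs ! k))"
    by (rule prod.distinct_set_conv_list[symmetric]) simp
  also have "\<dots> = (\<Prod>k\<le>n. x k ^ expo xs k)" using monl_length[OF assms] by (intro prod.cong) (auto simp: expo_def)
  finally show "form_eval n d (mform n d xs) x = (\<Prod>k\<leftarrow>[0..<Suc n]. x k ^ (xs ! k))"
    unfolding mform_def form_eval_single[OF M] by simp
qed

definition pts :: "(nat \<Rightarrow> complex) list \<Rightarrow> nat \<times> nat \<Rightarrow> complex" where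
  "pts xs = (\<lambda>(j, i). (xs ! j) i)"

lemma pt_pts: "pt (pts xs) j = xs ! j"
  by (simp add: pt_def pts_def)

lemma all_pts: "length xs = k \<Longrightarrow> (\<forall>j<k. P (pt (pts xs) j)) \<longleftrightarrow> (\<forall>x\<in>set xs. P x)"
  by (simp add: pt_pts all_set_conv_all_nth)

lemma card_Mon_values: "card (Mon 2 3) = 10" "card (Mon 2 6) = 28" "card (Mon 3 2) = 10" "card (Mon 3 4) = 35"
    "card (Mon 5 3) = 56"
  unfolding card_Mon by code_simp+

section \<open>Plane sextics\<close>

text \<open>The two conditions say that the binary sextic has double roots 1, -1, 2, so it is a
  multiple of ((s - 1) (s + 1) (s - 2))^2, whose coefficients appear here.\<close>

lemma sextic_double_roots:
  fixes c0 c1 c2 c3 c4 c5 c6 :: complex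
  assumes a: "\<And>s. s \<in> {1, -1, 2} \<Longrightarrow> 6 * c0 + 5 * c1 * s + 4 * c2 * s ^ 2 + 3 * c3 * s ^ 3 + 2 * c4 * s ^ 4
      + c5 * s ^ 5 = 0"
    and b: "\<And>s. s \<in> {1, -1, 2} \<Longrightarrow> c1 + 2 * c2 * s + 3 * c3 * s ^ 2 + 4 * c4 * s ^ 3 + 5 * c5 * s ^ 4
        + 6 * c6 * s ^ 5 = 0"
  shows "c0 = 4 * c6" "c1 = - 4 * c6" "c2 = - 7 * c6" "c3 = 8 * c6" "c4 = 2 * c6" "c5 = - 4 * c6"
proof -
  have e: "6 * c0 + 5 * c1 + 4 * c2 + 3 * c3 + 2 * c4 + c5 = 0" "6 * c0 - 5 * c1 + 4 * c2 - 3 * c3 + 2 * c4 - c5 = 0"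
    "6 * c0 + 10 * c1 + 16 * c2 + 24 * c3 + 32 * c4 + 32 * c5 = 0"
    "c1 + 2 * c2 + 3 * c3 + 4 * c4 + 5 * c5 + 6 * c6 = 0" "c1 - 2 * c2 + 3 * c3 - 4 * c4 + 5 * c5 - 6 * c6 = 0"
    "c1 + 4 * c2 + 12 * c3 + 32 * c4 + 80 * c5 + 192 * c6 = 0"
    using a[of 1] a[of "-1"] a[of 2] b[of 1] b[of "-1"] b[of 2] by (simp_all add: mult.commute)
  show "c0 = 4 * c6" "c1 = - 4 * c6" "c2 = - 7 * c6" "c3 = 8 * c6" "c4 = 2 * c6" "c5 = - 4 * c6"
    using e by algebra+
qed

text \<open>Without its outer terms the polynomial is s times a cubic, which is a multiple of (s -
  1) (s + 1) (s - 2). The zero terms keep the shape of the transverse conditions.\<close>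

lemma cubic_roots:
  fixes d1 d2 d3 d4 :: complex
  assumes "\<And>s. s \<in> {1, -1, 2} \<Longrightarrow> 0 + d1 * s + d2 * s ^ 2 + d3 * s ^ 3 + d4 * s ^ 4 + 0 * s ^ 5 = 0"
  shows "d1 = 2 * d4" "d2 = - d4" "d3 = - 2 * d4"
proof -
  have "d1 + d2 + d3 + d4 = 0" "- d1 + d2 - d3 + d4 = 0" "2 * d1 + 4 * d2 + 8 * d3 + 16 * d4 = 0"
    using assms[of 1] assms[of "-1"] assms[of 2] by (simp_all add: mult.commute)
  then show "d1 = 2 * d4" "d2 = - d4" "d3 = - 2 * d4" by algebra+
qed

text \<open>Three points on each side of the triangle x0 x1 x2 = 0. The parameters are chosen such
  that the ratios of coefficients collected once around the triangle, 4^3 along the sides and 2^3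
  for the transverse conditions, differ from 1.\<close>

definition sextic_pts :: "nat \<times> nat \<Rightarrow> complex" where
  "sextic_pts = pts [edge 0 1 1, edge 0 1 (-1), edge 0 1 2, edge 1 2 1, edge 1 2 (-1), edge 1 2 2,
     edge 2 0 1, edge 2 0 (-1), edge 2 0 2]"

lemma sextic_pts: "(\<forall>j<9. P (pt sextic_pts j)) \<longleftrightarrow>
    (\<forall>s\<in>{1, -1, 2}. P (edge 0 1 s) \<and> P (edge 1 2 s) \<and> P (edge 2 0 s))"
  unfolding sextic_pts_def by (subst all_pts) auto

lemma sextic_nondeg: "nondeg 2 6 9 sextic_pts"
proof (rule nondeg_witness[of "{expo [2, 2, 2]}"])
  show "{expo [2, 2, 2]} \<subseteq> Mon 2 6" by (simp add: Mon_monl monl_2_6)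
  show "card (Mon 2 6) = 9 * Suc 2 + card {expo [2, 2, 2]}" by (simp add: card_Mon_values)
next
  fix F \<alpha> assume sng: "\<And>j. j < 9 \<Longrightarrow> sing 2 6 F (pt sextic_pts j)"
    and F0: "\<And>\<alpha>. \<alpha> \<in> {expo [2, 2, 2]} \<Longrightarrow> F \<alpha> = 0" and \<alpha>: "\<alpha> \<in> Mon 2 6"
  have h: "\<And>s. s \<in> {1, -1, 2} \<Longrightarrow> sing 2 6 F (edge 0 1 s)" "\<And>s. s \<in> {1, -1, 2} \<Longrightarrow> sing 2 6 F (edge 1 2 s)"
    "\<And>s. s \<in> {1, -1, 2} \<Longrightarrow> sing 2 6 F (edge 2 0 s)"
    using sng sextic_pts[of "sing 2 6 F"] by blast+
  note A = sextic_double_roots[OF sextic_edge_01(1)[OF h(1)] sextic_edge_01(2)[OF h(1)]]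
    sextic_double_roots[OF sextic_edge_12(1)[OF h(2)] sextic_edge_12(2)[OF h(2)]]
    sextic_double_roots[OF sextic_edge_20(1)[OF h(3)] sextic_edge_20(2)[OF h(3)]]
  have "F (expo [6, 0, 0]) = 64 * F (expo [6, 0, 0])"
    using A(1) A(7) A(13) by simp
  then have "F (expo [6, 0, 0]) = 0" by simp
  then have edges: "F (expo [6, 0, 0]) = 0" "F (expo [0, 6, 0]) = 0" "F (expo [0, 0, 6]) = 0"
      using A(1) A(7) A(13) by auto
  have Z: "F (expo [5, 1, 0]) = 0" "F (expo [4, 2, 0]) = 0" "F (expo [3, 3, 0]) = 0" "F (expo [2, 4, 0]) = 0"
      "F (expo [1, 5, 0]) = 0"
    "F (expo [0, 5, 1]) = 0" "F (expo [0, 4, 2]) = 0" "F (expo [0, 3, 3]) = 0" "F (expo [0, 2, 4]) = 0"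
        "F (expo [0, 1, 5]) = 0"
    "F (expo [1, 0, 5]) = 0" "F (expo [2, 0, 4]) = 0" "F (expo [3, 0, 3]) = 0" "F (expo [4, 0, 2]) = 0"
        "F (expo [5, 0, 1]) = 0"
    using A unfolding edges by (simp_all del: One_nat_def)
  have b1: "0 + F (expo [4, 1, 1]) * s + F (expo [3, 2, 1]) * s ^ 2 + F (expo [2, 3, 1]) * s ^ 3
      + F (expo [1, 4, 1]) * s ^ 4 + 0 * s ^ 5 = 0" if "s \<in> {1, -1, 2}" for s
    using sextic_edge_01(3)[OF h(1)[OF that]] by (simp add: Z del: One_nat_def)
  have b2: "0 + F (expo [1, 4, 1]) * s + F (expo [1, 3, 2]) * s ^ 2 + F (expo [1, 2, 3]) * s ^ 3
      + F (expo [1, 1, 4]) * s ^ 4 + 0 * s ^ 5 = 0" if "s \<in> {1, -1, 2}" for s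
    using sextic_edge_12(3)[OF h(2)[OF that]] by (simp add: Z del: One_nat_def)
  have b3: "0 + F (expo [1, 1, 4]) * s + F (expo [2, 1, 3]) * s ^ 2 + F (expo [3, 1, 2]) * s ^ 3
      + F (expo [4, 1, 1]) * s ^ 4 + 0 * s ^ 5 = 0" if "s \<in> {1, -1, 2}" for s
    using sextic_edge_20(3)[OF h(3)[OF that]] by (simp add: Z del: One_nat_def)
  note B = cubic_roots[OF b1] cubic_roots[OF b2] cubic_roots[OF b3]
  have "F (expo [4, 1, 1]) = 8 * F (expo [4, 1, 1])" using B(1) B(4) B(7) by simp
  then have "F (expo [4, 1, 1]) = 0" by simp
  then have ones: "F (expo [4, 1, 1]) = 0" "F (expo [1, 4, 1]) = 0" "F (expo [1, 1, 4]) = 0" using B(1) B(4) B(7)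
      by auto
  have "\<forall>xs\<in>set (monl 2 6). F (expo xs) = 0"
    unfolding monl_2_6 using F0 B by (simp add: edges Z ones del: One_nat_def)
  then show "F \<alpha> = 0" using \<alpha> unfolding Mon_monl by blast
qed auto

lemma form_eval_nonzero:
  assumes "\<alpha> \<in> Mon n d" "F \<alpha> \<noteq> 0"
  shows "\<exists>x. form_eval n d F x \<noteq> 0"
  using form_eval_zero_iff[of n d F \<alpha>] assms by blast

lemma form_through_points:
  assumes "finite A" "card A < card (Mon n d)"
  shows "\<exists>G\<in>aff (Mon n d). (\<exists>\<alpha>\<in>Mon n d. G \<alpha> \<noteq> 0) \<and> (\<forall>a\<in>A. form_eval n d G (l a) = 0)"
proof -
  obtain q where q: "\<exists>\<alpha>\<in>Mon n d. q \<alpha> \<noteq> 0" "\<forall>a\<in>A. (\<Sum>\<alpha>\<in>Mon n d. q \<alpha> * (\<Prod>i\<le>n. l a i ^ \<alpha> i)) = 0"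
    using homogeneous_system[OF assms(1) finite_Mon assms(2), of "\<lambda>\<alpha> a. \<Prod>i\<le>n. l a i ^ \<alpha> i"] by blast
  define G where "G = (\<lambda>\<alpha>. if \<alpha> \<in> Mon n d then q \<alpha> else 0)"
  have "form_eval n d G x = form_eval n d q x" for x by (rule form_eval_cong) (simp add: G_def)
  then have "\<forall>a\<in>A. form_eval n d G (l a) = 0" using q(2) by (simp add: form_eval_def)
  moreover have "G \<in> aff (Mon n d)" by (auto simp: G_def aff_def)
  moreover have "\<exists>\<alpha>\<in>Mon n d. G \<alpha> \<noteq> 0" using q(1) by (auto simp: G_def)
  ultimately show ?thesis by blast
qed

text \<open>Moving along one direction q in which A has non-zero derivative leaves a single equation
  in one complex unknown.\<close>

lemma persist_line:
  fixes l q :: "nat \<Rightarrow> complex"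
  assumes A: "A \<in> poly_fun {..n}" and B: "B \<in> poly_fun {..n}" and "A l = 0" "dd A l q \<noteq> 0" "e > 0"
  shows "\<exists>\<delta>>0. \<forall>t. norm t < \<delta> \<longrightarrow> (\<exists>x. (\<forall>i\<le>n. norm (x i - l i) < e) \<and> A x + t * B x = 0)"
proof -
  obtain a where a: "\<And>z. A (\<lambda>i. l i + z * q i) = poly a z" using pf_line[OF A, of l q] by blast
  obtain b where b: "\<And>z. B (\<lambda>i. l i + z * q i) = poly b z" using pf_line[OF B, of l q] by blast
  define \<Phi> where "\<Phi> = (\<lambda>y :: complex \<times> complex. poly a (snd y) + fst y * poly b (snd y))"
  have da: "dd A l q = poly (pderiv a) 0"
    unfolding dd_def a by (rule DERIV_imp_deriv) (rule poly_DERIV)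
  have "poly a 0 = 0" using a[of 0] assms(3) by simp
  have der: "((\<lambda>y :: complex \<times> complex. poly c (snd y)) has_derivative (\<lambda>h.
      poly (pderiv c) 0 * snd h)) (at (0, 0))" for c
    by (rule has_derivative_compose[of snd snd "(0,0)" UNIV "poly c" "\<lambda>h. poly (pderiv c) 0 * h"])
      (use poly_DERIV[of c 0] in \<open>auto intro: has_derivative_snd has_derivative_ident simp: has_field_derivative_def\<close>)
  have "\<exists>\<delta>>0. \<forall>t. norm t < \<delta> \<longrightarrow> (\<exists>z. (\<forall>i\<le>n. norm (z * q i) < e) \<and> \<Phi> (t, z) = 0)"
  proof (rule persist_points[where c = "\<lambda>z i. z * q i" and D = "\<lambda>h. poly (pderiv a) 0 * snd h + (fst h * poly b 0)"])
    show "continuous_on UNIV \<Phi>" unfolding \<Phi>_def by (intro continuous_intros)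
    show "(\<Phi> has_derivative (\<lambda>h. poly (pderiv a) 0 * snd h + (fst h * poly b 0))) (at (0, 0))"
      unfolding \<Phi>_def by (rule has_derivative_eq_rhs[OF has_derivative_add[OF der has_derivative_mult[OF
          has_derivative_fst[OF has_derivative_ident] der]]]) auto
    show "\<Phi> (0, 0) = 0" using \<open>poly a 0 = 0\<close> by (simp add: \<Phi>_def)
    show "surj (\<lambda>z. poly (pderiv a) 0 * snd (0 :: complex, z) + (fst (0 :: complex, z) * poly b 0))"
      by (rule surjI[of _ "\<lambda>w. w / poly (pderiv a) 0"]) (use assms(4) da in simp)
    show "bounded_linear (\<lambda>z. z * q i)" for i by (rule bounded_linear_mult_left)
  qed (rule assms(5))
  then obtain \<delta> where \<delta>: "\<delta> > 0" "\<And>t. norm t < \<delta> \<Longrightarrow> \<exists>z. (\<forall>i\<le>n. norm (z * q i) < e) \<and> \<Phi> (t, z) = 0" by auto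
  show ?thesis
  proof (intro exI[of _ \<delta>] conjI \<delta>(1) allI impI)
    fix t :: complex assume "norm t < \<delta>"
    then obtain z where "\<forall>i\<le>n. norm (z * q i) < e" "\<Phi> (t, z) = 0" using \<delta>(2) by blast
    then show "\<exists>x. (\<forall>i\<le>n. norm (x i - l i) < e) \<and> A x + t * B x = 0"
      by (intro exI[of _ "\<lambda>i. l i + z * q i"]) (simp add: a b \<Phi>_def)
  qed
qed

text \<open>A square is singular wherever its root vanishes, so the witness points only have to stay
  on the moving cubic.\<close>

lemma square_in_zdual:
  assumes F: "F \<in> aff (Mon 2 6)" and G: "G \<in> aff (Mon 2 3)" and FG: "\<And>l. form_eval 2 6 F l = (form_eval 2 3 G l)^2"
  shows "F \<in> zdual (Mon 2 6) (sec_cone 2 6 9)"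
proof -
  \<comment> \<open>The triangle x0 x1 x2. Exactly one coordinate vanishes at each witness point, so
    the differential is non-zero there.\<close>
  let ?G0 = "mform 2 3 [1, 1, 1]"
  have in3: "[1, 1, 1] \<in> set (monl 2 3)" by code_simp
  have G0: "form_eval 2 3 ?G0 = (\<lambda>x. x 0 * (x 1 * x 2))"
    using mform(2)[OF in3] by (simp add: fun_eq_iff upt_3 del: upt_Suc)
  let ?B = "\<lambda>x. form_eval 2 3 G x - form_eval 2 3 ?G0 x"
  obtain C1 where C1: "pform {()} 2 3 (\<lambda>p x. form_eval 2 3 ?G0 x + p () * ?B x) C1"
    using pform_line[OF mform(1)[OF in3] G] by blast
  have six: "3 + 3 = (6::nat)" by simp
  from pform_mult[OF C1 C1, unfolded six]
  obtain C where C: "pform {()} 2 6 (\<lambda>p x. (form_eval 2 3 ?G0 x + p () * ?B x) * (form_eval 2 3 ?G0 x + p () * ?B x)) C"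
    ..
  have Apf: "form_eval 2 3 ?G0 \<in> poly_fun {..2}" and Bpf: "?B \<in> poly_fun {..2}"
    by (intro pf_diff pf_form_eval)+
  have "C (\<lambda>_. 1) \<in> zdual (Mon 2 6) (sec_cone 2 6 9)"
  proof (rule zdual_deform[OF sextic_nondeg _ C])
    fix j :: nat and e :: real assume j: "j < 9" and e: "e > 0"
    have "\<forall>j<9. form_eval 2 3 ?G0 (pt sextic_pts j) = 0 \<and> (\<exists>q. dd (form_eval 2 3 ?G0) (pt sextic_pts j) q \<noteq> 0)"
    proof -
      have d: "dd (form_eval 2 3 ?G0) x q = q 0 * (x 1 * x 2) + x 0 * (q 1 * x 2 + x 1 * q 2)" for x q
        unfolding G0 by (simp add: dd_mult[where I = UNIV] poly_fun.intros)
      have "\<exists>q. dd (form_eval 2 3 ?G0) (edge 0 1 s) q \<noteq> 0" if "s \<noteq> 0" for s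
        unfolding d using that by (intro exI[of _ "ax 2"]) (simp add: edge_def ax_def)
      moreover have "\<exists>q. dd (form_eval 2 3 ?G0) (edge 1 2 s) q \<noteq> 0" if "s \<noteq> 0" for s
        unfolding d using that by (intro exI[of _ "ax 0"]) (simp add: edge_def ax_def)
      moreover have "\<exists>q. dd (form_eval 2 3 ?G0) (edge 2 0 s) q \<noteq> 0" if "s \<noteq> 0" for s
        unfolding d using that by (intro exI[of _ "ax 1"]) (simp add: edge_def ax_def)
      moreover have "form_eval 2 3 ?G0 (edge 0 1 s) = 0" "form_eval 2 3 ?G0 (edge 1 2 s) = 0"
        "form_eval 2 3 ?G0 (edge 2 0 s) = 0" for s unfolding G0 by (simp_all add: edge_def)
      ultimately show ?thesis
        unfolding sextic_pts[where P = "\<lambda>x. form_eval 2 3 ?G0 x = 0 \<and> (\<exists>q. dd (form_eval 2 3 ?G0) x q \<noteq> 0)"] by simp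
    qed
    with j have q1: "form_eval 2 3 ?G0 (pt sextic_pts j) = 0" and "\<exists>q. dd (form_eval 2 3 ?G0) (pt sextic_pts j) q \<noteq> 0"
      by simp_all
    then obtain q where q: "dd (form_eval 2 3 ?G0) (pt sextic_pts j) q \<noteq> 0" by (elim exE)
    obtain \<delta> where \<delta>: "\<delta> > 0" "\<And>t. norm t < \<delta> \<Longrightarrow> \<exists>x. (\<forall>i\<le>2. norm (x i - pt sextic_pts j i) < e)
        \<and> form_eval 2 3 ?G0 x + t * ?B x = 0"
      using persist_line[OF Apf Bpf q1 q e] by (elim exE conjE) simp
    show "\<exists>\<delta>>0. \<forall>t. norm t < \<delta> \<longrightarrow> (\<exists>x. (\<forall>i\<le>2. norm (x i - pt sextic_pts j i) < e) \<and> sing 2 6 (C (\<lambda>_. t)) x)"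
    proof (intro exI[of _ \<delta>] conjI \<delta>(1) allI impI)
      fix t :: complex assume "norm t < \<delta>"
      from \<delta>(2)[OF this] obtain x where x: "\<forall>i\<le>2. norm (x i - pt sextic_pts j i) < e"
          "form_eval 2 3 ?G0 x + t * ?B x = 0"
        by (elim exE conjE)
      have "sing 2 6 (C (\<lambda>_. t)) x"
      proof (rule sing_mult[where g = "\<lambda>x. form_eval 2 3 ?G0 x + t * ?B x"
          and h = "\<lambda>x. form_eval 2 3 ?G0 x + t * ?B x"])
        show "(\<lambda>x. form_eval 2 3 ?G0 x + t * ?B x) \<in> poly_fun {..2}"
          by (rule pf_add[OF Apf pf_cmult[OF Bpf]])
        then show "(\<lambda>x. form_eval 2 3 ?G0 x + t * ?B x) \<in> poly_fun {..2}" .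
      qed (rule pformD(4)[OF C] x(2))+
      then show "\<exists>x. (\<forall>i\<le>2. norm (x i - pt sextic_pts j i) < e) \<and> sing 2 6 (C (\<lambda>_. t)) x" using x(1)
          by (intro exI[of _ x] conjI)
    qed
  qed simp
  moreover have "C (\<lambda>_. 1) = F"
    by (rule form_eval_inject[OF pformD(3)[OF C] F]) (simp add: pformD(4)[OF C] FG power2_eq_square)
  ultimately show ?thesis by simp
qed

lemma sextic_part:
  "double_cubics \<subseteq> zdual (Mon 2 6) (sec_cone 2 6 9) \<and>
   card (Mon 2 6) - zdim (Mon 2 6) (zdual (Mon 2 6) (sec_cone 2 6 9)) = 18"
proof -
  let ?Z = "zdual (Mon 2 6) (sec_cone 2 6 9)"
  let ?J = "Mon 2 3"
  have c1: "pform ?J 2 3 (\<lambda>p. form_eval 2 3 (\<lambda>\<alpha>. p \<alpha>)) (\<lambda>p \<alpha>. if \<alpha> \<in> Mon 2 3 then p \<alpha> else 0)"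
    by (rule pform_coeffs) (rule poly_fun.pf_coord)
  have six: "3 + 3 = (6::nat)" by simp
  from pform_mult[OF c1 c1, unfolded six]
  obtain C where C: "pform ?J 2 6 (\<lambda>p x. form_eval 2 3 p x * form_eval 2 3 p x) C"
    ..
  have CZ: "range C \<subseteq> ?Z"
  proof
    fix F assume "F \<in> range C"
    then obtain p where p: "F = C p" by (rule rangeE)
    let ?G = "\<lambda>\<alpha>. if \<alpha> \<in> Mon 2 3 then p \<alpha> else 0"
    show "F \<in> ?Z"
      unfolding p
      by (rule square_in_zdual[OF pformD(3)[OF C], of ?G])
        (auto simp: pformD(4)[OF C] power2_eq_square aff_def cong: form_eval_cong)
  qed
  have ZC: "?Z \<subseteq> zclosure (Mon 2 6) (range C)"
  proof (rule zdual_subset_singular[where S = "{p. nondeg 2 6 9 p}"])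
    show "f p = 0" if "f \<in> poly_fun (prm 9 2)" "\<And>q. q \<in> {p. nondeg 2 6 9 p} \<Longrightarrow> f q = 0" for f p
      using nondeg_dense[OF sextic_nondeg that(1)] that(2) by simp
    fix p F assume p: "p \<in> {p. nondeg 2 6 9 p}" and F: "F \<in> aff (Mon 2 6)" "\<And>j. j < 9 \<Longrightarrow> sing 2 6 F (pt p j)"
    \<comment> \<open>Plane cubics have 10 coefficients, one more than the number of points.\<close>
    obtain G where G: "G \<in> aff (Mon 2 3)" "\<exists>\<alpha>\<in>Mon 2 3. G \<alpha> \<noteq> 0" "\<forall>j\<in>{..<9::nat}. form_eval 2 3 G (pt p j) = 0"
      using form_through_points[of "{..<9::nat}" 2 3 "pt p"] by (auto simp: card_Mon_values)
    define H where "H = (\<lambda>b. if b then F else C G)"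
    have sg: "sing 2 6 (C G) (pt p j)" if "j < 9" for j
      using G(3) that by (intro sing_mult[OF pformD(4)[OF C]] pf_form_eval) auto
    \<comment> \<open>The 27 independent conditions leave one dimension of the 28, so F and the
      square of G are dependent.\<close>
    have "\<exists>q. (\<exists>a\<in>{True, False}. q a \<noteq> 0) \<and> (\<forall>x. (\<Sum>a\<in>{True, False}. q a * form_eval 2 6 (H a) x) = 0)"
      by (rule nondeg_singular_dim[of 2 6 9 p])
        (use p F sg pformD(3)[OF C] in \<open>auto simp: card_Mon_values H_def\<close>)
    then obtain q where q: "\<exists>a\<in>{True, False}. q a \<noteq> 0" "\<And>x. (\<Sum>a\<in>{True, False}. q a * form_eval 2 6 (H a) x) = 0"
        by blast
    have q': "q True * form_eval 2 6 F x + q False * (form_eval 2 3 G x)^2 = 0" for x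
      using q(2)[of x] by (simp add: H_def pformD(4)[OF C] power2_eq_square)
    obtain x0 where x0: "form_eval 2 3 G x0 \<noteq> 0" using G(2) form_eval_nonzero by blast
    have qt: "q True \<noteq> 0"
    proof
      assume "q True = 0"
      then have "q False = 0" using q'[of x0] x0 by simp
      then show False using q(1) \<open>q True = 0\<close> by auto
    qed
    \<comment> \<open>A complex square root absorbs the scalar into the cubic.\<close>
    define c where "c = csqrt (- q False / q True)"
    have "F = C (\<lambda>\<alpha>. c * G \<alpha>)"
    proof (rule form_eval_inject[OF F(1) pformD(3)[OF C]])
      fix x
      have "form_eval 2 6 F x = - q False / q True * (form_eval 2 3 G x)^2"
        using q'[of x] qt by (simp add: field_simps eq_neg_iff_add_eq_0)
      also have "\<dots> = c * form_eval 2 3 G x * (c * form_eval 2 3 G x)"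
        unfolding c_def by (simp add: power2_eq_square[symmetric] power_mult_distrib)
      finally show "form_eval 2 6 F x = form_eval 2 6 (C (\<lambda>\<alpha>. c * G \<alpha>)) x"
        by (simp add: pformD(4)[OF C] form_eval_cmult)
    qed
    then show "F \<in> range C" by simp
  qed
  \<comment> \<open>At x0^3 the differential of squaring is multiplication by 2 x0^3, which is
    injective because there are no zero divisors.\<close>
  let ?p0 = "mform 2 3 [3, 0, 0]"
  have in3: "[3, 0, 0] \<in> set (monl 2 3)" by code_simp
  have p0: "form_eval 2 3 ?p0 x = x 0 ^ 3" for x
    using mform(2)[OF in3] by (simp add: upt_3 del: upt_Suc)
  have pdm: "pd (\<lambda>p. form_eval 2 3 p x) \<alpha> p0 = (\<Prod>i\<le>2. x i ^ \<alpha> i)" if "\<alpha> \<in> Mon 2 3" for x \<alpha> p0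
    unfolding form_eval_def pd_def dd_linear_form using that
        by (simp add: ax_def if_distrib[of "\<lambda>c. c * _"] cong: if_cong)
  have pfm: "(\<lambda>p. form_eval 2 3 p x) \<in> poly_fun (Mon 2 3)" for x
    by (rule pf_form_eval_coeffs) (rule poly_fun.pf_coord)
  have "lin_indep ?J (Mon 2 6) (\<lambda>j \<alpha>. pd (\<lambda>p. C p \<alpha>) j ?p0)"
  proof (rule lin_indep_form_derivatives[OF C order_refl])
    fix q \<alpha> assume q: "\<And>x. (\<Sum>j\<in>?J. q j * pd (\<lambda>p. form_eval 2 3 p x * form_eval 2 3 p x) j ?p0) = 0" and \<alpha>: "\<alpha> \<in> ?J"
    have "x 0 ^ 3 * form_eval 2 3 q x = 0" for x
    proof -
      have "0 = (\<Sum>j\<in>?J. q j * (2 * x 0 ^ 3 * (\<Prod>i\<le>2. x i ^ j i)))"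
        unfolding q[of x, symmetric] by (intro sum.cong refl) (simp add: pd_mult_eq[OF pfm pfm] pdm p0 algebra_simps)
      also have "\<dots> = 2 * (x 0 ^ 3 * form_eval 2 3 q x)" by (simp add: form_eval_def sum_distrib_left mult_ac)
      finally show ?thesis by simp
    qed
    then have "(\<forall>x :: nat \<Rightarrow> complex. x 0 ^ 3 = 0) \<or> (\<forall>x. form_eval 2 3 q x = 0)"
      by (intro pf_mult_eq_zero[where I = "{..2}"] pf_power poly_fun.pf_coord pf_form_eval) auto
    moreover have "\<not> (\<forall>x :: nat \<Rightarrow> complex. x 0 ^ 3 = 0)" by (auto intro: exI[of _ "\<lambda>_. 1"])
    ultimately show "q \<alpha> = 0" using form_eval_zero_iff \<alpha> by blast
  qed
  then have "zchain (Mon 2 6) (zclosure (Mon 2 6) (range C)) (card ?J)"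
    by (intro zchain_immersion pformD(1,2)[OF C]) auto
  then have chain: "zchain (Mon 2 6) ?Z 10"
    using zclosure_minimal[OF zclosed_zdual CZ] zchain_mono unfolding card_Mon_values by blast
  have "dep_bound (Mon 2 6) (range C) 10"
    by (rule dep_bound_range[OF finite_Mon pformD(1)[OF C]]) (simp add: card_Mon_values)
  then have "zdim (Mon 2 6) ?Z = 10" by (rule zdim_eqI[OF _ ZC chain])
  moreover have "double_cubics \<subseteq> ?Z"
    unfolding double_cubics_def forms_def using square_in_zdual by blast
  ultimately show ?thesis by (simp add: card_Mon_values)
qed

section \<open>Quartic surfaces\<close>

text \<open>A binary quartic with double roots 1 and 2 is a multiple of ((s - 1) (s - 2))^2.\<close>

lemma quartic_double_roots:
  fixes c0 c1 c2 c3 c4 :: complex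
  assumes a: "\<And>s. s \<in> {1, 2} \<Longrightarrow> 4 * c0 + 3 * c1 * s + 2 * c2 * s ^ 2 + c3 * s ^ 3 = 0"
    and b: "\<And>s. s \<in> {1, 2} \<Longrightarrow> c1 + 2 * c2 * s + 3 * c3 * s ^ 2 + 4 * c4 * s ^ 3 = 0"
  shows "c0 = 4 * c4" "c1 = - 12 * c4" "c2 = 13 * c4" "c3 = - 6 * c4"
proof -
  have e: "4 * c0 + 3 * c1 + 2 * c2 + c3 = 0" "4 * c0 + 6 * c1 + 8 * c2 + 8 * c3 = 0"
    "c1 + 2 * c2 + 3 * c3 + 4 * c4 = 0" "c1 + 4 * c2 + 12 * c3 + 32 * c4 = 0"
    using a[of 1] a[of 2] b[of 1] b[of 2] by (simp_all add: mult.commute)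
  show "c0 = 4 * c4" "c1 = - 12 * c4" "c2 = 13 * c4" "c3 = - 6 * c4"
    using e by algebra+
qed

lemma quadratic_roots:
  fixes d0 d1 d2 :: complex
  assumes "\<And>s. s \<in> {1, 2} \<Longrightarrow> d0 + d1 * s + d2 * s ^ 2 = 0"
  shows "d0 = 2 * d2" "d1 = - 3 * d2"
proof -
  have "d0 + d1 + d2 = 0" "d0 + 2 * d1 + 4 * d2 = 0"
    using assms[of 1] assms[of 2] by (simp_all add: mult.commute)
  then show "d0 = 2 * d2" "d1 = - 3 * d2" by algebra+
qed

text \<open>Two points on each side of the quadrilateral x0 x2 = x1 x3 = 0, the base locus of a
  pencil of quadrics. The ratios collected around it are 4^4 and 2^4, again different from
  1.\<close>

definition quartic_pts :: "nat \<times> nat \<Rightarrow> complex" where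
  "quartic_pts = pts [edge 0 1 1, edge 0 1 2, edge 1 2 1, edge 1 2 2, edge 2 3 1, edge 2 3 2, edge 3 0 1, edge 3 0 2]"

lemma quartic_pts: "(\<forall>j<8. P (pt quartic_pts j)) \<longleftrightarrow>
    (\<forall>s\<in>{1, 2}. P (edge 0 1 s) \<and> P (edge 1 2 s) \<and> P (edge 2 3 s) \<and> P (edge 3 0 s))"
  unfolding quartic_pts_def by (subst all_pts) auto

lemma quartic_nondeg: "nondeg 3 4 8 quartic_pts"
proof (rule nondeg_witness[of "{expo [2, 0, 2, 0], expo [0, 2, 0, 2], expo [1, 1, 1, 1]}"])
  let ?B = "{expo [2, 0, 2, 0], expo [0, 2, 0, 2], expo [1, 1, 1, 1]}"
  show "?B \<subseteq> Mon 3 4" by (simp add: Mon_monl monl_3_4)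
  have "card (expo ` {[2, 0, 2, 0], [0, 2, 0, 2], [1, 1, 1, 1]}) = card {[2, 0, 2, 0], [0, 2, 0, 2], [1, 1, 1, 1::nat]}"
    by (rule card_image) (rule inj_onI, rule expo_inj, auto)
  then show "card (Mon 3 4) = 8 * Suc 3 + card ?B" by (simp add: card_Mon_values)
next
  fix F \<alpha> assume sng: "\<And>j. j < 8 \<Longrightarrow> sing 3 4 F (pt quartic_pts j)"
    and F0: "\<And>\<alpha>. \<alpha> \<in> {expo [2, 0, 2, 0], expo [0, 2, 0, 2], expo [1, 1, 1, 1]} \<Longrightarrow> F \<alpha> = 0" and \<alpha>: "\<alpha> \<in> Mon 3 4"
  have h: "\<And>s. s \<in> {1, 2} \<Longrightarrow> sing 3 4 F (edge 0 1 s)" "\<And>s. s \<in> {1, 2} \<Longrightarrow> sing 3 4 F (edge 1 2 s)"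
    "\<And>s. s \<in> {1, 2} \<Longrightarrow> sing 3 4 F (edge 2 3 s)" "\<And>s. s \<in> {1, 2} \<Longrightarrow> sing 3 4 F (edge 3 0 s)"
    using sng quartic_pts[of "sing 3 4 F"] by blast+
  note A = quartic_double_roots[OF quartic_edge_01(1)[OF h(1)] quartic_edge_01(2)[OF h(1)]]
    quartic_double_roots[OF quartic_edge_12(1)[OF h(2)] quartic_edge_12(2)[OF h(2)]]
    quartic_double_roots[OF quartic_edge_23(1)[OF h(3)] quartic_edge_23(2)[OF h(3)]]
    quartic_double_roots[OF quartic_edge_30(1)[OF h(4)] quartic_edge_30(2)[OF h(4)]]
  have "F (expo [4, 0, 0, 0]) = 256 * F (expo [4, 0, 0, 0])"
    using A(1) A(5) A(9) A(13) by simp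
  then have "F (expo [4, 0, 0, 0]) = 0" by simp
  then have edges: "F (expo [4, 0, 0, 0]) = 0" "F (expo [0, 4, 0, 0]) = 0" "F (expo [0, 0, 4, 0]) = 0"
      "F (expo [0, 0, 0, 4]) = 0"
    using A(1) A(5) A(9) A(13) by auto
  have Z: "F (expo [3, 1, 0, 0]) = 0" "F (expo [2, 2, 0, 0]) = 0" "F (expo [1, 3, 0, 0]) = 0"
      "F (expo [0, 3, 1, 0]) = 0"
    "F (expo [0, 2, 2, 0]) = 0" "F (expo [0, 1, 3, 0]) = 0" "F (expo [0, 0, 3, 1]) = 0" "F (expo [0, 0, 2, 2]) = 0"
    "F (expo [0, 0, 1, 3]) = 0" "F (expo [1, 0, 0, 3]) = 0" "F (expo [2, 0, 0, 2]) = 0" "F (expo [3, 0, 0, 1]) = 0"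
    using A unfolding edges by (simp_all del: One_nat_def)
  have b1: "F (expo [3, 0, 1, 0]) + F (expo [2, 1, 1, 0]) * s + F (expo [1, 2, 1, 0]) * s ^ 2 = 0" if "s \<in> {1, 2}" for s
    using quartic_edge_01(3)[OF h(1)[OF that]] by (simp add: Z del: One_nat_def)
  \<comment> \<open>Here the first of the four coefficients is known to vanish and not the last, so
    a factor s is removed.\<close>
  have b2: "F (expo [2, 1, 0, 1]) + F (expo [1, 2, 0, 1]) * s + F (expo [0, 3, 0, 1]) * s ^ 2 = 0" if "s \<in> {1, 2}" for s
  proof -
    have "s * (F (expo [2, 1, 0, 1]) + F (expo [1, 2, 0, 1]) * s + F (expo [0, 3, 0, 1]) * s ^ 2) = 0"
      using quartic_edge_01(4)[OF h(1)[OF that]]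
      by (simp add: Z algebra_simps power2_eq_square power3_eq_cube del: One_nat_def)
    then show ?thesis using that by auto
  qed
  have b3: "F (expo [1, 2, 1, 0]) + F (expo [1, 1, 2, 0]) * s + F (expo [1, 0, 3, 0]) * s ^ 2 = 0" if "s \<in> {1, 2}" for s
  proof -
    have "s * (F (expo [1, 2, 1, 0]) + F (expo [1, 1, 2, 0]) * s + F (expo [1, 0, 3, 0]) * s ^ 2) = 0"
      using quartic_edge_12(3)[OF h(2)[OF that]]
      by (simp add: Z algebra_simps power2_eq_square power3_eq_cube del: One_nat_def)
    then show ?thesis using that by auto
  qed
  have b4: "F (expo [0, 3, 0, 1]) + F (expo [0, 2, 1, 1]) * s + F (expo [0, 1, 2, 1]) * s ^ 2 = 0" if "s \<in> {1, 2}" for s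
    using quartic_edge_12(4)[OF h(2)[OF that]] by (simp add: Z del: One_nat_def)
  have b5: "F (expo [1, 0, 3, 0]) + F (expo [1, 0, 2, 1]) * s + F (expo [1, 0, 1, 2]) * s ^ 2 = 0" if "s \<in> {1, 2}" for s
    using quartic_edge_23(3)[OF h(3)[OF that]] by (simp add: Z del: One_nat_def)
  have b6: "F (expo [0, 1, 2, 1]) + F (expo [0, 1, 1, 2]) * s + F (expo [0, 1, 0, 3]) * s ^ 2 = 0" if "s \<in> {1, 2}" for s
  proof -
    have "s * (F (expo [0, 1, 2, 1]) + F (expo [0, 1, 1, 2]) * s + F (expo [0, 1, 0, 3]) * s ^ 2) = 0"
      using quartic_edge_23(4)[OF h(3)[OF that]]
      by (simp add: Z algebra_simps power2_eq_square power3_eq_cube del: One_nat_def)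
    then show ?thesis using that by auto
  qed
  have b7: "F (expo [0, 1, 0, 3]) + F (expo [1, 1, 0, 2]) * s + F (expo [2, 1, 0, 1]) * s ^ 2 = 0" if "s \<in> {1, 2}" for s
    using quartic_edge_30(3)[OF h(4)[OF that]] by (simp add: Z del: One_nat_def)
  have b8: "F (expo [1, 0, 1, 2]) + F (expo [2, 0, 1, 1]) * s + F (expo [3, 0, 1, 0]) * s ^ 2 = 0" if "s \<in> {1, 2}" for s
  proof -
    have "s * (F (expo [1, 0, 1, 2]) + F (expo [2, 0, 1, 1]) * s + F (expo [3, 0, 1, 0]) * s ^ 2) = 0"
      using quartic_edge_30(4)[OF h(4)[OF that]]
      by (simp add: Z algebra_simps power2_eq_square power3_eq_cube del: One_nat_def)
    then show ?thesis using that by auto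
  qed
  note B = quadratic_roots[OF b1] quadratic_roots[OF b2] quadratic_roots[OF b3] quadratic_roots[OF b4]
      quadratic_roots[OF b5] quadratic_roots[OF b6] quadratic_roots[OF b7] quadratic_roots[OF b8]
  \<comment> \<open>The transverse relations form two closed circuits of length four, one through
    the coefficient of x0^3 x2 and one through that of x1^3 x3; each relation contributes a factor
    2.\<close>
  have "F (expo [3, 0, 1, 0]) = 16 * F (expo [3, 0, 1, 0])" "F (expo [0, 3, 0, 1]) = 16 * F (expo [0, 3, 0, 1])"
    using B by (simp_all del: One_nat_def)
  then have opp: "F (expo [3, 0, 1, 0]) = 0" "F (expo [0, 3, 0, 1]) = 0" by simp_all
  then have opp': "F (expo [1, 0, 3, 0]) = 0" "F (expo [0, 1, 0, 3]) = 0"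
      "F (expo [1, 2, 1, 0]) = 0" "F (expo [1, 0, 1, 2]) = 0" "F (expo [0, 1, 2, 1]) = 0" "F (expo [2, 1, 0, 1]) = 0"
    using B by (simp_all del: One_nat_def)
  have "\<forall>xs\<in>set (monl 3 4). F (expo xs) = 0"
    unfolding monl_3_4 using F0 B by (simp add: edges Z opp opp' del: One_nat_def)
  then show "F \<alpha> = 0" using \<alpha> unfolding Mon_monl by blast
qed auto

text \<open>The directions q1 and q2 diagonalise the differential of the pair A1, A2 at l, so moving
  in their plane gives two equations in two unknowns with invertible linear part.\<close>

lemma persist_plane:
  fixes l q1 q2 :: "nat \<Rightarrow> complex"
  assumes A: "A1 \<in> poly_fun {..n}" "A2 \<in> poly_fun {..n}" and B: "B1 \<in> poly_fun {..n}" "B2 \<in> poly_fun {..n}"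
    and zero: "A1 l = 0" "A2 l = 0" and der: "dd A1 l q1 \<noteq> 0" "dd A1 l q2 = 0" "dd A2 l q1 = 0" "dd A2 l q2 \<noteq> 0"
    and e: "e > 0"
  shows "\<exists>\<delta>>0. \<forall>t. norm t < \<delta> \<longrightarrow> (\<exists>x. (\<forall>i\<le>n. norm (x i - l i) < e) \<and> A1 x + t * B1 x = 0 \<and> A2 x + t * B2 x = 0)"
proof -
  define c :: "complex \<times> complex \<Rightarrow> nat \<Rightarrow> complex" where "c = (\<lambda>z i. fst z * q1 i + snd z * q2 i)"
  have c0: "c (0, 0) i = 0" for i by (simp add: c_def)
  have bl: "bounded_linear (\<lambda>z. c z i)" for i unfolding c_def
    by (intro bounded_linear_add bounded_linear_compose[OF bounded_linear_mult_left bounded_linear_fst]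
        bounded_linear_compose[OF bounded_linear_mult_left bounded_linear_snd])
  have dl: "((\<lambda>y :: complex \<times> complex \<times> complex. l i + c (snd y) i) has_derivative (\<lambda>h.
      c (snd h) i)) (at (0, 0, 0))" for i
    unfolding c_def by (auto intro!: derivative_eq_intros)
  have df: "((\<lambda>y :: complex \<times> complex \<times> complex. f (\<lambda>i. l i + c (snd y) i)) has_derivative
      (\<lambda>h. fst (snd h) * dd f l q1 + snd (snd h) * dd f l q2)) (at (0, 0, 0))" if f: "f \<in> poly_fun {..n}" for f
  proof (rule has_derivative_eq_rhs[OF pf_has_derivative[OF f finite_atMost dl]])
    show "(\<lambda>h. \<Sum>i\<in>{..n}. pd f i (\<lambda>i. l i + c (snd (0, 0, 0)) i) * c (snd h) i) =
        (\<lambda>h :: complex \<times> complex \<times> complex. fst (snd h) * dd f l q1 + snd (snd h) * dd f l q2)"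
      unfolding dd_linear[OF f finite_atMost]
      by (simp add: fun_eq_iff c0 c_def sum_distrib_left sum.distrib algebra_simps)
  qed
  have cf: "continuous_on UNIV (\<lambda>y :: complex \<times> complex \<times> complex. f (\<lambda>i. l i + c (snd y) i))" if f:
      "f \<in> poly_fun {..n}" for f
    by (rule pf_continuous_on[OF f]) (auto simp: c_def intro!: continuous_intros)
  define \<Phi> :: "complex \<times> complex \<times> complex \<Rightarrow> complex \<times> complex" where
    "\<Phi> = (\<lambda>y. (A1 (\<lambda>i. l i + c (snd y) i) + fst y * B1 (\<lambda>i. l i + c (snd y) i),
                  A2 (\<lambda>i. l i + c (snd y) i) + fst y * B2 (\<lambda>i. l i + c (snd y) i)))"
  define D :: "complex \<times> complex \<times> complex \<Rightarrow> complex \<times> complex" where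
    "D = (\<lambda>h. (fst (snd h) * dd A1 l q1 + fst h * B1 l, snd (snd h) * dd A2 l q2 + fst h * B2 l))"
  have dm: "((\<lambda>y :: complex \<times> complex \<times> complex. fst y * f (\<lambda>i. l i + c (snd y) i)) has_derivative (\<lambda>h.
      fst h * f l)) (at (0, 0, 0))"
    if f: "f \<in> poly_fun {..n}" for f
    by (rule has_derivative_eq_rhs[OF has_derivative_mult[OF has_derivative_fst[OF has_derivative_ident] df[OF
        f]]]) (simp add: c0)
  have "\<exists>\<delta>>0. \<forall>t. norm t < \<delta> \<longrightarrow> (\<exists>z. (\<forall>i\<le>n. norm (c z i) < e) \<and> \<Phi> (t, z) = 0)"
  proof (rule persist_points[where D = D and c = c])
    show "continuous_on UNIV \<Phi>" unfolding \<Phi>_def by (intro continuous_intros cf A B)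
    show "(\<Phi> has_derivative D) (at (0, 0))"
      unfolding \<Phi>_def D_def zero_prod_def
      by (rule has_derivative_eq_rhs[OF has_derivative_Pair[OF has_derivative_add[OF df[OF A(1)] dm[OF B(1)]]
          has_derivative_add[OF df[OF A(2)] dm[OF B(2)]]]])
        (simp add: der)
    show "\<Phi> (0, 0) = 0" using zero by (simp add: \<Phi>_def zero_prod_def c0)
    show "surj (\<lambda>z. D (0, z))"
      by (rule surjI[of _ "\<lambda>w. (fst w / dd A1 l q1, snd w / dd A2 l q2)"]) (use der in \<open>simp add: D_def\<close>)
  qed (rule bl e)+
  then obtain \<delta> where \<delta>: "\<delta> > 0" "\<And>t. norm t < \<delta> \<Longrightarrow> \<exists>z. (\<forall>i\<le>n. norm (c z i) < e) \<and> \<Phi> (t, z) = 0" by auto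
  show ?thesis
  proof (intro exI[of _ \<delta>] conjI \<delta>(1) allI impI)
    fix t :: complex assume "norm t < \<delta>"
    from \<delta>(2)[OF this] obtain z where "\<forall>i\<le>n. norm (c z i) < e" "\<Phi> (t, z) = 0" by (elim exE conjE)
    then show "\<exists>x. (\<forall>i\<le>n. norm (x i - l i) < e) \<and> A1 x + t * B1 x = 0 \<and> A2 x + t * B2 x = 0"
      by (intro exI[of _ "\<lambda>i. l i + c z i"]) (simp add: \<Phi>_def zero_prod_def)
  qed
qed

text \<open>A product is singular where both factors vanish, so the witness points have to stay on
  both moving quadrics.\<close>

lemma product_in_zdual:
  assumes F: "F \<in> aff (Mon 3 4)" and Q: "Q1 \<in> aff (Mon 3 2)" "Q2 \<in> aff (Mon 3 2)"
    and FQ: "\<And>l. form_eval 3 4 F l = form_eval 3 2 Q1 l * form_eval 3 2 Q2 l"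
  shows "F \<in> zdual (Mon 3 4) (sec_cone 3 4 8)"
proof -
  let ?G1 = "mform 3 2 [1, 0, 1, 0]" and ?G2 = "mform 3 2 [0, 1, 0, 1]"
  have in1: "[1, 0, 1, 0] \<in> set (monl 3 2)" and in2: "[0, 1, 0, 1] \<in> set (monl 3 2)" by code_simp+
  have G1: "form_eval 3 2 ?G1 = (\<lambda>x. x 0 * x 2)"
    using mform(2)[OF in1] by (simp add: fun_eq_iff upt_4 del: upt_Suc)
  have G2: "form_eval 3 2 ?G2 = (\<lambda>x. x 1 * x 3)"
    using mform(2)[OF in2] by (simp add: fun_eq_iff upt_4 del: upt_Suc)
  define A1 where "A1 = form_eval 3 2 ?G1"
  define A2 where "A2 = form_eval 3 2 ?G2"
  define B1 where "B1 = (\<lambda>x. form_eval 3 2 Q1 x - form_eval 3 2 ?G1 x)"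
  define B2 where "B2 = (\<lambda>x. form_eval 3 2 Q2 x - form_eval 3 2 ?G2 x)"
  have pf: "A1 \<in> poly_fun {..3}" "A2 \<in> poly_fun {..3}" "B1 \<in> poly_fun {..3}" "B2 \<in> poly_fun {..3}"
    unfolding A1_def A2_def B1_def B2_def by (intro pf_diff pf_form_eval)+
  from pform_line[OF mform(1)[OF in1] Q(1)] obtain C1 where C1: "pform {()} 3 2 (\<lambda>p x. A1 x + p () * B1 x) C1"
    unfolding A1_def B1_def ..
  from pform_line[OF mform(1)[OF in2] Q(2)] obtain C2 where C2: "pform {()} 3 2 (\<lambda>p x. A2 x + p () * B2 x) C2"
    unfolding A2_def B2_def ..
  have four: "2 + 2 = (4::nat)" by simp
  from pform_mult[OF C1 C2, unfolded four]
  obtain C where C: "pform {()} 3 4 (\<lambda>p x. (A1 x + p () * B1 x) * (A2 x + p () * B2 x)) C" ..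
  have "C (\<lambda>_. 1) \<in> zdual (Mon 3 4) (sec_cone 3 4 8)"
  proof (rule zdual_deform[OF quartic_nondeg _ C])
    fix j :: nat and e :: real assume j: "j < 8" and e: "e > 0"
    have d: "dd A1 x q = q 0 * x 2 + x 0 * q 2" "dd A2 x q = q 1 * x 3 + x 1 * q 3" for x q
      unfolding A1_def A2_def G1 G2 by (simp_all add: dd_mult[where I = UNIV] poly_fun.intros)
    define P where "P = (\<lambda>x. A1 x = 0 \<and> A2 x = 0 \<and>
      (\<exists>q1 q2. dd A1 x q1 \<noteq> 0 \<and> dd A1 x q2 = 0 \<and> dd A2 x q1 = 0 \<and> dd A2 x q2 \<noteq> 0))"
    \<comment> \<open>On each side of the quadrilateral one of the two vanishing coordinates belongs
      to A1 and the other to A2; the corresponding coordinate directions separate the two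
      differentials.\<close>
    have "P (edge 0 1 s)" if "s \<noteq> 0" for s
      unfolding P_def d unfolding A1_def A2_def G1 G2
      by (insert that, intro conjI; (rule exI[of _ "ax 2"], rule exI[of _ "ax 3"])?; simp add: edge_def ax_def)
    moreover have "P (edge 1 2 s)" if "s \<noteq> 0" for s
      unfolding P_def d unfolding A1_def A2_def G1 G2
      by (insert that, intro conjI; (rule exI[of _ "ax 0"], rule exI[of _ "ax 3"])?; simp add: edge_def ax_def)
    moreover have "P (edge 2 3 s)" if "s \<noteq> 0" for s
      unfolding P_def d unfolding A1_def A2_def G1 G2
      by (insert that, intro conjI; (rule exI[of _ "ax 0"], rule exI[of _ "ax 1"])?; simp add: edge_def ax_def)
    moreover have "P (edge 3 0 s)" if "s \<noteq> 0" for s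
      unfolding P_def d unfolding A1_def A2_def G1 G2
      by (insert that, intro conjI; (rule exI[of _ "ax 2"], rule exI[of _ "ax 1"])?; simp add: edge_def ax_def)
    ultimately have "\<forall>j<8. P (pt quartic_pts j)" unfolding quartic_pts by simp
    with j have Pj: "P (pt quartic_pts j)" by simp
    then obtain q1 q2 where z: "A1 (pt quartic_pts j) = 0" "A2 (pt quartic_pts j) = 0"
      and q: "dd A1 (pt quartic_pts j) q1 \<noteq> 0" "dd A1 (pt quartic_pts j) q2 = 0"
        "dd A2 (pt quartic_pts j) q1 = 0" "dd A2 (pt quartic_pts j) q2 \<noteq> 0" unfolding P_def by (elim exE conjE)
    from persist_plane[OF pf z q e] obtain \<delta> where \<delta>: "\<delta> > 0"
      "\<And>t. norm t < \<delta> \<Longrightarrow> \<exists>x. (\<forall>i\<le>3. norm (x i - pt quartic_pts j i) < e) \<and> A1 x + t * B1 x = 0 \<and> A2 x + t * B2 x = 0"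
      by (elim exE conjE) simp
    show "\<exists>\<delta>>0. \<forall>t. norm t < \<delta> \<longrightarrow> (\<exists>x. (\<forall>i\<le>3. norm (x i - pt quartic_pts j i) < e) \<and> sing 3 4 (C (\<lambda>_. t)) x)"
    proof (intro exI[of _ \<delta>] conjI \<delta>(1) allI impI)
      fix t :: complex assume "norm t < \<delta>"
      from \<delta>(2)[OF this] obtain x where x: "\<forall>i\<le>3. norm (x i - pt quartic_pts j i) < e" "A1 x + t * B1 x = 0"
          "A2 x + t * B2 x = 0"
        by (elim exE conjE)
      have "sing 3 4 (C (\<lambda>_. t)) x"
      proof (rule sing_mult[where g = "\<lambda>x. A1 x + t * B1 x" and h = "\<lambda>x. A2 x + t * B2 x"])
        show "(\<lambda>x. A1 x + t * B1 x) \<in> poly_fun {..3}" by (rule pf_add[OF pf(1) pf_cmult[OF pf(3)]])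
        show "(\<lambda>x. A2 x + t * B2 x) \<in> poly_fun {..3}" by (rule pf_add[OF pf(2) pf_cmult[OF pf(4)]])
      qed (rule pformD(4)[OF C] x(2,3))+
      then show "\<exists>x. (\<forall>i\<le>3. norm (x i - pt quartic_pts j i) < e) \<and> sing 3 4 (C (\<lambda>_. t)) x" using x(1)
          by (intro exI[of _ x] conjI)
    qed
  qed simp
  moreover have "C (\<lambda>_. 1) = F"
    by (rule form_eval_inject[OF pformD(3)[OF C] F]) (simp add: pformD(4)[OF C] FQ A1_def A2_def B1_def B2_def)
  ultimately show ?thesis by simp
qed

lemma monomials_independent:
  fixes q :: "'s \<Rightarrow> complex"
  assumes "finite S" "inj_on e S" "e ` S \<subseteq> Mon n d"
    and "\<And>x. (\<Sum>j\<in>S. q j * (\<Prod>i\<le>n. x i ^ e j i)) = 0" "j \<in> S"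
  shows "q j = 0"
proof -
  define F where "F = (\<lambda>\<beta>. \<Sum>j\<in>S. q j * (if \<beta> = e j then 1 else 0))"
  have "form_eval n d F x = 0" for x
  proof -
    have "form_eval n d F x = (\<Sum>j\<in>S. q j * form_eval n d (\<lambda>\<beta>. if \<beta> = e j then 1 else 0) x)"
      unfolding F_def by (rule form_eval_lincomb)
    also have "\<dots> = (\<Sum>j\<in>S. q j * (\<Prod>i\<le>n. x i ^ e j i))"
      using assms(3) by (intro sum.cong refl) (simp add: form_eval_single image_subset_iff)
    finally show ?thesis using assms(4) by simp
  qed
  then have "F (e j) = 0" using form_eval_zero_iff[of n d F "e j"] assms(3,5) by blast
  moreover have "F (e j) = (\<Sum>k\<in>S. if k = j then q j else 0)"
    unfolding F_def using assms(2,5) by (intro sum.cong refl) (auto dest: inj_onD)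
  ultimately show ?thesis using assms(1,5) by simp
qed

text \<open>Binary quadratic forms split over the complex numbers. Hence every combination of the
  squares and the product of two quadrics X and Y is a product of two members of their
  pencil.\<close>

lemma pencil_factor:
  fixes a b c X Y :: complex
  shows "\<exists>\<alpha> \<beta> \<gamma> \<delta>. \<forall>X Y. a * X^2 + b * X * Y + c * Y^2 = (\<alpha> * X + \<beta> * Y) * (\<gamma> * X + \<delta> * Y)"
proof (cases "a = 0")
  case True
  then show ?thesis
    by (intro exI[of _ 0] exI[of _ 1] exI[of _ b] exI[of _ c]) (simp add: algebra_simps power2_eq_square)
next
  case False
  define r where "r = csqrt (b^2 - 4 * a * c)"
  have r: "r^2 = b^2 - 4 * a * c" by (simp add: r_def)
  have "a * X^2 + b * X * Y + c * Y^2 = (a * X + (b + r) / 2 * Y) * (1 * X + (b - r) / (2 * a) * Y)" for X Y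
  proof -
    have "(a * X + (b + r) / 2 * Y) * (1 * X + (b - r) / (2 * a) * Y)
        = a * X^2 + b * X * Y + (b^2 - r^2) / (4 * a) * Y^2"
      using False by (simp add: field_simps power2_eq_square)
    also have "(b^2 - r^2) / (4 * a) = c" using False by (simp add: r)
    finally show ?thesis by simp
  qed
  then show ?thesis by blast
qed

lemma quartic_part:
  "quadric_pairs \<subseteq> zdual (Mon 3 4) (sec_cone 3 4 8) \<and>
   card (Mon 3 4) - zdim (Mon 3 4) (zdual (Mon 3 4) (sec_cone 3 4 8)) = 16"
proof -
  let ?Z = "zdual (Mon 3 4) (sec_cone 3 4 8)"
  let ?M = "Mon 3 2"
  let ?\<alpha> = "expo [2, 0, 0, 0]"
  have \<alpha>M: "?\<alpha> \<in> ?M" unfolding Mon_monl by (rule imageI) code_simp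
  define J where "J = ?M <+> ?M"
  \<comment> \<open>A pair of quadrics has 20 coefficients, but opposite rescalings of the factors
    do not change the product. Fixing the coefficient of x0^2 in the first factor leaves 19
    parameters.\<close>
  define J' where "J' = (?M - {?\<alpha>}) <+> ?M"
  have fJ': "finite J'" and cJ': "card J' = 19" using \<alpha>M by (auto simp: J'_def card_Plus card_Mon_values)
  define f1 where "f1 = (\<lambda>p :: (nat \<Rightarrow> nat) + (nat \<Rightarrow> nat) \<Rightarrow> complex. form_eval 3 2 (\<lambda>\<alpha>. p (Inl \<alpha>)))"
  define f1' where "f1' = (\<lambda>p :: (nat \<Rightarrow> nat) + (nat \<Rightarrow> nat) \<Rightarrow> complex.
      form_eval 3 2 (\<lambda>\<alpha>. if \<alpha> = ?\<alpha> then 1 else p (Inl \<alpha>)))"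
  define f2 where "f2 = (\<lambda>p :: (nat \<Rightarrow> nat) + (nat \<Rightarrow> nat) \<Rightarrow> complex. form_eval 3 2 (\<lambda>\<alpha>. p (Inr \<alpha>)))"
  have four: "2 + 2 = (4::nat)" by simp
  have c1: "pform J 3 2 f1 (\<lambda>p \<alpha>. if \<alpha> \<in> ?M then p (Inl \<alpha>) else 0)"
    unfolding f1_def by (rule pform_coeffs) (auto simp: J_def intro: poly_fun.pf_coord)
  have c2: "pform J 3 2 f2 (\<lambda>p \<alpha>. if \<alpha> \<in> ?M then p (Inr \<alpha>) else 0)"
    unfolding f2_def by (rule pform_coeffs) (auto simp: J_def intro: poly_fun.pf_coord)
  have c1': "pform J' 3 2 f1' (\<lambda>p \<alpha>. if \<alpha> \<in> ?M then if \<alpha> = ?\<alpha> then 1 else p (Inl \<alpha>) else 0)"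
    unfolding f1'_def by (rule pform_coeffs) (auto simp: J'_def intro!: pf_if poly_fun.intros)
  have c2': "pform J' 3 2 f2 (\<lambda>p \<alpha>. if \<alpha> \<in> ?M then p (Inr \<alpha>) else 0)"
    unfolding f2_def by (rule pform_coeffs) (auto simp: J'_def intro: poly_fun.pf_coord)
  from pform_mult[OF c1 c2, unfolded four] obtain C where C: "pform J 3 4 (\<lambda>p x. f1 p x * f2 p x) C" ..
  from pform_mult[OF c1' c2', unfolded four] obtain C' where C': "pform J' 3 4 (\<lambda>p x. f1' p x * f2 p x) C'" ..
  have CZ: "range C' \<subseteq> ?Z"
  proof
    fix F assume "F \<in> range C'"
    then obtain p where p: "F = C' p" by (rule rangeE)
    show "F \<in> ?Z"
      unfolding p by (rule product_in_zdual[OF pformD(3)[OF C'] pformD(3)[OF c1', of p] pformD(3)[OF c2', of p]])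
        (simp only: pformD(4)[OF C'] pformD(4)[OF c1'] pformD(4)[OF c2'])
  qed
  \<comment> \<open>Rescaling normalises every product whose first factor has a non-zero coefficient
    of x0^2, and such pairs are dense.\<close>
  have CC: "range C \<subseteq> zclosure (Mon 3 4) (range C')"
  proof
    fix F assume "F \<in> range C"
    then obtain p where p: "F = C p" by (rule rangeE)
    show "F \<in> zclosure (Mon 3 4) (range C')"
      unfolding p
    proof (rule zclosureI[OF pformD(3)[OF C]])
      fix f assume f: "f \<in> poly_fun (Mon 3 4)" "\<And>y. y \<in> range C' \<Longrightarrow> f y = 0"
      show "f (C p) = 0"
      proof (rule pf_dense[of "\<lambda>p. f (C p)" J "\<lambda>p. p (Inl ?\<alpha>)" "\<lambda>_. 1"])
        show "(\<lambda>p. f (C p)) \<in> poly_fun J" by (rule pf_comp[OF f(1) pformD(1)[OF C]])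
        show "(\<lambda>p. p (Inl ?\<alpha>)) \<in> poly_fun J" using \<alpha>M by (auto simp: J_def intro: poly_fun.pf_coord)
        fix p :: "(nat \<Rightarrow> nat) + (nat \<Rightarrow> nat) \<Rightarrow> complex" assume nz: "p (Inl ?\<alpha>) \<noteq> 0"
        define c where "c = p (Inl ?\<alpha>)"
        define p' where "p' = case_sum (\<lambda>\<alpha>. inverse c * p (Inl \<alpha>)) (\<lambda>\<alpha>. c * p (Inr \<alpha>))"
        have "(\<lambda>\<alpha>. if \<alpha> = ?\<alpha> then 1 else p' (Inl \<alpha>)) = (\<lambda>\<alpha>. inverse c * p (Inl \<alpha>))"
          using nz by (auto simp: p'_def c_def)
        then have "f1' p' x = inverse c * f1 p x" for x unfolding f1'_def f1_def by (simp add: form_eval_cmult)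
        moreover have "f2 p' x = c * f2 p x" for x unfolding f2_def p'_def by (simp add: form_eval_cmult)
        ultimately have "C p = C' p'"
          using nz by (intro form_eval_inject[OF pformD(3)[OF C] pformD(3)[OF C']])
            (simp add: pformD(4)[OF C] pformD(4)[OF C'] c_def)
        then show "f (C p) = 0" using f(2) by simp
      qed simp
    qed
  qed
  have ZC: "?Z \<subseteq> zclosure (Mon 3 4) (range C)"
  proof (rule zdual_subset_singular[where S = "{p. nondeg 3 4 8 p}"])
    show "f p = 0" if "f \<in> poly_fun (prm 8 3)" "\<And>q. q \<in> {p. nondeg 3 4 8 p} \<Longrightarrow> f q = 0" for f p
      using nondeg_dense[OF quartic_nondeg that(1)] that(2) by simp
    fix p F assume p: "p \<in> {p. nondeg 3 4 8 p}" and F: "F \<in> aff (Mon 3 4)" "\<And>j. j < 8 \<Longrightarrow> sing 3 4 F (pt p j)"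
    obtain G1 where G1: "G1 \<in> aff ?M" "\<exists>\<alpha>\<in>?M. G1 \<alpha> \<noteq> 0" "\<forall>j\<in>{..<8::nat}. form_eval 3 2 G1 (pt p j) = 0"
      using form_through_points[of "{..<8::nat}" 3 2 "pt p"] by (auto simp: card_Mon_values)
    define X where "X = form_eval 3 2 G1"
    obtain y where y: "X y \<noteq> 0" using G1(2) form_eval_nonzero unfolding X_def by blast
    \<comment> \<open>The additional zero y, chosen off the first quadric, makes the second one
      independent of the first; nine conditions still leave one of the ten dimensions.\<close>
    obtain G2 where G2: "G2 \<in> aff ?M" "\<exists>\<alpha>\<in>?M. G2 \<alpha> \<noteq> 0"
      "\<forall>j\<in>{..<9::nat}. form_eval 3 2 G2 (if j = 8 then y else pt p j) = 0"
      using form_through_points[of "{..<9::nat}" 3 2 "\<lambda>j. if j = 8 then y else pt p j"] by (auto simp: card_Mon_values)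
    define Y where "Y = form_eval 3 2 G2"
    obtain w where w: "Y w \<noteq> 0" using G2(2) form_eval_nonzero unfolding Y_def by blast
    have Yy: "Y y = 0" using G2(3)[rule_format, of 8] by (simp add: Y_def)
    have XY: "X \<in> poly_fun {..3}" "Y \<in> poly_fun {..3}" unfolding X_def Y_def by (rule pf_form_eval)+
    have Xp: "X (pt p j) = 0" if "j < 8" for j using G1(3) that by (simp add: X_def)
    have Yp: "Y (pt p j) = 0" if "j < 8" for j using G2(3)[rule_format, of j] that by (simp add: Y_def)
    define K where "K = (\<lambda>a b. C (case_sum a b))"
    have K: "form_eval 3 4 (K a b) x = form_eval 3 2 a x * form_eval 3 2 b x" for a b x
      unfolding K_def pformD(4)[OF C] f1_def f2_def by simp
    define H where "H = (\<lambda>a::nat. if a = 0 then F else if a = 1 then K G1 G1 else if a = 2 then K G1 G2 else K G2 G2)"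
    have Haff: "H a \<in> aff (Mon 3 4)" for a unfolding H_def K_def using F(1) pformD(3)[OF C] by simp
    have Hs: "sing 3 4 (H a) (pt p j)" if "j < 8" for a j
    proof -
      have "sing 3 4 (K G1 G1) (pt p j)" by (rule sing_mult[of 3 4 _ X X,
          OF K[of G1 G1, folded X_def] XY(1) XY(1) Xp[OF that] Xp[OF that]])
      moreover have "sing 3 4 (K G1 G2) (pt p j)"
        by (rule sing_mult[of 3 4 _ X Y, OF K[of G1 G2, folded X_def Y_def] XY Xp[OF that] Yp[OF that]])
      moreover have "sing 3 4 (K G2 G2) (pt p j)" by (rule sing_mult[of 3 4 _ Y Y,
          OF K[of G2 G2, folded Y_def] XY(2) XY(2) Yp[OF that] Yp[OF that]])
      ultimately show ?thesis using F(2)[OF that] by (simp add: H_def)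
    qed
    \<comment> \<open>The 32 independent conditions leave dimension 3 of the 35, against the four
      forms F, X^2, X Y and Y^2.\<close>
    have "\<exists>q. (\<exists>a\<in>{0, 1, 2, 3}. q a \<noteq> 0) \<and> (\<forall>x. (\<Sum>a\<in>{0, 1, 2, 3}. q a * form_eval 3 4 (H a) x) = 0)"
      by (rule nondeg_singular_dim[of 3 4 8 p]) (use p Haff Hs in \<open>auto simp: card_Mon_values\<close>)
    then obtain q where q: "\<exists>a\<in>{0, 1, 2, 3}. q a \<noteq> 0" "\<And>x. (\<Sum>a\<in>{0, 1, 2, 3}. q a * form_eval 3 4 (H a) x) = 0" by blast
    have q': "q 0 * form_eval 3 4 F x + q 1 * (X x)^2 + q 2 * X x * Y x + q 3 * (Y x)^2 = 0" for x
      using q(2)[of x] by (simp add: H_def K X_def Y_def power2_eq_square algebra_simps)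
    \<comment> \<open>X^2, X Y and Y^2 are independent: evaluation at y removes the first
      coefficient, then a factor Y is cancelled and the rest is again evaluated.\<close>
    have q0: "q 0 \<noteq> 0"
    proof
      assume z0: "q 0 = 0"
      have z1: "q 1 = 0" using q'[of y] z0 y Yy by simp
      have "(q 2 * X x + q 3 * Y x) * Y x = 0" for x using q'[of x] z0 z1 by (simp add: power2_eq_square algebra_simps)
      then have "(\<forall>x. q 2 * X x + q 3 * Y x = 0) \<or> (\<forall>x. Y x = 0)"
        by (intro pf_mult_eq_zero[where I = "{..3}"] pf_add pf_cmult XY)
      then have lin: "q 2 * X x + q 3 * Y x = 0" for x using w by blast
      have z2: "q 2 = 0" using lin[of y] y Yy by simp
      have "q 3 = 0" using lin[of w] z2 w by simp
      then show False using q(1) z0 z1 z2 by simp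
    qed
    obtain a b c d where fac: "\<And>X Y. - q 1 / q 0 * X^2 + - q 2 / q 0 * X * Y + - q 3 / q 0 * Y^2
        = (a * X + b * Y) * (c * X + d * Y)"
      using pencil_factor[of "- q 1 / q 0" "- q 2 / q 0" "- q 3 / q 0"] by blast
    have "F = K (\<lambda>\<alpha>. a * G1 \<alpha> + b * G2 \<alpha>) (\<lambda>\<alpha>. c * G1 \<alpha> + d * G2 \<alpha>)"
    proof (rule form_eval_inject[OF F(1)])
      show "K (\<lambda>\<alpha>. a * G1 \<alpha> + b * G2 \<alpha>) (\<lambda>\<alpha>. c * G1 \<alpha> + d * G2 \<alpha>) \<in> aff (Mon 3 4)" unfolding K_def
          by (rule pformD(3)[OF C])
      fix x
      have "q 0 * form_eval 3 4 F x = - q 1 * (X x)^2 - q 2 * X x * Y x - q 3 * (Y x)^2"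
        using q'[of x] by (simp add: algebra_simps eq_neg_iff_add_eq_0)
      then have "form_eval 3 4 F x = - q 1 / q 0 * (X x)^2 + - q 2 / q 0 * X x * Y x + - q 3 / q 0 * (Y x)^2"
      proof -
        assume e: "q 0 * form_eval 3 4 F x = - q 1 * (X x)^2 - q 2 * X x * Y x - q 3 * (Y x)^2"
        have "form_eval 3 4 F x = (- q 1 * (X x)^2 - q 2 * X x * Y x - q 3 * (Y x)^2) / q 0"
          unfolding e[symmetric] using q0 by simp
        then show ?thesis by (simp add: add_divide_distrib diff_divide_distrib)
      qed
      then show "form_eval 3 4 F x = form_eval 3 4 (K (\<lambda>\<alpha>. a * G1 \<alpha> + b * G2 \<alpha>) (\<lambda>\<alpha>. c * G1 \<alpha> + d * G2 \<alpha>)) x"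
        unfolding fac K by (simp add: form_eval_add form_eval_cmult X_def Y_def)
    qed
    then show "F \<in> range C" by (simp add: K_def)
  qed
  have ZC': "?Z \<subseteq> zclosure (Mon 3 4) (range C')"
    using ZC zclosure_minimal[OF zclosed_zclosure CC] by blast
  \<comment> \<open>At the product x0^2 x1^2 the derivatives in the parameters are monomials: x1^2
    or x0^2 times a quadratic monomial.\<close>
  define p0 :: "(nat \<Rightarrow> nat) + (nat \<Rightarrow> nat) \<Rightarrow> complex" where "p0 = case_sum (\<lambda>_. 0) (mform 3 2 [0, 2, 0, 0])"
  have in1: "[2, 0, 0, 0] \<in> set (monl 3 2)" and in2: "[0, 2, 0, 0] \<in> set (monl 3 2)" by code_simp+
  have f1p0: "f1' p0 x = x 0 ^ 2" for x
    using mform(2)[OF in1, of x] unfolding mform_def f1'_def p0_def by (simp add: upt_4 del: upt_Suc cong: if_cong)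
  have f2p0: "f2 p0 x = x 1 ^ 2" for x
    using mform(2)[OF in2, of x] unfolding f2_def p0_def by (simp add: upt_4 del: upt_Suc)
  have pff1: "(\<lambda>p. f1' p x) \<in> poly_fun J'" and pff2: "(\<lambda>p. f2 p x) \<in> poly_fun J'" for x
    unfolding f1'_def f2_def by (rule pf_form_eval_coeffs, auto simp: J'_def intro!: pf_if poly_fun.intros)+
  define e where "e = case_sum (\<lambda>\<alpha> :: nat \<Rightarrow> nat. \<alpha>(1 := \<alpha> 1 + 2)) (\<lambda>\<alpha>. \<alpha>(0 := \<alpha> 0 + 2))"
  have prod3: "(\<Prod>i\<le>3::nat. g i) = g 0 * g 1 * g 2 * g 3" for g :: "nat \<Rightarrow> complex"
    by (simp add: numeral_eq_Suc)
  have pd1: "pd (\<lambda>p. f1' p x) j p0 = (case j of Inl \<beta> \<Rightarrow> \<Prod>i\<le>3. x i ^ \<beta> i | Inr _ \<Rightarrow> 0)" if j: "j \<in> J'" for x j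
  proof -
    have "dd (\<lambda>p. if \<alpha> = ?\<alpha> then 1 else p (Inl \<alpha>)) p0 (ax j) = (if j = Inl \<alpha> then 1 else 0)" if "\<alpha> \<in> ?M" for \<alpha>
      using j by (cases "\<alpha> = expo [2, 0, 0, 0]") (auto simp: J'_def ax_def)
    then have "pd (\<lambda>p. f1' p x) j p0 = form_eval 3 2 (\<lambda>\<alpha>. if j = Inl \<alpha> then 1 else 0) x"
      unfolding pd_def f1'_def
      by (subst form_eval_dd[where J = J', symmetric]) (auto simp: J'_def intro!: pf_if poly_fun.intros form_eval_cong)
    also have "\<dots> = (case j of Inl \<beta> \<Rightarrow> \<Prod>i\<le>3. x i ^ \<beta> i | Inr _ \<Rightarrow> 0)"
    proof (cases j)
      case (Inl \<beta>)
      then have "\<beta> \<in> ?M" using j by (auto simp: J'_def)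
      then show ?thesis using form_eval_single[of \<beta> 3 2 1 x] Inl by (simp add: eq_commute[of \<beta>])
    next
      case (Inr \<beta>)
      then show ?thesis by (simp add: form_eval_def)
    qed
    finally show ?thesis .
  qed
  have pd2: "pd (\<lambda>p. f2 p x) j p0 = (case j of Inl _ \<Rightarrow> 0 | Inr \<beta> \<Rightarrow> \<Prod>i\<le>3. x i ^ \<beta> i)" if j: "j \<in> J'" for x j
  proof -
    have "dd (\<lambda>p. p (Inr \<alpha>)) p0 (ax j) = (if j = Inr \<alpha> then 1 else 0)" for \<alpha>
      by (auto simp: ax_def)
    then have "pd (\<lambda>p. f2 p x) j p0 = form_eval 3 2 (\<lambda>\<alpha>. if j = Inr \<alpha> then 1 else 0) x"
      unfolding pd_def f2_def
      by (subst form_eval_dd[where J = J', symmetric]) (auto simp: J'_def intro!: poly_fun.intros form_eval_cong)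
    also have "\<dots> = (case j of Inl _ \<Rightarrow> 0 | Inr \<beta> \<Rightarrow> \<Prod>i\<le>3. x i ^ \<beta> i)"
    proof (cases j)
      case (Inr \<beta>)
      then have "\<beta> \<in> ?M" using j by (auto simp: J'_def)
      then show ?thesis using form_eval_single[of \<beta> 3 2 1 x] Inr by (simp add: eq_commute[of \<beta>])
    next
      case (Inl \<beta>)
      then show ?thesis by (simp add: form_eval_def)
    qed
    finally show ?thesis .
  qed
  have pdf: "pd (\<lambda>p. f1' p x * f2 p x) j p0 = (\<Prod>i\<le>3. x i ^ e j i)" if j: "j \<in> J'" for x j
    unfolding pd_mult_eq[OF pff1 pff2] pd1[OF j] pd2[OF j] f1p0 f2p0
    by (cases j) (simp_all add: e_def prod3 power_add power2_eq_square mult_ac)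
  have eM: "e ` J' \<subseteq> Mon 3 4"
    by (auto simp: e_def J'_def Mon_def numeral_eq_Suc)
  have einj: "inj_on e J'"
  proof -
    have eq_of_upd: "\<alpha> = \<beta>" if "\<alpha>(i := \<alpha> i + 2) = \<beta>(i := \<beta> i + 2)" for \<alpha> \<beta> :: "nat \<Rightarrow> nat" and i
    proof
      fix k show "\<alpha> k = \<beta> k" using fun_cong[OF that, of k] by (cases "k = i") auto
    qed
    \<comment> \<open>The only coincidence x1^2 \<alpha> = x0^2 \<beta> between the two kinds of
      monomials has \<alpha> = x0^2, which is the parameter removed by the normalisation.\<close>
    have ne: "\<alpha> = ?\<alpha>" if "\<alpha> \<in> ?M" "\<alpha>(1 := \<alpha> 1 + 2) = \<beta>(0 := \<beta> 0 + 2)" for \<alpha> \<beta>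
    proof
      fix k
      have "\<alpha> 0 = \<beta> 0 + 2" using fun_cong[OF that(2), of 0] by simp
      moreover have "\<alpha> 0 + \<alpha> 1 + \<alpha> 2 + \<alpha> 3 = 2" "\<forall>i>3. \<alpha> i = 0" using that(1) by (auto simp: Mon_def numeral_eq_Suc)
      ultimately show "\<alpha> k = ?\<alpha> k"
        by (cases "k = 0"; cases "k = 1"; cases "k = 2"; cases "k = 3") (auto simp: expo_def)
    qed
    show ?thesis
    proof (rule inj_onI)
      fix j k assume jk: "j \<in> J'" "k \<in> J'" "e j = e k"
      show "j = k"
      proof (cases j; cases k)
        fix \<alpha> \<beta> assume "j = Inl \<alpha>" "k = Inl \<beta>"
        then show ?thesis using jk(3) eq_of_upd[of \<alpha> 1 \<beta>] by (simp add: e_def)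
      next
        fix \<alpha> \<beta> assume "j = Inr \<alpha>" "k = Inr \<beta>"
        then show ?thesis using jk(3) eq_of_upd[of \<alpha> 0 \<beta>] by (simp add: e_def)
      next
        fix \<alpha> \<beta> assume "j = Inl \<alpha>" "k = Inr \<beta>"
        then show ?thesis using jk ne[of \<alpha> \<beta>] by (auto simp: e_def J'_def)
      next
        fix \<alpha> \<beta> assume "j = Inr \<alpha>" "k = Inl \<beta>"
        then show ?thesis using jk ne[of \<beta> \<alpha>] by (auto simp: e_def J'_def)
      qed
    qed
  qed
  have "lin_indep J' (Mon 3 4) (\<lambda>j \<alpha>. pd (\<lambda>p. C' p \<alpha>) j p0)"
  proof (rule lin_indep_form_derivatives[OF C' order_refl])
    fix q j assume q: "\<And>x. (\<Sum>j\<in>J'. q j * pd (\<lambda>p. f1' p x * f2 p x) j p0) = 0" and j: "j \<in> J'"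
    have "(\<Sum>j\<in>J'. q j * (\<Prod>i\<le>3. x i ^ e j i)) = 0" for x using q[of x] by (simp add: pdf)
    then show "q j = 0" by (rule monomials_independent[OF fJ' einj eM _ j])
  qed
  then have "zchain (Mon 3 4) (zclosure (Mon 3 4) (range C')) (card J')"
    by (intro zchain_immersion pformD(1,2)[OF C'] fJ') auto
  then have chain: "zchain (Mon 3 4) ?Z 19"
    using zclosure_minimal[OF zclosed_zdual CZ] zchain_mono unfolding cJ' by blast
  have "dep_bound (Mon 3 4) (range C') 19"
    by (rule dep_bound_range[OF fJ' pformD(1)[OF C']]) (simp add: cJ')
  then have "zdim (Mon 3 4) ?Z = 19" by (rule zdim_eqI[OF _ ZC' chain])
  moreover have "quadric_pairs \<subseteq> ?Z"
    unfolding quadric_pairs_def forms_def using product_in_zdual by blast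
  ultimately show ?thesis by (simp add: card_Mon_values)
qed

section \<open>Cubic fourfolds\<close>

text \<open>The degree of a binary cubic leaves no room for two double roots.\<close>

lemma double_roots:
  fixes c0 c1 c2 c3 :: complex
  assumes a: "\<And>s. s \<in> {1, -1} \<Longrightarrow> 3 * c0 + 2 * c1 * s + c2 * s ^ 2 = 0"
    and b: "\<And>s. s \<in> {1, -1} \<Longrightarrow> c1 + 2 * c2 * s + 3 * c3 * s ^ 2 = 0"
  shows "c0 = 0" "c1 = 0" "c2 = 0" "c3 = 0"
proof -
  have e: "3 * c0 + 2 * c1 + c2 = 0" "3 * c0 - 2 * c1 + c2 = 0" "c1 + 2 * c2 + 3 * c3 = 0" "c1 - 2 * c2 + 3 * c3 = 0"
    using a[of 1] a[of "-1"] b[of 1] b[of "-1"] by simp_all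
  show "c0 = 0" "c1 = 0" "c2 = 0" "c3 = 0"
    using e by algebra+
qed

lemma opposite_roots:
  fixes d0 d1 d2 :: complex
  assumes "\<And>s. s \<in> {1, -1} \<Longrightarrow> d0 + d1 * s + d2 * s ^ 2 = 0"
  shows "d1 = 0" "d0 + d2 = 0"
proof -
  have "d0 + d1 + d2 = 0" "d0 - d1 + d2 = 0" using assms[of 1] assms[of "-1"] by simp_all
  then show "d1 = 0" "d0 + d2 = 0" by algebra+
qed

text \<open>Points on a hexagon of coordinate lines, alternately one and two on a side. Two points
  kill all coefficients along their side; the other sides share both corners with such sides, so one
  point suffices there.\<close>

definition cubic_pts :: "nat \<times> nat \<Rightarrow> complex" where
  "cubic_pts = pts [edge 0 1 1, edge 1 2 1, edge 1 2 (-1), edge 2 3 1, edge 3 4 1, edge 3 4 (-1),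
     edge 4 5 1, edge 5 0 1, edge 5 0 (-1)]"

lemma cubic_pts: "(\<forall>j<9. P (pt cubic_pts j)) \<longleftrightarrow> P (edge 0 1 1) \<and> P (edge 2 3 1) \<and> P (edge 4 5 1) \<and>
    (\<forall>s\<in>{1, -1}. P (edge 1 2 s) \<and> P (edge 3 4 s) \<and> P (edge 5 0 s))"
  unfolding cubic_pts_def by (subst all_pts) auto

lemma cubic_nondeg: "nondeg 5 3 9 cubic_pts"
proof (rule nondeg_witness[of "{expo [1, 0, 1, 0, 1, 0], expo [0, 1, 0, 1, 0, 1]}"])
  let ?B = "{expo [1, 0, 1, 0, 1, 0], expo [0, 1, 0, 1, 0, 1]}"
  show "?B \<subseteq> Mon 5 3" by (simp add: Mon_monl monl_5_3)
  have "card (expo ` {[1, 0, 1, 0, 1, 0], [0, 1, 0, 1, 0, 1]}) = card {[1, 0, 1, 0, 1, 0], [0, 1, 0, 1, 0, 1::nat]}"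
    by (rule card_image) (rule inj_onI, rule expo_inj, auto)
  then show "card (Mon 5 3) = 9 * Suc 5 + card ?B" by (simp add: card_Mon_values)
next
  fix F \<alpha> assume sng: "\<And>j. j < 9 \<Longrightarrow> sing 5 3 F (pt cubic_pts j)"
    and F0: "\<And>\<alpha>. \<alpha> \<in> {expo [1, 0, 1, 0, 1, 0], expo [0, 1, 0, 1, 0, 1]} \<Longrightarrow> F \<alpha> = 0" and \<alpha>: "\<alpha> \<in> Mon 5 3"
  have h: "sing 5 3 F (edge 0 1 1)" "sing 5 3 F (edge 2 3 1)" "sing 5 3 F (edge 4 5 1)"
    "\<And>s. s \<in> {1, -1} \<Longrightarrow> sing 5 3 F (edge 1 2 s)" "\<And>s. s \<in> {1, -1} \<Longrightarrow> sing 5 3 F (edge 3 4 s)"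
    "\<And>s. s \<in> {1, -1} \<Longrightarrow> sing 5 3 F (edge 5 0 s)"
    using sng cubic_pts[of "sing 5 3 F"] by blast+
  note q12 = double_roots[OF cubic_edge_12(1)[OF h(4)] cubic_edge_12(2)[OF h(4)]]
  note q34 = double_roots[OF cubic_edge_34(1)[OF h(5)] cubic_edge_34(2)[OF h(5)]]
  note q50 = double_roots[OF cubic_edge_50(1)[OF h(6)] cubic_edge_50(2)[OF h(6)]]
  have Z1: "F (expo [0, 3, 0, 0, 0, 0]) = 0" "F (expo [0, 2, 1, 0, 0, 0]) = 0" "F (expo [0, 1, 2, 0, 0, 0]) = 0"
    "F (expo [0, 0, 3, 0, 0, 0]) = 0" "F (expo [0, 0, 0, 3, 0, 0]) = 0" "F (expo [0, 0, 0, 2, 1, 0]) = 0"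
    "F (expo [0, 0, 0, 1, 2, 0]) = 0" "F (expo [0, 0, 0, 0, 3, 0]) = 0" "F (expo [0, 0, 0, 0, 0, 3]) = 0"
    "F (expo [1, 0, 0, 0, 0, 2]) = 0" "F (expo [2, 0, 0, 0, 0, 1]) = 0" "F (expo [3, 0, 0, 0, 0, 0]) = 0"
    using q12 q34 q50 by (simp_all del: One_nat_def)
  note R = opposite_roots[OF cubic_edge_12(3)[OF h(4)]]
    opposite_roots[OF cubic_edge_12(4)[OF h(4)]]
    opposite_roots[OF cubic_edge_12(5)[OF h(4)]]
    opposite_roots[OF cubic_edge_12(6)[OF h(4)]]
    opposite_roots[OF cubic_edge_34(3)[OF h(5)]]
    opposite_roots[OF cubic_edge_34(4)[OF h(5)]]
    opposite_roots[OF cubic_edge_34(5)[OF h(5)]]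
    opposite_roots[OF cubic_edge_34(6)[OF h(5)]]
    opposite_roots[OF cubic_edge_50(3)[OF h(6)]]
    opposite_roots[OF cubic_edge_50(4)[OF h(6)]]
    opposite_roots[OF cubic_edge_50(5)[OF h(6)]]
    opposite_roots[OF cubic_edge_50(6)[OF h(6)]]
  have R1: "F (expo [1, 1, 1, 0, 0, 0]) = 0" "F (expo [0, 1, 1, 1, 0, 0]) = 0" "F (expo [0, 1, 1, 0, 1, 0]) = 0"
    "F (expo [0, 1, 1, 0, 0, 1]) = 0" "F (expo [1, 0, 0, 1, 1, 0]) = 0" "F (expo [0, 1, 0, 1, 1, 0]) = 0"
    "F (expo [0, 0, 1, 1, 1, 0]) = 0" "F (expo [0, 0, 0, 1, 1, 1]) = 0" "F (expo [1, 1, 0, 0, 0, 1]) = 0"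
    "F (expo [1, 0, 1, 0, 0, 1]) = 0" "F (expo [1, 0, 0, 1, 0, 1]) = 0" "F (expo [1, 0, 0, 0, 1, 1]) = 0"
    using R by (simp_all del: One_nat_def)
  \<comment> \<open>On the sides with one point the corner coefficients already vanish, and the two
    remaining coefficients satisfy two independent equations.\<close>
  have S: "F (expo [2, 1, 0, 0, 0, 0]) = 0" "F (expo [1, 2, 0, 0, 0, 0]) = 0"
    "F (expo [0, 0, 2, 1, 0, 0]) = 0" "F (expo [0, 0, 1, 2, 0, 0]) = 0"
    "F (expo [0, 0, 0, 0, 2, 1]) = 0" "F (expo [0, 0, 0, 0, 1, 2]) = 0"
  proof -
    show "F (expo [2, 1, 0, 0, 0, 0]) = 0" "F (expo [1, 2, 0, 0, 0, 0]) = 0"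
      using cubic_edge_01(1)[OF h(1)] cubic_edge_01(2)[OF h(1)]
      by (simp_all add: Z1 del: One_nat_def) algebra+
    show "F (expo [0, 0, 2, 1, 0, 0]) = 0" "F (expo [0, 0, 1, 2, 0, 0]) = 0"
      using cubic_edge_23(1)[OF h(2)] cubic_edge_23(2)[OF h(2)]
      by (simp_all add: Z1 del: One_nat_def) algebra+
    show "F (expo [0, 0, 0, 0, 2, 1]) = 0" "F (expo [0, 0, 0, 0, 1, 2]) = 0"
      using cubic_edge_45(1)[OF h(3)] cubic_edge_45(2)[OF h(3)]
      by (simp_all add: Z1 del: One_nat_def) algebra+
  qed
  \<comment> \<open>Transverse conditions at the one-point sides alternate with the relations d0 +
    d2 = 0 from the two-point sides; together they carry the vanishing across the hexagon in three
    rounds.\<close>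
  have T1: "F (expo [1, 0, 2, 0, 0, 0]) = 0" "F (expo [0, 2, 0, 1, 0, 0]) = 0" "F (expo [0, 0, 1, 0, 2, 0]) = 0"
    "F (expo [0, 0, 0, 2, 0, 1]) = 0" "F (expo [0, 1, 0, 0, 0, 2]) = 0" "F (expo [2, 0, 0, 0, 1, 0]) = 0"
    "F (expo [2, 0, 1, 0, 0, 0]) = 0" "F (expo [0, 2, 0, 0, 0, 1]) = 0" "F (expo [0, 1, 0, 2, 0, 0]) = 0"
    "F (expo [0, 0, 2, 0, 1, 0]) = 0" "F (expo [1, 0, 0, 0, 2, 0]) = 0" "F (expo [0, 0, 0, 1, 0, 2]) = 0"
    using R cubic_edge_01(3)[OF h(1)]
      cubic_edge_01(6)[OF h(1)]
      cubic_edge_23(4)[OF h(2)]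
      cubic_edge_23(5)[OF h(2)]
      cubic_edge_45(3)[OF h(3)]
      cubic_edge_45(6)[OF h(3)]
    by (simp_all add: Z1 S R1 del: One_nat_def)
  have T2: "F (expo [0, 2, 0, 0, 1, 0]) = 0" "F (expo [0, 0, 2, 0, 0, 1]) = 0" "F (expo [1, 0, 0, 2, 0, 0]) = 0"
    "F (expo [0, 1, 0, 0, 2, 0]) = 0" "F (expo [0, 0, 1, 0, 0, 2]) = 0" "F (expo [2, 0, 0, 1, 0, 0]) = 0"
    using R
    by (simp_all add: Z1 S R1 T1 del: One_nat_def)
  have T3: "F (expo [1, 1, 0, 1, 0, 0]) = 0" "F (expo [1, 1, 0, 0, 1, 0]) = 0" "F (expo [1, 0, 1, 1, 0, 0]) = 0"
    "F (expo [0, 0, 1, 1, 0, 1]) = 0" "F (expo [0, 1, 0, 0, 1, 1]) = 0" "F (expo [0, 0, 1, 0, 1, 1]) = 0"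
    using R cubic_edge_01(4)[OF h(1)]
      cubic_edge_01(5)[OF h(1)]
      cubic_edge_23(3)[OF h(2)]
      cubic_edge_23(6)[OF h(2)]
      cubic_edge_45(4)[OF h(3)]
      cubic_edge_45(5)[OF h(3)]
    by (simp_all add: Z1 S R1 T1 T2 del: One_nat_def)
  have "\<forall>xs\<in>set (monl 5 3). F (expo xs) = 0"
    unfolding monl_5_3 using F0 by (simp add: Z1 S R1 T1 T2 T3 del: One_nat_def)
  then show "F \<alpha> = 0" using \<alpha> unfolding Mon_monl by blast
qed auto

text \<open>The existential form of \<open>pform\<close> lets families be assembled by introduction
  rules while the coefficients stay implicit.\<close>

definition Pf :: "'j set \<Rightarrow> nat \<Rightarrow> nat \<Rightarrow> (('j \<Rightarrow> complex) \<Rightarrow> (nat \<Rightarrow> complex) \<Rightarrow> complex) \<Rightarrow> bool" where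
  "Pf J n d \<Phi> \<longleftrightarrow> (\<exists>C. pform J n d \<Phi> C)"

lemma Pf_add: "Pf J n d \<Phi> \<Longrightarrow> Pf J n d \<Psi> \<Longrightarrow> Pf J n d (\<lambda>p x. \<Phi> p x + \<Psi> p x)"
  unfolding Pf_def using pform_add by blast

lemma Pf_cmult: "c \<in> poly_fun J \<Longrightarrow> Pf J n d \<Phi> \<Longrightarrow> Pf J n d (\<lambda>p x. c p * \<Phi> p x)"
  unfolding Pf_def using pform_cmult by blast

lemma Pf_diff: "Pf J n d \<Phi> \<Longrightarrow> Pf J n d \<Psi> \<Longrightarrow> Pf J n d (\<lambda>p x. \<Phi> p x - \<Psi> p x)"
  using Pf_add[OF _ Pf_cmult[OF pf_const[of "-1"]], of J n d \<Phi> \<Psi>] by simp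

lemma Pf_sum:
  assumes "finite A" "\<And>a. a \<in> A \<Longrightarrow> Pf J n d (\<Phi> a)"
  shows "Pf J n d (\<lambda>p x. \<Sum>a\<in>A. \<Phi> a p x)"
proof -
  have "\<forall>a\<in>A. \<exists>C. pform J n d (\<Phi> a) C" using assms(2) by (simp add: Pf_def)
  then obtain C where "\<forall>a\<in>A. pform J n d (\<Phi> a) (C a)" by (rule bchoice[THEN exE])
  then show ?thesis unfolding Pf_def using pform_sum[OF assms(1)] by blast
qed

lemma Pf_mult: "Pf J n d \<Phi> \<Longrightarrow> Pf J n e \<Psi> \<Longrightarrow> Pf J n (d + e) (\<lambda>p x. \<Phi> p x * \<Psi> p x)"
  unfolding Pf_def using pform_mult by blast

lemma Pf_mult3: "Pf J n 1 f \<Longrightarrow> Pf J n 1 g \<Longrightarrow> Pf J n 1 h \<Longrightarrow> Pf J n 3 (\<lambda>p x. f p x * g p x * h p x)"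
  using Pf_mult[OF Pf_mult, of J n 1 f 1 g 1 h] by (simp add: numeral_3_eq_3)

lemma Pf_linear: "(\<And>i. i \<le> n \<Longrightarrow> c i \<in> poly_fun J) \<Longrightarrow> Pf J n 1 (\<lambda>p x. \<Sum>i\<le>n. c i p * x i)"
  unfolding Pf_def using pform_linear by blast

subsection \<open>Matrices of linear forms\<close>

type_synonym mat3 = "3 \<Rightarrow> 3 \<Rightarrow> complex"

definition lmat :: "(3 \<times> 3 \<times> nat \<Rightarrow> complex) \<Rightarrow> (nat \<Rightarrow> complex) \<Rightarrow> mat3" where
  "lmat c x r s = (\<Sum>i\<le>5. c (r, s, i) * x i)"

definition det3 :: "mat3 \<Rightarrow> complex" where
  "det3 m = m 1 1 * m 2 2 * m 3 3 + m 1 2 * m 2 3 * m 3 1 + m 1 3 * m 2 1 * m 3 2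
    - m 1 1 * m 2 3 * m 3 2 - m 1 2 * m 2 1 * m 3 3 - m 1 3 * m 2 2 * m 3 1"

lemma det_eq_det3: "det (\<chi> r s. m r s) = det3 m"
  by (simp add: det_3 det3_def)

text \<open>The matrix with rows (x0, x1, 0), (0, x2, x3), (x5, 0, x4), which has rank one at the points
  of \<open>cubic_pts\<close>.\<close>

definition hex :: "3 \<times> 3 \<times> nat \<Rightarrow> complex" where
  "hex a = (if a \<in> {(1, 1, 0), (1, 2, 1), (2, 2, 2), (2, 3, 3), (3, 3, 4), (3, 1, 5)} then 1 else 0)"

lemma sum_atMost_5: "(\<Sum>i\<le>5::nat. g i) = g 0 + g 1 + g 2 + g 3 + g 4 + g 5"
  by (simp add: numeral_nat)

lemma prod_atMost_5: "(\<Prod>i\<le>5::nat. g i) = g 0 * g 1 * g 2 * g 3 * g 4 * g 5"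
  by (simp add: numeral_nat)

lemma lmat_hex:
  "lmat hex x 1 1 = x 0" "lmat hex x 1 2 = x 1" "lmat hex x 1 3 = 0"
  "lmat hex x 2 1 = 0" "lmat hex x 2 2 = x 2" "lmat hex x 2 3 = x 3"
  "lmat hex x 3 1 = x 5" "lmat hex x 3 2 = 0" "lmat hex x 3 3 = x 4"
  by (simp_all add: lmat_def hex_def sum_atMost_5)

lemma Pf_lmat:
  assumes "\<And>r s i. i \<le> 5 \<Longrightarrow> (\<lambda>p. c p (r, s, i)) \<in> poly_fun J"
  shows "Pf J 5 1 (\<lambda>p x. lmat (c p) x r s)"
  unfolding lmat_def by (rule Pf_linear) (rule assms)

lemma Pf_det3:
  assumes "\<And>r s. Pf J n 1 (\<lambda>p x. m p x r s)"
  shows "Pf J n 3 (\<lambda>p x. det3 (m p x))"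
  unfolding det3_def by (intro Pf_add Pf_diff Pf_mult3 assms)

lemma pf_lmat: "(\<lambda>x. lmat c x r s) \<in> poly_fun {..5}"
  unfolding lmat_def by (intro pf_sum pf_cmult poly_fun.pf_coord) simp

text \<open>The trace of A [B, C].\<close>

definition trilin :: "mat3 \<Rightarrow> mat3 \<Rightarrow> mat3 \<Rightarrow> complex" where
  "trilin A B C = (\<Sum>a\<in>UNIV. \<Sum>b\<in>UNIV. \<Sum>c\<in>UNIV. A a b * (B b c * C c a - C b c * B c a))"

lemma dd_det3:
  assumes "\<And>r s. (\<lambda>p. m p r s) \<in> poly_fun J"
  defines "d \<equiv> \<lambda>p h r s. dd (\<lambda>p. m p r s) p h"
  shows "dd (\<lambda>p. det3 (m p)) p h =
      d p h 1 1 * (m p 2 2 * m p 3 3 - m p 2 3 * m p 3 2) + d p h 1 2 * (m p 2 3 * m p 3 1 - m p 2 1 * m p 3 3)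
    + d p h 1 3 * (m p 2 1 * m p 3 2 - m p 2 2 * m p 3 1) + d p h 2 1 * (m p 3 2 * m p 1 3 - m p 3 3 * m p 1 2)
    + d p h 2 2 * (m p 3 3 * m p 1 1 - m p 3 1 * m p 1 3) + d p h 2 3 * (m p 3 1 * m p 1 2 - m p 3 2 * m p 1 1)
    + d p h 3 1 * (m p 1 2 * m p 2 3 - m p 1 3 * m p 2 2) + d p h 3 2 * (m p 1 3 * m p 2 1 - m p 1 1 * m p 2 3)
    + d p h 3 3 * (m p 1 1 * m p 2 2 - m p 1 2 * m p 2 1)"
  unfolding det3_def d_def
  by (simp add: dd_add[where I = J] dd_diff[where I = J] dd_mult[where I = J] pf_add pf_diff pf_mult assms(1)
      algebra_simps)

text \<open>The differential of the determinant is linear in the 2 by 2 minors, and these vanish at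
  a matrix that is a product of a column and a row.\<close>

lemma sing_det3:
  assumes "\<And>x. form_eval 5 3 F x = det3 (lmat c x)" "\<And>r s. lmat c x r s = u r * w s"
  shows "sing 5 3 F x"
proof -
  have "form_eval 5 3 F = (\<lambda>x. det3 (lmat c x))" using assms(1) by auto
  then show ?thesis unfolding sing_def pd_def
    by (simp add: dd_det3[of "\<lambda>x. lmat c x" "{..5}", OF pf_lmat] assms(2) mult_ac)
qed

lemma has_derivative_vec_lambda:
  fixes f :: "'i::finite \<Rightarrow> 'a::euclidean_space \<Rightarrow> 'b::euclidean_space"
  assumes "\<And>i. (f i has_derivative f' i) (at x)"
  shows "((\<lambda>x. \<chi> i. f i x) has_derivative (\<lambda>h. \<chi> i. f' i h)) (at x)"
  unfolding has_derivative_def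
proof (intro conjI)
  have lin: "linear (f' i)" for i using assms by (rule has_derivative_linear)
  have "linear (\<lambda>h. \<chi> i. f' i h)"
    by (rule linearI) (simp_all add: vec_eq_iff linear_add[OF lin] linear_scale[OF lin])
  then show "bounded_linear (\<lambda>h. \<chi> i. f' i h)" by (simp add: linear_conv_bounded_linear)
  show "((\<lambda>y. ((\<chi> i. f i y) - (\<chi> i. f i (netlimit (at x))) - (\<chi> i. f' i (y - netlimit (at x)))) /\<^sub>R norm (y
      - netlimit (at x))) \<longlongrightarrow> 0) (at x)"
  proof (rule vec_tendstoI)
    fix i
    show "((\<lambda>y. (((\<chi> i. f i y) - (\<chi> i. f i (netlimit (at x))) - (\<chi> i. f' i (y - netlimit (at x)))) /\<^sub>R norm (y
        - netlimit (at x))) $ i) \<longlongrightarrow> 0 $ i) (at x)"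
      using assms[of i] unfolding has_derivative_def by simp
  qed
qed

definition vec3 :: "complex \<Rightarrow> complex \<Rightarrow> complex \<Rightarrow> 3 \<Rightarrow> complex" where
  "vec3 a b c r = (if r = 1 then a else if r = 2 then b else c)"

lemma vec3 [simp]: "vec3 a b c 1 = a" "vec3 a b c 2 = b" "vec3 a b c 3 = c"
  by (simp_all add: vec3_def)

text \<open>The determinantal locus is smooth of the expected dimension at a point l of rank one iff the
  span of the matrix entries and the tangent space of the Segre cone at l together fill the space of
  all matrices.\<close>

definition transversal :: "(nat \<Rightarrow> complex) \<Rightarrow> bool" where
  "transversal l \<longleftrightarrow> (\<exists>u0 w0. (\<forall>r s. lmat hex l r s = u0 r * w0 s) \<and>
     (\<forall>W. \<exists>y u w. \<forall>r s. lmat hex y r s - (u r * w0 s + u0 r * w s) = W r s))"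

lemma transversalI:
  fixes y :: "mat3 \<Rightarrow> nat \<Rightarrow> complex" and u w :: "mat3 \<Rightarrow> 3 \<Rightarrow> complex"
  assumes "\<And>r s. lmat hex l r s = u0 r * w0 s"
    and "\<And>W. lmat hex (y W) 1 1 - (u W 1 * w0 1 + u0 1 * w W 1) = W 1 1 \<and> lmat hex (y W) 1 2
        - (u W 1 * w0 2 + u0 1 * w W 2) = W 1 2 \<and>
      lmat hex (y W) 1 3 - (u W 1 * w0 3 + u0 1 * w W 3) = W 1 3
          \<and> lmat hex (y W) 2 1 - (u W 2 * w0 1 + u0 2 * w W 1) = W 2 1 \<and>
      lmat hex (y W) 2 2 - (u W 2 * w0 2 + u0 2 * w W 2) = W 2 2
          \<and> lmat hex (y W) 2 3 - (u W 2 * w0 3 + u0 2 * w W 3) = W 2 3 \<and>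
      lmat hex (y W) 3 1 - (u W 3 * w0 1 + u0 3 * w W 1) = W 3 1
          \<and> lmat hex (y W) 3 2 - (u W 3 * w0 2 + u0 3 * w W 2) = W 3 2 \<and>
      lmat hex (y W) 3 3 - (u W 3 * w0 3 + u0 3 * w W 3) = W 3 3"
  shows "transversal l"
  unfolding transversal_def
proof (rule exI[of _ u0], rule exI[of _ w0], intro conjI allI assms(1))
  fix W :: mat3
  show "\<exists>y u w. \<forall>r s. lmat hex y r s - (u r * w0 s + u0 r * w s) = W r s"
    by (rule exI[of _ "y W"], rule exI[of _ "u W"], rule exI[of _ "w W"]) (use assms(2)[of W] in \<open>simp add: forall_3\<close>)
qed

lemma rank_oneI:
  assumes "lmat hex l 1 1 = u 1 * w 1 \<and> lmat hex l 1 2 = u 1 * w 2 \<and> lmat hex l 1 3 = u 1 * w 3 \<and>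
    lmat hex l 2 1 = u 2 * w 1 \<and> lmat hex l 2 2 = u 2 * w 2 \<and> lmat hex l 2 3 = u 2 * w 3 \<and>
    lmat hex l 3 1 = u 3 * w 1 \<and> lmat hex l 3 2 = u 3 * w 2 \<and> lmat hex l 3 3 = u 3 * w 3"
  shows "lmat hex l r s = u r * w s"
  using assms exhaust_3[of r] exhaust_3[of s] by (elim disjE conjE) simp_all

text \<open>The three entries of W at the zero positions of \<open>hex\<close> are matched by u and
  w; the other six entries are then adjusted independently by the six variables in y.\<close>

lemma transversal_edges:
  assumes "s \<noteq> 0"
  shows "transversal (edge 0 1 s)" "transversal (edge 1 2 s)" "transversal (edge 2 3 s)"
    "transversal (edge 3 4 s)" "transversal (edge 4 5 s)" "transversal (edge 5 0 s)"
proof -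
  show "transversal (edge 0 1 s)"
    by (rule transversalI[where ?u0.0 = "vec3 1 0 0" and ?w0.0 = "vec3 1 s 0"
        and y = "\<lambda>W i. [W 1 1, W 1 2, W 2 2 - W 2 1 * s, W 2 3, W 3 3, W 3 1 - W 3 2 / s] ! i"
        and u = "\<lambda>W. vec3 0 (- W 2 1) (- W 3 2 / s)" and w = "\<lambda>W. vec3 0 0 (- W 1 3)"], rule rank_oneI)
      (use assms in \<open>simp_all add: lmat_hex edge_def\<close>)
  show "transversal (edge 1 2 s)"
    by (rule transversalI[where ?u0.0 = "vec3 1 s 0" and ?w0.0 = "vec3 0 1 0"
        and y = "\<lambda>W i. [W 1 1 - W 2 1 / s, W 1 2, W 2 2, W 2 3 - s * W 1 3, W 3 3, W 3 1] ! i"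
        and u = "\<lambda>W. vec3 0 0 (- W 3 2)" and w = "\<lambda>W. vec3 (- W 2 1 / s) 0 (- W 1 3)"], rule rank_oneI)
      (use assms in \<open>simp_all add: lmat_hex edge_def\<close>)
  show "transversal (edge 2 3 s)"
    by (rule transversalI[where ?u0.0 = "vec3 0 1 0" and ?w0.0 = "vec3 0 1 s"
        and y = "\<lambda>W i. [W 1 1, W 1 2 - W 1 3 / s, W 2 2, W 2 3, W 3 3 - s * W 3 2, W 3 1] ! i"
        and u = "\<lambda>W. vec3 (- W 1 3 / s) 0 (- W 3 2)" and w = "\<lambda>W. vec3 (- W 2 1) 0 0"], rule rank_oneI)
      (use assms in \<open>simp_all add: lmat_hex edge_def\<close>)
  show "transversal (edge 3 4 s)"
    by (rule transversalI[where ?u0.0 = "vec3 0 1 s" and ?w0.0 = "vec3 0 0 1"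
        and y = "\<lambda>W i. [W 1 1, W 1 2, W 2 2 - W 3 2 / s, W 2 3, W 3 3, W 3 1 - s * W 2 1] ! i"
        and u = "\<lambda>W. vec3 (- W 1 3) 0 0" and w = "\<lambda>W. vec3 (- W 2 1) (- W 3 2 / s) 0"], rule rank_oneI)
      (use assms in \<open>simp_all add: lmat_hex edge_def\<close>)
  show "transversal (edge 4 5 s)"
    by (rule transversalI[where ?u0.0 = "vec3 0 0 1" and ?w0.0 = "vec3 s 0 1"
        and y = "\<lambda>W i. [W 1 1 - s * W 1 3, W 1 2, W 2 2, W 2 3 - W 2 1 / s, W 3 3, W 3 1] ! i"
        and u = "\<lambda>W. vec3 (- W 1 3) (- W 2 1 / s) 0" and w = "\<lambda>W. vec3 0 (- W 3 2) 0"], rule rank_oneI)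
      (use assms in \<open>simp_all add: lmat_hex edge_def\<close>)
  show "transversal (edge 5 0 s)"
    by (rule transversalI[where ?u0.0 = "vec3 s 0 1" and ?w0.0 = "vec3 1 0 0"
        and y = "\<lambda>W i. [W 1 1, W 1 2 - s * W 3 2, W 2 2, W 2 3, W 3 3 - W 1 3 / s, W 3 1] ! i"
        and u = "\<lambda>W. vec3 0 (- W 2 1) 0" and w = "\<lambda>W. vec3 0 (- W 3 2) (- W 1 3 / s)"], rule rank_oneI)
      (use assms in \<open>simp_all add: lmat_hex edge_def\<close>)
qed

text \<open>The persistence lemma takes its unknowns in a Euclidean space, so the six coordinates
  are stored as two triples, the even ones in the first and the odd ones in the second.\<close>

definition six :: "(complex ^ 3) \<times> (complex ^ 3) \<Rightarrow> nat \<Rightarrow> complex" where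
  "six q i = (if i = 0 then fst q $ 1 else if i = 1 then snd q $ 1 else if i = 2 then fst q $ 2
     else if i = 3 then snd q $ 2 else if i = 4 then fst q $ 3 else if i = 5 then snd q $ 3 else 0)"

lemma bounded_linear_six: "bounded_linear (\<lambda>q. six q i)"
proof -
  have bl_if: "bounded_linear (\<lambda>x. if P then f x else g x)" if "bounded_linear f" "bounded_linear g"
    for P and f g :: "(complex ^ 3) \<times> (complex ^ 3) \<Rightarrow> complex" using that by (cases P) simp_all
  show ?thesis unfolding six_def
    by (intro bl_if bounded_linear_zero bounded_linear_compose[OF bounded_linear_vec_nth bounded_linear_fst]
        bounded_linear_compose[OF bounded_linear_vec_nth bounded_linear_snd])
qed

lemma lmat_add: "lmat c (\<lambda>i. x i + y i) r s = lmat c x r s + lmat c y r s"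
  by (simp add: lmat_def distrib_left sum.distrib)

text \<open>Rank one is written as nine equations with the factors u and w as additional unknowns,
  and transversality says that their linearisation is surjective. Equating the nine minors to zero
  would fail here, since their differentials are dependent at a matrix of rank one.\<close>

lemma persist_rank_one:
  assumes tr: "transversal l" and e: "e > 0"
  shows "\<exists>\<delta>>0. \<forall>t. norm t < \<delta> \<longrightarrow> (\<exists>x u w. (\<forall>i\<le>5. norm (x i - l i) < e) \<and>
    (\<forall>r s. lmat hex x r s + t * lmat B x r s = u r * w s))"
proof -
  obtain u0 w0 where l: "\<And>r s. lmat hex l r s = u0 r * w0 s"
    and sj: "\<And>W. \<exists>y u w. \<forall>r s. lmat hex y r s - (u r * w0 s + u0 r * w s) = W r s"
    using tr unfolding transversal_def by blast
  define c where "c = (\<lambda>z :: ((complex ^ 3) \<times> (complex ^ 3)) \<times> ((complex ^ 3) \<times> (complex ^ 3)). six (fst z))"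
  define M where "M = (\<lambda>b r s (y :: complex \<times> ((complex ^ 3) \<times> (complex ^ 3)) \<times> ((complex ^ 3) \<times> (complex ^ 3))).
      lmat b (c (snd y)) r s)"
  have blc: "bounded_linear (\<lambda>z. c z i)" for i
    unfolding c_def by (rule bounded_linear_compose[OF bounded_linear_six bounded_linear_fst])
  have blM: "bounded_linear (M b r s)" for b r s
    unfolding M_def lmat_def
    by (intro bounded_linear_sum bounded_linear_const_mult bounded_linear_compose[OF blc bounded_linear_snd])
  define \<Phi> where "\<Phi> = (\<lambda>y. \<chi> r s. (lmat hex l r s + M hex r s y) + fst y * (lmat B l r s + M B r s y)
      - (u0 r + fst (snd (snd y)) $ r) * (w0 s + snd (snd (snd y)) $ s))"
  define D where "D = (\<lambda>h. \<chi> r s. M hex r s h + fst h * lmat B l r s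
      - (fst (snd (snd h)) $ r * w0 s + u0 r * snd (snd (snd h)) $ s))"
  have M0: "M b r s 0 = 0" for b r s using linear_0[OF bounded_linear.linear[OF blM]] .
  have dM: "(M b r s has_derivative M b r s) F" for b r s F by (rule bounded_linear_imp_has_derivative[OF blM])
  have dU: "((\<lambda>y. fst (snd (snd y)) $ r) has_derivative (\<lambda>h. fst (snd (snd h)) $ r)) F"
    "((\<lambda>y. snd (snd (snd y)) $ r) has_derivative (\<lambda>h. snd (snd (snd h)) $ r)) F"
    for r :: 3 and F :: "(complex \<times> ((complex ^ 3) \<times> (complex ^ 3)) \<times> ((complex ^ 3) \<times> (complex ^ 3))) filter"
    by (intro bounded_linear.has_derivative[OF bounded_linear_vec_nth] has_derivative_fst has_derivative_snd
        has_derivative_ident)+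
  have "\<exists>\<delta>>0. \<forall>t. norm t < \<delta> \<longrightarrow> (\<exists>z. (\<forall>i\<le>5. norm (c z i) < e) \<and> \<Phi> (t, z) = 0)"
  proof (rule persist_points[where D = D])
    show "continuous_on UNIV \<Phi>" unfolding \<Phi>_def
      by (intro continuous_intros linear_continuous_on[OF blM])
    show "(\<Phi> has_derivative D) (at (0, 0))"
      unfolding \<Phi>_def D_def zero_prod_def[symmetric]
    proof (rule has_derivative_vec_lambda, rule has_derivative_vec_lambda)
      fix r s
      show "((\<lambda>y. (lmat hex l r s + M hex r s y) + fst y * (lmat B l r s + M B r s y)
          - (u0 r + fst (snd (snd y)) $ r) * (w0 s + snd (snd (snd y)) $ s)) has_derivative
        (\<lambda>h. M hex r s h + fst h * lmat B l r s - (fst (snd (snd h)) $ r * w0 s + u0 r * snd (snd (snd h)) $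
            s))) (at 0)"
        by (rule has_derivative_eq_rhs[OF has_derivative_diff[OF has_derivative_add[OF has_derivative_add[OF
            has_derivative_const dM]
            has_derivative_mult[OF has_derivative_fst[OF has_derivative_ident] has_derivative_add[OF
                has_derivative_const dM]]]
            has_derivative_mult[OF has_derivative_add[OF has_derivative_const dU(1)] has_derivative_add[OF
                has_derivative_const dU(2)]]]])
          (simp add: M0 fun_eq_iff algebra_simps)
    qed
    show "\<Phi> (0, 0) = 0" by (simp add: \<Phi>_def vec_eq_iff l M0 zero_prod_def[symmetric])
    show "surj (\<lambda>z. D (0, z))"
    proof (rule surjI)
      fix W :: "complex ^ 3 ^ 3"
      obtain y u w where y: "\<forall>r s. lmat hex y r s - (u r * w0 s + u0 r * w s) = W $ r $ s"
        using sj[of "\<lambda>r s. W $ r $ s"] by blast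
      define z where "z = (((\<chi> k. vec3 (y 0) (y 2) (y 4) k), (\<chi> k. vec3 (y 1) (y 3) (y 5) k)),
          ((\<chi> k. u k), (\<chi> k. w k)))"
      have "M hex r s (0, z) = lmat hex y r s" for r s
        unfolding M_def c_def lmat_def z_def by (simp add: sum_atMost_5 six_def)
      then have "D (0, z) = W" using y by (simp add: D_def vec_eq_iff z_def)
      then show "D (0, SOME z. D (0, z) = W) = W" by (rule someI)
    qed
  qed (rule blc e)+
  then obtain \<delta> where \<delta>: "\<delta> > 0" "\<And>t. norm t < \<delta> \<Longrightarrow> \<exists>z. (\<forall>i\<le>5. norm (c z i) < e) \<and> \<Phi> (t, z) = 0" by auto
  show ?thesis
  proof (intro exI[of _ \<delta>] conjI \<delta>(1) allI impI)
    fix t :: complex assume "norm t < \<delta>"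
    from \<delta>(2)[OF this] obtain z where z: "\<forall>i\<le>5. norm (c z i) < e" "\<Phi> (t, z) = 0" by (elim exE conjE)
    show "\<exists>x u w. (\<forall>i\<le>5. norm (x i - l i) < e) \<and> (\<forall>r s. lmat hex x r s + t * lmat B x r s = u r * w s)"
      by (rule exI[of _ "\<lambda>i. l i + c z i"], rule exI[of _ "\<lambda>r. u0 r + fst (snd z) $ r"],
          rule exI[of _ "\<lambda>s. w0 s + snd (snd z) $ s"])
        (use z in \<open>simp add: \<Phi>_def vec_eq_iff lmat_add M_def\<close>)
  qed
qed

text \<open>A determinant is singular where its matrix has rank one, so the witness points are moved
  inside the rank-one locus of hex + t (A - hex).\<close>

lemma determinant_in_zdual:
  assumes F: "F \<in> aff (Mon 5 3)" and FA: "\<And>l. form_eval 5 3 F l = det3 (lmat A l)"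
  shows "F \<in> zdual (Mon 5 3) (sec_cone 5 3 9)"
proof -
  define B where "B = (\<lambda>a. A a - hex a)"
  define c where "c = (\<lambda>(p :: unit \<Rightarrow> complex) a. hex a + p () * B a)"
  have lc: "lmat (c p) x r s = lmat hex x r s + p () * lmat B x r s" for p x r s
    by (simp add: lmat_def c_def distrib_right distrib_left sum.distrib sum_distrib_left mult_ac)
  have "Pf {()} 5 3 (\<lambda>p x. det3 (lmat (c p) x))"
    by (intro Pf_det3 Pf_lmat) (auto simp: c_def intro!: pf_add pf_mult pf_const poly_fun.pf_coord)
  then obtain C where C: "pform {()} 5 3 (\<lambda>p x. det3 (lmat (c p) x)) C" unfolding Pf_def ..
  have "C (\<lambda>_. 1) \<in> zdual (Mon 5 3) (sec_cone 5 3 9)"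
  proof (rule zdual_deform[OF cubic_nondeg _ C])
    fix j :: nat and e :: real assume j: "j < 9" and e: "e > 0"
    have "\<forall>j<9. transversal (pt cubic_pts j)" unfolding cubic_pts by (simp add: transversal_edges del: One_nat_def)
    then have "transversal (pt cubic_pts j)" using j by simp
    from persist_rank_one[OF this e, of B] obtain \<delta> where \<delta>: "\<delta> > 0"
      "\<And>t. norm t < \<delta> \<Longrightarrow> \<exists>x u w. (\<forall>i\<le>5. norm (x i - pt cubic_pts j i) < e) \<and>
        (\<forall>r s. lmat hex x r s + t * lmat B x r s = u r * w s)" by (elim exE conjE) simp
    show "\<exists>\<delta>>0. \<forall>t. norm t < \<delta> \<longrightarrow> (\<exists>x. (\<forall>i\<le>5. norm (x i - pt cubic_pts j i) < e) \<and> sing 5 3 (C (\<lambda>_. t)) x)"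
    proof (intro exI[of _ \<delta>] conjI \<delta>(1) allI impI)
      fix t :: complex assume "norm t < \<delta>"
      from \<delta>(2)[OF this] obtain x u w where x: "\<forall>i\<le>5. norm (x i - pt cubic_pts j i) < e"
        "\<forall>r s. lmat hex x r s + t * lmat B x r s = u r * w s" by (elim exE conjE)
      have "sing 5 3 (C (\<lambda>_. t)) x"
        by (rule sing_det3[where c = "c (\<lambda>_. t)" and u = u and w = w]) (simp_all add: pformD(4)[OF C] lc x(2))
      then show "\<exists>x. (\<forall>i\<le>5. norm (x i - pt cubic_pts j i) < e) \<and> sing 5 3 (C (\<lambda>_. t)) x" using x(1)
          by (intro exI[of _ x] conjI)
    qed
  qed simp
  moreover have "C (\<lambda>_. 1) = F"
    by (rule form_eval_inject[OF pformD(3)[OF C] F]) (simp add: pformD(4)[OF C] FA c_def B_def)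
  ultimately show ?thesis by simp
qed

text \<open>An entry ((r, s, i), xs) says that the monomial with exponents xs is, up to sign, x_i times the
  (r, s) cofactor of \<open>hex\<close>. Each of the 38 monomials that arise in this way is listed once.\<close>

definition minor_tab :: "((3 \<times> 3 \<times> nat) \<times> nat list) list" where
  "minor_tab =
    [((1, 1, 0), [1, 0, 1, 0, 1, 0]), ((1, 1, 1), [0, 1, 1, 0, 1, 0]),
     ((1, 1, 2), [0, 0, 2, 0, 1, 0]), ((1, 1, 3), [0, 0, 1, 1, 1, 0]),
     ((1, 1, 4), [0, 0, 1, 0, 2, 0]), ((1, 1, 5), [0, 0, 1, 0, 1, 1]),
     ((1, 2, 0), [1, 0, 0, 1, 0, 1]), ((1, 2, 1), [0, 1, 0, 1, 0, 1]),
     ((1, 2, 2), [0, 0, 1, 1, 0, 1]), ((1, 2, 3), [0, 0, 0, 2, 0, 1]),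
     ((1, 2, 4), [0, 0, 0, 1, 1, 1]), ((1, 2, 5), [0, 0, 0, 1, 0, 2]),
     ((1, 3, 0), [1, 0, 1, 0, 0, 1]), ((1, 3, 1), [0, 1, 1, 0, 0, 1]),
     ((1, 3, 2), [0, 0, 2, 0, 0, 1]), ((1, 3, 5), [0, 0, 1, 0, 0, 2]),
     ((2, 1, 0), [1, 1, 0, 0, 1, 0]), ((2, 1, 1), [0, 2, 0, 0, 1, 0]),
     ((2, 1, 3), [0, 1, 0, 1, 1, 0]), ((2, 1, 4), [0, 1, 0, 0, 2, 0]),
     ((2, 1, 5), [0, 1, 0, 0, 1, 1]), ((2, 2, 0), [2, 0, 0, 0, 1, 0]),
     ((2, 2, 3), [1, 0, 0, 1, 1, 0]), ((2, 2, 4), [1, 0, 0, 0, 2, 0]),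
     ((2, 2, 5), [1, 0, 0, 0, 1, 1]), ((2, 3, 0), [1, 1, 0, 0, 0, 1]),
     ((2, 3, 1), [0, 2, 0, 0, 0, 1]), ((2, 3, 5), [0, 1, 0, 0, 0, 2]),
     ((3, 1, 0), [1, 1, 0, 1, 0, 0]), ((3, 1, 1), [0, 2, 0, 1, 0, 0]),
     ((3, 1, 2), [0, 1, 1, 1, 0, 0]), ((3, 1, 3), [0, 1, 0, 2, 0, 0]),
     ((3, 2, 0), [2, 0, 0, 1, 0, 0]), ((3, 2, 2), [1, 0, 1, 1, 0, 0]),
     ((3, 2, 3), [1, 0, 0, 2, 0, 0]), ((3, 3, 0), [2, 0, 1, 0, 0, 0]),
     ((3, 3, 1), [1, 1, 1, 0, 0, 0]), ((3, 3, 2), [1, 0, 2, 0, 0, 0])]"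

lemma minor_tab_snd: "distinct (map snd minor_tab)" "\<forall>xs\<in>set (map snd minor_tab). xs \<in> set (monl 5 3)"
  unfolding monl_5_3 by (simp_all add: minor_tab_def)

lemma length_minor_tab: "length minor_tab = 38"
  by (simp add: minor_tab_def)

text \<open>Each cofactor of \<open>hex\<close> is, up to sign, the product of two variables that
  are not adjacent in the hexagon; the sign is negative exactly at the positions of the zero
  entries.\<close>

lemma minor_tab_derivative:
  assumes "((r, s, i), xs) \<in> set minor_tab" and d: "\<And>r' s'. d r' s' = (if r' = r \<and> s' = s then x i else 0)" and m:
      "m = lmat hex x"
  shows "d 1 1 * (m 2 2 * m 3 3 - m 2 3 * m 3 2) + d 1 2 * (m 2 3 * m 3 1 - m 2 1 * m 3 3)
    + d 1 3 * (m 2 1 * m 3 2 - m 2 2 * m 3 1) + d 2 1 * (m 3 2 * m 1 3 - m 3 3 * m 1 2)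
    + d 2 2 * (m 3 3 * m 1 1 - m 3 1 * m 1 3) + d 2 3 * (m 3 1 * m 1 2 - m 3 2 * m 1 1)
    + d 3 1 * (m 1 2 * m 2 3 - m 1 3 * m 2 2) + d 3 2 * (m 1 3 * m 2 1 - m 1 1 * m 2 3)
    + d 3 3 * (m 1 1 * m 2 2 - m 1 2 * m 2 1)
    = (if (r, s) \<in> {(1, 3), (2, 1), (3, 2)} then - 1 else 1) * (\<Prod>k\<le>5. x k ^ expo xs k)"
  using assms(1) unfolding minor_tab_def d m lmat_hex prod_atMost_5
  by (simp, elim disjE conjE, simp_all add: expo_def power2_eq_square power3_eq_cube)

text \<open>Perturbing only the 38 listed coefficients of \<open>hex\<close> gives derivatives of
  the determinant that are distinct monomials up to sign, so this subfamily of determinants is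
  immersed at \<open>hex\<close>.\<close>

lemma cubic_chain: "zchain (Mon 5 3) (zdual (Mon 5 3) (sec_cone 5 3 9)) 38"
proof -
  define a where "a = (\<lambda>k. fst (minor_tab ! k))"
  define c where "c = (\<lambda>(p :: nat \<Rightarrow> complex) b. hex b + (\<Sum>k<38. if a k = b then p k else 0))"
  have cpf: "(\<lambda>p. c p b) \<in> poly_fun {..<38}" for b
    unfolding c_def by (intro pf_add pf_sum pf_if pf_const poly_fun.pf_coord)
  have "Pf {..<38} 5 3 (\<lambda>p x. det3 (lmat (c p) x))"
    by (intro Pf_det3 Pf_lmat cpf)
  then obtain C where C: "pform {..<38} 5 3 (\<lambda>p x. det3 (lmat (c p) x)) C" unfolding Pf_def ..
  have CZ: "range C \<subseteq> zdual (Mon 5 3) (sec_cone 5 3 9)"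
    using determinant_in_zdual[OF pformD(3)[OF C] pformD(4)[OF C]] by auto
  have c0: "c (\<lambda>_. 0) = hex" by (auto simp: c_def)
  have lpf: "(\<lambda>p. lmat (c p) x r s) \<in> poly_fun {..<38}" for x r s
    unfolding lmat_def by (intro pf_sum pf_mult cpf pf_const)
  define sg :: "nat \<Rightarrow> complex" where
    "sg = (\<lambda>k. if (fst (a k), fst (snd (a k))) \<in> {(1, 3), (2, 1), (3, 2)} then - 1 else 1)"
  define e where "e = (\<lambda>k. expo (snd (minor_tab ! k)))"
  have der: "pd (\<lambda>p. det3 (lmat (c p) x)) k (\<lambda>_. 0) = sg k * (\<Prod>i\<le>5. x i ^ e k i)" if k: "k < 38" for x k
  proof -
    obtain r s i where ak: "a k = (r, s, i)" by (cases "a k") auto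
    have dc: "dd (\<lambda>p. c p b) (\<lambda>_. 0) (ax k) = (if a k = b then 1 else 0)" for b
    proof -
      have "dd (\<lambda>p. c p b) (\<lambda>_. 0) (ax k) = (\<Sum>j<38. dd (\<lambda>p. if a j = b then p j else 0) (\<lambda>_. 0) (ax k))"
        unfolding c_def
      proof (subst dd_add[where I = "{..<38}"])
        show pf: "(\<lambda>p. \<Sum>j<38. if a j = b then p j else 0) \<in> poly_fun {..<38}"
          by (intro pf_sum pf_if pf_const poly_fun.pf_coord)
        show "dd (\<lambda>p. hex b) (\<lambda>_. 0) (ax k) + dd (\<lambda>p. \<Sum>j<38. if a j = b then p j else 0) (\<lambda>_. 0) (ax k)
            = (\<Sum>j<38. dd (\<lambda>p. if a j = b then p j else 0) (\<lambda>_. 0) (ax k))"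
          by (subst dd_sum[where I = "{..<38}"]) (simp_all add: pf_if pf_const poly_fun.pf_coord)
      qed (rule pf_const)
      also have "\<dots> = (\<Sum>j<38. if j = k then (if a k = b then 1 else 0) else 0)"
      proof (intro sum.cong refl)
        fix j
        show "dd (\<lambda>p. if a j = b then p j else 0) (\<lambda>_. 0) (ax k) = (if j = k then (if a k = b then 1 else 0) else 0)"
          by (cases "a j = b") (auto simp: ax_def)
      qed
      finally show ?thesis using k by simp
    qed
    have dl: "dd (\<lambda>p. lmat (c p) x r' s') (\<lambda>_. 0) (ax k) = (if r' = r \<and> s' = s then x i else 0)" if i: "i \<le> 5" for r' s'
    proof -
      have "dd (\<lambda>p. lmat (c p) x r' s') (\<lambda>_. 0) (ax k) = (\<Sum>j\<le>5. dd (\<lambda>p. c p (r', s', j)) (\<lambda>_. 0) (ax k) * x j)"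
        unfolding lmat_def
        by (subst dd_sum[where I = "{..<38}"]) (auto intro!: pf_mult cpf pf_const sum.cong
            simp: dd_mult[OF cpf pf_const])
      also have "\<dots> = (\<Sum>j\<le>5. if j = i then (if r' = r \<and> s' = s then x i else 0) else 0)"
        by (intro sum.cong refl) (auto simp: dc ak)
      finally show ?thesis using i by simp
    qed
    have mem: "((r, s, i), snd (minor_tab ! k)) \<in> set minor_tab"
      using ak nth_mem[of k minor_tab] k length_minor_tab unfolding a_def by (metis prod.collapse)
    then have i5: "i \<le> 5" unfolding minor_tab_def by auto
    have "pd (\<lambda>p. det3 (lmat (c p) x)) k (\<lambda>_. 0)
        = (if (r, s) \<in> {(1, 3), (2, 1), (3, 2)} then - 1 else 1) * (\<Prod>i\<le>5. x i ^ expo (snd (minor_tab ! k)) i)"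
      unfolding pd_def dd_det3[of "\<lambda>p. lmat (c p) x" "{..<38}", OF lpf] c0
      by (rule minor_tab_derivative[where d = "\<lambda>r' s'. dd (\<lambda>p. lmat (c p) x r' s') (\<lambda>_. 0) (ax k)" and m = "lmat hex x"
          and x = x and r = r and s = s and i = i, OF mem _ refl]) (rule dl[OF i5])
    then show ?thesis by (simp add: sg_def ak e_def)
  qed
  have einj: "inj_on e {..<38}"
  proof (rule inj_onI)
    fix j k assume jk: "j \<in> {..<38}" "k \<in> {..<38}" "e j = e k"
    have "snd (minor_tab ! j) \<in> set (monl 5 3)" "snd (minor_tab ! k) \<in> set (monl 5 3)"
      using minor_tab_snd(2) jk length_minor_tab by auto
    then have "map snd minor_tab ! j = map snd minor_tab ! k"
      using jk length_minor_tab expo_inj[of "snd (minor_tab ! j)" "snd (minor_tab ! k)"] monl_length[of _ 5 3]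
      by (simp add: e_def)
    then show "j = k" using jk length_minor_tab minor_tab_snd(1) by (simp add: nth_eq_iff_index_eq del: nth_map)
  qed
  have eM: "e ` {..<38} \<subseteq> Mon 5 3"
    using minor_tab_snd(2) length_minor_tab by (auto simp: e_def Mon_monl)
  have "lin_indep {..<38} (Mon 5 3) (\<lambda>j \<alpha>. pd (\<lambda>p. C p \<alpha>) j (\<lambda>_. 0))"
  proof (rule lin_indep_form_derivatives[OF C order_refl])
    fix q j assume q: "\<And>x. (\<Sum>j<38. q j * pd (\<lambda>p. det3 (lmat (c p) x)) j (\<lambda>_. 0)) = 0" and j: "j \<in> {..<38::nat}"
    have "(\<Sum>j<38. (q j * sg j) * (\<Prod>i\<le>5. x i ^ e j i)) = 0" for x
      using q[of x] by (simp add: der mult_ac)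
    then have "q j * sg j = 0" by (rule monomials_independent[OF finite_lessThan einj eM _ j])
    then show "q j = 0" by (auto simp: sg_def split: if_splits)
  qed
  then have "zchain (Mon 5 3) (zclosure (Mon 5 3) (range C)) (card {..<38::nat})"
    by (intro zchain_immersion pformD(1,2)[OF C]) auto
  then show ?thesis
    using zclosure_minimal[OF zclosed_zdual CZ] zchain_mono by simp
qed

text \<open>The rows of \<open>wtab\<close> span the linear relations between the points of \<open>cubic_pts\<close>, those of \<open>vtab\<close>
  the relations between the products of rows of \<open>wtab\<close>, and the matrices \<open>ttab k\<close> the orthogonal
  complement of the span of the coefficient matrices of \<open>hex\<close>.\<close>

definition wtab :: "3 \<Rightarrow> nat \<Rightarrow> complex" where
  "wtab k j = ([vec3 (-2) 0 0, vec3 1 1 0, vec3 1 (-1) 0, vec3 0 (-2) 0, vec3 0 1 1, vec3 0 1 (-1),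
     vec3 0 0 (-2), vec3 1 0 1, vec3 (-1) 0 1] ! j) k"

definition vtab :: "3 \<Rightarrow> nat \<Rightarrow> complex" where
  "vtab k j = ([vec3 (-1/2) (-1/2) 0, vec3 0 1 0, vec3 0 1 0, vec3 0 (-1/2) (-1/2), vec3 0 0 1, vec3 0 0 1,
     vec3 (-1/2) 0 (-1/2), vec3 1 0 0, vec3 1 0 0] ! j) k"

definition ttab :: "3 \<Rightarrow> 3 \<times> 3 \<Rightarrow> complex" where
  "ttab k a = (if (k, a) \<in> {(1, 1, 3), (2, 2, 1), (3, 3, 2)} then 1 else 0)"

lemma all_less_9: "(\<forall>j<9::nat. P j) \<longleftrightarrow> P 0 \<and> P 1 \<and> P 2 \<and> P 3 \<and> P 4 \<and> P 5 \<and> P 6 \<and> P 7 \<and> P 8"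
  by (simp add: numeral_nat less_Suc_eq all_conj_distrib)

lemma sum_less_9: "(\<Sum>j<9::nat. g j) = g 0 + g 1 + g 2 + g 3 + g 4 + g 5 + g 6 + g 7 + g 8"
  by (simp add: numeral_nat)

lemma pt_cubic_pts:
  "cubic_pts (0, i) = edge 0 1 1 i" "cubic_pts (1, i) = edge 1 2 1 i" "cubic_pts (2, i) = edge 1 2 (-1) i"
  "cubic_pts (3, i) = edge 2 3 1 i" "cubic_pts (4, i) = edge 3 4 1 i" "cubic_pts (5, i) = edge 3 4 (-1) i"
  "cubic_pts (6, i) = edge 4 5 1 i" "cubic_pts (7, i) = edge 5 0 1 i" "cubic_pts (8, i) = edge 5 0 (-1) i"
  by (simp_all add: cubic_pts_def pts_def)

lemma wtab_relation: "i \<le> 5 \<Longrightarrow> (\<Sum>j<9. wtab k j * cubic_pts (j, i)) = 0"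
proof -
  have "\<forall>i\<le>5. \<forall>k. (\<Sum>j<9. wtab k j * cubic_pts (j, i)) = 0"
    unfolding all_le5 forall_3 sum_less_9 pt_cubic_pts by (simp add: wtab_def edge_def)
  then show "i \<le> 5 \<Longrightarrow> (\<Sum>j<9. wtab k j * cubic_pts (j, i)) = 0" by blast
qed

lemma vtab_relation: "(\<Sum>j<9. vtab k j * (wtab a j * wtab c j)) = 0"
proof -
  have "\<forall>k a c. (\<Sum>j<9. vtab k j * (wtab a j * wtab c j)) = 0"
    unfolding forall_3 sum_less_9 by (simp add: wtab_def vtab_def)
  then show ?thesis by blast
qed

lemma tab_product: "j < 9 \<Longrightarrow> lmat hex (pt cubic_pts j) a c = wtab a j * vtab c j"
proof -
  have "\<forall>j<9. \<forall>a c. lmat hex (pt cubic_pts j) a c = wtab a j * vtab c j"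
    unfolding all_less_9 forall_3 lmat_hex pt_def pt_cubic_pts by (simp add: wtab_def vtab_def edge_def)
  then show "j < 9 \<Longrightarrow> lmat hex (pt cubic_pts j) a c = wtab a j * vtab c j" by blast
qed

lemma cubic_pts_independent: "lin_indep {..5} {..<9} (\<lambda>i j. cubic_pts (j, i))"
  unfolding lin_indep_def
proof (intro allI impI)
  fix q assume q: "\<forall>j\<in>{..<9}. (\<Sum>i\<le>5. q i * cubic_pts (j, i)) = 0"
  have e: "q 0 + q 1 = 0" "q 1 + q 2 = 0" "q 1 = q 2" "q 2 + q 3 = 0" "q 3 + q 4 = 0" "q 3 = q 4" "q 4 + q 5 = 0"
    using bspec[OF q, of 0] bspec[OF q, of 1] bspec[OF q, of 2] bspec[OF q, of 3] bspec[OF q, of 4]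
      bspec[OF q, of 5] bspec[OF q, of 6]
    unfolding sum_atMost_5 pt_cubic_pts by (simp_all only: edge_def) simp_all
  have "q 0 = 0 \<and> q 1 = 0 \<and> q 2 = 0 \<and> q 3 = 0 \<and> q 4 = 0 \<and> q 5 = 0"
    using e by (intro conjI) algebra+
  then have "\<forall>i\<le>5. q i = 0" unfolding all_le5 .
  then show "\<forall>i\<in>{..5}. q i = 0" by simp
qed

text \<open>Unordered pairs of indices: products of two rows are symmetric, so at most these six can
  be independent.\<close>

definition sym_pairs :: "(3 \<times> 3) set" where
  "sym_pairs = {(1, 1), (2, 2), (3, 3), (1, 2), (2, 3), (1, 3)}"

lemma sym_pairs: "(a, c) \<in> sym_pairs \<or> (c, a) \<in> sym_pairs"
  using exhaust_3[of a] exhaust_3[of c] by (auto simp: sym_pairs_def)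

lemma wtab_products_independent: "lin_indep sym_pairs {..<9} (\<lambda>a j. wtab (fst a) j * wtab (snd a) j)"
  unfolding lin_indep_def
proof (intro allI impI)
  fix q :: "3 \<times> 3 \<Rightarrow> complex"
  assume q: "\<forall>j\<in>{..<9}. (\<Sum>a\<in>sym_pairs. q a * (wtab (fst a) j * wtab (snd a) j)) = 0"
  have d: "q (1, 1) = 0" "q (2, 2) = 0" "q (3, 3) = 0"
    using bspec[OF q, of 0] bspec[OF q, of 3] bspec[OF q, of 6] by (simp_all add: sym_pairs_def wtab_def)
  have "q (1, 2) = 0" "q (2, 3) = 0" "q (1, 3) = 0"
    using bspec[OF q, of 1] bspec[OF q, of 4] bspec[OF q, of 7] d by (simp_all add: sym_pairs_def wtab_def)
  note e = this d
  show "\<forall>a\<in>sym_pairs. q a = 0" using e by (simp add: sym_pairs_def)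
qed

text \<open>Given nine points l, let w be a Gale dual configuration in the plane and v a Gale dual of its
  second Veronese image. Then the tensors w_j \<otimes> v_j satisfy all linear relations between the
  points, so there is a matrix L of linear forms whose values at the nine points have rank one.
  All choices are polynomial in l.\<close>

lemma determinantal_family:
  obtains Lc :: "(nat \<times> nat \<Rightarrow> complex) \<Rightarrow> 3 \<times> 3 \<times> nat \<Rightarrow> complex" and T :: "3 \<Rightarrow> (nat \<times> nat \<Rightarrow> complex) \<Rightarrow> 3 \<times> 3 \<Rightarrow> complex"
    and \<kappa> \<mu> :: complex
  where "\<And>a. (\<lambda>p. Lc p a) \<in> poly_fun (prm 9 5)" "\<And>k a. (\<lambda>p. T k p a) \<in> poly_fun (prm 9 5)"
    "\<And>p j. j < 9 \<Longrightarrow> \<exists>u w. \<forall>r s. lmat (Lc p) (pt p j) r s = u r * w s"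
    "\<And>k p x. (\<Sum>a\<in>UNIV. \<Sum>c\<in>UNIV. T k p (a, c) * lmat (Lc p) x a c) = 0"
    "\<kappa> \<noteq> 0" "\<mu> \<noteq> 0" "\<And>a c i. i \<le> 5 \<Longrightarrow> Lc cubic_pts (a, c, i) = \<kappa> * hex (a, c, i)"
    "\<And>k a. T k cubic_pts a = \<mu> * ttab k a"
proof -
  let ?J = "prm 9 5" and ?p0 = cubic_pts
  define m where "m = (\<lambda>i (p :: nat \<times> nat \<Rightarrow> complex) j. p (j, i))"
  have mpf: "(\<lambda>p. m i p j) \<in> poly_fun ?J" if "i \<in> {..5}" "j \<in> {..<9}" for i j
    unfolding m_def using that by (intro poly_fun.pf_coord) auto
  have mind: "lin_indep {..5} {..<9} (\<lambda>i. m i ?p0)" unfolding m_def by (rule cubic_pts_independent)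
  obtain b D where D: "D \<in> poly_fun ?J" "D ?p0 \<noteq> 0"
    and b0: "\<forall>i\<in>{..5}. \<forall>j. (\<lambda>p. b i p j) \<in> poly_fun ?J"
    and bm0: "\<forall>p. \<forall>i\<in>{..5}. \<forall>i'\<in>{..5}. (\<Sum>j\<in>{..<9}. b i p j * m i' p j) = (if i = i' then D p else 0)"
    using poly_dual_basis[where m = m and R = "{..5}" and I = "{..<9}" and J = ?J and ?p0.0 = ?p0,
        OF _ _ mpf mind] by auto
  have b: "(\<lambda>p. b i p j) \<in> poly_fun ?J" if "i \<le> 5" for i j using b0 that by simp
  have bm: "(\<Sum>j<9. b i p j * m i' p j) = (if i = i' then D p else 0)" if "i \<le> 5" "i' \<le> 5" for i i' p
    using bm0 that by simp
  \<comment> \<open>The constant table \<open>wtab\<close> is projected, up to the factor D, onto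
    the linear relations between the nine points of p; at the witness it is only rescaled.\<close>
  define w where "w = (\<lambda>k p j. D p * wtab k j - (\<Sum>i\<le>5. (\<Sum>j<9. wtab k j * m i p j) * b i p j))"
  have wpf: "(\<lambda>p. w k p j) \<in> poly_fun ?J" for k j
    unfolding w_def using mpf by (intro pf_diff pf_mult pf_sum pf_const D b) auto
  have wm: "(\<Sum>j<9. w k p j * m i p j) = 0" if "i \<le> 5" for k p i
    unfolding w_def using that bm by (intro section_orthogonal) auto
  have w0: "w k ?p0 j = D ?p0 * wtab k j" for k j
    using wtab_relation by (simp add: w_def m_def)
  define n where "n = (\<lambda>a p j. w (fst a) p j * w (snd a) p j)"
  have nind: "lin_indep sym_pairs {..<9} (\<lambda>a. n a ?p0)"
    unfolding lin_indep_def
  proof (intro allI impI)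
    fix q assume q: "\<forall>j\<in>{..<9}. (\<Sum>a\<in>sym_pairs. q a * n a ?p0 j) = 0"
    have "(\<Sum>a\<in>sym_pairs. q a * (wtab (fst a) j * wtab (snd a) j)) = 0" if "j \<in> {..<9}" for j
    proof -
      have "D ?p0 * D ?p0 * (\<Sum>a\<in>sym_pairs. q a * (wtab (fst a) j * wtab (snd a) j)) = (\<Sum>a\<in>sym_pairs. q a * n a ?p0 j)"
        by (simp add: n_def w0 sum_distrib_left mult_ac)
      then show ?thesis using q that D by simp
    qed
    then show "\<forall>a\<in>sym_pairs. q a = 0" using lin_indepD[OF wtab_products_independent, of q] by blast
  qed
  have npf: "(\<lambda>p. n a p j) \<in> poly_fun ?J" for a j unfolding n_def by (intro pf_mult wpf)
  have fs: "finite sym_pairs" by (simp add: sym_pairs_def)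
  obtain D1 S1 where D1: "D1 ?p0 \<noteq> 0" and S1: "\<forall>F. \<forall>j. (\<lambda>p. S1 F p j) \<in> poly_fun ?J"
    "\<forall>F p. \<forall>a\<in>sym_pairs. (\<Sum>j\<in>{..<9}. S1 F p j * n a p j) = 0"
    "\<forall>F. (\<forall>a\<in>sym_pairs. (\<Sum>j\<in>{..<9}. F j * n a ?p0 j) = 0) \<longrightarrow> (\<forall>j. S1 F ?p0 j = D1 ?p0 * F j)"
    using poly_section[where m = n and R = sym_pairs and I = "{..<9}" and J = ?J and ?p0.0 = ?p0,
        OF fs _ npf nind] by auto
  define z where "z = (\<lambda>k. S1 (vtab k))"
  have zpf: "(\<lambda>p. z k p j) \<in> poly_fun ?J" for k j unfolding z_def using S1(1) by simp
  have zw: "(\<Sum>j<9. z k p j * (w a p j * w c p j)) = 0" for k p a c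
  proof -
    have z: "(\<Sum>j<9. z k p j * n a p j) = 0" if "a \<in> sym_pairs" for a
      using S1(2) that unfolding z_def by simp
    from sym_pairs[of a c] show ?thesis
    proof
      assume "(a, c) \<in> sym_pairs"
      then show ?thesis using z unfolding n_def by fastforce
    next
      assume "(c, a) \<in> sym_pairs"
      from z[OF this] show ?thesis unfolding n_def by (simp add: mult_ac)
    qed
  qed
  have z0: "z k ?p0 j = D1 ?p0 * vtab k j" for k j
  proof -
    have "(\<Sum>j\<in>{..<9}. vtab k j * n a ?p0 j) = 0" for a
    proof -
      have "(\<Sum>j<9. vtab k j * n a ?p0 j) = D ?p0 * D ?p0 * (\<Sum>j<9. vtab k j * (wtab (fst a) j * wtab (snd a) j))"
        by (simp add: n_def w0 sum_distrib_left mult_ac)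
      then show ?thesis using vtab_relation by simp
    qed
    then show ?thesis using S1(3) unfolding z_def by simp
  qed
  \<comment> \<open>The dual basis b reads off the coefficients of linear forms whose values at the
    points are to be D times the products of w and z.\<close>
  define Lc where "Lc = (\<lambda>p a. if snd (snd a) \<le> 5 then \<Sum>j<9.
      b (snd (snd a)) p j * (w (fst a) p j * z (fst (snd a)) p j) else 0)"
  have Lpf: "(\<lambda>p. Lc p a) \<in> poly_fun ?J" for a
    unfolding Lc_def by (intro pf_if pf_sum pf_mult b wpf zpf pf_const) auto
  \<comment> \<open>The six rows b and the three relations w form a basis of the nine-dimensional
    space at the witness, hence for general p.\<close>
  define M where "M = (\<lambda>x p j. case x of Inl i \<Rightarrow> b i p j | Inr k \<Rightarrow> w k p j)"
  let ?R = "{..5::nat} <+> (UNIV :: 3 set)"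
  have Mpf: "(\<lambda>p. M x p j) \<in> poly_fun ?J" if "x \<in> ?R" for x j
    using that by (auto simp: M_def intro: b wpf)
  have Mind: "lin_indep ?R {..<9} (\<lambda>x. M x ?p0)"
    unfolding lin_indep_def
  proof (intro allI impI)
    fix q assume "\<forall>j\<in>{..<9}. (\<Sum>x\<in>?R. q x * M x ?p0 j) = 0"
    then have q: "(\<Sum>i\<le>5. q (Inl i) * b i ?p0 j) + (\<Sum>k\<in>UNIV. q (Inr k) * w k ?p0 j) = 0" if "j < 9" for j
      using that by (simp add: sum.Plus M_def)
    have qi: "q (Inl i) = 0" if i: "i \<le> 5" for i
    proof -
      have "0 = (\<Sum>j<9. ((\<Sum>i\<le>5. q (Inl i) * b i ?p0 j) + (\<Sum>k\<in>UNIV. q (Inr k) * w k ?p0 j)) * m i ?p0 j)"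
        using q by simp
      also have "\<dots> = (\<Sum>i'\<le>5. q (Inl i') * (\<Sum>j<9. b i' ?p0 j * m i ?p0 j))
          + (\<Sum>k\<in>UNIV. q (Inr k) * (\<Sum>j<9. w k ?p0 j * m i ?p0 j))"
        unfolding distrib_right sum.distrib sum_distrib_right sum_distrib_left
        by (subst (1 2) sum.swap) (simp add: mult_ac)
      also have "\<dots> = (\<Sum>i'\<le>5. q (Inl i') * (if i' = i then D ?p0 else 0))"
        using bm[OF _ i] wm[OF i] by simp
      also have "\<dots> = q (Inl i) * D ?p0" using i by (simp add: if_distrib[of "\<lambda>c. _ * c"] cong: if_cong)
      finally show ?thesis using D by simp
    qed
    then have "\<forall>j<9. (\<Sum>k\<in>UNIV. q (Inr k) * wtab k j) = 0"
    proof (intro allI impI)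
      fix j :: nat assume "j < 9"
      then have "D ?p0 * (\<Sum>k\<in>UNIV. q (Inr k) * wtab k j) = 0"
        using q[of j] qi by (simp add: w0 sum_distrib_left mult_ac)
      then show "(\<Sum>k\<in>UNIV. q (Inr k) * wtab k j) = 0" using D by simp
    qed
    then have "\<forall>k. q (Inr k) = 0" unfolding all_less_9 forall_3 sum_3 by (simp add: wtab_def)
    then show "\<forall>x\<in>?R. q x = 0" using qi by auto
  qed
  obtain h where h: "h \<in> poly_fun ?J" "h ?p0 \<noteq> 0" and hM: "\<forall>p. h p \<noteq> 0 \<longrightarrow> lin_indep ?R {..<9} (\<lambda>x. M x p)"
    using lin_indep_open[where m = M and R = ?R and I = "{..<9}" and J = ?J and ?p0.0 = ?p0, OF _ _ Mpf Mind] by auto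
  \<comment> \<open>The defect Y between the prescribed values and those of the linear form is
    orthogonal to every b by the choice of coefficients and to every w by \<open>zw\<close>; where M
    is a basis it vanishes.\<close>
  have key: "D p * (w a p j * z c p j) - (\<Sum>i\<le>5. Lc p (a, c, i) * m i p j) = 0" if j: "j < 9" for p a c j
  proof (rule pf_dense[where f = "\<lambda>p. D p * (w a p j * z c p j) - (\<Sum>i\<le>5. Lc p (a, c, i) * m i p j)" and I = ?J
      and h = h and ?x0.0 = ?p0])
    show "(\<lambda>p. D p * (w a p j * z c p j) - (\<Sum>i\<le>5. Lc p (a, c, i) * m i p j)) \<in> poly_fun ?J"
      using j by (intro pf_diff pf_mult pf_sum D wpf zpf Lpf mpf) auto
    fix p assume hp: "h p \<noteq> 0"
    define X where "X = (\<lambda>j. w a p j * z c p j)"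
    define Y where "Y = (\<lambda>j. D p * X j - (\<Sum>i\<le>5. (\<Sum>j<9. b i p j * X j) * m i p j))"
    have "Y j = 0"
    proof (rule orthogonal_to_basis[OF hM[rule_format, OF hp]])
      fix x assume x: "x \<in> ?R"
      show "(\<Sum>j\<in>{..<9}. Y j * M x p j) = 0"
      proof (cases x)
        case (Inl i)
        then have i: "i \<in> {..5}" using x by auto
        have "(\<Sum>j\<in>{..<9}. (D p * X j - (\<Sum>r\<in>{..5}. (\<Sum>j\<in>{..<9}. X j * b r p j) * m r p j)) * b i p j) = 0"
          by (rule section_orthogonal[OF _ i]) (use bm i in \<open>auto simp: mult.commute\<close>)
        then show ?thesis unfolding Y_def Inl M_def by (simp add: mult.commute[of "X _"])
      next
        case (Inr k)
        have "(\<Sum>j<9. Y j * w k p j) = D p * (\<Sum>j<9. z c p j * (w a p j * w k p j))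
            - (\<Sum>i\<le>5. (\<Sum>j<9. b i p j * X j) * (\<Sum>j<9. w k p j * m i p j))"
        proof -
          have "(\<Sum>j<9. (\<Sum>i\<le>5. (\<Sum>j<9. b i p j * X j) * m i p j) * w k p j)
              = (\<Sum>i\<le>5. (\<Sum>j<9. b i p j * X j) * (\<Sum>j<9. w k p j * m i p j))"
            unfolding sum_distrib_left[of _ _ "{..<9}"] sum_distrib_right
                by (subst sum.swap) (simp add: mult_ac sum_distrib_left)
          then show ?thesis unfolding Y_def left_diff_distrib sum_subtractf
              by (simp add: X_def sum_distrib_left mult_ac)
        qed
        then show ?thesis using zw wm unfolding Inr M_def by simp
      qed
    qed (use j in \<open>auto simp: card_Plus\<close>)
    then show "D p * (w a p j * z c p j) - (\<Sum>i\<le>5. Lc p (a, c, i) * m i p j) = 0"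
      by (simp add: Y_def X_def Lc_def)
  qed (rule h)+
  have Lval: "lmat (Lc p) (pt p j) a c = D p * (w a p j * z c p j)" if "j < 9" for p j a c
    using key[OF that, of p a c] by (simp add: lmat_def pt_def m_def)
  define \<kappa> where "\<kappa> = D ?p0 * (D ?p0 * D1 ?p0)"
  have L0: "Lc ?p0 (a, c, i) = \<kappa> * hex (a, c, i)" if i: "i \<le> 5" for a c i
  proof -
    have "(\<Sum>i\<le>5. (Lc ?p0 (a, c, i) - \<kappa> * hex (a, c, i)) * cubic_pts (j, i)) = 0" if "j \<in> {..<9}" for j
    proof -
      have "j < 9" using that by simp
      have "(\<Sum>i\<le>5. (Lc ?p0 (a, c, i) - \<kappa> * hex (a, c, i)) * cubic_pts (j, i))
          = lmat (Lc ?p0) (pt ?p0 j) a c - \<kappa> * lmat hex (pt ?p0 j) a c"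
        by (simp add: lmat_def pt_def left_diff_distrib sum_subtractf sum_distrib_left mult.assoc)
      also have "\<dots> = 0"
        unfolding Lval[OF \<open>j < 9\<close>] tab_product[OF \<open>j < 9\<close>] by (simp add: w0 z0 \<kappa>_def mult_ac)
      finally show ?thesis .
    qed
    then have "Lc ?p0 (a, c, i) - \<kappa> * hex (a, c, i) = 0"
      using lin_indepD[OF cubic_pts_independent, of "\<lambda>i. Lc ?p0 (a, c, i) - \<kappa> * hex (a, c, i)" i] i by simp
    then show ?thesis by simp
  qed
  have \<kappa>: "\<kappa> \<noteq> 0" using D D1 by (simp add: \<kappa>_def)
  \<comment> \<open>The six coefficient matrices of L. Projecting \<open>ttab\<close> onto their
    orthogonal complement yields the matrices T, as \<open>wtab\<close> yielded w.\<close>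
  define t where "t = (\<lambda>i p a. Lc p (fst a, snd a, i))"
  have tind: "lin_indep {..5} UNIV (\<lambda>i. t i ?p0)"
    unfolding lin_indep_def
  proof (intro allI impI)
    fix q assume q: "\<forall>a\<in>UNIV. (\<Sum>i\<le>5. q i * t i ?p0 a) = 0"
    have "\<kappa> * (\<Sum>i\<le>5. q i * hex (a, c, i)) = 0" for a c
      using bspec[OF q, of "(a, c)"] by (simp add: t_def L0 sum_distrib_left mult_ac)
    then have e: "(\<Sum>i\<le>5. q i * hex (a, c, i)) = 0" for a c using \<kappa> by simp
    have "\<forall>i\<le>5. q i = 0" unfolding all_le5
      using e[of 1 1] e[of 1 2] e[of 2 2] e[of 2 3] e[of 3 3] e[of 3 1] by (simp add: sum_atMost_5 hex_def)
    then show "\<forall>i\<in>{..5}. q i = 0" by simp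
  qed
  have tpf: "(\<lambda>p. t i p a) \<in> poly_fun ?J" for i a unfolding t_def by (rule Lpf)
  obtain D2 S2 where D2: "D2 ?p0 \<noteq> 0" and S2: "\<forall>F. \<forall>a. (\<lambda>p. S2 F p a) \<in> poly_fun ?J"
    "\<forall>F p. \<forall>i\<in>{..5}. (\<Sum>a\<in>UNIV. S2 F p a * t i p a) = 0"
    "\<forall>F. (\<forall>i\<in>{..5}. (\<Sum>a\<in>UNIV. F a * t i ?p0 a) = 0) \<longrightarrow> (\<forall>a. S2 F ?p0 a = D2 ?p0 * F a)"
    using poly_section[where m = t and R = "{..5}" and I = UNIV and J = ?J and ?p0.0 = ?p0, OF _ _ tpf tind] by auto
  show thesis
  proof (rule that[of Lc "\<lambda>k. S2 (ttab k)" \<kappa> "D2 ?p0"])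
    show "(\<lambda>p. Lc p a) \<in> poly_fun ?J" for a by (rule Lpf)
    show "(\<lambda>p. S2 (ttab k) p a) \<in> poly_fun ?J" for k a using S2(1) by (cases a) simp
    show "\<exists>u w. \<forall>r s. lmat (Lc p) (pt p j) r s = u r * w s" if "j < 9" for p j
      using Lval[OF that] by (intro exI[of _ "\<lambda>a. D p * w a p j"] exI[of _ "\<lambda>c. z c p j"]) simp
    show "(\<Sum>a\<in>UNIV. \<Sum>c\<in>UNIV. S2 (ttab k) p (a, c) * lmat (Lc p) x a c) = 0" for k p x
    proof -
      have "(\<Sum>a\<in>UNIV. \<Sum>c\<in>UNIV. S2 (ttab k) p (a, c) * lmat (Lc p) x a c)
          = (\<Sum>a\<in>UNIV. S2 (ttab k) p a * (\<Sum>i\<le>5. t i p a * x i))"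
        by (simp add: lmat_def t_def sum.cartesian_product case_prod_beta' UNIV_Times_UNIV)
      also have "\<dots> = (\<Sum>i\<le>5. (\<Sum>a\<in>UNIV. S2 (ttab k) p a * t i p a) * x i)"
        unfolding sum_distrib_left sum_distrib_right by (subst sum.swap) (simp add: mult_ac)
      also have "\<dots> = 0" using S2(2) by simp
      finally show ?thesis .
    qed
    show "\<kappa> \<noteq> 0" "D2 ?p0 \<noteq> 0" by (rule \<kappa>, rule D2)
    show "Lc ?p0 (a, c, i) = \<kappa> * hex (a, c, i)" if "i \<le> 5" for a c i using L0[OF that] .
    show "S2 (ttab k) ?p0 a = D2 ?p0 * ttab k a" for k a
    proof -
      have "\<forall>k. \<forall>i\<le>5. (\<Sum>a\<in>UNIV. \<Sum>c\<in>UNIV. ttab k (a, c) * hex (a, c, i)) = 0"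
        unfolding forall_3 sum_3 all_le5 by (simp add: ttab_def hex_def)
      then have "(\<Sum>a\<in>UNIV. ttab k a * t i ?p0 a) = 0" if "i \<le> 5" for i
      proof -
        have "(\<Sum>a\<in>UNIV. ttab k a * t i ?p0 a) = \<kappa> * (\<Sum>a\<in>UNIV. \<Sum>c\<in>UNIV. ttab k (a, c) * hex (a, c, i))"
          using that by (simp add: t_def L0 sum.cartesian_product case_prod_beta' UNIV_Times_UNIV
              sum_distrib_left mult_ac)
        then show ?thesis using \<open>\<forall>k. \<forall>i\<le>5. _ k i = 0\<close> that by simp
      qed
      then show ?thesis using S2(3) by (cases a) simp
    qed
  qed
qed

subsection \<open>The ideal of 2 by 2 minors\<close>

definition nx :: "3 \<Rightarrow> 3" where
  "nx r = (if r = 1 then 2 else if r = 2 then 3 else 1)"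

lemma nx [simp]: "nx 1 = 2" "nx 2 = 3" "nx 3 = 1"
  by (simp_all add: nx_def)

text \<open>Advancing the indices cyclically builds the checkerboard sign into the formula.\<close>

definition cof :: "3 \<Rightarrow> 3 \<Rightarrow> mat3 \<Rightarrow> complex" where
  "cof r s m = m (nx r) (nx s) * m (nx (nx r)) (nx (nx s)) - m (nx r) (nx (nx s)) * m (nx (nx r)) (nx s)"

definition minor2 :: "mat3 \<Rightarrow> 3 \<Rightarrow> 3 \<Rightarrow> 3 \<Rightarrow> 3 \<Rightarrow> complex" where
  "minor2 m e g c a = m e c * m g a - m g c * m e a"

text \<open>Two distinct indices out of three are in cyclic or reversed order and leave out one
  index: \<open>sg\<close> is the sign of the pair, zero for equal indices, and \<open>th\<close>
  the index left out.\<close>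

lemma minor2_eq_cof: "\<exists>k r s. \<forall>m. minor2 m e g c a = k * cof r s m"
proof -
  define sg :: "3 \<Rightarrow> 3 \<Rightarrow> complex" where "sg = (\<lambda>e g. if e = g then 0 else if g = nx e then 1 else - 1)"
  define th where "th = (\<lambda>e g. if g = nx e then nx g else nx e)"
  have "\<forall>e g c a m. minor2 m e g c a = (sg e g * sg c a) * cof (th e g) (th c a) m"
    unfolding forall_3 by (simp add: minor2_def cof_def sg_def th_def)
  then have "\<forall>m. minor2 m e g c a = (sg e g * sg c a) * cof (th e g) (th c a) m" by simp
  then show ?thesis by (intro exI)
qed

lemma cof_expansion:
  "(\<Sum>s\<in>UNIV. cof r s m * m t s) = (if r = t then det3 m else 0)"
  "(\<Sum>r\<in>UNIV. cof r s m * m r t) = (if s = t then det3 m else 0)"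
proof -
  have "\<forall>r t. (\<Sum>s\<in>UNIV. cof r s m * m t s) = (if r = t then det3 m else 0)"
    unfolding forall_3 sum_3 cof_def det3_def by (simp add: algebra_simps)
  then show "(\<Sum>s\<in>UNIV. cof r s m * m t s) = (if r = t then det3 m else 0)" by blast
  have "\<forall>s t. (\<Sum>r\<in>UNIV. cof r s m * m r t) = (if s = t then det3 m else 0)"
    unfolding forall_3 sum_3 cof_def det3_def by (simp add: algebra_simps)
  then show "(\<Sum>r\<in>UNIV. cof r s m * m r t) = (if s = t then det3 m else 0)" by blast
qed

lemma dd_lmat:
  assumes "\<And>a. (\<lambda>p. c p a) \<in> poly_fun J"
  shows "dd (\<lambda>p. lmat (c p) x r s) p w = lmat (\<lambda>a. dd (\<lambda>p. c p a) p w) x r s"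
  unfolding lmat_def
  by (subst dd_sum[where I = J]) (auto intro!: pf_mult assms pf_const sum.cong simp: dd_mult[OF assms pf_const])

lemma pf_lmat_param:
  assumes "\<And>a. (\<lambda>p. c p a) \<in> poly_fun J"
  shows "(\<lambda>p. lmat (c p) x r s) \<in> poly_fun J"
  unfolding lmat_def by (intro pf_sum pf_mult assms pf_const)

lemma dd_det3_cof:
  assumes "\<And>r s. (\<lambda>p. m p r s) \<in> poly_fun J"
  shows "dd (\<lambda>p. det3 (m p)) p h = (\<Sum>r\<in>UNIV. \<Sum>s\<in>UNIV. dd (\<lambda>p. m p r s) p h * cof r s (m p))"
  unfolding dd_det3[of m J, OF assms] sum_3 cof_def by (simp add: mult_ac)

lemma pf_det3:
  assumes "\<And>r s. (\<lambda>p. m p r s) \<in> poly_fun J"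
  shows "(\<lambda>p. det3 (m p)) \<in> poly_fun J"
  unfolding det3_def by (intro pf_add pf_diff pf_mult assms)

section \<open>Traces of commutators\<close>

definition comm :: "mat3 \<Rightarrow> mat3 \<Rightarrow> mat3" where
  "comm B C b a = (\<Sum>c\<in>UNIV. B b c * C c a - C b c * B c a)"

lemma trilin_comm: "trilin A B C = (\<Sum>a\<in>UNIV. \<Sum>b\<in>UNIV. A a b * comm B C b a)"
  by (simp add: trilin_def comm_def sum_distrib_left)

lemma trilin_cyclic: "trilin A B C = trilin B C A"
  unfolding trilin_def sum_3 by (simp add: algebra_simps)

lemma pf_trilin:
  assumes "\<And>r s. (\<lambda>p. A p r s) \<in> poly_fun J" "\<And>r s. (\<lambda>p. B p r s) \<in> poly_fun J" "\<And>r s. (\<lambda>p. C p r s) \<in> poly_fun J"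
  shows "(\<lambda>p. trilin (A p) (B p) (C p)) \<in> poly_fun J"
  unfolding trilin_def by (intro pf_sum pf_diff pf_mult assms)

text \<open>Cyclic invariance of the trace brings each argument to the front, so its derivative is
  paired with the commutator of the other two.\<close>

lemma dd_trilin:
  assumes A: "\<And>r s. (\<lambda>p. A p r s) \<in> poly_fun J" and B: "\<And>r s. (\<lambda>p. B p r s) \<in> poly_fun J"
    and C: "\<And>r s. (\<lambda>p. C p r s) \<in> poly_fun J"
  shows "dd (\<lambda>p. trilin (A p) (B p) (C p)) p h =
      (\<Sum>a\<in>UNIV. \<Sum>b\<in>UNIV. dd (\<lambda>p. A p a b) p h * comm (B p) (C p) b a)
    + (\<Sum>a\<in>UNIV. \<Sum>b\<in>UNIV. dd (\<lambda>p. B p a b) p h * comm (C p) (A p) b a)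
    + (\<Sum>a\<in>UNIV. \<Sum>b\<in>UNIV. dd (\<lambda>p. C p a b) p h * comm (A p) (B p) b a)"
proof -
  let ?A = "\<lambda>r s. dd (\<lambda>p. A p r s) p h" and ?B = "\<lambda>r s. dd (\<lambda>p. B p r s) p h" and ?C = "\<lambda>r s. dd (\<lambda>p. C p r s) p h"
  have "dd (\<lambda>p. trilin (A p) (B p) (C p)) p h
      = (\<Sum>a\<in>UNIV. \<Sum>b\<in>UNIV. \<Sum>c\<in>UNIV. dd (\<lambda>p. A p a b * (B p b c * C p c a - C p b c * B p c a)) p h)"
    unfolding trilin_def
    by (subst dd_sum[where I = J], intro pf_sum pf_diff pf_mult A B C, intro sum.cong refl)
      (subst dd_sum[where I = J], intro pf_sum pf_diff pf_mult A B C, intro sum.cong refl,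
        rule dd_sum[where I = J], intro pf_diff pf_mult A B C)
  also have "\<dots> = trilin ?A (B p) (C p) + trilin (A p) ?B (C p) + trilin (A p) (B p) ?C"
    unfolding trilin_def sum.distrib[symmetric]
  proof (intro sum.cong refl)
    fix a b c
    show "dd (\<lambda>p. A p a b * (B p b c * C p c a - C p b c * B p c a)) p h =
        ?A a b * (B p b c * C p c a - C p b c * B p c a) + A p a b * (?B b c * C p c a - C p b c * ?B c a)
        + A p a b * (B p b c * ?C c a - ?C b c * B p c a)"
      by (subst dd_mult[where I = J], rule A, intro pf_diff pf_mult B C, subst dd_diff[where I = J],
          (intro pf_mult B C)+, simp add: dd_mult[OF B C] dd_mult[OF C B] algebra_simps)
  qed
  also have "\<dots> = trilin ?A (B p) (C p) + trilin ?B (C p) (A p) + trilin ?C (A p) (B p)"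
    by (metis trilin_cyclic)
  finally show ?thesis unfolding trilin_comm .
qed

text \<open>The coefficients of the matrix of linear forms T^T L.\<close>

definition contract :: "(3 \<times> 3 \<Rightarrow> complex) \<Rightarrow> (3 \<times> 3 \<times> nat \<Rightarrow> complex) \<Rightarrow> 3 \<times> 3 \<times> nat \<Rightarrow> complex" where
  "contract T L a = (\<Sum>e\<in>UNIV. T (e, fst a) * L (e, snd a))"

lemma lmat_contract: "lmat (contract T L) x a c = (\<Sum>e\<in>UNIV. T (e, a) * lmat L x e c)"
  unfolding lmat_def contract_def sum_distrib_left sum_distrib_right
  by (subst sum.swap) (simp add: mult.assoc)

text \<open>Subtracting multiples of the two vanishing pairings turns products of entries into minors.\<close>

lemma comm_minors:
  fixes X :: mat3
  assumes "(\<Sum>a\<in>UNIV. \<Sum>c\<in>UNIV. T (a, c) * X a c) = 0" "(\<Sum>a\<in>UNIV. \<Sum>c\<in>UNIV. U (a, c) * X a c) = 0"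
  shows "comm (\<lambda>a c. \<Sum>e\<in>UNIV. T (e, a) * X e c) (\<lambda>a c. \<Sum>e\<in>UNIV. U (e, a) * X e c) b a =
    (\<Sum>e\<in>UNIV. \<Sum>g\<in>UNIV. \<Sum>c\<in>UNIV. (T (e, b) * U (g, c) - U (e, b) * T (g, c)) * minor2 X e g c a)"
proof -
  have "(\<Sum>e\<in>UNIV. \<Sum>g\<in>UNIV. \<Sum>c\<in>UNIV. (T (e, b) * U (g, c) - U (e, b) * T (g, c)) * minor2 X e g c a)
     = (\<Sum>e\<in>UNIV. \<Sum>g\<in>UNIV. \<Sum>c\<in>UNIV. (T (e, b) * U (g, c) - U (e, b) * T (g, c)) * (X e c * X g a))
      - (\<Sum>e\<in>UNIV. T (e, b) * X e a) * (\<Sum>a\<in>UNIV. \<Sum>c\<in>UNIV. U (a, c) * X a c)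
      + (\<Sum>e\<in>UNIV. U (e, b) * X e a) * (\<Sum>a\<in>UNIV. \<Sum>c\<in>UNIV. T (a, c) * X a c)"
    unfolding sum_3 minor2_def by (simp add: algebra_simps)
  also have "\<dots> = (\<Sum>e\<in>UNIV. \<Sum>g\<in>UNIV. \<Sum>c\<in>UNIV. (T (e, b) * U (g, c) - U (e, b) * T (g, c)) * (X e c * X g a))"
    unfolding assms by simp
  also have "\<dots> = comm (\<lambda>a c. \<Sum>e\<in>UNIV. T (e, a) * X e c) (\<lambda>a c. \<Sum>e\<in>UNIV. U (e, a) * X e c) b a"
    unfolding sum_3 comm_def by (simp add: algebra_simps)
  finally show ?thesis ..
qed

text \<open>The entries of the commutator are combinations of 2 by 2 minors of L, so they vanish
  where L has rank one. This is what makes F_2 singular at the nine points.\<close>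

lemma comm_rank_one:
  assumes "(\<Sum>a\<in>UNIV. \<Sum>c\<in>UNIV. T (a, c) * lmat L x a c) = 0" "(\<Sum>a\<in>UNIV. \<Sum>c\<in>UNIV. U (a, c) * lmat L x a c) = 0"
    and "\<And>r s. lmat L x r s = u r * w s"
  shows "comm (lmat (contract T L) x) (lmat (contract U L) x) b a = 0"
proof -
  have "minor2 (lmat L x) e g c a = 0" for e g c a by (simp add: minor2_def assms(3))
  then show ?thesis unfolding lmat_contract[abs_def] comm_minors[OF assms(1,2)] by simp
qed

lemma sing_trilin:
  assumes "\<And>x. form_eval 5 3 F x = trilin (lmat A x) (lmat B x) (lmat C x)"
    and "\<And>b a. comm (lmat B x) (lmat C x) b a = 0" "\<And>b a. comm (lmat C x) (lmat A x) b a = 0"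
      "\<And>b a. comm (lmat A x) (lmat B x) b a = 0"
  shows "sing 5 3 F x"
proof -
  have "form_eval 5 3 F = (\<lambda>x. trilin (lmat A x) (lmat B x) (lmat C x))" using assms(1) by auto
  then show ?thesis unfolding sing_def pd_def
    by (simp add: dd_trilin[of "lmat A" "{..5}" "lmat B" "lmat C", OF pf_lmat pf_lmat pf_lmat] assms(2-4))
qed

lemma Pf_trilin:
  assumes "\<And>r s. Pf J n 1 (\<lambda>p x. A p x r s)" "\<And>r s. Pf J n 1 (\<lambda>p x. B p x r s)" "\<And>r s. Pf J n 1 (\<lambda>p x. C p x r s)"
  shows "Pf J n 3 (\<lambda>p x. trilin (A p x) (B p x) (C p x))"
proof -
  have "Pf J n 3 (\<lambda>p x. \<Sum>a\<in>UNIV. \<Sum>b\<in>UNIV. \<Sum>c\<in>UNIV.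
      A p x a b * B p x b c * C p x c a - A p x a b * C p x b c * B p x c a)"
    by (intro Pf_sum Pf_diff Pf_mult3 assms finite)
  then show ?thesis by (simp add: trilin_def right_diff_distrib mult.assoc)
qed

abbreviation triples :: "(3 \<times> 3 \<times> nat) set" where
  "triples \<equiv> UNIV \<times> UNIV \<times> {..5}"

lemma sum_triples: "(\<Sum>\<alpha>\<in>triples. f \<alpha>) = (\<Sum>r\<in>UNIV. \<Sum>s\<in>UNIV. \<Sum>i\<le>5. f (r, s, i))"
  by (simp add: sum.cartesian_product case_prod_beta')

definition minor_gen :: "(3 \<times> 3 \<times> nat \<Rightarrow> complex) \<Rightarrow> (nat \<Rightarrow> complex) \<Rightarrow> 3 \<times> 3 \<times> nat \<Rightarrow> complex" where
  "minor_gen L x = (\<lambda>(r, s, i). cof r s (lmat L x) * x i)"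

text \<open>The cubic part of the ideal of 2 by 2 minors: the minors are quadratic, so it is spanned
  by the 54 products of a cofactor and a variable.\<close>

definition in_minors :: "(3 \<times> 3 \<times> nat \<Rightarrow> complex) \<Rightarrow> ((nat \<Rightarrow> complex) \<Rightarrow> complex) \<Rightarrow> bool" where
  "in_minors L g \<longleftrightarrow> (\<exists>c. \<forall>x. g x = (\<Sum>\<alpha>\<in>triples. c \<alpha> * minor_gen L x \<alpha>))"

lemma in_minorsI: "(\<And>x. g x = (\<Sum>\<alpha>\<in>triples. c \<alpha> * minor_gen L x \<alpha>)) \<Longrightarrow> in_minors L g"
  unfolding in_minors_def by (rule exI[of _ c]) simp

lemma in_minors_add:
  assumes "in_minors L g" "in_minors L h"
  shows "in_minors L (\<lambda>x. g x + h x)"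
proof -
  obtain c where c: "\<forall>x. g x = (\<Sum>\<alpha>\<in>triples. c \<alpha> * minor_gen L x \<alpha>)" using assms(1) unfolding in_minors_def ..
  obtain d where d: "\<forall>x. h x = (\<Sum>\<alpha>\<in>triples. d \<alpha> * minor_gen L x \<alpha>)" using assms(2) unfolding in_minors_def ..
  show ?thesis
    by (rule in_minorsI[of _ "\<lambda>\<alpha>. c \<alpha> + d \<alpha>"]) (simp add: c d distrib_right sum.distrib)
qed

lemma in_minors_cmult:
  assumes "in_minors L g"
  shows "in_minors L (\<lambda>x. k * g x)"
proof -
  obtain c where c: "\<forall>x. g x = (\<Sum>\<alpha>\<in>triples. c \<alpha> * minor_gen L x \<alpha>)" using assms(1) unfolding in_minors_def ..
  show ?thesis
    by (rule in_minorsI[of _ "\<lambda>\<alpha>. k * c \<alpha>"]) (simp add: c sum_distrib_left mult.assoc)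
qed

lemma in_minors_sum: "(\<And>a. a \<in> A \<Longrightarrow> in_minors L (g a)) \<Longrightarrow> in_minors L (\<lambda>x. \<Sum>a\<in>A. g a x)"
proof (induction A rule: infinite_finite_induct)
  case (insert a A)
  have "in_minors L (\<lambda>x. g a x + (\<Sum>a\<in>A. g a x))"
    by (rule in_minors_add) (use insert in auto)
  then show ?case using insert.hyps by simp
qed (auto intro: in_minorsI[of _ "\<lambda>_. 0"])

lemma sum_single: "(\<Sum>r'\<in>UNIV. \<Sum>s'\<in>UNIV. if r' = r \<and> s' = s then h r' s' else 0) = (h r s :: complex)" for r s :: 3
  using exhaust_3[of r] exhaust_3[of s] by (auto simp: sum_3)

lemma in_minors_cof: "in_minors L (\<lambda>x. lmat B x a b * cof r s (lmat L x))"
proof (rule in_minorsI[of _ "\<lambda>(r', s', i). if r' = r \<and> s' = s then B (a, b, i) else 0"])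
  fix x
  have "(\<Sum>\<alpha>\<in>triples. (case \<alpha> of (r', s', i) \<Rightarrow> if r' = r \<and> s' = s then B (a, b, i) else 0) * minor_gen L x \<alpha>)
     = (\<Sum>r'\<in>UNIV. \<Sum>s'\<in>UNIV. if r' = r \<and> s' = s then lmat B x a b * cof r' s' (lmat L x) else 0)"
    unfolding sum_triples
  proof (intro sum.cong refl)
    fix r' s'
    show "(\<Sum>i\<le>5. (case (r', s', i) of (r', s', i) \<Rightarrow> if r' = r \<and> s'
        = s then B (a, b, i) else 0) * minor_gen L x (r', s', i))
        = (if r' = r \<and> s' = s then lmat B x a b * cof r' s' (lmat L x) else 0)"
      by (cases "r' = r \<and> s' = s") (auto simp: minor_gen_def lmat_def[of B] sum_distrib_left mult_ac)
  qed
  then show "lmat B x a b * cof r s (lmat L x)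
      = (\<Sum>\<alpha>\<in>triples. (case \<alpha> of (r', s', i) \<Rightarrow> if r' = r \<and> s' = s then B (a, b, i) else 0) * minor_gen L x \<alpha>)"
    by (simp add: sum_single)
qed

lemma in_minors_minor2: "in_minors L (\<lambda>x. lmat B x r s * minor2 (lmat L x) e g c a)"
proof -
  obtain k r' s' where m: "\<forall>m. minor2 m e g c a = k * cof r' s' m" using minor2_eq_cof[of e g c a] by (elim exE)
  have "in_minors L (\<lambda>x. k * (lmat B x r s * cof r' s' (lmat L x)))"
    by (intro in_minors_cmult in_minors_cof)
  then show ?thesis by (simp add: m mult_ac)
qed

lemma in_minors_det_deriv: "in_minors L (\<lambda>x. \<Sum>r\<in>UNIV. \<Sum>s\<in>UNIV. lmat B x r s * cof r s (lmat L x))"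
  by (intro in_minors_sum in_minors_cof)

lemma in_minors_det: "in_minors L (\<lambda>x. det3 (lmat L x))"
proof -
  have "in_minors L (\<lambda>x. \<Sum>s\<in>UNIV. lmat L x 1 s * cof 1 s (lmat L x))"
    by (intro in_minors_sum in_minors_cof)
  moreover have "(\<Sum>s\<in>UNIV. lmat L x 1 s * cof 1 s (lmat L x)) = det3 (lmat L x)" for x
    using cof_expansion(1)[of 1 "lmat L x" 1] by (simp add: mult.commute)
  ultimately show ?thesis by simp
qed

text \<open>Vanishing pairings rewrite the commutator in terms of minors with constant coefficients,
  and the entry of B supplies the linear factor.\<close>

lemma in_minors_comm:
  assumes "\<And>x. (\<Sum>a\<in>UNIV. \<Sum>c\<in>UNIV. T (a, c) * lmat L x a c) = 0"
    and "\<And>x. (\<Sum>a\<in>UNIV. \<Sum>c\<in>UNIV. U (a, c) * lmat L x a c) = 0"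
  shows "in_minors L (\<lambda>x. \<Sum>a\<in>UNIV. \<Sum>b\<in>UNIV. lmat B x a b * comm (lmat (contract T L) x) (lmat (contract U L) x) b a)"
proof (intro in_minors_sum)
  fix a b :: 3
  have "in_minors L (\<lambda>x. \<Sum>e\<in>UNIV. \<Sum>g\<in>UNIV. \<Sum>c\<in>UNIV. (T (e, b) * U (g, c) - U (e, b) * T (g, c)) *
      (lmat B x a b * minor2 (lmat L x) e g c a))"
    by (intro in_minors_sum in_minors_cmult in_minors_minor2)
  moreover have "comm (lmat (contract T L) x) (lmat (contract U L) x) b a =
      (\<Sum>e\<in>UNIV. \<Sum>g\<in>UNIV. \<Sum>c\<in>UNIV. (T (e, b) * U (g, c) - U (e, b) * T (g, c)) * minor2 (lmat L x) e g c a)" for x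
    unfolding lmat_contract[abs_def] by (rule comm_minors[OF assms])
  ultimately show "in_minors L (\<lambda>x. lmat B x a b * comm (lmat (contract T L) x) (lmat (contract U L) x) b a)"
    by (simp add: sum_distrib_left mult.left_commute)
qed

text \<open>Laplace expansion yields 18 vectors of linear relations between the 54 products of a cofactor and a
  coordinate, up to multiples of the determinant, which are recorded in the coordinate \<open>Inr True\<close>. The only
  dependence among the 18 vectors comes from expanding along all rows and along all columns; the
  coordinate \<open>Inr False\<close> removes it. So the products span a space of dimension at most 54 - 16 = 38.\<close>

fun syz :: "(3 \<times> 3 \<times> nat \<Rightarrow> complex) \<Rightarrow> (3 \<times> 3) + (3 \<times> 3) \<Rightarrow> (3 \<times> 3 \<times> nat) + bool \<Rightarrow> complex" where
  "syz L (Inl (a, b)) (Inl (r, s, i)) = (if r = a then L (b, s, i) else 0)"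
| "syz L (Inr (a, b)) (Inl (r, s, i)) = (if s = b then L (r, a, i) else 0)"
| "syz L (Inl (a, b)) (Inr t) = (if t \<and> a = b then 1 else 0)"
| "syz L (Inr (a, b)) (Inr t) = (if a = b \<and> (t \<or> a = 3) then 1 else 0)"

lemma syz_minor_gen: "(\<Sum>\<alpha>\<in>triples. syz L y (Inl \<alpha>) * minor_gen L x \<alpha>) = syz L y (Inr True) * det3 (lmat L x)"
proof (cases y)
  case (Inl z)
  obtain a b where z: "z = (a, b)" by (cases z)
  have "(\<Sum>i\<le>5. syz L y (Inl (r, s, i)) * minor_gen L x (r, s, i))
      = (if r = a then cof r s (lmat L x) * lmat L x b s else 0)" for r s
    by (simp add: Inl z minor_gen_def lmat_def[of L x b] sum_distrib_left mult_ac)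
  then have "(\<Sum>\<alpha>\<in>triples. syz L y (Inl \<alpha>) * minor_gen L x \<alpha>)
      = (\<Sum>r\<in>UNIV. if r = a then \<Sum>s\<in>UNIV. cof r s (lmat L x) * lmat L x b s else 0)"
    unfolding sum_triples by (intro sum.cong) auto
  then show ?thesis by (simp add: Inl z cof_expansion)
next
  case (Inr z)
  obtain a b where z: "z = (a, b)" by (cases z)
  have "(\<Sum>i\<le>5. syz L y (Inl (r, s, i)) * minor_gen L x (r, s, i))
      = (if s = b then cof r s (lmat L x) * lmat L x r a else 0)" for r s
    by (simp add: Inr z minor_gen_def lmat_def[of L x r a] sum_distrib_left mult_ac)
  then have "(\<Sum>\<alpha>\<in>triples. syz L y (Inl \<alpha>) * minor_gen L x \<alpha>) = (\<Sum>r\<in>UNIV. cof r b (lmat L x) * lmat L x r a)"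
    unfolding sum_triples by simp
  then show ?thesis by (simp add: Inr z cof_expansion)
qed

text \<open>The 39 coefficient vectors and the 18 vectors \<open>syz\<close> are 57 vectors with 54
  + 2 coordinates, hence dependent. As the 18 are independent, some g j occurs; the vectors
  \<open>syz\<close> contribute a multiple of the determinant, which the coordinate
  \<open>Inr True\<close> forces to be zero.\<close>

lemma minors_dim:
  assumes ind: "lin_indep UNIV (triples <+> UNIV) (syz L)" and S: "finite S" "card S = 39"
    and g: "\<And>j. j \<in> S \<Longrightarrow> in_minors L (g j)"
  shows "\<exists>q. (\<exists>j\<in>S. q j \<noteq> 0) \<and> (\<forall>x. (\<Sum>j\<in>S. q j * g j x) = 0)"
proof -
  have "\<forall>j\<in>S. \<exists>c. \<forall>x. g j x = (\<Sum>\<alpha>\<in>triples. c \<alpha> * minor_gen L x \<alpha>)" using g unfolding in_minors_def by (rule ballI)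
  then obtain c where c: "\<forall>j\<in>S. \<forall>x. g j x = (\<Sum>\<alpha>\<in>triples. c j \<alpha> * minor_gen L x \<alpha>)" by (rule bchoice[THEN exE])
  define M where "M = (\<lambda>y b. case y of Inl j \<Rightarrow> (case b of Inl \<alpha> \<Rightarrow> c j \<alpha> | Inr t \<Rightarrow> 0) | Inr z \<Rightarrow> syz L z b)"
  let ?A = "S <+> (UNIV :: ((3 \<times> 3) + (3 \<times> 3)) set)" and ?B = "triples <+> (UNIV :: bool set)"
  have card_U: "card (UNIV :: ((3 \<times> 3) + (3 \<times> 3)) set) = 18"
    by (subst card_UNIV_sum) (simp_all add: card_cartesian_product flip: UNIV_Times_UNIV)
  have "\<exists>q. (\<exists>a\<in>?A. q a \<noteq> 0) \<and> (\<forall>b\<in>?B. (\<Sum>a\<in>?A. q a * M a b) = 0)"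
    by (rule homogeneous_system) (simp_all add: S card_Plus card_cartesian_product card_U)
  then obtain q where q0: "\<exists>a\<in>?A. q a \<noteq> 0" and q: "\<forall>b\<in>?B. (\<Sum>a\<in>?A. q a * M a b) = 0" by (elim exE conjE)
  have e1: "(\<Sum>j\<in>S. q (Inl j) * c j \<alpha>) = - (\<Sum>z\<in>UNIV. q (Inr z) * syz L z (Inl \<alpha>))" if "\<alpha> \<in> triples" for \<alpha>
    using bspec[OF q InlI[OF that]] by (simp add: sum.Plus[OF S(1)] M_def eq_neg_iff_add_eq_0)
  have e2: "(\<Sum>z\<in>UNIV. q (Inr z) * syz L z (Inr t)) = 0" for t
    using bspec[OF q InrI[OF UNIV_I[of t]]] by (simp add: sum.Plus[OF S(1)] M_def)
  have "\<exists>j\<in>S. q (Inl j) \<noteq> 0"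
  proof (rule ccontr)
    assume n: "\<not> ?thesis"
    have "(\<Sum>z\<in>UNIV. q (Inr z) * syz L z b) = 0" if "b \<in> ?B" for b
    proof (cases b)
      case (Inl \<alpha>)
      then have "\<alpha> \<in> triples" using that by auto
      then show ?thesis using e1[of \<alpha>] n unfolding Inl by simp
    qed (simp add: e2)
    then have "q (Inr z) = 0" for z
      using lin_indepD[OF ind, of "\<lambda>z. q (Inr z)" z] by simp
    then show False using q0 n by auto
  qed
  moreover have "(\<Sum>j\<in>S. q (Inl j) * g j x) = 0" for x
  proof -
    have "(\<Sum>j\<in>S. q (Inl j) * g j x) = (\<Sum>j\<in>S. \<Sum>\<alpha>\<in>triples. q (Inl j) * c j \<alpha> * minor_gen L x \<alpha>)"
      using c by (intro sum.cong refl) (simp add: sum_distrib_left mult.assoc)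
    also have "\<dots> = (\<Sum>\<alpha>\<in>triples. (\<Sum>j\<in>S. q (Inl j) * c j \<alpha>) * minor_gen L x \<alpha>)"
      by (subst sum.swap) (simp add: sum_distrib_right)
    also have "\<dots> = (\<Sum>\<alpha>\<in>triples. - (\<Sum>z\<in>UNIV. q (Inr z) * (syz L z (Inl \<alpha>) * minor_gen L x \<alpha>)))"
      by (intro sum.cong refl) (simp add: e1 sum_distrib_right mult.assoc del: mem_Sigma_iff)
    also have "\<dots> = - (\<Sum>z\<in>UNIV. q (Inr z) * (\<Sum>\<alpha>\<in>triples. syz L z (Inl \<alpha>) * minor_gen L x \<alpha>))"
      unfolding sum_negf sum_distrib_left[of "q _"] by (subst sum.swap) (rule refl)
    also have "\<dots> = - ((\<Sum>z\<in>UNIV. q (Inr z) * syz L z (Inr True)) * det3 (lmat L x))"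
      unfolding syz_minor_gen sum_distrib_right by (simp add: mult.assoc)
    finally show ?thesis by (simp add: e2)
  qed
  ultimately show ?thesis by (intro exI[of _ "\<lambda>j. q (Inl j)"]) blast
qed

text \<open>For \<open>hex\<close> the equations separate: off-diagonal unknowns vanish, and each
  non-zero entry makes a diagonal row unknown the negative of a diagonal column unknown. The six
  entries link all rows and columns, so one value determines the rest, and the coordinate
  \<open>Inr False\<close> sets that value to zero.\<close>

lemma syz_hex:
  assumes "\<kappa> \<noteq> 0" "\<And>a c i. i \<le> 5 \<Longrightarrow> L (a, c, i) = \<kappa> * hex (a, c, i)"
  shows "lin_indep UNIV (triples <+> UNIV) (syz L)"
  unfolding lin_indep_def
proof (intro allI impI)
  fix q :: "(3 \<times> 3) + (3 \<times> 3) \<Rightarrow> complex"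
  assume q: "\<forall>i\<in>triples <+> UNIV. (\<Sum>r\<in>UNIV. q r * syz L r i) = 0"
  define P Q where "P = (\<lambda>a b. q (Inl (a, b)))" and "Q = (\<lambda>a b. q (Inr (a, b)))"
  have sm: "(\<Sum>y\<in>UNIV. q y * syz L y i) = (\<Sum>a\<in>UNIV. \<Sum>b\<in>UNIV. P a b * syz L (Inl (a, b)) i)
      + (\<Sum>a\<in>UNIV. \<Sum>b\<in>UNIV. Q a b * syz L (Inr (a, b)) i)" for i
    by (simp add: P_def Q_def sum.Plus UNIV_Plus_UNIV[symmetric] sum.cartesian_product case_prod_beta'
        UNIV_Times_UNIV del: UNIV_Plus_UNIV)
  have e: "(\<Sum>b\<in>UNIV. P r b * hex (b, s, i)) + (\<Sum>a\<in>UNIV. Q a s * hex (r, a, i)) = 0" if i: "i \<le> 5" for r s i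
  proof -
    have "0 = (\<Sum>a\<in>UNIV. \<Sum>b\<in>UNIV. P a b * syz L (Inl (a, b)) (Inl (r, s, i)))
      + (\<Sum>a\<in>UNIV. \<Sum>b\<in>UNIV. Q a b * syz L (Inr (a, b)) (Inl (r, s, i)))"
      using bspec[OF q InlI[of "(r, s, i)"]] i unfolding sm by simp
    also have "(\<Sum>a\<in>UNIV. \<Sum>b\<in>UNIV. P a b * syz L (Inl (a, b)) (Inl (r, s, i))) = \<kappa> * (\<Sum>b\<in>UNIV. P r b * hex (b, s, i))"
      using i exhaust_3[of r] unfolding sum_3 by (auto simp: assms(2) algebra_simps)
    also have "(\<Sum>a\<in>UNIV. \<Sum>b\<in>UNIV. Q a b * syz L (Inr (a, b)) (Inl (r, s, i))) = \<kappa> * (\<Sum>a\<in>UNIV. Q a s * hex (r, a, i))"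
      using i exhaust_3[of s] unfolding sum_3 by (auto simp: assms(2) algebra_simps)
    finally have "\<kappa> * ((\<Sum>b\<in>UNIV. P r b * hex (b, s, i)) + (\<Sum>a\<in>UNIV. Q a s * hex (r, a, i))) = 0"
      by (simp add: distrib_left)
    then show ?thesis using assms(1) by simp
  qed
  have h: "(if s = s0 then P r b else 0) + (if r = b then Q s0 s else 0) = 0"
    if "(b, s0) \<in> {(1, 1), (1, 2), (2, 2), (2, 3), (3, 3), (3, 1)}" for r s b s0
  proof -
    have "\<exists>i\<le>5. \<forall>b' s'. hex (b', s', i) = (if b' = b \<and> s' = s0 then 1 else 0)"
      using that
      apply (elim insertE emptyE)
      apply (intro exI[of _ 0]; auto simp: hex_def)
      apply (intro exI[of _ 1]; auto simp: hex_def)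
      apply (intro exI[of _ 2]; auto simp: hex_def)
      apply (intro exI[of _ 3]; auto simp: hex_def)
      apply (intro exI[of _ 4]; auto simp: hex_def)
      apply (intro exI[of _ 5]; auto simp: hex_def)
      done
    then obtain i where "i \<le> 5" "\<forall>b' s'. hex (b', s', i) = (if b' = b \<and> s' = s0 then 1 else 0)" by (elim exE conjE)
    then show ?thesis
      using e[of i r s] exhaust_3[of b] exhaust_3[of s0] by (auto simp: sum_3)
  qed
  have offP: "P r b = 0" if "r \<noteq> b" for r b
    using h[of b b b r] exhaust_3[of b] that by auto
  have offQ: "Q s0 s = 0" if "s \<noteq> s0" for s s0
    using h[of s0 s0 s s0] exhaust_3[of s0] that by auto
  have d: "P b b + Q s0 s0 = 0" if "(b, s0) \<in> {(1, 1), (1, 2), (2, 2), (2, 3), (3, 3), (3, 1)}" for b s0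
    using h[OF that, of s0 b] by simp
  have q3: "Q 3 3 = 0"
    using bspec[OF q InrI[OF UNIV_I[of False]]] unfolding sm by (simp add: sum_3)
  have d3: "P 2 2 = 0" "P 3 3 = 0" using d[of 2 3] d[of 3 3] q3 by simp_all
  then have d2: "Q 1 1 = 0" "Q 2 2 = 0" using d[of 3 1] d[of 2 2] by simp_all
  then have "P 1 1 = 0" using d[of 1 1] by simp
  then have "P r s = 0 \<and> Q r s = 0" for r s
    using offP offQ d2 d3 q3 exhaust_3[of r] by (cases "r = s") auto
  then show "\<forall>y\<in>UNIV. q y = 0"
    unfolding P_def Q_def by (metis obj_sumE surj_pair)
qed

lemma cubic_part:
  "determinantal_cubics \<subseteq> zdual (Mon 5 3) (sec_cone 5 3 9) \<and>
   card (Mon 5 3) - zdim (Mon 5 3) (zdual (Mon 5 3) (sec_cone 5 3 9)) = 18"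
proof -
  let ?Z = "zdual (Mon 5 3) (sec_cone 5 3 9)"
  obtain Lc T \<kappa> \<mu> where L: "\<And>a. (\<lambda>p. Lc p a) \<in> poly_fun (prm 9 5)" and T: "\<And>k a. (\<lambda>p. T k p a) \<in> poly_fun (prm 9 5)"
    and rk: "\<And>p j. j < 9 \<Longrightarrow> \<exists>u w. \<forall>r s. lmat (Lc p) (pt p j) r s = u r * w s"
    and TL: "\<And>k p x. (\<Sum>a\<in>UNIV. \<Sum>c\<in>UNIV. T k p (a, c) * lmat (Lc p) x a c) = 0"
    and nz: "\<kappa> \<noteq> 0" "\<mu> \<noteq> 0" and L0: "\<And>a c i. i \<le> 5 \<Longrightarrow> Lc cubic_pts (a, c, i) = \<kappa> * hex (a, c, i)"
    and T0: "\<And>k a. T k cubic_pts a = \<mu> * ttab k a"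
  proof (rule determinantal_family, goal_cases)
    case (1 Lc T \<kappa> \<mu>)
    show ?case by (rule that[of Lc T \<kappa> \<mu>]) (fact 1)+
  qed
  define y where "y = (\<lambda>k p. contract (T k p) (Lc p))"
  define F1 where "F1 = (\<lambda>p x. det3 (lmat (Lc p) x))"
  define F2 where "F2 = (\<lambda>p x. trilin (lmat (y 1 p) x) (lmat (y 2 p) x) (lmat (y 3 p) x))"
  \<comment> \<open>The scalars s and t are stored under point index 9, outside the range of the
    nine points.\<close>
  let ?s = "(9, 0) :: nat \<times> nat" and ?t = "(9, 1) :: nat \<times> nat"
  define J where "J = insert ?s (insert ?t (prm 9 5))"
  have fJ: "finite J" by (simp add: J_def)
  have J: "prm 9 5 \<subseteq> J" by (auto simp: J_def)
  have y: "(\<lambda>p. y k p a) \<in> poly_fun (prm 9 5)" for k a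
    unfolding y_def contract_def by (intro pf_sum pf_mult T L)
  have LJ: "(\<lambda>p. Lc p a) \<in> poly_fun J" for a by (rule pf_mono[OF L J])
  have yJ: "(\<lambda>p. y k p a) \<in> poly_fun J" for k a by (rule pf_mono[OF y J])
  have st: "(\<lambda>p. p ?s) \<in> poly_fun J" "(\<lambda>p. p ?t) \<in> poly_fun J"
    by (auto simp: J_def intro: poly_fun.pf_coord)
  have F1pf: "(\<lambda>p. F1 p x) \<in> poly_fun (prm 9 5)" for x
    unfolding F1_def by (intro pf_det3 pf_lmat_param L)
  have F2pf: "(\<lambda>p. F2 p x) \<in> poly_fun (prm 9 5)" for x
    unfolding F2_def by (intro pf_trilin pf_lmat_param y)
  define \<phi> where "\<phi> = (\<lambda>p x. p ?s * F1 p x + p ?t * F2 p x)"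
  have "Pf J 5 3 \<phi>"
    unfolding \<phi>_def F1_def F2_def by (intro Pf_add Pf_cmult st Pf_det3 Pf_trilin Pf_lmat LJ yJ)
  then obtain C where C: "pform J 5 3 \<phi> C" unfolding Pf_def ..
  have F1J: "(\<lambda>p. F1 p x) \<in> poly_fun J" and F2J: "(\<lambda>p. F2 p x) \<in> poly_fun J" for x
    by (rule pf_mono[OF F1pf J], rule pf_mono[OF F2pf J])
  have tangent: "in_minors (Lc p) (\<lambda>x. pd (\<lambda>p. \<phi> p x) j p)" for p j
  proof -
    have d1: "dd (\<lambda>p. F1 p x) p (ax j) = (\<Sum>r\<in>UNIV. \<Sum>s\<in>UNIV.
        lmat (\<lambda>a. dd (\<lambda>p. Lc p a) p (ax j)) x r s * cof r s (lmat (Lc p) x))" for x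
      unfolding F1_def dd_det3_cof[of "\<lambda>p. lmat (Lc p) x" J, OF pf_lmat_param[OF LJ]] dd_lmat[OF LJ] ..
    have d2: "dd (\<lambda>p. F2 p x) p (ax j) =
        (\<Sum>a\<in>UNIV. \<Sum>b\<in>UNIV. lmat (\<lambda>a. dd (\<lambda>p. y 1 p a) p (ax j)) x a b * comm (lmat (y 2 p) x) (lmat (y 3 p) x) b a)
      + (\<Sum>a\<in>UNIV. \<Sum>b\<in>UNIV. lmat (\<lambda>a. dd (\<lambda>p. y 2 p a) p (ax j)) x a b * comm (lmat (y 3 p) x) (lmat (y 1 p) x) b a)
      + (\<Sum>a\<in>UNIV. \<Sum>b\<in>UNIV. lmat (\<lambda>a. dd (\<lambda>p. y 3 p a) p (ax j)) x a b * comm (lmat (y 1 p) x) (lmat (y 2 p) x) b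
          a)" for x
      unfolding F2_def dd_trilin[of "\<lambda>p. lmat (y 1 p) x" J "\<lambda>p. lmat (y 2 p) x" "\<lambda>p. lmat (y 3 p) x",
          OF pf_lmat_param[OF yJ] pf_lmat_param[OF yJ] pf_lmat_param[OF yJ]]
        dd_lmat[OF yJ] ..
    have m1: "in_minors (Lc p) (\<lambda>x. dd (\<lambda>p. F1 p x) p (ax j))"
      unfolding d1 by (rule in_minors_det_deriv)
    have m2: "in_minors (Lc p) (\<lambda>x. dd (\<lambda>p. F2 p x) p (ax j))"
      unfolding d2 y_def by (intro in_minors_add in_minors_comm TL)
    have f1: "in_minors (Lc p) (F1 p)" unfolding F1_def by (rule in_minors_det)
    have f2: "in_minors (Lc p) (F2 p)"
      unfolding F2_def trilin_comm[abs_def] y_def by (rule in_minors_comm[OF TL TL])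
    have "in_minors (Lc p) (\<lambda>x. (ax j ?s * F1 p x + p ?s * dd (\<lambda>p. F1 p x) p (ax j))
        + (ax j ?t * F2 p x + p ?t * dd (\<lambda>p. F2 p x) p (ax j)))"
      by (intro in_minors_add in_minors_cmult m1 m2 f1 f2)
    moreover have "pd (\<lambda>p. \<phi> p x) j p = (ax j ?s * F1 p x + p ?s * dd (\<lambda>p. F1 p x) p (ax j))
        + (ax j ?t * F2 p x + p ?t * dd (\<lambda>p. F2 p x) p (ax j))" for x
      unfolding pd_def \<phi>_def dd_add[OF pf_mult[OF st(1) F1J] pf_mult[OF st(2) F2J]] dd_mult[OF st(1) F1J]
          dd_mult[OF st(2) F2J]
      by simp
    ultimately show ?thesis by simp
  qed
  have spf: "(\<lambda>p. syz (Lc p) z b) \<in> poly_fun J" for z b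
    by (cases z; cases b) (auto intro!: pf_if LJ pf_const)
  \<comment> \<open>Independence of the relations at \<open>hex\<close> makes it an open condition,
    which gives the rank bound at general parameters.\<close>
  obtain h where h: "h \<in> poly_fun J" "h cubic_pts \<noteq> 0"
    and hs: "\<And>p. h p \<noteq> 0 \<Longrightarrow> lin_indep UNIV (triples <+> UNIV) (syz (Lc p))"
    using lin_indep_open[where m = "\<lambda>z p. syz (Lc p) z" and R = UNIV and I = "triples <+> UNIV" and J = J
        and ?p0.0 = cubic_pts,
        OF _ _ spf] syz_hex[OF nz(1) L0] by auto
  have bound: "dep_bound (Mon 5 3) (range C) 38"
  proof (rule dep_bound_rank[OF finite_Mon fJ pformD(1)[OF C] h])
    fix p S assume hp: "h p \<noteq> 0" and S: "S \<subseteq> J" "card S = Suc 38"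
    have fS: "finite S" using S(1) fJ finite_subset by blast
    obtain q where q: "\<exists>j\<in>S. q j \<noteq> 0" "\<forall>x. (\<Sum>j\<in>S. q j * pd (\<lambda>p. \<phi> p x) j p) = 0"
      using minors_dim[OF hs[OF hp] fS, of "\<lambda>j x. pd (\<lambda>p. \<phi> p x) j p"] S(2) tangent by auto
    have "form_eval 5 3 (\<lambda>\<alpha>. \<Sum>j\<in>S. q j * pd (\<lambda>p. C p \<alpha>) j p) x = 0" for x
      unfolding form_eval_lincomb pd_def form_eval_dd[OF pformD(1)[OF C]] pformD(4)[OF C]
      using q(2) by (simp add: pd_def)
    then have "(\<Sum>j\<in>S. q j * pd (\<lambda>p. C p \<alpha>) j p) = 0" if "\<alpha> \<in> Mon 5 3" for \<alpha>
      using form_eval_zero_iff[OF _ that] by blast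
    then show "\<not> lin_indep S (Mon 5 3) (\<lambda>j i. pd (\<lambda>p. C p i) j p)"
      using q(1) lin_indepD[of S "Mon 5 3" "\<lambda>j i. pd (\<lambda>p. C p i) j p" q] by blast
  qed
  \<comment> \<open>At the witness F1 and F2 are, up to non-zero scalars, x0 x2 x4 + x1 x3 x5 and x0
    x2 x4 - x1 x3 x5. Each of the two points isolates one of the monomials, and W is the determinant
    that tests independence.\<close>
  let ?a = "\<lambda>i::nat. if even i then 1 else 0 :: complex" and ?b = "\<lambda>i::nat. if even i then 0 else 1 :: complex"
  define W where "W = (\<lambda>p. F1 p ?a * F2 p ?b - F1 p ?b * F2 p ?a)"
  have Wpf: "W \<in> poly_fun (prm 9 5)" unfolding W_def by (intro pf_diff pf_mult F1pf F2pf)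
  have L0x: "lmat (Lc cubic_pts) x r s = \<kappa> * lmat hex x r s" for x r s
    by (simp add: lmat_def L0 sum_distrib_left mult.assoc)
  have y0x: "lmat (y k cubic_pts) x a c = \<mu> * \<kappa> * (\<Sum>e\<in>UNIV. ttab k (e, a) * lmat hex x e c)" for k x a c
    by (simp add: y_def lmat_contract T0 L0x sum_distrib_left mult_ac)
  have "F1 cubic_pts ?a = \<kappa> ^ 3" "F1 cubic_pts ?b = \<kappa> ^ 3"
    "F2 cubic_pts ?a = (\<mu> * \<kappa>) ^ 3" "F2 cubic_pts ?b = - ((\<mu> * \<kappa>) ^ 3)"
    by (simp_all add: F1_def F2_def det3_def trilin_def L0x y0x sum_3 lmat_hex ttab_def power3_eq_cube)
  then have W0: "W cubic_pts \<noteq> 0" using nz by (simp add: W_def power_mult_distrib)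
  have ZC: "?Z \<subseteq> zclosure (Mon 5 3) (range C)"
  proof (rule zdual_subset_singular[where S = "{p. nondeg 5 3 9 p \<and> W p \<noteq> 0}"])
    fix f p assume f: "f \<in> poly_fun (prm 9 5)" "\<And>q. q \<in> {p. nondeg 5 3 9 p \<and> W p \<noteq> 0} \<Longrightarrow> f q = 0"
    obtain D where D: "D \<in> poly_fun (prm 9 5)" "D cubic_pts \<noteq> 0" "\<forall>p. D p \<noteq> 0 \<longrightarrow> nondeg 5 3 9 p"
      using nondeg_open[OF cubic_nondeg] by (elim bexE conjE)
    show "f p = 0"
      by (rule pf_dense[where f = f and h = "\<lambda>p. D p * W p" and I = "prm 9 5" and ?x0.0 = cubic_pts])
        (use f D Wpf W0 in \<open>auto intro: poly_fun.pf_mult\<close>)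
  next
    fix p F assume p: "p \<in> {p. nondeg 5 3 9 p \<and> W p \<noteq> 0}"
      and F: "F \<in> aff (Mon 5 3)" "\<And>j. j < 9 \<Longrightarrow> sing 5 3 F (pt p j)"
    \<comment> \<open>Only s and t are changed, so L and the matrices T stay those of the
      configuration p.\<close>
    define P where "P = (\<lambda>s t. p(?s := s, ?t := t))"
    have eq: "Lc (P s t) = Lc p" "T k (P s t) = T k p" for s t k
      by (auto intro!: pf_cong[OF L] pf_cong[OF T] simp: P_def)
    have \<phi>P: "\<phi> (P s t) x = s * F1 p x + t * F2 p x" for s t x
      by (simp add: \<phi>_def F1_def F2_def y_def eq) (simp add: P_def)
    have s1: "sing 5 3 (C (P 1 0)) (pt p j)" and s2: "sing 5 3 (C (P 0 1)) (pt p j)" if j: "j < 9" for j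
    proof -
      obtain u w where uw: "\<And>r s. lmat (Lc p) (pt p j) r s = u r * w s" using rk[OF j, of p] by blast
      show "sing 5 3 (C (P 1 0)) (pt p j)"
        by (rule sing_det3[of _ "Lc p"]) (simp_all add: pformD(4)[OF C] \<phi>P F1_def uw)
      show "sing 5 3 (C (P 0 1)) (pt p j)"
        by (rule sing_trilin[of _ "y 1 p" "y 2 p" "y 3 p"])
          (simp add: pformD(4)[OF C] \<phi>P F2_def, unfold y_def, (rule comm_rank_one[OF TL TL uw])+)
    qed
    define H where "H = (\<lambda>i::nat. if i = 0 then F else if i = 1 then C (P 1 0) else C (P 0 1))"
    \<comment> \<open>The 54 independent conditions leave dimension 2 of the 56, against the three
      forms F, F1 and F2.\<close>
    have "\<exists>q. (\<exists>a\<in>{0, 1, 2}. q a \<noteq> 0) \<and> (\<forall>x. (\<Sum>a\<in>{0, 1, 2}. q a * form_eval 5 3 (H a) x) = 0)"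
      by (rule nondeg_singular_dim[of 5 3 9 p])
        (use p F s1 s2 pformD(3)[OF C] in \<open>auto simp: card_Mon_values H_def\<close>)
    then obtain q where q: "\<exists>a\<in>{0, 1, 2}. q a \<noteq> 0" "\<And>x. (\<Sum>a\<in>{0, 1, 2}. q a * form_eval 5 3 (H a) x) = 0" by blast
    have q': "q 0 * form_eval 5 3 F x + q 1 * F1 p x + q 2 * F2 p x = 0" for x
      using q(2)[of x] by (simp add: H_def pformD(4)[OF C] \<phi>P add.assoc)
    have q0: "q 0 \<noteq> 0"
    proof
      assume z: "q 0 = 0"
      then have "q 1 * F1 p ?a + q 2 * F2 p ?a = 0" "q 1 * F1 p ?b + q 2 * F2 p ?b = 0" using q'[of ?a] q'[of ?b]
          by simp_all
      then have "q 1 * W p = 0" "q 2 * W p = 0" unfolding W_def by algebra+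
      then show False using p q(1) z by auto
    qed
    have "F = C (P (- q 1 / q 0) (- q 2 / q 0))"
    proof (rule form_eval_inject[OF F(1) pformD(3)[OF C]])
      show "form_eval 5 3 F x = form_eval 5 3 (C (P (- q 1 / q 0) (- q 2 / q 0))) x" for x
        using q'[of x] q0 by (simp add: pformD(4)[OF C] \<phi>P field_simps) algebra
    qed
    then show "F \<in> range C" by simp
  qed
  have "zdim (Mon 5 3) ?Z = 38" by (rule zdim_eqI[OF bound ZC cubic_chain])
  moreover have "determinantal_cubics \<subseteq> ?Z"
  proof
    fix F assume "F \<in> determinantal_cubics"
    then obtain A :: "3 \<Rightarrow> 3 \<Rightarrow> nat \<Rightarrow> complex" where F: "F \<in> aff (Mon 5 3)"
      "\<And>l. form_eval 5 3 F l = det (\<chi> r s. \<Sum>i\<le>5. A r s i * l i)"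
      unfolding determinantal_cubics_def forms_def by blast
    have "lmat (\<lambda>(r, s, i). A r s i) l = (\<lambda>r s. \<Sum>i\<le>5. A r s i * l i)" for l
      by (simp add: lmat_def fun_eq_iff)
    then have "form_eval 5 3 F l = det3 (lmat (\<lambda>(r, s, i). A r s i) l)" for l
      unfolding F(2) det_eq_det3 by simp
    then show "F \<in> ?Z" by (rule determinant_in_zdual[OF F(1)])
  qed
  ultimately show ?thesis by (simp add: card_Mon_values)
qed

theorem theorem4p2:
  shows "(double_cubics \<subseteq> zdual (Mon 2 6) (sec_cone 2 6 9) \<and>
          card (Mon 2 6) - zdim (Mon 2 6) (zdual (Mon 2 6) (sec_cone 2 6 9)) = 18)
       \<and> (quadric_pairs \<subseteq> zdual (Mon 3 4) (sec_cone 3 4 8) \<and>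
          card (Mon 3 4) - zdim (Mon 3 4) (zdual (Mon 3 4) (sec_cone 3 4 8)) = 16)
       \<and> (determinantal_cubics \<subseteq> zdual (Mon 5 3) (sec_cone 5 3 9) \<and>
          card (Mon 5 3) - zdim (Mon 5 3) (zdual (Mon 5 3) (sec_cone 5 3 9)) = 18)"
  using sextic_part quartic_part cubic_part by blast

end
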